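(* The dg permutad $\mathrm{permAs}_\infty$ is a quasi-free model of the permutad $\mathrm{permAs}$; that is, it is quasi-free and there is a quasi-isomorphism of dg permutads $\mathrm{permAs}_\infty\to\mathrm{permAs}$ (with $\mathrm{permAs}$ concentrated in homological degree $0$ with zero differential).
   Context: $\mathbb{K}$ is a commutative ring; $\underline{n}=\{1,\dots,n\}$. $\mathrm{Sur}(\underline{n},\underline{k})$ is the set of surjections $\underline{n}\to\underline{k}$; the unique element of $\mathrm{Sur}(\underline{n},\underline{1})$ is the corolla $c_{n+1}$. Substitution: for $t\in\mathrm{Sur}(\underline{n},\underline{k})$ and $t_j\in\mathrm{Sur}(\underline{i_j},\underline{m_j})$ with $i_j=\#t^{-1}(j)$, $(t;t_1,\dots,t_k):\underline{n}\to\underline{m_1+\cdots+m_k}$ is the surjection with $(t;t_1,\dots,t_k)(a)=m_1+\cdots+m_{j-1}+t_j(b)$ whenever $t(a)=j$ and $a$ is the $b$-th element of $t^{-1}(j)$ in increasing order. A permutad is an arity-graded module $\mathcal{P}=\{\mathcal{P}_n\}_{n\ge1}$ with $\mathcal{P}_1=\mathbb{K}\,\mathrm{id}$ together with linear maps $\Gamma(t;-,\dots,-):\bigotimes_{j=1}^k\mathcal{P}_{\#t^{-1}(j)+1}\to\mathcal{P}_{n+1}$ for all surjections $t:\underline{n}\to\underline{k}$, with $\Gamma(c_{n+1};\mu)=\mu$ and compatible with substitution: $\Gamma((t;t_1,\dots,t_k);\lambda^1_1,\dots,\lambda^k_{m_k})=\Gamma(t;\Gamma(t_1;\lambda^1_1,\dots,\lambda^1_{m_1}),\dots,\Gamma(t_k;\lambda^k_1,\dots,\lambda^k_{m_k}))$.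 For an arity-graded module $M$, $\mathbb{P}(M)_1=\mathbb{K}\,\mathrm{id}$ and $\mathbb{P}(M)_{n+1}=\bigoplus_{k}\bigoplus_{t\in\mathrm{Sur}(\underline{n},\underline{k})}\bigotimes_{j=1}^kM_{\#t^{-1}(j)+1}$ ($n\ge1$); if $M_1=0$ this is, with $\Gamma$ induced by substitution, the free permutad on $M$. An ideal is an arity-graded submodule such that any composition $\Gamma(t;\lambda_1,\dots,\lambda_k)$ having at least one entry in it lies in it. A dg permutad is defined by replacing $\mathbb{K}$-modules by chain complexes: for a dg arity-graded module $(M,d)$, $\mathbb{P}(M)$ has differential $d(t;\mu_1,\dots,\mu_k)=\sum_i(-1)^{|\mu_1|+\cdots+|\mu_{i-1}|}(t;\mu_1,\dots,d\mu_i,\dots,\mu_k)$, and $\Gamma:\mathbb{P}(\mathcal{P})\to\mathcal{P}$ is required to be a chain map. A dg permutad is quasi-free if, forgetting the differential, it is a free permutad. $\mathrm{permAs}$ is the permutad generated by one operation $\mu$ of arity $2$ with the relation $\Gamma(1_2;\mu,\mu)=\Gamma((12);\mu,\mu)$ (free permutad on $\mu$ modulo the ideal generated by the difference), where $1_2,(12)\in\mathbb{S}_2$ are regarded as surjections $\underline{2}\to\underline{2}$. $\mathrm{permAs}_\infty$ is the dg permutad defined as follows. Let $V_1=0$, $V_n=\mathbb{K}\,m_n$ for $n\ge2$, $m_n$ of homological degree $n-2$. As a permutad $\mathrm{permAs}_\infty=\mathbb{P}(V)$. Thus $(\mathrm{permAs}_\infty)_{n+1}$ ($n\ge1$) is free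 on the surjections with source $\underline{n}$ (each vertex decorated by the appropriate $m$), which index the cells of the permutohedron $\mathtt{P}^{n-1}$ (the convex hull in $\mathbb{R}^n$ of the points $(\sigma(1),\dots,\sigma(n))$, $\sigma\in\mathbb{S}_n$): a surjection $t:\underline{n}\to\underline{k}$ corresponds to an $(n-k)$-dimensional cell of the form $\mathtt{P}^{i_1-1}\times\cdots\times\mathtt{P}^{i_k-1}$, $i_j=\#t^{-1}(j)$. The differential is the boundary map of the permutohedron: $d(m_{n+1})=\sum_t\mathrm{sgn}(t)\,t$ over surjections $t:\underline{n}\to\underline{2}$, with $\mathrm{sgn}(t)=\mathrm{sgn}(\sigma_t)(-1)^{\#t^{-1}(1)}$, $\sigma_t$ being the permutation whose list of values is $t^{-1}(1)$ in increasing order followed by $t^{-1}(2)$ in increasing order, and $d$ is extended to $\mathbb{P}(V)$ by $d(t;\mu_1,\dots,\mu_k)=\sum_i(-1)^{|\mu_1|+\cdots+|\mu_{i-1}|}(t;\mu_1,\dots,d\mu_i,\dots,\mu_k)$ followed by substitution. *)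

theory Defs
  imports "HOL-Algebra.Module" "HOL-Algebra.AbelCoset" "HOL-Combinatorics.Permutations"
begin

section \<open>Surjections and substitution\<close>

text \<open>
  Positions and values are shifted by one: the set \<open>{1..n}\<close> is modelled by \<open>{..<n}\<close>, and a map
  \<open>t\<close> out of it by its list of values, so that \<open>t ! a\<close> is the image of \<open>a\<close> and
  \<open>count_list t j\<close> is the cardinality of the fibre over \<open>j\<close>.
\<close>

definition Sur :: "nat \<Rightarrow> nat \<Rightarrow> nat list set"
  where "Sur n k = {t. length t = n \<and> set t = {..<k}}"

definition blocks :: "nat list \<Rightarrow> nat"
  where "blocks t = card (set t)"

definition corolla :: "nat \<Rightarrow> nat list"
  where "corolla n = replicate n 0"

text \<open>
  \<open>count_list (take a t) (t ! a)\<close> is the position, counted from 0, of \<open>a\<close> within its fibre.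
\<close>

definition sur_subst :: "nat list \<Rightarrow> nat list list \<Rightarrow> nat list"
  where "sur_subst t ts =
    map (\<lambda>a. (\<Sum>i<t ! a. blocks (ts ! i)) + (ts ! (t ! a)) ! count_list (take a t) (t ! a))
      [0..<length t]"

definition shuffle_perm :: "nat list \<Rightarrow> nat \<Rightarrow> nat"
  where "shuffle_perm t =
    (let l = filter (\<lambda>a. t ! a = 0) [0..<length t] @ filter (\<lambda>a. t ! a = 1) [0..<length t]
     in (\<lambda>a. if a < length t then l ! a else a))"

definition sur_sgn :: "nat list \<Rightarrow> int"
  where "sur_sgn t = sign (shuffle_perm t) * (- 1) ^ count_list t 0"

definition neg1_pow :: "int \<Rightarrow> int"
  where "neg1_pow p = (if even p then 1 else - 1)"


section \<open>Modules\<close>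

text \<open>The ring operations \<open>mult\<close> and \<open>one\<close> of a \<open>module\<close> record carry no meaning.\<close>

definition gen_submodule ::
    "('a, 'r) ring_scheme \<Rightarrow> ('a, 'x, 'm) module_scheme \<Rightarrow> 'x set \<Rightarrow> 'x set"
  where "gen_submodule R M X = \<Inter>{H. submodule H R M \<and> X \<subseteq> H}"

definition linear_map ::
    "('a, 'r) ring_scheme \<Rightarrow> ('a, 'x, 'm) module_scheme \<Rightarrow> ('a, 'y, 'n) module_scheme
      \<Rightarrow> ('x \<Rightarrow> 'y) \<Rightarrow> bool"
  where "linear_map R M N f \<longleftrightarrow>
    f \<in> carrier M \<rightarrow> carrier N \<and>
    (\<forall>x\<in>carrier M. \<forall>y\<in>carrier M. f (x \<oplus>\<^bsub>M\<^esub> y) = f x \<oplus>\<^bsub>N\<^esub> f y) \<and>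
    (\<forall>c\<in>carrier R. \<forall>x\<in>carrier M. f (c \<odot>\<^bsub>M\<^esub> x) = c \<odot>\<^bsub>N\<^esub> f x)"

text \<open>
  Functions out of a quotient are given on a coset \<open>X\<close> by applying the function to all
  representatives and adding the submodule again; for a well-defined function this is the coset
  of the value at any representative.
\<close>

definition quot_module :: "('a, 'x, 'm) module_scheme \<Rightarrow> 'x set \<Rightarrow> ('a, 'x set) module"
  where "quot_module M N =
    \<lparr>carrier = a_rcosets\<^bsub>M\<^esub> N, monoid.mult = (\<lambda>_ _. undefined), one = undefined,
     zero = N, add = set_add M, smult = (\<lambda>c X. N <+>\<^bsub>M\<^esub> (\<lambda>x. c \<odot>\<^bsub>M\<^esub> x) ` X)\<rparr>"

definition free_module :: "('a, 'r) ring_scheme \<Rightarrow> 's set \<Rightarrow> ('a, 's \<Rightarrow> 'a) module"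
  where "free_module R S =
    \<lparr>carrier = {f. (\<forall>s\<in>S. f s \<in> carrier R) \<and> (\<forall>s. s \<notin> S \<longrightarrow> f s = \<zero>\<^bsub>R\<^esub>) \<and>
                  finite {s. f s \<noteq> \<zero>\<^bsub>R\<^esub>}},
     monoid.mult = (\<lambda>_ _. undefined), one = undefined,
     zero = (\<lambda>_. \<zero>\<^bsub>R\<^esub>), add = (\<lambda>f g s. f s \<oplus>\<^bsub>R\<^esub> g s), smult = (\<lambda>c f s. c \<otimes>\<^bsub>R\<^esub> f s)\<rparr>"

definition basis_elem :: "('a, 'r) ring_scheme \<Rightarrow> 's \<Rightarrow> 's \<Rightarrow> 'a"
  where "basis_elem R s = (\<lambda>x. if x = s then \<one>\<^bsub>R\<^esub> else \<zero>\<^bsub>R\<^esub>)"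

definition regular_module :: "('a, 'r) ring_scheme \<Rightarrow> ('a, 'a) module"
  where "regular_module R =
    \<lparr>carrier = carrier R, monoid.mult = (\<lambda>_ _. undefined), one = undefined,
     zero = \<zero>\<^bsub>R\<^esub>, add = add R, smult = monoid.mult R\<rparr>"

definition zero_module :: "('a, 'r) ring_scheme \<Rightarrow> ('a, 'a) module"
  where "zero_module R = (regular_module R)\<lparr>carrier := {\<zero>\<^bsub>R\<^esub>}\<rparr>"

text \<open>A graded module is a module that is the internal direct sum of submodules \<open>H p\<close>.\<close>

definition graded_module ::
    "('a, 'r) ring_scheme \<Rightarrow> ('a, 'x, 'm) module_scheme \<Rightarrow> (int \<Rightarrow> 'x set) \<Rightarrow> bool"
  where "graded_module R M H \<longleftrightarrow>
    module R M \<and> (\<forall>p. submodule (H p) R M) \<and>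
    (\<forall>x\<in>carrier M. \<exists>!f. (\<forall>p. f p \<in> H p) \<and> finite {p. f p \<noteq> \<zero>\<^bsub>M\<^esub>} \<and>
        x = (\<Oplus>\<^bsub>M\<^esub>p\<in>{p. f p \<noteq> \<zero>\<^bsub>M\<^esub>}. f p))"


section \<open>Permutads and dg permutads\<close>

text \<open>
  In arity-graded objects only the arities \<open>n \<ge> 1\<close> are meaningful. Linear maps out of a tensor
  product are given as multilinear functions of lists.
\<close>

record ('a, 'x) permutad =
  ar :: "nat \<Rightarrow> ('a, 'x) module"
  ident :: 'x
  Gam :: "nat list \<Rightarrow> 'x list \<Rightarrow> 'x"

record ('a, 'x) dg_permutad = "('a, 'x) permutad" +
  hdeg :: "nat \<Rightarrow> int \<Rightarrow> 'x set"
  dif :: "nat \<Rightarrow> 'x \<Rightarrow> 'x"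

definition decorations :: "(nat \<Rightarrow> ('a, 'x) module) \<Rightarrow> nat list \<Rightarrow> 'x list set"
  where "decorations M t =
    {\<mu>s. length \<mu>s = blocks t \<and> (\<forall>j<blocks t. \<mu>s ! j \<in> carrier (M (count_list t j + 1)))}"

locale permutad =
  fixes R :: "('a, 'r) ring_scheme" and P :: "('a, 'x, 'm) permutad_scheme"
  assumes module_ar: "n \<ge> 1 \<Longrightarrow> module R (ar P n)"
    and ident_closed: "ident P \<in> carrier (ar P 1)"
    and ident_basis:
      "bij_betw (\<lambda>c. c \<odot>\<^bsub>ar P 1\<^esub> ident P) (carrier R) (carrier (ar P 1))"
    and Gam_closed:
      "\<lbrakk>n \<ge> 1; t \<in> Sur n k; \<mu>s \<in> decorations (ar P) t\<rbrakk> \<Longrightarrow> Gam P t \<mu>s \<in> carrier (ar P (n + 1))"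
    and Gam_add:
      "\<lbrakk>n \<ge> 1; t \<in> Sur n k; \<mu>s \<in> decorations (ar P) t; j < k;
        x \<in> carrier (ar P (count_list t j + 1)); y \<in> carrier (ar P (count_list t j + 1))\<rbrakk> \<Longrightarrow>
       Gam P t (\<mu>s[j := x \<oplus>\<^bsub>ar P (count_list t j + 1)\<^esub> y]) =
         Gam P t (\<mu>s[j := x]) \<oplus>\<^bsub>ar P (n + 1)\<^esub> Gam P t (\<mu>s[j := y])"
    and Gam_smult:
      "\<lbrakk>n \<ge> 1; t \<in> Sur n k; \<mu>s \<in> decorations (ar P) t; j < k;
        c \<in> carrier R; x \<in> carrier (ar P (count_list t j + 1))\<rbrakk> \<Longrightarrow>
       Gam P t (\<mu>s[j := c \<odot>\<^bsub>ar P (count_list t j + 1)\<^esub> x]) =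
         c \<odot>\<^bsub>ar P (n + 1)\<^esub> Gam P t (\<mu>s[j := x])"
    and Gam_corolla:
      "\<lbrakk>n \<ge> 1; \<mu> \<in> carrier (ar P (n + 1))\<rbrakk> \<Longrightarrow> Gam P (corolla n) [\<mu>] = \<mu>"
    and Gam_subst:
      "\<lbrakk>n \<ge> 1; t \<in> Sur n k; length ts = k; length \<mu>ss = k;
        \<And>j. j < k \<Longrightarrow> ts ! j \<in> Sur (count_list t j) (m j);
        \<And>j. j < k \<Longrightarrow> \<mu>ss ! j \<in> decorations (ar P) (ts ! j)\<rbrakk> \<Longrightarrow>
       Gam P (sur_subst t ts) (concat \<mu>ss) = Gam P t (map2 (Gam P) ts \<mu>ss)"

text \<open>
  The last axiom says that \<open>Gam\<close> is a chain map: composition with substituted trees preserves the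
  order of the tensor factors, so that it involves no signs of its own.
\<close>

locale dg_permutad = permutad R P
  for R :: "('a, 'r) ring_scheme" and P :: "('a, 'x, 'm) dg_permutad_scheme" +
  assumes graded: "n \<ge> 1 \<Longrightarrow> graded_module R (ar P n) (hdeg P n)"
    and ident_deg: "ident P \<in> hdeg P 1 0"
    and dif_linear: "n \<ge> 1 \<Longrightarrow> linear_map R (ar P n) (ar P n) (dif P n)"
    and dif_deg: "\<lbrakk>n \<ge> 1; x \<in> hdeg P n p\<rbrakk> \<Longrightarrow> dif P n x \<in> hdeg P n (p - 1)"
    and dif_dif: "\<lbrakk>n \<ge> 1; x \<in> carrier (ar P n)\<rbrakk> \<Longrightarrow> dif P n (dif P n x) = \<zero>\<^bsub>ar P n\<^esub>"
    and Gam_deg: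
      "\<lbrakk>n \<ge> 1; t \<in> Sur n k; length \<mu>s = k;
        \<And>j. j < k \<Longrightarrow> \<mu>s ! j \<in> hdeg P (count_list t j + 1) (q j)\<rbrakk> \<Longrightarrow>
       Gam P t \<mu>s \<in> hdeg P (n + 1) (\<Sum>j<k. q j)"
    and Gam_dif:
      "\<lbrakk>n \<ge> 1; t \<in> Sur n k; length \<mu>s = k;
        \<And>j. j < k \<Longrightarrow> \<mu>s ! j \<in> hdeg P (count_list t j + 1) (q j)\<rbrakk> \<Longrightarrow>
       dif P (n + 1) (Gam P t \<mu>s) =
         (\<Oplus>\<^bsub>ar P (n + 1)\<^esub>i\<in>{..<k}. [neg1_pow (\<Sum>j<i. q j)] \<cdot>\<^bsub>ar P (n + 1)\<^esub>
            Gam P t (\<mu>s[i := dif P (count_list t i + 1) (\<mu>s ! i)]))"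

definition permutad_hom ::
    "('a, 'r) ring_scheme \<Rightarrow> ('a, 'x, 'm) permutad_scheme \<Rightarrow> ('a, 'y, 'n) permutad_scheme
      \<Rightarrow> (nat \<Rightarrow> 'x \<Rightarrow> 'y) \<Rightarrow> bool"
  where "permutad_hom R P Q \<phi> \<longleftrightarrow>
    permutad R P \<and> permutad R Q \<and>
    (\<forall>n\<ge>1. linear_map R (ar P n) (ar Q n) (\<phi> n)) \<and>
    \<phi> 1 (ident P) = ident Q \<and>
    (\<forall>n\<ge>1. \<forall>k. \<forall>t\<in>Sur n k. \<forall>\<mu>s\<in>decorations (ar P) t.
       \<phi> (n + 1) (Gam P t \<mu>s) =
         Gam Q t (map (\<lambda>j. \<phi> (count_list t j + 1) (\<mu>s ! j)) [0..<k]))"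

definition permutad_iso ::
    "('a, 'r) ring_scheme \<Rightarrow> ('a, 'x, 'm) permutad_scheme \<Rightarrow> ('a, 'y, 'n) permutad_scheme
      \<Rightarrow> (nat \<Rightarrow> 'x \<Rightarrow> 'y) \<Rightarrow> bool"
  where "permutad_iso R P Q \<phi> \<longleftrightarrow>
    permutad_hom R P Q \<phi> \<and> (\<forall>n\<ge>1. bij_betw (\<phi> n) (carrier (ar P n)) (carrier (ar Q n)))"

definition dg_permutad_hom ::
    "('a, 'r) ring_scheme \<Rightarrow> ('a, 'x, 'm) dg_permutad_scheme \<Rightarrow> ('a, 'y, 'n) dg_permutad_scheme
      \<Rightarrow> (nat \<Rightarrow> 'x \<Rightarrow> 'y) \<Rightarrow> bool"
  where "dg_permutad_hom R P Q \<phi> \<longleftrightarrow>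
    dg_permutad R P \<and> dg_permutad R Q \<and> permutad_hom R P Q \<phi> \<and>
    (\<forall>n\<ge>1. \<forall>p. \<phi> n ` hdeg P n p \<subseteq> hdeg Q n p) \<and>
    (\<forall>n\<ge>1. \<forall>x\<in>carrier (ar P n). \<phi> n (dif P n x) = dif Q n (\<phi> n x))"

definition cycles :: "('a, 'x, 'm) dg_permutad_scheme \<Rightarrow> nat \<Rightarrow> int \<Rightarrow> 'x set"
  where "cycles P n p = {x \<in> hdeg P n p. dif P n x = \<zero>\<^bsub>ar P n\<^esub>}"

definition boundaries :: "('a, 'x, 'm) dg_permutad_scheme \<Rightarrow> nat \<Rightarrow> int \<Rightarrow> 'x set"
  where "boundaries P n p = dif P n ` hdeg P n (p + 1)"

definition homology ::
    "('a, 'x, 'm) dg_permutad_scheme \<Rightarrow> nat \<Rightarrow> int \<Rightarrow> ('a, 'x set) module"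
  where "homology P n p = quot_module ((ar P n)\<lparr>carrier := cycles P n p\<rparr>) (boundaries P n p)"

definition homology_map ::
    "('a, 'y, 'n) dg_permutad_scheme \<Rightarrow> (nat \<Rightarrow> 'x \<Rightarrow> 'y) \<Rightarrow> nat \<Rightarrow> int \<Rightarrow> 'x set \<Rightarrow> 'y set"
  where "homology_map Q \<phi> n p X = boundaries Q n p <+>\<^bsub>ar Q n\<^esub> \<phi> n ` X"

definition quasi_iso ::
    "('a, 'r) ring_scheme \<Rightarrow> ('a, 'x, 'm) dg_permutad_scheme \<Rightarrow> ('a, 'y, 'n) dg_permutad_scheme
      \<Rightarrow> (nat \<Rightarrow> 'x \<Rightarrow> 'y) \<Rightarrow> bool"
  where "quasi_iso R P Q \<phi> \<longleftrightarrow>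
    dg_permutad_hom R P Q \<phi> \<and>
    (\<forall>n\<ge>1. \<forall>p. bij_betw (homology_map Q \<phi> n p)
        (carrier (homology P n p)) (carrier (homology Q n p)))"

definition in_degree_0 :: "('a, 'x) permutad \<Rightarrow> ('a, 'x) dg_permutad"
  where "in_degree_0 P =
    \<lparr>ar = ar P, ident = ident P, Gam = Gam P,
     hdeg = (\<lambda>n p. if p = 0 then carrier (ar P n) else {\<zero>\<^bsub>ar P n\<^esub>}),
     dif = (\<lambda>n _. \<zero>\<^bsub>ar P n\<^esub>)\<rparr>"


section \<open>Free permutads\<close>

text \<open>
  The direct sum, over the surjections \<open>t\<close> out of an \<open>n\<close>-element set, of the tensor products of
  the decorating modules is constructed at once: as the free module on all pairs of a
  surjection and a list of decorations, modulo multilinearity in the decorations. For \<open>n = 0\<close>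
  the only pair is \<open>([], [])\<close>, with the empty tensor product: this gives the component
  spanned by the identity.
\<close>

definition trees :: "(nat \<Rightarrow> ('a, 'b) module) \<Rightarrow> nat \<Rightarrow> (nat list \<times> 'b list) set"
  where "trees M n = {(t, \<mu>s). t \<in> (\<Union>k. Sur n k) \<and> \<mu>s \<in> decorations M t}"

type_synonym ('a, 'b) tree_comb = "nat list \<times> 'b list \<Rightarrow> 'a"

definition multilinear_rels ::
    "('a, 'r) ring_scheme \<Rightarrow> (nat \<Rightarrow> ('a, 'b) module) \<Rightarrow> nat \<Rightarrow> ('a, 'b) tree_comb set"
  where "multilinear_rels R M n =
    (let F = free_module R (trees M n); e = basis_elem R in
      {e (t, \<mu>s[j := x \<oplus>\<^bsub>M (count_list t j + 1)\<^esub> y])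
          \<ominus>\<^bsub>F\<^esub> (e (t, \<mu>s[j := x]) \<oplus>\<^bsub>F\<^esub> e (t, \<mu>s[j := y])) | t \<mu>s j x y.
          (t, \<mu>s) \<in> trees M n \<and> j < blocks t \<and>
          x \<in> carrier (M (count_list t j + 1)) \<and> y \<in> carrier (M (count_list t j + 1))} \<union>
      {e (t, \<mu>s[j := c \<odot>\<^bsub>M (count_list t j + 1)\<^esub> x])
          \<ominus>\<^bsub>F\<^esub> c \<odot>\<^bsub>F\<^esub> e (t, \<mu>s[j := x]) | t \<mu>s j c x.
          (t, \<mu>s) \<in> trees M n \<and> j < blocks t \<and>
          c \<in> carrier R \<and> x \<in> carrier (M (count_list t j + 1))})"

definition tensor_rel ::
    "('a, 'r) ring_scheme \<Rightarrow> (nat \<Rightarrow> ('a, 'b) module) \<Rightarrow> nat \<Rightarrow> ('a, 'b) tree_comb set"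
  where "tensor_rel R M n =
    gen_submodule R (free_module R (trees M n)) (multilinear_rels R M n)"

definition tensor_sum ::
    "('a, 'r) ring_scheme \<Rightarrow> (nat \<Rightarrow> ('a, 'b) module) \<Rightarrow> nat \<Rightarrow> ('a, ('a, 'b) tree_comb set) module"
  where "tensor_sum R M n = quot_module (free_module R (trees M n)) (tensor_rel R M n)"

text \<open>The element \<open>(t; \<mu>\<^sub>1, \<dots>, \<mu>\<^sub>k)\<close>.\<close>

definition tree_class ::
    "('a, 'r) ring_scheme \<Rightarrow> (nat \<Rightarrow> ('a, 'b) module) \<Rightarrow> nat list \<Rightarrow> 'b list
      \<Rightarrow> ('a, 'b) tree_comb set"
  where "tree_class R M t \<mu>s =
    tensor_rel R M (length t) +>\<^bsub>free_module R (trees M (length t))\<^esub> basis_elem R (t, \<mu>s)"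

text \<open>Multilinear extension of \<open>((t\<^sub>1, \<mu>s\<^sub>1), \<dots>) \<mapsto> (sur_subst t [t\<^sub>1, \<dots>], \<mu>s\<^sub>1 @ \<dots>)\<close>.\<close>

definition subst_ext ::
    "('a, 'r) ring_scheme \<Rightarrow> (nat \<Rightarrow> ('a, 'b) module) \<Rightarrow> nat list \<Rightarrow> ('a, 'b) tree_comb list
      \<Rightarrow> ('a, 'b) tree_comb"
  where "subst_ext R M t fs =
    (let F = free_module R (trees M (length t)) in
      \<Oplus>\<^bsub>F\<^esub>zs\<in>{zs. length zs = length fs \<and> (\<forall>j<length fs. (fs ! j) (zs ! j) \<noteq> \<zero>\<^bsub>R\<^esub>)}.
        (\<Otimes>\<^bsub>R\<^esub>j\<in>{..<length fs}. (fs ! j) (zs ! j)) \<odot>\<^bsub>F\<^esub>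
          basis_elem R (sur_subst t (map fst zs), concat (map snd zs)))"

definition free_permutad ::
    "('a, 'r) ring_scheme \<Rightarrow> (nat \<Rightarrow> ('a, 'b) module) \<Rightarrow> ('a, ('a, 'b) tree_comb set) permutad"
  where "free_permutad R M =
    \<lparr>ar = (\<lambda>n. tensor_sum R M (n - 1)),
     ident = tree_class R M [] [],
     Gam = (\<lambda>t Xs. tensor_rel R M (length t) <+>\<^bsub>free_module R (trees M (length t))\<^esub>
              subst_ext R M t ` {fs. list_all2 (\<in>) fs Xs})\<rparr>"

text \<open>The grading on the free permutad induced by a grading \<open>G\<close> of its generators.\<close>

definition free_hdeg ::
    "('a, 'r) ring_scheme \<Rightarrow> (nat \<Rightarrow> ('a, 'b) module) \<Rightarrow> (nat \<Rightarrow> int \<Rightarrow> 'b set)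
      \<Rightarrow> nat \<Rightarrow> int \<Rightarrow> ('a, 'b) tree_comb set set"
  where "free_hdeg R M G n p =
    gen_submodule R (ar (free_permutad R M) n)
      {tree_class R M t \<mu>s | t \<mu>s q. (t, \<mu>s) \<in> trees M (n - 1) \<and>
         (\<forall>j<blocks t. \<mu>s ! j \<in> G (count_list t j + 1) (q j)) \<and> (\<Sum>j<blocks t. q j) = p}"

text \<open>
  \<open>P\<close>, without its differential, is isomorphic to the free permutad on the graded arity-graded
  module \<open>(M, G)\<close>.
\<close>

definition quasi_free_on ::
    "('a, 'r) ring_scheme \<Rightarrow> ('a, 'x, 'm) dg_permutad_scheme \<Rightarrow> (nat \<Rightarrow> ('a, 'b) module)
      \<Rightarrow> (nat \<Rightarrow> int \<Rightarrow> 'b set) \<Rightarrow> bool"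
  where "quasi_free_on R P M G \<longleftrightarrow>
    dg_permutad R P \<and>
    (\<forall>n\<ge>1. graded_module R (M n) (G n)) \<and> carrier (M 1) = {\<zero>\<^bsub>M 1\<^esub>} \<and>
    (\<exists>\<phi>. permutad_iso R (free_permutad R M) P \<phi> \<and>
       (\<forall>n\<ge>1. \<forall>p. \<phi> n ` free_hdeg R M G n p = hdeg P n p))"


section \<open>Ideals and quotients\<close>

definition permutad_ideal ::
    "('a, 'r) ring_scheme \<Rightarrow> ('a, 'x, 'm) permutad_scheme \<Rightarrow> (nat \<Rightarrow> 'x set) \<Rightarrow> bool"
  where "permutad_ideal R P I \<longleftrightarrow>
    (\<forall>n\<ge>1. submodule (I n) R (ar P n)) \<and>
    (\<forall>n\<ge>1. \<forall>k. \<forall>t\<in>Sur n k. \<forall>\<mu>s\<in>decorations (ar P) t.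
       (\<exists>j<k. \<mu>s ! j \<in> I (count_list t j + 1)) \<longrightarrow> Gam P t \<mu>s \<in> I (n + 1))"

definition gen_ideal ::
    "('a, 'r) ring_scheme \<Rightarrow> ('a, 'x, 'm) permutad_scheme \<Rightarrow> (nat \<Rightarrow> 'x set) \<Rightarrow> nat \<Rightarrow> 'x set"
  where "gen_ideal R P X n = \<Inter>{I n | I. permutad_ideal R P I \<and> (\<forall>m\<ge>1. X m \<subseteq> I m)}"

definition quot_permutad ::
    "('a, 'x, 'm) permutad_scheme \<Rightarrow> (nat \<Rightarrow> 'x set) \<Rightarrow> ('a, 'x set) permutad"
  where "quot_permutad P I =
    \<lparr>ar = (\<lambda>n. quot_module (ar P n) (I n)),
     ident = I 1 +>\<^bsub>ar P 1\<^esub> ident P,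
     Gam = (\<lambda>t Xs. I (length t + 1) <+>\<^bsub>ar P (length t + 1)\<^esub>
              Gam P t ` {\<mu>s. list_all2 (\<in>) \<mu>s Xs})\<rparr>"


section \<open>The permutad permAs\<close>

definition permAs_gens :: "('a, 'r) ring_scheme \<Rightarrow> nat \<Rightarrow> ('a, 'a) module"
  where "permAs_gens R n = (if n = 2 then regular_module R else zero_module R)"

definition permAs_rel ::
    "('a, 'r) ring_scheme \<Rightarrow> nat \<Rightarrow> ('a, 'a) tree_comb set set"
  where "permAs_rel R n =
    (let P = free_permutad R (permAs_gens R); \<mu> = tree_class R (permAs_gens R) (corolla 1) [\<one>\<^bsub>R\<^esub>]
     in if n = 3 then {Gam P [0, 1] [\<mu>, \<mu>] \<ominus>\<^bsub>ar P 3\<^esub> Gam P [1, 0] [\<mu>, \<mu>]} else {})"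

definition permAs ::
    "('a, 'r) ring_scheme \<Rightarrow> ('a, ('a, 'a) tree_comb set set) permutad"
  where "permAs R =
    (let P = free_permutad R (permAs_gens R) in quot_permutad P (gen_ideal R P (permAs_rel R)))"


section \<open>The dg permutad permAs-infinity\<close>

text \<open>In arity \<open>n \<ge> 2\<close> the generator \<open>m\<^sub>n\<close>, of degree \<open>n - 2\<close>, is the unit of \<open>R\<close>.\<close>

definition inf_gens :: "('a, 'r) ring_scheme \<Rightarrow> nat \<Rightarrow> ('a, 'a) module"
  where "inf_gens R n = (if n \<ge> 2 then regular_module R else zero_module R)"

definition inf_gens_hdeg :: "('a, 'r) ring_scheme \<Rightarrow> nat \<Rightarrow> int \<Rightarrow> 'a set"
  where "inf_gens_hdeg R n p =
    (if p = int n - 2 then carrier (inf_gens R n) else {\<zero>\<^bsub>inf_gens R n\<^esub>})"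

text \<open>The differential of \<open>c \<cdot> m\<^bsub>n+1\<^esub>\<close>, for a scalar \<open>c\<close>.\<close>

definition inf_dif_gen :: "('a, 'r) ring_scheme \<Rightarrow> nat \<Rightarrow> 'a \<Rightarrow> ('a, 'a) tree_comb set"
  where "inf_dif_gen R n c =
    (let P = free_permutad R (inf_gens R) in
      \<Oplus>\<^bsub>ar P (n + 1)\<^esub>t\<in>Sur n 2.
        [sur_sgn t] \<cdot>\<^bsub>ar P (n + 1)\<^esub>
          (c \<odot>\<^bsub>ar P (n + 1)\<^esub> tree_class R (inf_gens R) t [\<one>\<^bsub>R\<^esub>, \<one>\<^bsub>R\<^esub>]))"

text \<open>
  The differential of \<open>(t; \<mu>\<^sub>1, \<dots>, \<mu>\<^sub>k)\<close>; the decoration of vertex \<open>j\<close> has degree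
  \<open>count_list t j - 1\<close>, and composition in the free permutad performs the substitution.
\<close>

definition inf_dif_tree ::
    "('a, 'r) ring_scheme \<Rightarrow> nat list \<times> 'a list \<Rightarrow> ('a, 'a) tree_comb set"
  where "inf_dif_tree R = (\<lambda>(t, \<mu>s).
    (let P = free_permutad R (inf_gens R); A = ar P (length t + 1) in
      \<Oplus>\<^bsub>A\<^esub>i\<in>{..<blocks t}.
        [neg1_pow (\<Sum>j<i. int (count_list t j) - 1)] \<cdot>\<^bsub>A\<^esub>
          Gam P t (map (\<lambda>j. if j = i then inf_dif_gen R (count_list t j) (\<mu>s ! j)
                            else tree_class R (inf_gens R) (corolla (count_list t j)) [\<mu>s ! j])
                     [0..<blocks t])))"

text \<open>
  The linear extension has the same value on all representatives \<open>f\<close> of a class \<open>X\<close>, so the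
  union is that value.
\<close>

definition inf_dif ::
    "('a, 'r) ring_scheme \<Rightarrow> nat \<Rightarrow> ('a, 'a) tree_comb set \<Rightarrow> ('a, 'a) tree_comb set"
  where "inf_dif R n X =
    (let A = ar (free_permutad R (inf_gens R)) n in
      \<Union>f\<in>X. \<Oplus>\<^bsub>A\<^esub>z\<in>{z. f z \<noteq> \<zero>\<^bsub>R\<^esub>}. f z \<odot>\<^bsub>A\<^esub> inf_dif_tree R z)"

definition permAs_inf ::
    "('a, 'r) ring_scheme \<Rightarrow> ('a, ('a, 'a) tree_comb set) dg_permutad"
  where "permAs_inf R =
    (let P = free_permutad R (inf_gens R) in
     \<lparr>ar = ar P, ident = ident P, Gam = Gam P,
      hdeg = free_hdeg R (inf_gens R) (inf_gens_hdeg R), dif = inf_dif R\<rparr>)"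

end

theory Submission
  imports Defs
begin

text \<open>
  Recording an element of a free permutad with one generator in each of the chosen arities by its
  coefficients on surjections turns \<open>permAs_inf R\<close> into the complex of faces of the permutohedra,
  which is acyclic in nonzero degrees: removing the last point exhibits each permutohedron as a
  family of subdivided intervals over the next smaller one, and induction applies. In degree 0
  everything is a cycle, and the boundaries are spanned by the boundaries of the edges. An edge is
  a composite of copies of the arity 2 generator and one copy of the arity 3 generator, whose
  boundary is the defining relation of \<open>permAs R\<close> up to sign; hence the boundaries in degree 0 form
  exactly the ideal generated by that relation.
\<close>


section \<open>Surjections, substitution and refinement\<close>

text \<open>The obstacle is the form of the definitions: elements are cosets modulo multilinearity,
  and composition and differential are given through representatives. Coordinates remove it because
  a surjection \<open>s\<close> decomposes along \<open>t\<close> in at most one way, and does so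
  exactly when \<open>coarser t s\<close>. Composition thus becomes a product of coefficients,
  without a sum. Dually, the coefficient of a boundary at \<open>s\<close> is a signed sum over the
  merges of two adjacent blocks of \<open>s\<close>. Compatibility of boundary and composition then
  separates merges inside one vertex from merges across two vertices, and \<open>d^2 = 0\<close> is
  the relation between successive merges. The signs in both come from the single exponent
  \<open>dexp\<close>. The set \<open>S\<close> of arities of the generators is a parameter, so that
  \<open>S = {2}\<close> and \<open>S = {2..}\<close> share one model. The surjections for
  \<open>S = {2}\<close> are the permutations, which are also the degree 0 part for
  \<open>S = {2..}\<close>; the projection onto \<open>permAs R\<close> only restricts coordinates
  to them. Since \<open>R\<close> is any commutative ring, acyclicity is proved by an explicit
  primitive instead of a count of dimensions.\<close>

definition surj_list :: "nat list \<Rightarrow> bool"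
  where "surj_list s \<longleftrightarrow> set s = {..<blocks s}"

lemma Sur_iff: "s \<in> Sur n k \<longleftrightarrow> length s = n \<and> surj_list s \<and> blocks s = k"
  unfolding Sur_def surj_list_def blocks_def by (metis (mono_tags, lifting) card_lessThan mem_Collect_eq)

section \<open>Restriction of a list to the fibres of a surjection\<close>

definition part :: "nat list \<Rightarrow> 'b list \<Rightarrow> nat \<Rightarrow> 'b list"
  where "part t s j = map snd (filter (\<lambda>z. fst z = j) (zip t s))"

lemma part_Nil [simp]: "part [] s j = []" "part t [] j = []"
  by (simp_all add: part_def)

lemma part_Cons [simp]: "part (x # t) (y # s) j = (if x = j then [y] else []) @ part t s j"
  by (simp add: part_def)

lemma part_append:
  "length t = length s \<Longrightarrow> part (t @ t') (s @ s') j = part t s j @ part t' s' j"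
  by (simp add: part_def)

lemma length_part: "length t = length s \<Longrightarrow> length (part t s j) = count_list t j"
  by (induction t s rule: list_induct2) auto

lemma part_map: "part t (map f s) j = map f (part t s j)"
  by (induction t s rule: list_induct2') auto

lemma part_map_left: "inj f \<Longrightarrow> part (map f t) s (f j) = part t s j"
  by (induction t s rule: list_induct2') (auto dest: injD)

lemma set_part: "set (part t s j) = {y. (j, y) \<in> set (zip t s)}"
  by (force simp: part_def)

lemma set_part_subset: "set (part t s j) \<subseteq> set s"
  by (auto simp: set_part dest: set_zip_rightD)

text \<open>The index occurring here is the one by which \<open>sur_subst\<close> looks up the value
  of a point within its fibre. This links the pointwise definition of substitution to whole
  fibres.\<close>

lemma part_nth:
  assumes "length t = length s" "a < length t"
  shows "part t s (t ! a) ! count_list (take a t) (t ! a) = s ! a"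
    and "count_list (take a t) (t ! a) < count_list t (t ! a)"
proof -
  have t: "t = take a t @ t ! a # drop (Suc a) t" and s: "s = take a s @ s ! a # drop (Suc a) s"
    using assms by (simp_all add: id_take_nth_drop)
  have "part t s (t ! a)
      = part (take a t) (take a s) (t ! a) @ s ! a # part (drop (Suc a) t) (drop (Suc a) s) (t ! a)"
    using assms part_append[of "take a t" "take a s" "t ! a # drop (Suc a) t" "s ! a # drop (Suc a) s"]
    by (subst (1) t, subst (1) s) simp
  moreover have "length (part (take a t) (take a s) (t ! a)) = count_list (take a t) (t ! a)"
    using assms by (simp add: length_part)
  ultimately show "part t s (t ! a) ! count_list (take a t) (t ! a) = s ! a"
    by (metis nth_append_length)
  have "count_list t (t ! a) = count_list (take a t) (t ! a) + Suc (count_list (drop (Suc a) t) (t ! a))"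
    by (subst (1) t) simp
  then show "count_list (take a t) (t ! a) < count_list t (t ! a)"
    by simp
qed

lemma count_list_position:
  "c < count_list t j \<Longrightarrow> \<exists>a<length t. t ! a = j \<and> count_list (take a t) j = c"
proof (induction t arbitrary: c)
  case (Cons x t)
  show ?case
  proof (cases "x = j \<and> c = 0")
    case True
    then show ?thesis by (intro exI[of _ 0]) auto
  next
    case False
    then have "(if x = j then c - 1 else c) < count_list t j"
      using Cons.prems by (auto split: if_splits)
    then obtain a where "a < length t" "t ! a = j" "count_list (take a t) j = (if x = j then c - 1 else c)"
      using Cons.IH by blast
    then show ?thesis
      using False by (intro exI[of _ "Suc a"]) auto
  qed
qed simp

text \<open>The main way to prove identities between substituted surjections: they are compared on
  each fibre of \<open>t\<close>, where substitution is only a shift.\<close>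

lemma part_ext:
  assumes "length s = length t" "length s' = length t"
    and "\<And>j. j \<in> set t \<Longrightarrow> part t s j = part t s' j"
  shows "s = s'"
proof (rule nth_equalityI)
  fix a assume "a < length s"
  then show "s ! a = s' ! a"
    using assms part_nth(1)[of t s a] part_nth(1)[of t s' a] by auto
qed (use assms in simp)

section \<open>Block offsets and substitution\<close>

definition offset :: "nat list list \<Rightarrow> nat \<Rightarrow> nat"
  where "offset us j = (\<Sum>i<j. blocks (us ! i))"

lemma offset_0 [simp]: "offset us 0 = 0"
  and offset_Suc: "offset us (Suc j) = offset us j + blocks (us ! j)"
  by (simp_all add: offset_def)

lemma offset_mono: "i \<le> j \<Longrightarrow> offset us i \<le> offset us j"
  unfolding offset_def by (rule sum_mono2) auto

lemma offset_add_less: "i < j \<Longrightarrow> v < blocks (us ! i) \<Longrightarrow> offset us i + v < offset us j"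
  using offset_mono[of "Suc i" j us] by (simp add: offset_Suc)

text \<open>Together with \<open>offset_unique\<close> this is a division with remainder: every
  block of a composite is addressed by an outer vertex \<open>l\<close> and a block \<open>v\<close>
  of the surjection inserted there.\<close>

lemma offset_decomp:
  "i < offset us k \<Longrightarrow> \<exists>l<k. \<exists>v<blocks (us ! l). i = offset us l + v"
proof (induction k)
  case (Suc k)
  show ?case
  proof (cases "i < offset us k")
    case True
    then show ?thesis using Suc.IH less_SucI by blast
  next
    case False
    then show ?thesis using Suc.prems
      by (intro exI[of _ k]) (auto simp: offset_Suc intro!: exI[of _ "i - offset us k"])
  qed
qed simp

lemma offset_unique:
  assumes "offset us l + v = offset us l' + v'" "v < blocks (us ! l)" "v' < blocks (us ! l')"
  shows "l = l'" "v = v'"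
proof -
  show "l = l'"
    using assms offset_add_less[of l l' v us] offset_add_less[of l' l v' us]
    by (metis add_leD1 leD le_refl linorder_neqE_nat)
  then show "v = v'" using assms by simp
qed

lemma length_sur_subst [simp]: "length (sur_subst t us) = length t"
  by (simp add: sur_subst_def)

definition admissible :: "nat list \<Rightarrow> nat list list \<Rightarrow> bool"
  where "admissible t us \<longleftrightarrow> length us = blocks t \<and>
    (\<forall>j<blocks t. length (us ! j) = count_list t j \<and> surj_list (us ! j))"

text \<open>The points of the fibre over \<open>j\<close> are looked up in \<open>us ! j\<close> in
  their increasing order, so only the constant shift remains. This fibrewise form is what most later
  arguments use in place of the indexed definition.\<close>

lemma part_sur_subst:
  assumes "length (us ! j) = count_list t j"
  shows "part t (sur_subst t us) j = map ((+) (offset us j)) (us ! j)"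
proof -
  show ?thesis
  proof (rule nth_equalityI)
    fix c assume "c < length (part t (sur_subst t us) j)"
    then obtain a where a: "a < length t" "t ! a = j" "count_list (take a t) j = c"
      using count_list_position[of c t j] by (auto simp: length_part)
    then have "part t (sur_subst t us) j ! c = offset us j + us ! j ! c"
      using part_nth(1)[of t "sur_subst t us" a] by (simp add: sur_subst_def offset_def)
    then show "part t (sur_subst t us) j ! c = map ((+) (offset us j)) (us ! j) ! c"
      using a part_nth(2)[of t t a] assms by simp
  qed (use assms in \<open>simp add: length_part\<close>)
qed

lemma UN_offset:
  assumes "\<And>j. j < k \<Longrightarrow> surj_list (us ! j)"
  shows "(\<Union>j<k. (+) (offset us j) ` set (us ! j)) = {..<offset us k}"
proof -
  have *: "(+) (offset us j) ` set (us ! j) = {offset us j..<offset us (Suc j)}" if "j < k" for j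
    using assms[OF that] by (simp add: surj_list_def offset_Suc lessThan_atLeast0 add.commute)
  have "(\<Union>j<k. {offset us j..<offset us (Suc j)}) = {..<offset us k}"
  proof (intro equalityI subsetI)
    fix i assume "i \<in> {..<offset us k}"
    then obtain l v where "l < k" "v < blocks (us ! l)" "i = offset us l + v"
      using offset_decomp by blast
    then show "i \<in> (\<Union>j<k. {offset us j..<offset us (Suc j)})"
      by (auto simp: offset_Suc intro!: bexI[of _ l])
  next
    fix i assume "i \<in> (\<Union>j<k. {offset us j..<offset us (Suc j)})"
    then obtain j where "j < k" "i < offset us (Suc j)" by auto
    then show "i \<in> {..<offset us k}"
      using offset_mono[of "Suc j" k us] by auto
  qed
  then show ?thesis using * by simp
qed

lemma set_eq_UN_part: "length s = length t \<Longrightarrow> set s = (\<Union>j\<in>set t. set (part t s j))"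
proof (intro equalityI subsetI)
  fix x assume l: "length s = length t" and "x \<in> set s"
  then obtain a where "a < length s" "x = s ! a" by (auto simp: in_set_conv_nth)
  with l have "(t ! a, x) \<in> set (zip t s)" "t ! a \<in> set t" by (auto simp: in_set_zip)
  then show "x \<in> (\<Union>j\<in>set t. set (part t s j))" by (auto simp: set_part)
qed (use set_part_subset in fast)

lemma set_sur_subst:
  assumes "surj_list t" "admissible t us"
  shows "set (sur_subst t us) = {..<offset us (blocks t)}"
proof -
  have "set (sur_subst t us) = (\<Union>j\<in>set t. set (part t (sur_subst t us) j))"
    by (rule set_eq_UN_part) simp
  also have "\<dots> = (\<Union>j<blocks t. (+) (offset us j) ` set (us ! j))"
    using assms by (auto simp: part_sur_subst surj_list_def admissible_def)
  also have "\<dots> = {..<offset us (blocks t)}"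
    using assms(2) by (intro UN_offset) (auto simp: admissible_def)
  finally show ?thesis .
qed

lemma surj_sur_subst:
  assumes "surj_list t" "admissible t us"
  shows "surj_list (sur_subst t us)" "blocks (sur_subst t us) = offset us (blocks t)"
proof -
  show "blocks (sur_subst t us) = offset us (blocks t)"
    using set_sur_subst[OF assms] by (simp add: blocks_def[of "sur_subst t us"])
  then show "surj_list (sur_subst t us)"
    using set_sur_subst[OF assms] by (simp add: surj_list_def)
qed

section \<open>Refinement: containment of faces, and the unique decomposition of the smaller
  face\<close>

definition coarser :: "nat list \<Rightarrow> nat list \<Rightarrow> bool"
  where "coarser t s \<longleftrightarrow>
    (\<forall>(j, x)\<in>set (zip t s). \<forall>(j', x')\<in>set (zip t s). j < j' \<longrightarrow> x < x')"

lemma coarserD: "coarser t s \<Longrightarrow> j < j' \<Longrightarrow> x \<in> set (part t s j) \<Longrightarrow> x' \<in> set (part t s j') \<Longrightarrow> x < x'"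
  unfolding coarser_def set_part by blast

lemma coarserI:
  "(\<And>j j' x x'. j \<in> set t \<Longrightarrow> j' \<in> set t \<Longrightarrow> j < j' \<Longrightarrow> x \<in> set (part t s j) \<Longrightarrow> x' \<in> set (part t s j') \<Longrightarrow> x < x') \<Longrightarrow> coarser t s"
  unfolding coarser_def set_part by (blast dest: set_zip_leftD)

text \<open>Inverts substitution from \<open>s\<close> and \<open>t\<close> alone: for a refinement
  of \<open>t\<close> the minimum on a fibre is its offset, so the inner surjection is recovered
  without reference to the other fibres.\<close>

definition restr :: "nat list \<Rightarrow> nat list \<Rightarrow> nat \<Rightarrow> nat list"
  where "restr t s j = map (\<lambda>v. v - Min (set (part t s j))) (part t s j)"

lemma length_restr: "length t = length s \<Longrightarrow> length (restr t s j) = count_list t j"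
  by (simp add: restr_def length_part)

lemma count_list_pos: "x \<in> set t \<longleftrightarrow> 0 < count_list t x"
  using count_list_0_iff[of t x] by auto

lemma coarser_sur_subst:
  assumes "surj_list t" "admissible t us"
  shows "coarser t (sur_subst t us)"
proof (rule coarserI)
  fix j j' x x' assume j: "j \<in> set t" "j' \<in> set t" "j < j'"
    "x \<in> set (part t (sur_subst t us) j)" "x' \<in> set (part t (sur_subst t us) j')"
  then have "j < blocks t" "j' < blocks t"
    using assms by (auto simp: surj_list_def)
  then obtain v v' where "v < blocks (us ! j)" "x = offset us j + v" "x' = offset us j' + v'"
    using j assms by (auto simp: part_sur_subst admissible_def surj_list_def)
  then show "x < x'"
    using offset_add_less[OF j(3), of v us] by simp
qed

lemma restr_sur_subst:
  assumes "surj_list t" "admissible t us" "j < blocks t"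
  shows "restr t (sur_subst t us) j = us ! j"
proof -
  have u: "length (us ! j) = count_list t j" "set (us ! j) = {..<blocks (us ! j)}"
    using assms by (auto simp: admissible_def surj_list_def)
  \<comment> \<open>The fibre is nonempty, so the inner surjection attains 0 and the minimum of the
    shifted values is the offset itself.\<close>
  have "us ! j \<noteq> []"
    using u assms(1,3) count_list_pos[of j t] by (auto simp: surj_list_def)
  then have "0 \<in> set (us ! j)"
    using u by (metis lessThan_iff lessThan_0 gr0I set_empty)
  then have "Min ((+) (offset us j) ` set (us ! j)) = offset us j"
    by (intro Min_eqI) (auto simp: image_iff intro: bexI[of _ 0])
  then show ?thesis
    by (simp add: restr_def part_sur_subst[OF u(1)] o_def)
qed

lemma downset_eq_lessThan:
  fixes A :: "nat set"
  assumes "finite A" "\<And>x y. x \<in> A \<Longrightarrow> y < x \<Longrightarrow> y \<in> A"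
  shows "A = {..<card A}"
proof (cases "A = {}")
  case False
  have "A = {..Max A}"
    using assms False by (metis Max_ge Max_in atMost_iff equalityI le_neq_implies_less subsetI)
  then show ?thesis by (metis card_atMost lessThan_Suc_atMost)
qed simp

text \<open>Refinement puts the values on the first \<open>m\<close> fibres below all others, so
  their union is closed downwards and hence an initial segment. The values on one fibre are the
  difference of two such segments.\<close>

lemma set_part_coarser:
  assumes "surj_list t" "surj_list s" "length s = length t" "coarser t s" "j < blocks t"
  shows "set (part t s j) = {(\<Sum>i<j. card (set (part t s i)))..<(\<Sum>i<Suc j. card (set (part t s i)))}"
proof -
  let ?A = "\<lambda>i. set (part t s i)"
  have un: "(\<Union>i<m. ?A i) = {..<\<Sum>i<m. card (?A i)}" if "m \<le> blocks t" for m
  proof -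
    have "(\<Union>i<m. ?A i) = {..<card (\<Union>i<m. ?A i)}"
    proof (rule downset_eq_lessThan)
      fix x y assume x: "x \<in> (\<Union>i<m. ?A i)" and "y < x"
      then obtain i where i: "i < m" "x \<in> ?A i" by auto
      have "x \<in> set s" using i set_part_subset[of t s i] by auto
      then have "y \<in> set s" using \<open>y < x\<close> assms(2) by (auto simp: surj_list_def)
      then obtain i' where i': "y \<in> ?A i'"
        using set_eq_UN_part[OF assms(3)] by auto
      then have "\<not> i < i'"
        using coarserD[OF assms(4) _ i(2), of i' y] \<open>y < x\<close> by auto
      then show "y \<in> (\<Union>i<m. ?A i)" using i' i by (auto intro!: bexI[of _ i'])
    qed auto
    moreover have "card (\<Union>i<m. ?A i) = (\<Sum>i<m. card (?A i))"
    proof (rule card_UN_disjoint)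
      show "\<forall>i\<in>{..<m}. \<forall>j\<in>{..<m}. i \<noteq> j \<longrightarrow> ?A i \<inter> ?A j = {}"
        using coarserD[OF assms(4)] by (metis disjoint_iff less_irrefl linorder_neqE_nat)
    qed auto
    ultimately show ?thesis by simp
  qed
  have "?A j = (\<Union>i<Suc j. ?A i) - (\<Union>i<j. ?A i)"
  proof -
    have "?A j \<inter> ?A i = {}" if "i < j" for i
      using coarserD[OF assms(4) that] by (metis disjoint_iff less_irrefl)
    then show ?thesis by (auto simp: less_Suc_eq)
  qed
  also have "\<dots> = {..<\<Sum>i<Suc j. card (?A i)} - {..<\<Sum>i<j. card (?A i)}"
    using un[of j] un[of "Suc j"] assms(5) by simp
  finally show ?thesis by auto
qed

lemma blocks_map_inj: "inj_on f (set s) \<Longrightarrow> blocks (map f s) = blocks s"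
  by (simp add: blocks_def card_image)

text \<open>The converse of \<open>coarser_sur_subst\<close>. Since the values on a fibre form an
  interval, subtracting its left end yields a surjection, and the left ends are the offsets of the
  pieces. Uniqueness of the pieces is \<open>restr_sur_subst\<close>.\<close>

lemma coarser_decomp:
  assumes "surj_list t" "surj_list s" "length s = length t" "coarser t s"
  shows "admissible t (map (restr t s) [0..<blocks t])"
    and "sur_subst t (map (restr t s) [0..<blocks t]) = s"
proof -
  let ?us = "map (restr t s) [0..<blocks t]"
  let ?o = "\<lambda>j. \<Sum>i<j. card (set (part t s i))"
  have rs: "restr t s j = map (\<lambda>v. v - ?o j) (part t s j) \<and> blocks (restr t s j) = card (set (part t s j))
     \<and> set (restr t s j) = {..<blocks (restr t s j)}"
    if j: "j < blocks t" for j
  proof -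
    have "j \<in> set t"
      using assms(1) j by (simp add: surj_list_def)
    then have ne: "part t s j \<noteq> []"
      using length_part[of t s j] assms(3) count_list_pos[of j t] by auto
    have A: "set (part t s j) = {?o j..<?o (Suc j)}"
      by (rule set_part_coarser[OF assms j])
    then have lt: "?o j < ?o (Suc j)" using ne
      by (metis atLeastLessThan_empty_iff set_empty)
    have M: "Min (set (part t s j)) = ?o j"
      unfolding A using lt by (intro Min_eqI) auto
    have "inj_on (\<lambda>v. v - ?o j) (set (part t s j))"
      unfolding A by (auto simp: inj_on_def)
    then have b: "blocks (restr t s j) = card (set (part t s j))"
      unfolding restr_def M by (simp add: blocks_map_inj blocks_def[of "part t s j"])
    have "set (restr t s j) = (\<lambda>v. v - ?o j) ` {?o j..<?o j + card (set (part t s j))}"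
      using A by (simp add: restr_def M)
    also have "\<dots> = {..<card (set (part t s j))}"
      by (auto intro!: image_eqI[of _ _ "?o j + x" for x])
    finally show ?thesis using b by (auto simp: restr_def M)
  qed
  show adm: "admissible t ?us"
  proof -
    have "set (restr t s j) = {..<blocks (restr t s j)}" if "j < blocks t" for j
      using rs[OF that] by blast
    then show ?thesis
      using assms(3) by (simp add: admissible_def surj_list_def length_restr)
  qed
  have o: "offset ?us j = ?o j" if "j \<le> blocks t" for j
  proof -
    have "blocks (restr t s i) = card (set (part t s i))" if "i < blocks t" for i
      using rs[OF that] by blast
    then show ?thesis
      unfolding offset_def using that by (intro sum.cong) auto
  qed
  show "sur_subst t ?us = s"
  proof (rule part_ext)
    fix j assume "j \<in> set t"
    then have j: "j < blocks t" using assms(1) by (simp add: surj_list_def)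
    have "part t (sur_subst t ?us) j = map ((+) (offset ?us j)) (?us ! j)"
      using adm j by (intro part_sur_subst) (simp add: admissible_def)
    also have "\<dots> = map (\<lambda>v. ?o j + (v - ?o j)) (part t s j)"
      using rs[OF j] o[of j] j by (simp add: o_def)
    also have "\<dots> = part t s j"
    proof (intro map_idI le_add_diff_inverse)
      fix v assume "v \<in> set (part t s j)"
      then show "?o j \<le> v"
        unfolding set_part_coarser[OF assms j] by simp
    qed
    finally show "part t (sur_subst t ?us) j = part t s j" .
  qed (use assms in simp_all)
qed

lemma count_list_filter: "count_list s j = length (filter ((=) j) s)"
  by (induction s) auto

lemma filter_part:
  assumes "length t = length s" "\<forall>(j', y)\<in>set (zip t s). P y \<longrightarrow> j' = j"
  shows "filter P (part t s j) = filter P s"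
  using assms by (induction t s rule: list_induct2) auto

lemma fibre_unique:
  assumes "surj_list t" "admissible t us" "j < blocks t" "v < blocks (us ! j)"
    "(j', offset us j + v) \<in> set (zip t (sur_subst t us))"
  shows "j' = j"
proof -
  have j': "j' < blocks t"
    using assms(1,5) by (auto simp: surj_list_def dest: set_zip_leftD)
  have "offset us j + v \<in> set (part t (sur_subst t us) j')"
    using assms(5) by (simp add: set_part)
  then obtain v' where "v' < blocks (us ! j')" "offset us j + v = offset us j' + v'"
    using j' assms(2) by (auto simp: part_sur_subst admissible_def surj_list_def)
  then show ?thesis
    using offset_unique(1)[of us j v j' v'] assms(4) by simp
qed

text \<open>The values in the range belonging to \<open>j\<close> occur only over \<open>j\<close>,
  so a predicate confined to that range sees nothing of the other fibres. Block sizes and inversions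
  of a composite are reduced to the inner surjection by it.\<close>

lemma filter_sur_subst:
  assumes "surj_list t" "admissible t us" "j < blocks t"
    and "\<And>y. P y \<Longrightarrow> \<exists>v<blocks (us ! j). y = offset us j + v"
  shows "filter P (sur_subst t us) = map ((+) (offset us j)) (filter (\<lambda>v. P (offset us j + v)) (us ! j))"
proof -
  have "filter P (sur_subst t us) = filter P (part t (sur_subst t us) j)"
    using assms(4) fibre_unique[OF assms(1-3)] by (intro filter_part[symmetric]) (simp, blast)
  also have "\<dots> = map ((+) (offset us j)) (filter (\<lambda>v. P (offset us j + v)) (us ! j))"
    using assms(2,3) by (subst part_sur_subst) (auto simp: admissible_def filter_map o_def)
  finally show ?thesis .
qed

lemma count_sur_subst:
  assumes "surj_list t" "admissible t us" "j < blocks t" "v < blocks (us ! j)"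
  shows "count_list (sur_subst t us) (offset us j + v) = count_list (us ! j) v"
proof -
  have "filter ((=) (offset us j + v)) (sur_subst t us)
      = map ((+) (offset us j)) (filter (\<lambda>w. offset us j + v = offset us j + w) (us ! j))"
    using assms(4) by (intro filter_sur_subst[OF assms(1-3)]) auto
  then show ?thesis
    by (simp add: count_list_filter)
qed

lemma part_part:
  assumes "length t = length s" "length s = length s'"
    "\<forall>(j', y)\<in>set (zip t s). y = w \<longrightarrow> j' = j"
  shows "part (part t s j) (part t s' j) w = part s s' w"
  using assms by (induction t s s' rule: list_induct3) auto

section \<open>Flattened decorations and associativity of substitution\<close>

lemma offset_sum_list: "v \<le> length us \<Longrightarrow> offset us v = sum_list (map blocks (take v us))"
  by (induction v) (auto simp: offset_Suc take_Suc_conv_app_nth)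

lemma sum_list_concat: "sum_list (concat xss) = sum_list (map sum_list xss)"
  by (induction xss) auto

context
  fixes ts :: "nat list list" and xss :: "'b list list"
  assumes len: "length xss = length ts" "\<And>j. j < length ts \<Longrightarrow> length (xss ! j) = blocks (ts ! j)"
begin

lemma map_length_blocks: "map length xss = map blocks ts"
  using len by (intro nth_equalityI) auto

lemma concat_split:
  assumes "j < length ts"
  shows "concat xss = concat (take j xss) @ xss ! j @ concat (drop (Suc j) xss)"
    and "length (concat (take j xss)) = offset ts j"
proof -
  show "concat xss = concat (take j xss) @ xss ! j @ concat (drop (Suc j) xss)"
    using assms len by (metis concat.simps(2) concat_append id_take_nth_drop)
  have "map length (take j xss) = map blocks (take j ts)"
    using map_length_blocks by (simp add: take_map[symmetric])
  then show "length (concat (take j xss)) = offset ts j"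
    using assms by (simp add: length_concat offset_sum_list)
qed

text \<open>The start of the \<open>j\<close>-th list in the concatenation is the same offset that
  shifts the values of the \<open>j\<close>-th inner surjection. Hence flattening the decorations
  and numbering the vertices agree, and substitution preserves the order of the tensor
  factors.\<close>

lemma concat_index:
  assumes "j < length ts" "v < blocks (ts ! j)"
  shows "concat xss ! (offset ts j + v) = xss ! j ! v"
  using assms len concat_split[OF assms(1)] by (simp add: nth_append)

lemma length_concat_offset: "length (concat xss) = offset ts (length ts)"
  using map_length_blocks by (simp add: length_concat offset_sum_list)

end

context
  fixes t ts tss
  assumes t: "surj_list t" "admissible t ts" and tss: "length tss = blocks t"
    "\<And>j. j < blocks t \<Longrightarrow> admissible (ts ! j) (tss ! j)"
begin

lemma length_ts: "length ts = blocks t"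
  using t by (simp add: admissible_def)

lemma lengths_tss: "length tss = length ts" "j < length ts \<Longrightarrow> length (tss ! j) = blocks (ts ! j)"
  using length_ts tss by (auto simp: admissible_def)

lemma concat_split':
  assumes "j < blocks t"
  shows "concat tss = concat (take j tss) @ tss ! j @ concat (drop (Suc j) tss)"
    and "length (concat (take j tss)) = offset ts j"
  using concat_split[of tss ts j] lengths_tss assms length_ts by auto

lemma concat_index': "j < blocks t \<Longrightarrow> v < blocks (ts ! j) \<Longrightarrow> concat tss ! (offset ts j + v) = tss ! j ! v"
  using concat_index[of tss ts j v] lengths_tss length_ts by auto

lemma length_concat': "length (concat tss) = offset ts (blocks t)"
  using length_concat_offset[of tss ts] lengths_tss length_ts by auto

lemma blocks_map2:
  "map blocks (map2 sur_subst ts tss) = map (\<lambda>us. sum_list (map blocks us)) tss"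
proof (rule nth_equalityI)
  fix j assume "j < length (map blocks (map2 sur_subst ts tss))"
  then have j: "j < blocks t" using length_ts tss(1) by simp
  then have "blocks (sur_subst (ts ! j) (tss ! j)) = sum_list (map blocks (tss ! j))"
    using t(2) tss(2)[OF j] surj_sur_subst(2)[of "ts ! j" "tss ! j"]
    by (simp add: admissible_def offset_sum_list)
  then show "map blocks (map2 sur_subst ts tss) ! j = map (\<lambda>us. sum_list (map blocks us)) tss ! j"
    using j length_ts tss(1) by simp
qed (simp add: length_ts tss(1))

text \<open>Flattening groups the innermost surjections by outer vertex, and a group has as many
  blocks in total as the composite that it defines (\<open>blocks_map2\<close>).\<close>

lemma offset_concat:
  assumes "j < blocks t" "v \<le> blocks (ts ! j)"
  shows "offset (concat tss) (offset ts j + v) = offset (map2 sur_subst ts tss) j + offset (tss ! j) v"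
proof -
  have v: "v \<le> length (tss ! j)"
    using assms tss(2)[OF assms(1)] by (simp add: admissible_def)
  have "take (offset ts j + v) (concat tss) = concat (take j tss) @ take v (tss ! j)"
    using concat_split'[OF assms(1)] v by simp
  moreover have "offset ts j + v \<le> length (concat tss)"
    using concat_split'[OF assms(1)] v by simp
  moreover have "offset (map2 sur_subst ts tss) j = sum_list (map blocks (concat (take j tss)))"
  proof -
    have "offset (map2 sur_subst ts tss) j = sum_list (take j (map blocks (map2 sur_subst ts tss)))"
      using assms(1) length_ts tss(1) by (simp add: offset_sum_list take_map)
    also have "\<dots> = sum_list (map (\<lambda>us. sum_list (map blocks us)) (take j tss))"
      unfolding blocks_map2 by (simp add: take_map)
    also have "\<dots> = sum_list (map blocks (concat (take j tss)))"
      by (simp add: map_concat sum_list_concat o_def)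
    finally show ?thesis .
  qed
  ultimately show ?thesis
    using v by (simp add: offset_sum_list)
qed

lemma admissible_concat: "admissible (sur_subst t ts) (concat tss)"
  unfolding admissible_def
proof (intro conjI allI impI)
  show "length (concat tss) = blocks (sur_subst t ts)"
    using length_concat' surj_sur_subst(2)[OF t] by simp
  fix w assume "w < blocks (sur_subst t ts)"
  then obtain j v where w: "j < blocks t" "v < blocks (ts ! j)" "w = offset ts j + v"
    using offset_decomp surj_sur_subst(2)[OF t] by metis
  then show "length (concat tss ! w) = count_list (sur_subst t ts) w" "surj_list (concat tss ! w)"
    using tss(2)[OF w(1)] count_sur_subst[OF t w(1,2)] concat_index'[OF w(1,2)]
    by (auto simp: admissible_def)
qed

lemma admissible_map2: "admissible t (map2 sur_subst ts tss)"
  using t(2) tss length_ts surj_sur_subst(1) by (simp add: admissible_def)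

text \<open>Both sides are compared on the fibres of \<open>t\<close>, and inside each of them on
  the fibres of \<open>ts ! j\<close>. There both are shifts of \<open>tss ! j ! v\<close>, and the
  shifts agree by \<open>offset_concat\<close>.\<close>

lemma sur_subst_assoc:
  "sur_subst (sur_subst t ts) (concat tss) = sur_subst t (map2 sur_subst ts tss)"
proof (rule part_ext)
  let ?S = "sur_subst t ts" and ?S' = "sur_subst (sur_subst t ts) (concat tss)"
  fix j assume "j \<in> set t"
  then have j: "j < blocks t" using t(1) by (simp add: surj_list_def)
  have tj: "length (ts ! j) = count_list t j" "surj_list (ts ! j)"
    using t(2) j by (auto simp: admissible_def)
  have R: "part t (sur_subst t (map2 sur_subst ts tss)) j
      = map ((+) (offset (map2 sur_subst ts tss) j)) (sur_subst (ts ! j) (tss ! j))"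
    using tj j length_ts tss(1) by (subst part_sur_subst) simp_all
  have "part t ?S' j = map ((+) (offset (map2 sur_subst ts tss) j)) (sur_subst (ts ! j) (tss ! j))"
  proof (rule part_ext[of _ "ts ! j"])
    fix v assume "v \<in> set (ts ! j)"
    then have v: "v < blocks (ts ! j)" using tj(2) by (simp add: surj_list_def)
    \<comment> \<open>Shifting \<open>ts ! j\<close> by its offset turns it into the restriction of
      \<open>?S\<close> to the fibre over \<open>j\<close>; the inner fibre thereby becomes a fibre
      of \<open>?S\<close> itself.\<close>
    have "part (ts ! j) (part t ?S' j) v = part (map ((+) (offset ts j)) (ts ! j)) (part t ?S' j) (offset ts j + v)"
      by (rule part_map_left[symmetric]) (simp add: inj_def)
    also have "\<dots> = part (part t ?S j) (part t ?S' j) (offset ts j + v)"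
      using part_sur_subst[of ts j t] tj by simp
    also have "\<dots> = part ?S ?S' (offset ts j + v)"
      using fibre_unique[OF t j v] by (intro part_part) auto
    also have "\<dots> = map ((+) (offset (concat tss) (offset ts j + v))) (tss ! j ! v)"
      using tss(2)[OF j] v concat_index'[OF j v] count_sur_subst[OF t j v]
      by (subst part_sur_subst) (auto simp: admissible_def)
    also have "\<dots> = map ((+) (offset (map2 sur_subst ts tss) j)) (part (ts ! j) (sur_subst (ts ! j) (tss ! j)) v)"
      using tss(2)[OF j] v offset_concat[OF j, of v]
      by (subst part_sur_subst) (auto simp: admissible_def o_def add.assoc)
    also have "\<dots> = part (ts ! j) (map ((+) (offset (map2 sur_subst ts tss) j)) (sur_subst (ts ! j) (tss ! j))) v"
      by (simp add: part_map)
    finally show "part (ts ! j) (part t ?S' j) v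
      = part (ts ! j) (map ((+) (offset (map2 sur_subst ts tss) j)) (sur_subst (ts ! j) (tss ! j))) v" .
  qed (use tj in \<open>simp_all add: length_part\<close>)
  then show "part t ?S' j = part t (sur_subst t (map2 sur_subst ts tss)) j"
    using R by simp
qed simp_all

end

section \<open>Merging adjacent blocks: from a facet to a face that contains it\<close>

definition merge :: "nat \<Rightarrow> nat list \<Rightarrow> nat list"
  where "merge i s = map (\<lambda>v. if v \<le> i then v else v - 1) s"

lemma length_merge [simp]: "length (merge i s) = length s"
  by (simp add: merge_def)

lemma set_merge:
  assumes "surj_list s" "Suc i < blocks s"
  shows "set (merge i s) = {..<blocks s - 1}"
proof -
  have "(\<lambda>v. if v \<le> i then v else v - 1) ` {..<b} = {..<b - 1}" if "Suc i < b" for b :: nat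
  proof (intro equalityI subsetI)
    fix x assume "x \<in> {..<b - 1}"
    then show "x \<in> (\<lambda>v. if v \<le> i then v else v - 1) ` {..<b}"
      by (intro image_eqI[of _ _ "if x \<le> i then x else Suc x"]) auto
  qed (use that in auto)
  then show ?thesis
    using assms by (simp add: merge_def surj_list_def)
qed

lemma
  assumes "surj_list s" "Suc i < blocks s"
  shows blocks_merge: "blocks (merge i s) = blocks s - 1" and surj_merge: "surj_list (merge i s)"
proof -
  show "blocks (merge i s) = blocks s - 1"
    using set_merge[OF assms] by (simp add: blocks_def[of "merge i s"])
  then show "surj_list (merge i s)"
    using set_merge[OF assms] by (simp add: surj_list_def)
qed

text \<open>The analogue of a simplicial identity; the index shift accounts for the block lost below
  \<open>i'\<close>.\<close>

lemma merge_merge: "i \<le> i' \<Longrightarrow> merge i' (merge i s) = merge i (merge (Suc i') s)"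
  by (auto simp: merge_def)

lemma coarser_merge:
  assumes "coarser t (merge i s)"
  shows "coarser t s"
proof (rule coarserI)
  fix j j' x x' assume *: "j < j'" "x \<in> set (part t s j)" "x' \<in> set (part t s j')"
  let ?f = "\<lambda>v. if v \<le> i then v else v - 1"
  have "?f x < ?f x'"
    using coarserD[OF assms *(1), of "?f x" "?f x'"] * by (simp add: merge_def part_map)
  then show "x < x'" by (auto split: if_splits)
qed

lemma offset_update:
  assumes "l < length us" "blocks u + 1 = blocks (us ! l)"
  shows "j \<le> l \<Longrightarrow> offset (us[l := u]) j = offset us j"
    and "l < j \<Longrightarrow> offset (us[l := u]) j + 1 = offset us j"
proof -
  show *: "j \<le> l \<Longrightarrow> offset (us[l := u]) j = offset us j" for j
    by (simp add: offset_def)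
  show "l < j \<Longrightarrow> offset (us[l := u]) j + 1 = offset us j"
    using *[of l] assms by (induction j) (auto simp: offset_Suc less_Suc_eq)
qed

lemma admissible_update:
  "admissible t us \<Longrightarrow> l < blocks t \<Longrightarrow> length u = count_list t l \<Longrightarrow> surj_list u
    \<Longrightarrow> admissible t (us[l := u])"
  by (auto simp: admissible_def nth_list_update)

text \<open>Adjacent blocks that belong to one vertex can be merged before substituting: the block
  lost at \<open>l\<close> lowers exactly the offsets behind \<open>l\<close>. With
  \<open>not_coarser_merge\<close> this is the combinatorial content of the Leibniz rule.\<close>

lemma merge_sur_subst:
  assumes "surj_list t" "admissible t us" "l < blocks t" "Suc i < blocks (us ! l)"
  shows "merge (offset us l + i) (sur_subst t us) = sur_subst t (us[l := merge i (us ! l)])"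
proof (rule part_ext[of _ t])
  let ?f = "\<lambda>i v. if v \<le> i then v else v - 1 :: nat" and ?us = "us[l := merge i (us ! l)]"
  have l: "l < length us" "surj_list (us ! l)" "length (us ! l) = count_list t l"
    using assms(2,3) by (auto simp: admissible_def)
  have b: "blocks (merge i (us ! l)) + 1 = blocks (us ! l)"
    using blocks_merge[OF l(2) assms(4)] assms(4) by simp
  have adm: "admissible t ?us"
    using assms surj_merge l by (intro admissible_update) auto
  fix j assume "j \<in> set t"
  then have j: "j < blocks t" using assms(1) by (simp add: surj_list_def)
  have uj: "set (us ! j) = {..<blocks (us ! j)}"
    using assms(2) j by (auto simp: admissible_def surj_list_def)
  have L: "part t (merge (offset us l + i) (sur_subst t us)) j
      = map (\<lambda>v. ?f (offset us l + i) (offset us j + v)) (us ! j)"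
    using assms(2) j by (simp add: merge_def part_map part_sur_subst admissible_def o_def)
  have R: "part t (sur_subst t ?us) j = map ((+) (offset ?us j)) (?us ! j)"
    using adm j by (intro part_sur_subst) (simp add: admissible_def)
  consider "j < l" | "j = l" | "l < j" by linarith
  then show "part t (merge (offset us l + i) (sur_subst t us)) j = part t (sur_subst t ?us) j"
  proof cases
    case 1
    then have "offset us j + v < offset us l" if "v \<in> set (us ! j)" for v
      using offset_add_less[of j l v us] that uj by simp
    then show ?thesis
      unfolding L R using 1 offset_update(1)[OF l(1) b, of j] by (auto intro!: map_cong dest: less_imp_le trans_le_add1)
  next
    case 2
    then show ?thesis
      unfolding L R using offset_update(1)[OF l(1) b, of j] l(1) by (auto simp: merge_def)
  next
    case 3
    then have "offset us l + i < offset us j" "offset us j = Suc (offset ?us j)"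
      using offset_add_less[of l j i us] offset_update(2)[OF l(1) b, of j] assms(4) by auto
    then show ?thesis
      unfolding L R using 3 by (auto intro!: map_cong)
  qed
qed simp_all

text \<open>The merged block contains points over \<open>l\<close> and points over
  \<open>Suc l\<close>, so these two fibres of \<open>t\<close> share a value. Such merges
  contribute nothing to the boundary of a composite.\<close>

lemma not_coarser_merge:
  assumes "surj_list t" "admissible t us" "Suc l < blocks t" "Suc i = blocks (us ! l)"
  shows "\<not> coarser t (merge (offset us l + i) (sur_subst t us))"
proof
  let ?f = "\<lambda>i v. if v \<le> i then v else v - 1 :: nat"
  assume *: "coarser t (merge (offset us l + i) (sur_subst t us))"
  have part: "set (part t (merge (offset us l + i) (sur_subst t us)) j)
      = (\<lambda>v. ?f (offset us l + i) (offset us j + v)) ` {..<blocks (us ! j)}" if "j < blocks t" for j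
  proof -
    have "set (us ! j) = {..<blocks (us ! j)}"
      using assms(2) that by (auto simp: admissible_def surj_list_def)
    then show ?thesis
      using assms(2) that by (simp add: merge_def part_map part_sur_subst admissible_def image_image)
  qed
  have "us ! Suc l \<noteq> []"
    using assms count_list_pos[of "Suc l" t] by (auto simp: admissible_def surj_list_def)
  then have "0 < blocks (us ! Suc l)" by (simp add: blocks_def card_gt_0_iff)
  then have "offset us l + i \<in> set (part t (merge (offset us l + i) (sur_subst t us)) (Suc l))"
    using assms by (subst part) (auto simp: offset_Suc intro!: image_eqI[of _ _ 0])
  moreover have "offset us l + i \<in> set (part t (merge (offset us l + i) (sur_subst t us)) l)"
    using assms by (subst part) (auto intro!: image_eqI[of _ _ i])
  ultimately show False
    using coarserD[OF * lessI] by blast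
qed


section \<open>Inversions and boundary signs\<close>

lemma length_filter_disj:
  "(\<And>x. \<not> (P x \<and> Q x)) \<Longrightarrow> length (filter (\<lambda>x. P x \<or> Q x) s) = length (filter P s) + length (filter Q s)"
  by (induction s) auto

lemma count_merge:
  "count_list (merge i s) j =
    (if j < i then count_list s j
     else if j = i then count_list s i + count_list s (Suc i)
     else count_list s (Suc j))"
  by (induction s) (auto simp: merge_def)

text \<open>Predicates are used in place of values so that a merged block becomes a disjunction and
  a relabelling of blocks becomes a composition.\<close>

fun icount :: "('b \<Rightarrow> bool) \<Rightarrow> ('b \<Rightarrow> bool) \<Rightarrow> 'b list \<Rightarrow> nat"
  where
    "icount P Q [] = 0"
  | "icount P Q (x # s) = (if P x then length (filter Q s) else 0) + icount P Q s"

lemma icount_map: "icount P Q (map f s) = icount (P \<circ> f) (Q \<circ> f) s"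
  by (induction s) (auto simp: filter_map o_def)

lemma icount_append:
  "icount P Q (s @ s') = icount P Q s + icount P Q s' + length (filter P s) * length (filter Q s')"
  by (induction s) auto

lemma icount_filter: "(\<And>x. P x \<or> Q x \<Longrightarrow> S x) \<Longrightarrow> icount P Q (filter S s) = icount P Q s"
  by (induction s) (auto intro!: arg_cong[of _ _ length] filter_cong)

lemma icount_disj_left:
  "(\<And>x. \<not> (P x \<and> P' x)) \<Longrightarrow> icount (\<lambda>x. P x \<or> P' x) Q s = icount P Q s + icount P' Q s"
  by (induction s) auto

lemma icount_disj_right:
  "(\<And>x. \<not> (Q x \<and> Q' x)) \<Longrightarrow> icount P (\<lambda>x. Q x \<or> Q' x) s = icount P Q s + icount P Q' s"
  by (induction s) (auto simp: length_filter_disj)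

text \<open>For \<open>i < j\<close> these are the inversions of the shuffle that lists block
  \<open>i\<close> before block \<open>j\<close>; for \<open>i = 0\<close> and \<open>j = 1\<close>
  their parity gives the sign of \<open>shuffle_perm\<close>.\<close>

definition inversions :: "nat \<Rightarrow> nat \<Rightarrow> nat list \<Rightarrow> nat"
  where "inversions i j s = icount ((=) j) ((=) i) s"

text \<open>The exponent of the sign with which \<open>s\<close> occurs in the boundary of \<open>merge i s\<close>: a vertex
  below \<open>i\<close> has degree \<open>count_list s j - 1\<close>, and the remaining summands are those of \<open>sur_sgn\<close>
  for the splitting of the merged block.\<close>

definition dexp :: "nat list \<Rightarrow> nat \<Rightarrow> nat"
  where "dexp s i = (\<Sum>j<i. count_list s j + 1) + count_list s i + inversions i (Suc i) s"

lemma inversions_merge: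
  assumes "k < j"
  shows "inversions k j (merge i s) =
    (if j < i then inversions k j s
     else if j = i then inversions k i s + inversions k (Suc i) s
     else if k < i then inversions k (Suc j) s
     else if k = i then inversions i (Suc j) s + inversions (Suc i) (Suc j) s
     else inversions (Suc k) (Suc j) s)"
proof -
  let ?f = "\<lambda>v. if v \<le> i then v else v - 1 :: nat"
  have *: "(=) m \<circ> ?f = (if m < i then (=) m else if m = i then (\<lambda>v. i = v \<or> Suc i = v) else (=) (Suc m))" for m
    by (rule ext) auto
  show ?thesis
    using assms unfolding inversions_def merge_def icount_map *
    by (auto simp: icount_disj_left icount_disj_right)
qed

lemma sum_count_merge:
  "(\<Sum>j<m. count_list (merge i s) j + 1) + (if i < m then 1 else 0)
    = (\<Sum>j<(if i < m then Suc m else m). count_list s j + 1)"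
proof (induction m)
  case (Suc m)
  consider "i < m" | "i = m" | "m < i" by linarith
  then show ?case using Suc by cases (auto simp: count_merge)
qed simp

text \<open>The sign identity behind \<open>d^2 = 0\<close>. For \<open>i < i'\<close>, merging at
  \<open>i\<close> removes one block and so lowers the sum of the terms
  \<open>count_list s j + 1\<close> below \<open>i'\<close> by one. For \<open>i = i'\<close>, the
  inversions among three blocks are only grouped differently, and the odd unit is the
  \<open>+ 1\<close> belonging to block \<open>i\<close>.\<close>

lemma dexp_merge_merge:
  assumes "i \<le> i'"
  shows "even (dexp s i + dexp (merge i s) i') \<longleftrightarrow> odd (dexp s (Suc i') + dexp (merge (Suc i') s) i)"
proof (cases "i = i'")
  case True
  then show ?thesis
    using sum_count_merge[of i s i] sum_count_merge[of i s "Suc i"]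
    by (auto simp: dexp_def inversions_merge count_merge)
next
  case False
  with assms have "i < i'" by simp
  then have "dexp (merge (Suc i') s) i = dexp s i" "dexp (merge i s) i' + 1 = dexp s (Suc i')"
    using sum_count_merge[of i s i'] sum_count_merge[of "Suc i'" s i]
    by (auto simp: dexp_def inversions_merge count_merge)
  then show ?thesis by presburger
qed

lemma sum_count_list:
  "surj_list s \<Longrightarrow> (\<Sum>v<blocks s. count_list s v) = length s"
  unfolding surj_list_def by (metis sum_count_set finite_set order_refl finite_lessThan)

lemma sum_count_sur_subst:
  assumes "surj_list t" "admissible t us" "l \<le> blocks t"
  shows "(\<Sum>j<offset us l. count_list (sur_subst t us) j + 1) = (\<Sum>j<l. count_list t j + blocks (us ! j))"
  using assms(3)
proof (induction l)
  case (Suc l)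
  let ?S = "sur_subst t us"
  have u: "surj_list (us ! l)" "length (us ! l) = count_list t l"
    using assms(2) Suc.prems by (auto simp: admissible_def)
  have "(\<Sum>j<offset us l + b. count_list ?S j + 1)
      = (\<Sum>j<offset us l. count_list ?S j + 1) + (\<Sum>v<b. count_list (us ! l) v + 1)" if "b \<le> blocks (us ! l)" for b
    using that count_sur_subst[OF assms(1,2), of l] Suc.prems by (induction b) auto
  from this[of "blocks (us ! l)"] show ?case
    using Suc sum_count_list[OF u(1)] u(2) by (simp add: offset_Suc sum.distrib sum_Suc)
qed simp

lemma inversions_sur_subst:
  assumes "surj_list t" "admissible t us" "l < blocks t" "Suc i < blocks (us ! l)"
  shows "inversions (offset us l + i) (Suc (offset us l + i)) (sur_subst t us) = inversions i (Suc i) (us ! l)"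
proof -
  let ?o = "offset us l"
  let ?P = "\<lambda>y. ?o + i = y \<or> Suc (?o + i) = y"
  have f: "filter ?P (sur_subst t us) = map ((+) ?o) (filter (\<lambda>v. ?P (?o + v)) (us ! l))"
  proof (rule filter_sur_subst[OF assms(1-3)])
    fix y assume "?P y"
    then show "\<exists>v<blocks (us ! l). y = ?o + v"
      using assms(4) by (elim disjE) (auto intro: exI[of _ i] exI[of _ "Suc i"])
  qed
  have "inversions (?o + i) (Suc (?o + i)) (sur_subst t us)
      = icount ((=) (Suc (?o + i))) ((=) (?o + i)) (filter ?P (sur_subst t us))"
    unfolding inversions_def by (rule icount_filter[symmetric]) auto
  also have "\<dots> = icount ((=) (Suc (?o + i)) \<circ> (+) ?o) ((=) (?o + i) \<circ> (+) ?o) (filter (\<lambda>v. ?P (?o + v)) (us ! l))"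
    unfolding f icount_map ..
  also have "\<dots> = icount ((=) (Suc i)) ((=) i) (filter (\<lambda>v. ?P (?o + v)) (us ! l))"
    by (intro arg_cong2[of _ _ _ _ "\<lambda>P Q. icount P Q _"]) auto
  also have "\<dots> = inversions i (Suc i) (us ! l)"
    unfolding inversions_def by (rule icount_filter) auto
  finally show ?thesis .
qed

text \<open>\<open>count_list t j + blocks (us ! j)\<close> has the parity of the degree
  \<open>count_list t j - blocks (us ! j)\<close> of the \<open>j\<close>-th piece. The additional
  summand is therefore the exponent of the Koszul sign for passing the pieces before
  \<open>l\<close>.\<close>

lemma dexp_sur_subst:
  assumes "surj_list t" "admissible t us" "l < blocks t" "Suc i < blocks (us ! l)"
  shows "dexp (sur_subst t us) (offset us l + i) = (\<Sum>j<l. count_list t j + blocks (us ! j)) + dexp (us ! l) i"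
proof -
  have "(\<Sum>j<offset us l + b. count_list (sur_subst t us) j + 1)
      = (\<Sum>j<l. count_list t j + blocks (us ! j)) + (\<Sum>v<b. count_list (us ! l) v + 1)" if "b \<le> blocks (us ! l)" for b
    using that
  proof (induction b)
    case 0
    then show ?case using sum_count_sur_subst[OF assms(1,2)] assms(3) by simp
  next
    case (Suc b)
    then show ?case using count_sur_subst[OF assms(1-3), of b] by simp
  qed
  from this[of i] show ?thesis
    using assms(4) count_sur_subst[OF assms(1-3), of i] inversions_sur_subst[OF assms]
    by (simp add: dexp_def)
qed

section \<open>Modules and linear maps\<close>

text \<open>Each module axiom is an identity or an existence statement, and these pass to the image
  of a map that respects the operations. Quotients and transported structures are both obtained from
  it.\<close>

lemma module_image:
  assumes M: "module R M"
    and car: "carrier N = f ` carrier M" and z: "f \<zero>\<^bsub>M\<^esub> = \<zero>\<^bsub>N\<^esub>"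
    and add: "\<And>x y. x \<in> carrier M \<Longrightarrow> y \<in> carrier M \<Longrightarrow> f (x \<oplus>\<^bsub>M\<^esub> y) = f x \<oplus>\<^bsub>N\<^esub> f y"
    and sm: "\<And>c x. c \<in> carrier R \<Longrightarrow> x \<in> carrier M \<Longrightarrow> f (c \<odot>\<^bsub>M\<^esub> x) = c \<odot>\<^bsub>N\<^esub> f x"
  shows "module R N"
proof -
  interpret M: module R M by fact
  note eqs = add[symmetric] sm[symmetric] z[symmetric]
  show ?thesis
  proof (rule moduleI)
    show "abelian_group N"
    proof (rule abelian_groupI)
      fix x assume "x \<in> carrier N"
      then obtain x' where x': "x' \<in> carrier M" "x = f x'" using car by auto
      then have "f (\<ominus>\<^bsub>M\<^esub> x') \<oplus>\<^bsub>N\<^esub> x = \<zero>\<^bsub>N\<^esub>"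
        by (simp add: eqs M.l_neg)
      then show "\<exists>y\<in>carrier N. y \<oplus>\<^bsub>N\<^esub> x = \<zero>\<^bsub>N\<^esub>"
        using car x' by auto
    qed (auto simp: car eqs M.a_ac)
  qed (auto simp: car eqs M.is_cring M.smult_l_distr M.smult_r_distr M.smult_assoc1)
qed

context module
begin

lemma submodule_diff:
  "submodule N R M \<Longrightarrow> x \<in> N \<Longrightarrow> y \<in> N \<Longrightarrow> x \<ominus>\<^bsub>M\<^esub> y \<in> N"
  using submoduleE[of N] by (simp add: a_minus_def)

lemma submodule_zero: "submodule N R M \<Longrightarrow> \<zero>\<^bsub>M\<^esub> \<in> N"
  using subgroup.one_closed[of N "add_monoid M"] by (simp add: submodule_def)

lemma submodule_subset: "submodule N R M \<Longrightarrow> N \<subseteq> carrier M"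
  by (rule submoduleE)

lemma mem_coset_iff:
  assumes "submodule N R M" "y \<in> carrier M"
  shows "x \<in> N +>\<^bsub>M\<^esub> y \<longleftrightarrow> x \<in> carrier M \<and> x \<ominus>\<^bsub>M\<^esub> y \<in> N"
proof
  assume "x \<in> N +>\<^bsub>M\<^esub> y"
  then obtain h where "h \<in> N" "x = h \<oplus>\<^bsub>M\<^esub> y" by (auto simp: a_r_coset_def')
  moreover from this have "h \<in> carrier M" using submodule_subset[OF assms(1)] by auto
  ultimately show "x \<in> carrier M \<and> x \<ominus>\<^bsub>M\<^esub> y \<in> N"
    using assms(2) by (simp add: a_minus_def M.a_assoc M.r_neg)
next
  assume "x \<in> carrier M \<and> x \<ominus>\<^bsub>M\<^esub> y \<in> N"
  moreover from this have "x = (x \<ominus>\<^bsub>M\<^esub> y) \<oplus>\<^bsub>M\<^esub> y"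
    using assms(2) by (simp add: a_minus_def M.a_assoc M.l_neg)
  ultimately show "x \<in> N +>\<^bsub>M\<^esub> y"
    unfolding a_r_coset_def' by blast
qed

lemma coset_self: "submodule N R M \<Longrightarrow> y \<in> carrier M \<Longrightarrow> y \<in> N +>\<^bsub>M\<^esub> y"
  using submodule_zero by (simp add: mem_coset_iff a_minus_def M.r_neg)

lemma coset_eq_iff:
  assumes "submodule N R M" "x \<in> carrier M" "y \<in> carrier M"
  shows "N +>\<^bsub>M\<^esub> x = N +>\<^bsub>M\<^esub> y \<longleftrightarrow> x \<ominus>\<^bsub>M\<^esub> y \<in> N"
proof
  assume "N +>\<^bsub>M\<^esub> x = N +>\<^bsub>M\<^esub> y"
  then show "x \<ominus>\<^bsub>M\<^esub> y \<in> N"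
    using coset_self[OF assms(1,2)] mem_coset_iff[OF assms(1,3)] by auto
next
  assume *: "x \<ominus>\<^bsub>M\<^esub> y \<in> N"
  have "z \<ominus>\<^bsub>M\<^esub> y = (z \<ominus>\<^bsub>M\<^esub> x) \<oplus>\<^bsub>M\<^esub> (x \<ominus>\<^bsub>M\<^esub> y)" if "z \<in> carrier M" for z
  proof -
    have "\<ominus>\<^bsub>M\<^esub> x \<oplus>\<^bsub>M\<^esub> (x \<oplus>\<^bsub>M\<^esub> \<ominus>\<^bsub>M\<^esub> y) = \<ominus>\<^bsub>M\<^esub> y"
      using assms by (simp add: M.a_assoc[symmetric] M.l_neg)
    then show ?thesis using that assms by (simp add: a_minus_def M.a_assoc)
  qed
  moreover have "z \<ominus>\<^bsub>M\<^esub> x = (z \<ominus>\<^bsub>M\<^esub> y) \<ominus>\<^bsub>M\<^esub> (x \<ominus>\<^bsub>M\<^esub> y)" if "z \<in> carrier M" for z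
  proof -
    have "\<ominus>\<^bsub>M\<^esub> y \<oplus>\<^bsub>M\<^esub> (\<ominus>\<^bsub>M\<^esub> x \<oplus>\<^bsub>M\<^esub> y) = \<ominus>\<^bsub>M\<^esub> x"
      using assms M.a_lcomm[of "\<ominus>\<^bsub>M\<^esub> y" "\<ominus>\<^bsub>M\<^esub> x" y] by (simp add: M.l_neg)
    then show ?thesis using that assms by (simp add: a_minus_def M.a_assoc M.minus_add)
  qed
  ultimately have "z \<ominus>\<^bsub>M\<^esub> x \<in> N \<longleftrightarrow> z \<ominus>\<^bsub>M\<^esub> y \<in> N" if "z \<in> carrier M" for z
    using that * submoduleE(5)[OF assms(1)] submodule_diff[OF assms(1)] by metis
  then show "N +>\<^bsub>M\<^esub> x = N +>\<^bsub>M\<^esub> y"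
    using assms by (auto simp: set_eq_iff mem_coset_iff)
qed

text \<open>\<open>quot_module\<close>, \<open>quot_permutad\<close> and
  \<open>free_permutad\<close> apply a function to all representatives and then add the submodule.
  This is the common reason why the outcome is a single coset.\<close>

lemma set_add_coset:
  assumes "submodule N R M" "y \<in> carrier M" "A \<noteq> {}" "A \<subseteq> N +>\<^bsub>M\<^esub> y"
  shows "N <+>\<^bsub>M\<^esub> A = N +>\<^bsub>M\<^esub> y"
proof -
  have "N <+>\<^bsub>M\<^esub> A = (\<Union>a\<in>A. N +>\<^bsub>M\<^esub> a)"
    by (auto simp: set_add_def' a_r_coset_def')
  also have "\<dots> = N +>\<^bsub>M\<^esub> y"
  proof -
    have "N +>\<^bsub>M\<^esub> a = N +>\<^bsub>M\<^esub> y" if "a \<in> A" for a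
      using that assms coset_eq_iff[OF assms(1) _ assms(2), of a] mem_coset_iff[OF assms(1,2), of a] by auto
    then show ?thesis using assms(3) by auto
  qed
  finally show ?thesis .
qed

lemma coset_sum:
  assumes "submodule N R M" "x \<in> carrier M" "y \<in> carrier M"
  shows "(N +>\<^bsub>M\<^esub> x) <+>\<^bsub>M\<^esub> (N +>\<^bsub>M\<^esub> y) = N +>\<^bsub>M\<^esub> (x \<oplus>\<^bsub>M\<^esub> y)"
proof -
  have "additive_subgroup N M"
    using assms(1) by (simp add: submodule_def additive_subgroup_def)
  then interpret abelian_subgroup N M
    by (rule abelian_subgroupI3) (rule M.abelian_group_axioms)
  show ?thesis using assms by (simp add: a_rcos_sum)
qed

lemma smult_coset:
  assumes "submodule N R M" "c \<in> carrier R" "x \<in> carrier M"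
  shows "N <+>\<^bsub>M\<^esub> (\<lambda>x. c \<odot>\<^bsub>M\<^esub> x) ` (N +>\<^bsub>M\<^esub> x) = N +>\<^bsub>M\<^esub> (c \<odot>\<^bsub>M\<^esub> x)"
proof (rule set_add_coset[OF assms(1)])
  show "(\<lambda>x. c \<odot>\<^bsub>M\<^esub> x) ` (N +>\<^bsub>M\<^esub> x) \<subseteq> N +>\<^bsub>M\<^esub> (c \<odot>\<^bsub>M\<^esub> x)"
  proof
    fix z assume "z \<in> (\<lambda>x. c \<odot>\<^bsub>M\<^esub> x) ` (N +>\<^bsub>M\<^esub> x)"
    then obtain y where y: "y \<in> carrier M" "y \<ominus>\<^bsub>M\<^esub> x \<in> N" "z = c \<odot>\<^bsub>M\<^esub> y"
      using mem_coset_iff[OF assms(1,3)] by auto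
    have "c \<odot>\<^bsub>M\<^esub> y \<ominus>\<^bsub>M\<^esub> c \<odot>\<^bsub>M\<^esub> x = c \<odot>\<^bsub>M\<^esub> (y \<ominus>\<^bsub>M\<^esub> x)"
      using assms y by (simp add: a_minus_def smult_r_distr smult_r_minus)
    then show "z \<in> N +>\<^bsub>M\<^esub> (c \<odot>\<^bsub>M\<^esub> x)"
      using y assms submoduleE(4)[OF assms(1)] by (simp add: mem_coset_iff)
  qed
qed (use assms coset_self in auto)

lemma quot_module_simps [simp]:
  "zero (quot_module M N) = N"
  "add (quot_module M N) = set_add M"
  "smult (quot_module M N) = (\<lambda>c X. N <+>\<^bsub>M\<^esub> (\<lambda>x. c \<odot>\<^bsub>M\<^esub> x) ` X)"
  by (simp_all add: quot_module_def)

lemma carrier_quot_module: "carrier (quot_module M N) = (\<lambda>x. N +>\<^bsub>M\<^esub> x) ` carrier M"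
  by (auto simp: quot_module_def A_RCOSETS_def')

lemma coset_zero: "submodule N R M \<Longrightarrow> N +>\<^bsub>M\<^esub> \<zero>\<^bsub>M\<^esub> = N"
  using submodule_subset by (intro M.a_coset_add_zero) auto

lemma quot_module:
  assumes "submodule N R M"
  shows "module R (quot_module M N)"
    and "linear_map R M (quot_module M N) (\<lambda>x. N +>\<^bsub>M\<^esub> x)"
proof -
  show "module R (quot_module M N)"
    by (rule module_image[OF module_axioms, of _ "\<lambda>x. N +>\<^bsub>M\<^esub> x"])
      (simp_all add: carrier_quot_module coset_zero coset_sum smult_coset assms)
  show "linear_map R M (quot_module M N) (\<lambda>x. N +>\<^bsub>M\<^esub> x)"
    by (auto simp: linear_map_def carrier_quot_module coset_sum smult_coset assms)
qed

lemma gen_submodule: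
  assumes "X \<subseteq> carrier M"
  shows "submodule (gen_submodule R M X) R M" "X \<subseteq> gen_submodule R M X"
    and "submodule H R M \<Longrightarrow> X \<subseteq> H \<Longrightarrow> gen_submodule R M X \<subseteq> H"
proof -
  show "submodule (gen_submodule R M X) R M"
  proof (rule submoduleI)
    show "gen_submodule R M X \<subseteq> carrier M"
      using carrier_is_submodule assms by (auto simp: gen_submodule_def)
  qed (auto simp: gen_submodule_def submodule_zero submoduleE)
  show "X \<subseteq> gen_submodule R M X" by (auto simp: gen_submodule_def)
  show "submodule H R M \<Longrightarrow> X \<subseteq> H \<Longrightarrow> gen_submodule R M X \<subseteq> H"
    by (auto simp: gen_submodule_def)
qed

end

locale linear = M: module R M + N: module R N for R M N +
  fixes f
  assumes linear: "linear_map R M N f"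
begin

lemma closed [simp]: "x \<in> carrier M \<Longrightarrow> f x \<in> carrier N"
  and f_add: "x \<in> carrier M \<Longrightarrow> y \<in> carrier M \<Longrightarrow> f (x \<oplus>\<^bsub>M\<^esub> y) = f x \<oplus>\<^bsub>N\<^esub> f y"
  and f_smult: "c \<in> carrier R \<Longrightarrow> x \<in> carrier M \<Longrightarrow> f (c \<odot>\<^bsub>M\<^esub> x) = c \<odot>\<^bsub>N\<^esub> f x"
  using linear by (auto simp: linear_map_def)

lemma f_zero: "f \<zero>\<^bsub>M\<^esub> = \<zero>\<^bsub>N\<^esub>"
  using f_smult[of "\<zero>\<^bsub>R\<^esub>" "\<zero>\<^bsub>M\<^esub>"] by simp

lemma f_a_inv: "x \<in> carrier M \<Longrightarrow> f (\<ominus>\<^bsub>M\<^esub> x) = \<ominus>\<^bsub>N\<^esub> f x"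
  using f_smult[of "\<ominus>\<^bsub>R\<^esub> \<one>\<^bsub>R\<^esub>" x] by (simp add: M.smult_l_minus N.smult_l_minus)

lemma f_minus: "x \<in> carrier M \<Longrightarrow> y \<in> carrier M \<Longrightarrow> f (x \<ominus>\<^bsub>M\<^esub> y) = f x \<ominus>\<^bsub>N\<^esub> f y"
  by (simp add: a_minus_def f_add f_a_inv)

lemma f_finsum: "g \<in> A \<rightarrow> carrier M \<Longrightarrow> f (finsum M g A) = finsum N (\<lambda>x. f (g x)) A"
proof (induction A rule: infinite_finite_induct)
  case (insert a A)
  then have "g \<in> A \<rightarrow> carrier M" "g a \<in> carrier M" by auto
  then have "(\<lambda>x. f (g x)) \<in> A \<rightarrow> carrier N" by (auto simp: Pi_iff)
  then show ?case
    using insert \<open>g \<in> A \<rightarrow> carrier M\<close> \<open>g a \<in> carrier M\<close> by (simp add: f_add)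
qed (simp_all add: f_zero)

lemma submodule_preimage:
  assumes "submodule H R N"
  shows "submodule {x \<in> carrier M. f x \<in> H} R M"
  by (rule M.submoduleI)
    (auto simp: f_zero f_add f_a_inv f_smult N.submodule_zero[OF assms] N.submoduleE[OF assms])

lemma submodule_image:
  assumes "submodule H R M"
  shows "submodule (f ` H) R N"
proof (rule N.submoduleI)
  have H: "x \<in> carrier M" if "x \<in> H" for x
    using M.submodule_subset[OF assms] that by auto
  show "f ` H \<subseteq> carrier N" using H by auto
  show "\<zero>\<^bsub>N\<^esub> \<in> f ` H" using M.submodule_zero[OF assms] f_zero by (metis imageI)
  fix a assume "a \<in> f ` H"
  then obtain x where x: "x \<in> H" "a = f x" by auto
  then show "\<ominus>\<^bsub>N\<^esub> a \<in> f ` H"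
    using H M.submoduleE(3)[OF assms] f_a_inv by (metis imageI)
  show "c \<odot>\<^bsub>N\<^esub> a \<in> f ` H" if "c \<in> carrier R" for c
    using x H M.submoduleE(4)[OF assms] f_smult that by (metis imageI)
  fix b assume "b \<in> f ` H"
  then obtain y where "y \<in> H" "b = f y" by auto
  then show "a \<oplus>\<^bsub>N\<^esub> b \<in> f ` H"
    using x H M.submoduleE(5)[OF assms] f_add by (metis imageI)
qed

end

lemma linearI: "module R M \<Longrightarrow> module R N \<Longrightarrow> linear_map R M N f \<Longrightarrow> linear R M N f"
  by (simp add: linear_def linear_axioms_def)

context abelian_group
begin

lemma add_pow_int_minus_one: "x \<in> carrier G \<Longrightarrow> [(- 1::int)] \<cdot> x = \<ominus> x"
  by (simp add: add_pow_int_lt)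

end

lemma free_module_simps [simp]:
  "zero (free_module R S) = (\<lambda>_. \<zero>\<^bsub>R\<^esub>)"
  "add (free_module R S) = (\<lambda>f g s. f s \<oplus>\<^bsub>R\<^esub> g s)"
  "smult (free_module R S) = (\<lambda>c f s. c \<otimes>\<^bsub>R\<^esub> f s)"
  by (simp_all add: free_module_def)

context cring
begin

lemma free_module_carrier:
  "f \<in> carrier (free_module R S) \<longleftrightarrow>
    (\<forall>s. f s \<in> carrier R) \<and> (\<forall>s. s \<notin> S \<longrightarrow> f s = \<zero>) \<and> finite {s. f s \<noteq> \<zero>}"
  by (simp add: free_module_def) (metis zero_closed)

lemma free_module_closed [simp, intro]: "f \<in> carrier (free_module R S) \<Longrightarrow> f s \<in> carrier R"
  by (simp add: free_module_carrier)

lemma free_module: "module R (free_module R S)"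
proof (rule moduleI)
  have fin: "finite {s. h s \<noteq> \<zero>}" if "finite {s. f s \<noteq> \<zero>}" "finite {s. g s \<noteq> \<zero>}"
    "\<And>s. f s = \<zero> \<Longrightarrow> g s = \<zero> \<Longrightarrow> h s = \<zero>" for f g h :: "'c \<Rightarrow> 'a"
    by (rule finite_subset[of _ "{s. f s \<noteq> \<zero>} \<union> {s. g s \<noteq> \<zero>}"]) (use that in auto)
  show "abelian_group (free_module R S)"
  proof (rule abelian_groupI)
    fix f assume f: "f \<in> carrier (free_module R S)"
    then have "(\<lambda>s. \<ominus> f s) \<in> carrier (free_module R S)"
      by (auto simp: free_module_carrier elim!: fin)
    moreover have "(\<lambda>s. \<ominus> f s) \<oplus>\<^bsub>free_module R S\<^esub> f = \<zero>\<^bsub>free_module R S\<^esub>"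
      using f by (auto simp: free_module_carrier l_neg)
    ultimately show "\<exists>g\<in>carrier (free_module R S). g \<oplus>\<^bsub>free_module R S\<^esub> f = \<zero>\<^bsub>free_module R S\<^esub>"
      by blast
  qed (auto simp: free_module_carrier a_ac elim: fin)
  show "c \<odot>\<^bsub>free_module R S\<^esub> f \<in> carrier (free_module R S)"
    if "c \<in> carrier R" "f \<in> carrier (free_module R S)" for c f
    using that by (auto simp: free_module_carrier intro: finite_subset[of _ "{s. f s \<noteq> \<zero>}"])
qed (auto simp: free_module_carrier is_cring l_distr r_distr m_assoc)

lemma free_module_a_inv:
  assumes "f \<in> carrier (free_module R S)"
  shows "\<ominus>\<^bsub>free_module R S\<^esub> f = (\<lambda>s. \<ominus> f s)"
proof -
  interpret F: module R "free_module R S" by (rule free_module)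
  have "\<ominus>\<^bsub>free_module R S\<^esub> f = (\<ominus> \<one>) \<odot>\<^bsub>free_module R S\<^esub> f"
    using assms F.smult_l_minus[of \<one> f] F.smult_one[OF assms] by simp
  then show ?thesis using assms by (simp add: free_module_carrier l_minus)
qed

lemma free_module_finsum:
  assumes "g \<in> A \<rightarrow> carrier (free_module R S)"
  shows "finsum (free_module R S) g A s = (\<Oplus>i\<in>A. g i s)"
proof -
  interpret F: module R "free_module R S" by (rule free_module)
  show ?thesis using assms
  proof (induction A rule: infinite_finite_induct)
    case (insert a A)
    then have "g \<in> A \<rightarrow> carrier (free_module R S)" "g a \<in> carrier (free_module R S)"
      by auto
    then have "(\<lambda>i. g i s) \<in> A \<rightarrow> carrier R" by auto
    then show ?case using insert \<open>g \<in> A \<rightarrow> carrier (free_module R S)\<close>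
        \<open>g a \<in> carrier (free_module R S)\<close> by simp
  qed simp_all
qed

lemma basis_elem_closed [simp]: "s \<in> S \<Longrightarrow> basis_elem R s \<in> carrier (free_module R S)"
  by (auto simp: free_module_carrier basis_elem_def)

text \<open>Serves as an induction principle: with \<open>H\<close> a preimage or an equalizer, a
  statement about elements is reduced to the basis elements in their support.\<close>

lemma free_module_span:
  assumes H: "submodule H R (free_module R S)"
    and f: "f \<in> carrier (free_module R S)" "\<And>s. f s \<noteq> \<zero> \<Longrightarrow> basis_elem R s \<in> H"
  shows "f \<in> H"
proof -
  interpret F: module R "free_module R S" by (rule free_module)
  have "finite {s. f s \<noteq> \<zero>}" using f(1) by (simp add: free_module_carrier)
  then show ?thesis using f
  proof (induction "{s. f s \<noteq> \<zero>}" arbitrary: f rule: finite_induct)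
    case empty
    then have "f = (\<lambda>_. \<zero>)" by auto
    then show ?case using F.submodule_zero[OF H] by simp
  next
    case (insert z A)
    let ?g = "f(z := \<zero>)"
    have A: "A = {s. ?g s \<noteq> \<zero>}" using insert.hyps by auto
    have g: "?g \<in> carrier (free_module R S)"
      using insert.prems(1) insert.hyps(1) A by (auto simp: free_module_carrier)
    have "?g \<in> H"
    proof (rule insert.hyps(3)[OF A g])
      fix s assume "?g s \<noteq> \<zero>"
      then show "basis_elem R s \<in> H" using insert.prems(2)[of s] by (auto split: if_splits)
    qed
    moreover have "f z \<odot>\<^bsub>free_module R S\<^esub> basis_elem R z \<in> H"
      using insert.prems insert.hyps(4) by (intro F.submoduleE(4)[OF H]) auto
    moreover have "f = ?g \<oplus>\<^bsub>free_module R S\<^esub> (f z \<odot>\<^bsub>free_module R S\<^esub> basis_elem R z)"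
      using insert.prems(1) by (auto simp: basis_elem_def free_module_carrier)
    ultimately show ?case using F.submoduleE(5)[OF H] by metis
  qed
qed

lemma linear_map_eqI:
  assumes N: "module R N" and lin: "linear_map R (free_module R S) N f" "linear_map R (free_module R S) N g"
    and eq: "\<And>s. s \<in> S \<Longrightarrow> f (basis_elem R s) = g (basis_elem R s)"
    and x: "x \<in> carrier (free_module R S)"
  shows "f x = g x"
proof -
  let ?F = "free_module R S"
  interpret f: linear R ?F N f by (intro linearI free_module N lin)
  interpret g: linear R ?F N g by (intro linearI free_module N lin)
  have "x \<in> {x \<in> carrier ?F. f x = g x}"
  proof (rule free_module_span[OF _ x])
    show "submodule {x \<in> carrier ?F. f x = g x} R ?F"
      by (rule f.M.submoduleI)
        (auto simp del: free_module_simps simp: f.f_zero g.f_zero f.f_add g.f_add f.f_a_inv g.f_a_inv f.f_smult g.f_smult)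
    fix s assume "x s \<noteq> \<zero>"
    then have "s \<in> S" using x by (auto simp: free_module_carrier)
    then show "basis_elem R s \<in> {x \<in> carrier ?F. f x = g x}" using eq by simp
  qed
  then show ?thesis by simp
qed

end

text \<open>The sum over the support has the form used by \<open>inf_dif\<close>, so that the given
  differential can be recognized as a linear extension.\<close>

definition lin_ext ::
    "('a, 'r) ring_scheme \<Rightarrow> ('a, 'y, 'm) module_scheme \<Rightarrow> ('s \<Rightarrow> 'y) \<Rightarrow> ('s \<Rightarrow> 'a) \<Rightarrow> 'y"
  where "lin_ext R N v f = (\<Oplus>\<^bsub>N\<^esub>z\<in>{z. f z \<noteq> \<zero>\<^bsub>R\<^esub>}. f z \<odot>\<^bsub>N\<^esub> v z)"

context module
begin

text \<open>A common finite index set makes it possible to add elements with different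
  supports.\<close>

lemma lin_ext_superset:
  assumes "finite A" "{z. f z \<noteq> \<zero>} \<subseteq> A" "v \<in> A \<rightarrow> carrier M" "f \<in> A \<rightarrow> carrier R"
  shows "lin_ext R M v f = (\<Oplus>\<^bsub>M\<^esub>z\<in>A. f z \<odot>\<^bsub>M\<^esub> v z)"
  unfolding lin_ext_def using assms
  by (intro M.add.finprod_mono_neutral_cong_left) (auto simp: Pi_iff)

lemma lin_ext_linear:
  assumes v: "v \<in> S \<rightarrow> carrier M"
  shows "linear_map R (free_module R S) M (lin_ext R M v)"
proof -
  let ?F = "free_module R S"
  have carr: "(\<lambda>z. f z \<odot>\<^bsub>M\<^esub> v z) \<in> A \<rightarrow> carrier M" if "f \<in> carrier ?F" "A \<subseteq> S" for f A
    using that v by auto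
  have supp: "{z. f z \<noteq> \<zero>} \<subseteq> S" "finite {z. f z \<noteq> \<zero>}" if "f \<in> carrier ?F" for f
    using that by (auto simp: free_module_carrier)
  have eq: "lin_ext R M v f = (\<Oplus>\<^bsub>M\<^esub>z\<in>A. f z \<odot>\<^bsub>M\<^esub> v z)"
    if "f \<in> carrier ?F" "finite A" "{z. f z \<noteq> \<zero>} \<subseteq> A" "A \<subseteq> S" for f A
    using that v by (intro lin_ext_superset) auto
  interpret F: module R ?F by (rule free_module)
  show ?thesis unfolding linear_map_def
  proof (intro conjI ballI funcsetI)
    fix f assume f: "f \<in> carrier ?F"
    show "lin_ext R M v f \<in> carrier M"
      unfolding lin_ext_def by (intro M.finsum_closed carr[OF f] supp[OF f])
    show "lin_ext R M v (c \<odot>\<^bsub>?F\<^esub> f) = c \<odot>\<^bsub>M\<^esub> lin_ext R M v f" if c: "c \<in> carrier R" for c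
    proof -
      let ?A = "{z. f z \<noteq> \<zero>}"
      have "lin_ext R M v (c \<odot>\<^bsub>?F\<^esub> f) = (\<Oplus>\<^bsub>M\<^esub>z\<in>?A. (c \<odot>\<^bsub>?F\<^esub> f) z \<odot>\<^bsub>M\<^esub> v z)"
        using supp[OF f] F.smult_closed[OF c f] c by (intro eq) auto
      also have "\<dots> = (\<Oplus>\<^bsub>M\<^esub>z\<in>?A. c \<odot>\<^bsub>M\<^esub> (f z \<odot>\<^bsub>M\<^esub> v z))"
        using supp(1)[OF f] f c v by (intro M.finsum_cong') (auto simp: smult_assoc1 Pi_iff subset_iff)
      also have "\<dots> = c \<odot>\<^bsub>M\<^esub> lin_ext R M v f"
        unfolding lin_ext_def by (rule finsum_smult_ldistr[symmetric, OF supp(2)[OF f] c carr[OF f supp(1)[OF f]]])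
      finally show ?thesis .
    qed
    fix g assume g: "g \<in> carrier ?F"
    let ?A = "{z. f z \<noteq> \<zero>} \<union> {z. g z \<noteq> \<zero>}"
    have A: "finite ?A" "?A \<subseteq> S" using supp[OF f] supp[OF g] by auto
    have "lin_ext R M v (f \<oplus>\<^bsub>?F\<^esub> g) = (\<Oplus>\<^bsub>M\<^esub>z\<in>?A. (f \<oplus>\<^bsub>?F\<^esub> g) z \<odot>\<^bsub>M\<^esub> v z)"
      using A F.a_closed[OF f g] by (intro eq) auto
    also have "\<dots> = (\<Oplus>\<^bsub>M\<^esub>z\<in>?A. (f z \<odot>\<^bsub>M\<^esub> v z) \<oplus>\<^bsub>M\<^esub> (g z \<odot>\<^bsub>M\<^esub> v z))"
      using A(2) f g v by (intro M.finsum_cong') (auto simp: smult_l_distr Pi_iff subset_iff)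
    also have "\<dots> = (\<Oplus>\<^bsub>M\<^esub>z\<in>?A. f z \<odot>\<^bsub>M\<^esub> v z) \<oplus>\<^bsub>M\<^esub> (\<Oplus>\<^bsub>M\<^esub>z\<in>?A. g z \<odot>\<^bsub>M\<^esub> v z)"
      by (intro M.finsum_addf carr f g A)
    also have "\<dots> = lin_ext R M v f \<oplus>\<^bsub>M\<^esub> lin_ext R M v g"
      using eq[OF f A(1) _ A(2)] eq[OF g A(1) _ A(2)] by simp
    finally show "lin_ext R M v (f \<oplus>\<^bsub>?F\<^esub> g) = lin_ext R M v f \<oplus>\<^bsub>M\<^esub> lin_ext R M v g" .
  qed
qed

lemma lin_ext_basis:
  assumes "v z \<in> carrier M"
  shows "lin_ext R M v (basis_elem R z) = v z"
proof -
  have "lin_ext R M v (basis_elem R z) = (\<Oplus>\<^bsub>M\<^esub>y\<in>{z}. basis_elem R z y \<odot>\<^bsub>M\<^esub> v y)"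
    using assms by (intro lin_ext_superset) (auto simp: basis_elem_def)
  then show ?thesis using assms by (simp add: basis_elem_def)
qed

end

context cring
begin

lemma finprod_lessThan_update:
  assumes "j < (k::nat)" "h \<in> {..<k} \<rightarrow> carrier R"
  shows "(\<Otimes>i\<in>{..<k}. h i) = h j \<otimes> (\<Otimes>i\<in>{..<k} - {j}. h i)"
proof -
  have "{..<k} = insert j ({..<k} - {j})" using assms(1) by auto
  then show ?thesis
    using assms finprod_insert[of "{..<k} - {j}" j h] by (auto simp: Pi_iff)
qed

lemma finprod_zero:
  assumes "j < (k::nat)" "h \<in> {..<k} \<rightarrow> carrier R" "h j = \<zero>"
  shows "(\<Otimes>i\<in>{..<k}. h i) = \<zero>"
proof -
  have "(\<Otimes>i\<in>{..<k} - {j}. h i) \<in> carrier R"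
    using assms(2) by (intro finprod_closed) auto
  then show ?thesis
    using finprod_lessThan_update[OF assms(1,2)] assms(3) by simp
qed

lemma finsum_Times:
  assumes "finite A" "finite B" "\<And>a b. a \<in> A \<Longrightarrow> b \<in> B \<Longrightarrow> g (a, b) \<in> carrier R"
  shows "finsum R g (A \<times> B) = (\<Oplus>a\<in>A. \<Oplus>b\<in>B. g (a, b))"
proof -
  have "finsum R g (\<Union>a\<in>A. Pair a ` B) = (\<Oplus>a\<in>A. finsum R g (Pair a ` B))"
    using assms by (intro add.finprod_UN_disjoint) (auto simp: pairwise_def disjnt_def)
  also have "\<dots> = (\<Oplus>a\<in>A. \<Oplus>b\<in>B. g (a, b))"
  proof (intro finsum_cong' refl)
    show "(\<lambda>a. \<Oplus>b\<in>B. g (a, b)) \<in> A \<rightarrow> carrier R"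
      using assms(3) by (auto intro!: finsum_closed)
    show "finsum R g (Pair a ` B) = (\<Oplus>b\<in>B. g (a, b))" if "a \<in> A" for a
      using assms that by (intro finsum_reindex) (auto simp: inj_on_def)
  qed
  also have "(\<Union>a\<in>A. Pair a ` B) = A \<times> B" by auto
  finally show ?thesis .
qed

lemma lists_nth_Suc:
  "{zs. length zs = Suc k \<and> (\<forall>j<Suc k. zs ! j \<in> A j)}
    = (\<lambda>(zs, z). zs @ [z]) ` ({zs. length zs = k \<and> (\<forall>j<k. zs ! j \<in> A j)} \<times> A k)" (is "?L = ?R")
proof (intro equalityI subsetI)
  fix zs assume zs: "zs \<in> ?L"
  then have ne: "zs \<noteq> []" "length zs = Suc k" by auto
  then have "last zs = zs ! k" by (simp add: last_conv_nth)
  then have "(butlast zs, last zs) \<in> {zs. length zs = k \<and> (\<forall>j<k. zs ! j \<in> A j)} \<times> A k"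
    using zs by (auto simp: nth_butlast)
  moreover have "zs = (\<lambda>(zs, z). zs @ [z]) (butlast zs, last zs)"
    using ne by simp
  ultimately show "zs \<in> ?R" by (rule rev_image_eqI)
qed (auto simp: nth_append less_Suc_eq)

lemma finite_lists_nth:
  "(\<And>j. j < k \<Longrightarrow> finite (A j)) \<Longrightarrow> finite {zs. length zs = k \<and> (\<forall>j<k. zs ! j \<in> A j)}"
proof (induction k)
  case (Suc k)
  then show ?case unfolding lists_nth_Suc by (intro finite_imageI finite_cartesian_product) auto
qed simp

text \<open>Distributivity, with the choices of summands recorded as lists. Such lists index the sum
  in \<open>subst_ext\<close>, whose coordinates are computed by reading this identity from right to
  left.\<close>

lemma finprod_finsum_lists:
  assumes "\<And>j. j < k \<Longrightarrow> finite (A j)" "\<And>j z. j < k \<Longrightarrow> z \<in> A j \<Longrightarrow> h j z \<in> carrier R"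
  shows "(\<Otimes>j\<in>{..<k}. \<Oplus>z\<in>A j. h j z)
    = (\<Oplus>zs\<in>{zs. length zs = k \<and> (\<forall>j<k. zs ! j \<in> A j)}. \<Otimes>j\<in>{..<k}. h j (zs ! j))"
  using assms
proof (induction k)
  case 0
  have "{zs. length zs = 0 \<and> (\<forall>j<0. zs ! j \<in> A j)} = {[]}" by auto
  then show ?case by simp
next
  case (Suc k)
  let ?L = "{zs. length zs = k \<and> (\<forall>j<k. zs ! j \<in> A j)}"
  let ?p = "\<lambda>zs. \<Otimes>j\<in>{..<k}. h j (zs ! j)"
  have fin: "finite ?L" using Suc.prems(1) by (intro finite_lists_nth) auto
  have p: "?p zs \<in> carrier R" if "zs \<in> ?L" for zs
    using that Suc.prems(2) by (intro finprod_closed) auto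
  have hk: "h k z \<in> carrier R" if "z \<in> A k" for z using that Suc.prems(2) by auto
  have sk: "(\<Oplus>z\<in>A k. h k z) \<in> carrier R" using hk by (intro finsum_closed) auto
  have ss: "(\<lambda>j. \<Oplus>z\<in>A j. h j z) \<in> {..<k} \<rightarrow> carrier R"
    using Suc.prems(2) by (auto intro!: finsum_closed)
  have app: "(\<Otimes>j\<in>{..<Suc k}. h j ((zs @ [z]) ! j)) = h k z \<otimes> ?p zs"
    if zs: "zs \<in> ?L" and z: "z \<in> A k" for zs z
  proof -
    have "(\<Otimes>j\<in>{..<k}. h j ((zs @ [z]) ! j)) = ?p zs"
      using zs Suc.prems(2) by (intro finprod_cong') (auto simp: nth_append)
    moreover have "(\<lambda>j. h j ((zs @ [z]) ! j)) \<in> {..<k} \<rightarrow> carrier R"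
      using zs Suc.prems(2) by (auto simp: nth_append)
    ultimately show ?thesis
      using zs hk[OF z] by (simp add: lessThan_Suc nth_append)
  qed
  have "(\<Otimes>j\<in>{..<Suc k}. \<Oplus>z\<in>A j. h j z) = (\<Oplus>z\<in>A k. h k z) \<otimes> (\<Oplus>zs\<in>?L. ?p zs)"
    using sk ss Suc by (simp add: lessThan_Suc)
  also have "\<dots> = (\<Oplus>zs\<in>?L. (\<Oplus>z\<in>A k. h k z) \<otimes> ?p zs)"
    using fin sk p by (intro finsum_rdistr) auto
  also have "\<dots> = (\<Oplus>zs\<in>?L. \<Oplus>z\<in>A k. h k z \<otimes> ?p zs)"
    using Suc.prems(1) hk p by (intro finsum_cong' finsum_ldistr) (auto intro!: finsum_closed)
  also have "\<dots> = (\<Oplus>zs\<in>?L. \<Oplus>z\<in>A k. (\<lambda>(zs, z). h k z \<otimes> ?p zs) (zs, z))"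
    by simp
  also have "\<dots> = (\<Oplus>x\<in>?L \<times> A k. (\<lambda>(zs, z). h k z \<otimes> ?p zs) x)"
    using fin Suc.prems(1) hk p by (intro finsum_Times[symmetric]) auto
  also have "\<dots> = (\<Oplus>x\<in>?L \<times> A k. \<Otimes>j\<in>{..<Suc k}. h j (((\<lambda>(zs, z). zs @ [z]) x) ! j))"
    using app hk p by (intro finsum_cong') auto
  also have "\<dots> = (\<Oplus>zs\<in>(\<lambda>(zs, z). zs @ [z]) ` (?L \<times> A k). \<Otimes>j\<in>{..<Suc k}. h j (zs ! j))"
    using app hk p by (intro finsum_reindex[symmetric]) (auto simp: inj_on_def)
  finally show ?case unfolding lists_nth_Suc .
qed

end

section \<open>The coordinate permutad\<close>

lemma (in comm_monoid) finprod_lessThan_add: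
  assumes "\<And>i. i < a + b \<Longrightarrow> F i \<in> carrier G"
  shows "finprod G F {..<a + b} = finprod G F {..<a} \<otimes> finprod G (\<lambda>i. F (a + i)) {..<b :: nat}"
proof -
  have "finprod G F ({..<a} \<union> (+) a ` {..<b}) = finprod G F {..<a} \<otimes> finprod G F ((+) a ` {..<b})"
    using assms by (intro finprod_Un_disjoint) auto
  also have "finprod G F ((+) a ` {..<b}) = finprod G (\<lambda>i. F (a + i)) {..<b}"
    using assms by (intro finprod_reindex) (auto simp: inj_on_def)
  also have "{..<a} \<union> (+) a ` {..<b} = {..<a + b}"
    by (auto simp: lessThan_atLeast0 image_iff)
  finally show ?thesis .
qed

text \<open>Regroups the blocks of a composite by outer vertex. In this generality it serves for the
  products in \<open>comb_Gam\<close> and, through the additive monoid of the ring, for the sums in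
  \<open>comb_dif\<close>.\<close>

lemma (in comm_monoid) finprod_offset:
  assumes "\<And>i. i < offset us k \<Longrightarrow> F i \<in> carrier G"
  shows "finprod G F {..<offset us k}
    = finprod G (\<lambda>j. finprod G (\<lambda>v. F (offset us j + v)) {..<blocks (us ! j)}) {..<k}"
  using assms
proof (induction k)
  case (Suc k)
  have c: "(\<lambda>j. finprod G (\<lambda>v. F (offset us j + v)) {..<blocks (us ! j)}) \<in> {..<Suc k} \<rightarrow> carrier G"
    using Suc.prems offset_add_less[of _ "Suc k" _ us] by (auto intro!: finprod_closed)
  have k: "finprod G F {..<offset us k} \<in> carrier G"
    using Suc.prems by (intro finprod_closed) (auto simp: offset_Suc)
  have "finprod G F {..<offset us (Suc k)}
      = finprod G F {..<offset us k} \<otimes> finprod G (\<lambda>v. F (offset us k + v)) {..<blocks (us ! k)}"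
    using Suc.prems unfolding offset_Suc by (intro finprod_lessThan_add) auto
  moreover have "finprod G F {..<offset us k} = finprod G (\<lambda>j. finprod G (\<lambda>v. F (offset us j + v)) {..<blocks (us ! j)}) {..<k}"
    using Suc.prems by (intro Suc.IH) (auto simp: offset_Suc)
  ultimately show ?case
    using c k by (simp add: lessThan_Suc Pi_iff m_comm)
qed simp

text \<open>The index set of a basis of the free permutad on one generator for each arity in
  \<open>S\<close>: a vertex with \<open>c\<close> points in its fibre carries an operation of arity
  \<open>c + 1\<close>.\<close>

definition sur_lists :: "nat set \<Rightarrow> nat \<Rightarrow> nat list set"
  where "sur_lists S n = {s. length s = n \<and> surj_list s \<and> (\<forall>j<blocks s. count_list s j + 1 \<in> S)}"

definition parity :: "('a, 'r) ring_scheme \<Rightarrow> nat \<Rightarrow> 'a"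
  where "parity R m = (if even m then \<one>\<^bsub>R\<^esub> else \<ominus>\<^bsub>R\<^esub> \<one>\<^bsub>R\<^esub>)"

definition comb_Gam ::
    "('a, 'r) ring_scheme \<Rightarrow> nat list \<Rightarrow> (nat list \<Rightarrow> 'a) list \<Rightarrow> nat list \<Rightarrow> 'a"
  where "comb_Gam R t gs = (\<lambda>s.
    if length s = length t \<and> surj_list s \<and> coarser t s
    then \<Otimes>\<^bsub>R\<^esub>j\<in>{..<blocks t}. (gs ! j) (restr t s j) else \<zero>\<^bsub>R\<^esub>)"

definition comb_dif :: "('a, 'r) ring_scheme \<Rightarrow> (nat list \<Rightarrow> 'a) \<Rightarrow> nat list \<Rightarrow> 'a"
  where "comb_dif R g = (\<lambda>s.
    if surj_list s then \<Oplus>\<^bsub>R\<^esub>i\<in>{..<blocks s - 1}. parity R (dexp s i) \<otimes>\<^bsub>R\<^esub> g (merge i s) else \<zero>\<^bsub>R\<^esub>)"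

text \<open>A condition on the support: the zero function satisfies it for every \<open>p\<close>,
  as it must if the homogeneous parts are to be submodules.\<close>

definition comb_deg :: "('a, 'r) ring_scheme \<Rightarrow> nat \<Rightarrow> int \<Rightarrow> (nat list \<Rightarrow> 'a) \<Rightarrow> bool"
  where "comb_deg R n p g \<longleftrightarrow> (\<forall>s. g s \<noteq> \<zero>\<^bsub>R\<^esub> \<longrightarrow> int n - int (blocks s) = p)"

text \<open>A model of the free permutad on one generator in each of the arities in \<open>S\<close>: its
  elements are coordinate functions on the surjections, and the coordinates of a composite are
  read off from the (unique) decomposition of a surjection. For \<open>S = {2..}\<close> the differential
  is the one of \<open>permAs_inf\<close>, the coordinates of a boundary being indexed by the facets \<open>s\<close>
  of the faces \<open>merge i s\<close>.\<close>

definition comb :: "('a, 'r) ring_scheme \<Rightarrow> nat set \<Rightarrow> ('a, nat list \<Rightarrow> 'a) dg_permutad"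
  where "comb R S =
    \<lparr>ar = (\<lambda>n. free_module R (sur_lists S (n - 1))), ident = basis_elem R [], Gam = comb_Gam R,
     hdeg = (\<lambda>n p. {g \<in> carrier (free_module R (sur_lists S (n - 1))). comb_deg R (n - 1) p g}),
     dif = (\<lambda>_. comb_dif R)\<rparr>"

lemma comb_simps [simp]:
  "ar (comb R S) = (\<lambda>n. free_module R (sur_lists S (n - 1)))"
  "ident (comb R S) = basis_elem R []" "Gam (comb R S) = comb_Gam R"
  "hdeg (comb R S) n p = {g \<in> carrier (free_module R (sur_lists S (n - 1))). comb_deg R (n - 1) p g}"
  "dif (comb R S) n = comb_dif R"
  by (simp_all add: comb_def)

lemma blocks_le_length: "blocks s \<le> length s"
  by (simp add: blocks_def card_length)

lemma finite_sur_lists: "finite (sur_lists S n)"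
proof (rule finite_subset)
  show "sur_lists S n \<subseteq> {s. set s \<subseteq> {..<n} \<and> length s = n}"
  proof
    fix s assume "s \<in> sur_lists S n"
    then show "s \<in> {s. set s \<subseteq> {..<n} \<and> length s = n}"
      using blocks_le_length[of s] by (simp add: sur_lists_def surj_list_def)
  qed
qed (simp add: finite_lists_length_eq)

lemma sur_lists_sur_subst:
  assumes "surj_list t" "admissible t us"
  shows "sur_subst t us \<in> sur_lists S (length t) \<longleftrightarrow> (\<forall>j<blocks t. us ! j \<in> sur_lists S (count_list t j))"
proof
  assume *: "sur_subst t us \<in> sur_lists S (length t)"
  show "\<forall>j<blocks t. us ! j \<in> sur_lists S (count_list t j)"
  proof (intro allI impI)
    fix j assume j: "j < blocks t"
    have "count_list (us ! j) v + 1 \<in> S" if "v < blocks (us ! j)" for v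
    proof -
      have "offset us j + v < blocks (sur_subst t us)"
        using surj_sur_subst(2)[OF assms] offset_add_less[OF j that] by simp
      then show ?thesis
        using * count_sur_subst[OF assms j that] unfolding sur_lists_def by force
    qed
    then show "us ! j \<in> sur_lists S (count_list t j)"
      using assms(2) j by (simp add: sur_lists_def admissible_def)
  qed
next
  assume *: "\<forall>j<blocks t. us ! j \<in> sur_lists S (count_list t j)"
  have "count_list (sur_subst t us) w + 1 \<in> S" if w: "w < blocks (sur_subst t us)" for w
  proof -
    obtain j v where "j < blocks t" "v < blocks (us ! j)" "w = offset us j + v"
      using offset_decomp w surj_sur_subst(2)[OF assms] by metis
    then show ?thesis
      using * count_sur_subst[OF assms] by (simp add: sur_lists_def)
  qed
  then show "sur_subst t us \<in> sur_lists S (length t)"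
    using surj_sur_subst(1)[OF assms] by (simp add: sur_lists_def)
qed

lemma decorations_comb_iff:
  "gs \<in> decorations (ar (comb R S)) t \<longleftrightarrow>
    length gs = blocks t \<and> (\<forall>j<blocks t. gs ! j \<in> carrier (free_module R (sur_lists S (count_list t j))))"
  by (simp add: decorations_def)

lemma decorations_update:
  "gs \<in> decorations M t \<Longrightarrow> j < blocks t \<Longrightarrow> x \<in> carrier (M (count_list t j + 1)) \<Longrightarrow> gs[j := x] \<in> decorations M t"
  by (auto simp: decorations_def nth_list_update)

lemma surj_corolla: "n \<ge> 1 \<Longrightarrow> surj_list (corolla n) \<and> blocks (corolla n) = 1"
  by (auto simp: corolla_def surj_list_def blocks_def)

lemma count_list_corolla: "count_list (corolla n) 0 = n"
  by (induction n) (auto simp: corolla_def)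

lemma take_corolla: "a \<le> n \<Longrightarrow> take a (corolla n) = corolla a"
  by (simp add: corolla_def min_def)

lemma sur_subst_corolla:
  assumes "n \<ge> 1" "length s = n" "surj_list s"
  shows "admissible (corolla n) [s]" "sur_subst (corolla n) [s] = s"
proof -
  show "admissible (corolla n) [s]"
    using assms surj_corolla[of n] by (simp add: admissible_def count_list_corolla)
  show "sur_subst (corolla n) [s] = s"
  proof (rule nth_equalityI)
    fix a assume "a < length (sur_subst (corolla n) [s])"
    then have a: "a < n" by (simp add: corolla_def)
    then have "corolla n ! a = 0" by (simp add: corolla_def)
    then show "sur_subst (corolla n) [s] ! a = s ! a"
      using a take_corolla[of a n] count_list_corolla[of a]
      by (simp add: sur_subst_def) (simp add: corolla_def)
  qed (simp add: assms corolla_def)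
qed

context cring
begin

lemma parity_closed [simp]: "parity R m \<in> carrier R"
  by (simp add: parity_def)

lemma parity_add: "parity R (m + n) = parity R m \<otimes> parity R n"
  by (simp add: parity_def l_minus)

lemma parity_eq: "even m = even n \<Longrightarrow> parity R m = parity R n"
  and parity_neq: "even m \<noteq> even n \<Longrightarrow> parity R m = \<ominus> parity R n"
  by (auto simp: parity_def)

lemma comb_Gam_sur_subst:
  assumes "surj_list t" "admissible t us" "\<And>j. j < blocks t \<Longrightarrow> (gs ! j) (us ! j) \<in> carrier R"
  shows "comb_Gam R t gs (sur_subst t us) = (\<Otimes>j\<in>{..<blocks t}. (gs ! j) (us ! j))"
  using assms surj_sur_subst(1)[OF assms(1,2)] coarser_sur_subst[OF assms(1,2)] restr_sur_subst[OF assms(1,2)]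
  by (auto simp: comb_Gam_def intro!: finprod_cong')

text \<open>Reduces the evaluation of composites to arguments of the form
  \<open>sur_subst t us\<close>, where \<open>comb_Gam_sur_subst\<close> gives a plain
  product.\<close>

lemma comb_Gam_cases [consumes 1, case_names decomposed other]:
  assumes "surj_list t"
  obtains us where "admissible t us" "s = sur_subst t us"
  | "\<not> (length s = length t \<and> surj_list s \<and> coarser t s)" "\<And>gs. comb_Gam R t gs s = \<zero>"
proof (cases "length s = length t \<and> surj_list s \<and> coarser t s")
  case True
  then show ?thesis using coarser_decomp[OF assms] that(1) by metis
qed (auto simp: comb_Gam_def that(2))

text \<open>If a piece of the decomposition has a vertex of an arity outside \<open>S\<close>, the
  corresponding factor vanishes; so the support stays among the surjections allowed by
  \<open>S\<close>.\<close>

lemma comb_Gam_closed: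
  assumes "surj_list t" "gs \<in> decorations (ar (comb R S)) t"
  shows "comb_Gam R t gs \<in> carrier (free_module R (sur_lists S (length t)))"
proof -
  have car: "(gs ! j) u \<in> carrier R" if "j < blocks t" for j u
    using assms(2) that unfolding decorations_comb_iff by auto
  have "comb_Gam R t gs s \<in> carrier R" for s
    using car by (auto simp: comb_Gam_def intro!: finprod_closed)
  moreover have supp: "s \<in> sur_lists S (length t)" if nz: "comb_Gam R t gs s \<noteq> \<zero>" for s
    using assms(1)
  proof (cases rule: comb_Gam_cases[where s = s])
    case (decomposed us)
    have "us ! j \<in> sur_lists S (count_list t j)" if j: "j < blocks t" for j
    proof (rule ccontr)
      assume "us ! j \<notin> sur_lists S (count_list t j)"
      then have "(gs ! j) (us ! j) = \<zero>"
        using assms(2) j unfolding decorations_comb_iff free_module_carrier by auto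
      then have "comb_Gam R t gs s = \<zero>"
        using decomposed j car assms(1) by (auto simp: comb_Gam_sur_subst intro!: finprod_zero[of j])
      then show False using nz by simp
    qed
    then show ?thesis using sur_lists_sur_subst[OF assms(1) decomposed(1)] decomposed(2) by simp
  qed (use nz in simp)
  ultimately show ?thesis
    unfolding free_module_carrier using supp
    by (auto intro: finite_subset[OF _ finite_sur_lists[of S "length t"]])
qed

text \<open>Isolating the factor of entry \<open>j\<close> turns multilinearity of composition into
  the distributive and associative laws of the ring.\<close>

lemma comb_Gam_update:
  assumes "surj_list t" "gs \<in> decorations (ar (comb R S)) t" "j < blocks t"
    and "\<And>u. x u \<in> carrier R"
  shows "comb_Gam R t (gs[j := x]) s =
    (if length s = length t \<and> surj_list s \<and> coarser t s
     then x (restr t s j) \<otimes> (\<Otimes>i\<in>{..<blocks t} - {j}. (gs ! i) (restr t s i)) else \<zero>)"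
proof (cases "length s = length t \<and> surj_list s \<and> coarser t s")
  case True
  have len: "length gs = blocks t" and car: "(gs ! i) u \<in> carrier R" if "i < blocks t" for i u
    using assms(2) that by (auto simp: decorations_def)
  have "(\<Otimes>i\<in>{..<blocks t}. (gs[j := x] ! i) (restr t s i))
      = (gs[j := x] ! j) (restr t s j) \<otimes> (\<Otimes>i\<in>{..<blocks t} - {j}. (gs[j := x] ! i) (restr t s i))"
    using assms(3,4) car len by (intro finprod_lessThan_update) (auto simp: nth_list_update)
  also have "(\<Otimes>i\<in>{..<blocks t} - {j}. (gs[j := x] ! i) (restr t s i)) = (\<Otimes>i\<in>{..<blocks t} - {j}. (gs ! i) (restr t s i))"
    using car by (intro finprod_cong') auto
  finally show ?thesis using True len assms(3) by (simp add: comb_Gam_def)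
qed (auto simp: comb_Gam_def)

lemma comb_Gam_corolla:
  assumes "n \<ge> 1" "\<mu> \<in> carrier (free_module R (sur_lists S n))"
  shows "comb_Gam R (corolla n) [\<mu>] = \<mu>"
proof
  fix s
  show "comb_Gam R (corolla n) [\<mu>] s = \<mu> s"
  proof (cases "length s = n \<and> surj_list s")
    case True
    then have "comb_Gam R (corolla n) [\<mu>] (sur_subst (corolla n) [s]) = (\<Otimes>j\<in>{..<1::nat}. ([\<mu>] ! j) ([s] ! j))"
      using comb_Gam_sur_subst[of "corolla n" "[s]" "[\<mu>]"] assms surj_corolla[of n] sur_subst_corolla[of n s] by auto
    then show ?thesis
      using True assms sur_subst_corolla[of n s] by (auto simp: lessThan_Suc)
  next
    case False
    then have "\<mu> s = \<zero>" using assms(2) by (auto simp: free_module_carrier sur_lists_def)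
    then show ?thesis using False by (auto simp: comb_Gam_def corolla_def)
  qed
qed

text \<open>At a surjection with a two-level decomposition both sides are the same product over the
  innermost pieces, by associativity of substitution. At every other surjection both sides
  vanish.\<close>

lemma comb_Gam_subst:
  assumes t: "surj_list t" "admissible t ts"
    and len: "length \<mu>ss = blocks t"
    and dec: "\<And>j. j < blocks t \<Longrightarrow> \<mu>ss ! j \<in> decorations (ar (comb R S)) (ts ! j)"
  shows "comb_Gam R (sur_subst t ts) (concat \<mu>ss) = comb_Gam R t (map2 (comb_Gam R) ts \<mu>ss)"
proof
  fix s
  let ?S = "sur_subst t ts" and ?G = "map2 (comb_Gam R) ts \<mu>ss"
  have lts: "length ts = blocks t" and tj: "\<And>j. j < blocks t \<Longrightarrow> surj_list (ts ! j)"
    using t(2) by (auto simp: admissible_def)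
  have S: "surj_list ?S" "blocks ?S = offset ts (blocks t)"
    using surj_sur_subst[OF t] .
  have G: "?G ! j = comb_Gam R (ts ! j) (\<mu>ss ! j)" if "j < blocks t" for j
    using that lts len by simp
  have car: "(\<mu>ss ! j ! v) u \<in> carrier R" if "j < blocks t" "v < blocks (ts ! j)" for j v u
    using dec[OF that(1)] that(2) by (auto simp: decorations_def)
  have cG: "comb_Gam R (ts ! j) (\<mu>ss ! j) u \<in> carrier R" if "j < blocks t" for j u
    using comb_Gam_closed[OF tj[OF that] dec[OF that]] by auto
  have cn: "concat \<mu>ss ! (offset ts j + v) = \<mu>ss ! j ! v" if "j < blocks t" "v < blocks (ts ! j)" for j v
    using dec len lts that by (intro concat_index) (auto simp: decorations_def)
  have good: "comb_Gam R ?S (concat \<mu>ss) s = comb_Gam R t ?G s"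
    if tss: "length tss = blocks t" "\<And>j. j < blocks t \<Longrightarrow> admissible (ts ! j) (tss ! j)"
      and s: "s = sur_subst t (map2 sur_subst ts tss)" for tss
  proof -
    note ass = t tss
    have eqS: "s = sur_subst ?S (concat tss)" using sur_subst_assoc[OF ass] s by simp
    have ci: "concat tss ! (offset ts j + v) = tss ! j ! v" if "j < blocks t" "v < blocks (ts ! j)" for j v
      by (rule concat_index'[OF ass that])
    have "(concat \<mu>ss ! w) (concat tss ! w) \<in> carrier R" if w: "w < offset ts (blocks t)" for w
    proof -
      obtain j v where "j < blocks t" "v < blocks (ts ! j)" "w = offset ts j + v"
        using offset_decomp w by metis
      then show ?thesis using cn ci car by simp
    qed
    then have "comb_Gam R ?S (concat \<mu>ss) s
        = (\<Otimes>j\<in>{..<blocks t}. \<Otimes>v\<in>{..<blocks (ts ! j)}. (concat \<mu>ss ! (offset ts j + v)) (concat tss ! (offset ts j + v)))"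
      unfolding eqS using S admissible_concat[OF ass]
      by (subst comb_Gam_sur_subst) (auto simp: finprod_offset)
    also have "\<dots> = (\<Otimes>j\<in>{..<blocks t}. (?G ! j) (map2 sur_subst ts tss ! j))"
    proof (rule finprod_cong')
      show "(\<lambda>j. (?G ! j) (map2 sur_subst ts tss ! j)) \<in> {..<blocks t} \<rightarrow> carrier R"
        using G cG by auto
      fix j assume "j \<in> {..<blocks t}"
      then have j: "j < blocks t" by simp
      have "(?G ! j) (map2 sur_subst ts tss ! j) = (\<Otimes>v\<in>{..<blocks (ts ! j)}. (\<mu>ss ! j ! v) (tss ! j ! v))"
        using G[OF j] j lts tss tj car comb_Gam_sur_subst[of "ts ! j" "tss ! j" "\<mu>ss ! j"] by simp
      also have "\<dots> = (\<Otimes>v\<in>{..<blocks (ts ! j)}. (concat \<mu>ss ! (offset ts j + v)) (concat tss ! (offset ts j + v)))"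
        using cn[OF j] ci[OF j] car[OF j] by (intro finprod_cong') auto
      finally show "(\<Otimes>v\<in>{..<blocks (ts ! j)}. (concat \<mu>ss ! (offset ts j + v)) (concat tss ! (offset ts j + v)))
          = (?G ! j) (map2 sur_subst ts tss ! j)" by simp
    qed simp
    also have "\<dots> = comb_Gam R t ?G s"
      unfolding s using t(1) admissible_map2[OF ass] G cG
      by (subst comb_Gam_sur_subst) auto
    finally show ?thesis .
  qed
  show "comb_Gam R ?S (concat \<mu>ss) s = comb_Gam R t ?G s"
  proof (cases "\<exists>tss. length tss = blocks t \<and> (\<forall>j<blocks t. admissible (ts ! j) (tss ! j)) \<and> s = sur_subst t (map2 sur_subst ts tss)")
    case True
    then show ?thesis using good by metis
  next
    case False
    have "comb_Gam R ?S (concat \<mu>ss) s = \<zero>"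
      using S(1)
    proof (cases rule: comb_Gam_cases[where s = s])
      case (decomposed vs)
      \<comment> \<open>The flat family \<open>vs\<close> is cut into one group for each outer
        vertex; this inverts the concatenation.\<close>
      define tss where "tss = map (\<lambda>j. map (\<lambda>v. vs ! (offset ts j + v)) [0..<blocks (ts ! j)]) [0..<blocks t]"
      have tss: "length tss = blocks t" "\<And>j. j < blocks t \<Longrightarrow> admissible (ts ! j) (tss ! j)"
      proof -
        fix j assume j: "j < blocks t"
        have "length (vs ! (offset ts j + v)) = count_list (ts ! j) v \<and> surj_list (vs ! (offset ts j + v))"
          if v: "v < blocks (ts ! j)" for v
        proof -
          have "offset ts j + v < blocks ?S" using S(2) offset_add_less[OF j v] by simp
          then show ?thesis
            using decomposed(1) count_sur_subst[OF t j v] by (auto simp: admissible_def)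
        qed
        then show "admissible (ts ! j) (tss ! j)"
          using j by (simp add: admissible_def tss_def)
      qed (simp add: tss_def)
      have "concat tss = vs"
      proof (rule nth_equalityI)
        show "length (concat tss) = length vs"
          using length_concat'[OF t tss] decomposed(1) S(2) by (simp add: admissible_def)
        fix w assume "w < length (concat tss)"
        then have "w < offset ts (blocks t)" using length_concat'[OF t tss] by simp
        then obtain j v where jv: "j < blocks t" "v < blocks (ts ! j)" "w = offset ts j + v"
          using offset_decomp by metis
        then show "concat tss ! w = vs ! w"
          using concat_index'[OF t tss jv(1,2)] by (simp add: tss_def)
      qed
      then have "s = sur_subst t (map2 sur_subst ts tss)"
        using decomposed(2) sur_subst_assoc[OF t tss] by simp
      then show ?thesis using False tss by blast
    qed simp
    moreover have "comb_Gam R t ?G s = \<zero>"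
      using t(1)
    proof (cases rule: comb_Gam_cases[where s = s])
      case (decomposed us)
      have "\<exists>j<blocks t. (?G ! j) (us ! j) = \<zero>"
      proof (rule ccontr)
        assume nz: "\<not> (\<exists>j<blocks t. (?G ! j) (us ! j) = \<zero>)"
        \<comment> \<open>A nonzero factor forces its piece to decompose along
          \<open>ts ! j\<close>. If all factors were nonzero, \<open>s\<close> would have a
          two-level decomposition.\<close>
        have "\<exists>vs. admissible (ts ! j) vs \<and> us ! j = sur_subst (ts ! j) vs" if j: "j < blocks t" for j
          using tj[OF j] by (cases rule: comb_Gam_cases[where s = "us ! j"]) (use nz j G in auto)
        then obtain f where f: "\<And>j. j < blocks t \<Longrightarrow> admissible (ts ! j) (f j) \<and> us ! j = sur_subst (ts ! j) (f j)"
          by metis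
        have "us = map2 sur_subst ts (map f [0..<blocks t])"
          using decomposed(1) f lts by (intro nth_equalityI) (auto simp: admissible_def)
        then have "s = sur_subst t (map2 sur_subst ts (map f [0..<blocks t]))"
          using decomposed(2) by simp
        moreover have "length (map f [0..<blocks t]) = blocks t" "\<forall>j<blocks t. admissible (ts ! j) (map f [0..<blocks t] ! j)"
          using f by auto
        ultimately show False using False by blast
      qed
      then obtain j where "j < blocks t" "(?G ! j) (us ! j) = \<zero>" by blast
      then show ?thesis
        unfolding decomposed(2) using t(1) decomposed(1) G cG by (subst comb_Gam_sur_subst) (auto intro!: finprod_zero[of j])
    qed simp
    ultimately show ?thesis by simp
  qed
qed

lemma sur_lists_0: "sur_lists S 0 = {[]}"
  by (auto simp: sur_lists_def surj_list_def blocks_def)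

lemma permutad_comb: "permutad R (comb R S)"
proof (rule permutad.intro)
  fix n :: nat
  show "module R (ar (comb R S) n)" by (simp add: free_module)
next
  show "ident (comb R S) \<in> carrier (ar (comb R S) 1)" by (simp add: sur_lists_0)
next
  \<comment> \<open>The empty list is the only surjection on no points, so evaluation at
    \<open>[]\<close> inverts the scaling of the identity.\<close>
  show "bij_betw (\<lambda>c. c \<odot>\<^bsub>ar (comb R S) 1\<^esub> ident (comb R S)) (carrier R) (carrier (ar (comb R S) 1))"
    by (rule bij_betw_byWitness[where f' = "\<lambda>f. f []"])
      (auto simp: sur_lists_0 free_module_carrier basis_elem_def fun_eq_iff)
next
  fix n t k \<mu>s assume "n \<ge> 1" "t \<in> Sur n k" "\<mu>s \<in> decorations (ar (comb R S)) t"
  then show "Gam (comb R S) t \<mu>s \<in> carrier (ar (comb R S) (n + 1))"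
    using comb_Gam_closed[of t \<mu>s S] by (simp add: Sur_iff)
next
  fix n t k \<mu>s j x y
  assume "n \<ge> 1" and t: "t \<in> Sur n k" and \<mu>s: "\<mu>s \<in> decorations (ar (comb R S)) t" and j: "j < k"
    and x: "x \<in> carrier (ar (comb R S) (count_list t j + 1))"
    and y: "y \<in> carrier (ar (comb R S) (count_list t j + 1))"
  have *: "(\<Otimes>i\<in>{..<blocks t} - {j}. (\<mu>s ! i) (restr t s i)) \<in> carrier R" for s
    using \<mu>s by (intro finprod_closed) (auto simp: decorations_def)
  show "Gam (comb R S) t (\<mu>s[j := x \<oplus>\<^bsub>ar (comb R S) (count_list t j + 1)\<^esub> y]) =
         Gam (comb R S) t (\<mu>s[j := x]) \<oplus>\<^bsub>ar (comb R S) (n + 1)\<^esub> Gam (comb R S) t (\<mu>s[j := y])"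
    using t j x y * comb_Gam_update[OF _ \<mu>s, of j] by (auto simp: Sur_iff l_distr fun_eq_iff)
next
  fix n t k \<mu>s j c x
  assume "n \<ge> 1" and t: "t \<in> Sur n k" and \<mu>s: "\<mu>s \<in> decorations (ar (comb R S)) t" and j: "j < k"
    and c: "c \<in> carrier R" and x: "x \<in> carrier (ar (comb R S) (count_list t j + 1))"
  have *: "(\<Otimes>i\<in>{..<blocks t} - {j}. (\<mu>s ! i) (restr t s i)) \<in> carrier R" for s
    using \<mu>s by (intro finprod_closed) (auto simp: decorations_def)
  show "Gam (comb R S) t (\<mu>s[j := c \<odot>\<^bsub>ar (comb R S) (count_list t j + 1)\<^esub> x]) =
         c \<odot>\<^bsub>ar (comb R S) (n + 1)\<^esub> Gam (comb R S) t (\<mu>s[j := x])"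
    using t j c x * comb_Gam_update[OF _ \<mu>s, of j] by (auto simp: Sur_iff m_assoc fun_eq_iff)
next
  fix n \<mu> assume "n \<ge> 1" "\<mu> \<in> carrier (ar (comb R S) (n + 1))"
  then show "Gam (comb R S) (corolla n) [\<mu>] = \<mu>"
    using comb_Gam_corolla[of n \<mu> S] by simp
next
  fix n t k m ts \<mu>ss
  assume "n \<ge> 1" "t \<in> Sur n k" "length ts = k" "length \<mu>ss = k"
    "\<And>j. j < k \<Longrightarrow> ts ! j \<in> Sur (count_list t j) (m j)"
    "\<And>j. j < k \<Longrightarrow> \<mu>ss ! j \<in> decorations (ar (comb R S)) (ts ! j)"
  then show "Gam (comb R S) (sur_subst t ts) (concat \<mu>ss) = Gam (comb R S) t (map2 (Gam (comb R S)) ts \<mu>ss)"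
    using comb_Gam_subst[of t ts \<mu>ss S] by (simp add: Sur_iff admissible_def)
qed

end

section \<open>Gradings and the boundary operator in coordinates\<close>

lemma sur_lists_all: "s \<in> sur_lists {2..} n \<longleftrightarrow> length s = n \<and> surj_list s"
  using count_list_pos[of _ s] by (auto simp: sur_lists_def surj_list_def Suc_le_eq)

text \<open>The definitions express signs by integer multiples in the module. As ring scalars they
  are respected by linear maps, and the absolute value keeps the parity of an exponent that may be
  negative.\<close>

lemma (in module) smult_parity:
  assumes "x \<in> carrier M"
  shows "[neg1_pow p] \<cdot>\<^bsub>M\<^esub> x = parity R (nat \<bar>p\<bar>) \<odot>\<^bsub>M\<^esub> x"
proof -
  have "even (nat \<bar>p\<bar>) = even p"
    by (simp add: even_nat_iff)
  then show ?thesis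
    using assms smult_l_minus[of \<one> x]
    by (auto simp: neg1_pow_def parity_def M.add_pow_int_minus_one)
qed

lemma (in module) graded_module_concentrated:
  "graded_module R M (\<lambda>p. if p = d then carrier M else {\<zero>\<^bsub>M\<^esub>})"
  unfolding graded_module_def
proof (intro conjI allI ballI module_axioms)
  fix p :: int
  show "submodule (if p = d then carrier M else {\<zero>\<^bsub>M\<^esub>}) R M"
    using carrier_is_submodule by (auto intro!: submoduleI)
next
  fix x assume x: "x \<in> carrier M"
  let ?f = "\<lambda>p. if p = d then x else \<zero>\<^bsub>M\<^esub>"
  show "\<exists>!f. (\<forall>p. f p \<in> (if p = d then carrier M else {\<zero>\<^bsub>M\<^esub>})) \<and> finite {p. f p \<noteq> \<zero>\<^bsub>M\<^esub>} \<and>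
      x = (\<Oplus>\<^bsub>M\<^esub>p\<in>{p. f p \<noteq> \<zero>\<^bsub>M\<^esub>}. f p)"
  proof (rule ex1I[of _ ?f])
    have "{p. ?f p \<noteq> \<zero>\<^bsub>M\<^esub>} = (if x = \<zero>\<^bsub>M\<^esub> then {} else {d})" by auto
    then show "(\<forall>p. ?f p \<in> (if p = d then carrier M else {\<zero>\<^bsub>M\<^esub>})) \<and> finite {p. ?f p \<noteq> \<zero>\<^bsub>M\<^esub>} \<and>
      x = (\<Oplus>\<^bsub>M\<^esub>p\<in>{p. ?f p \<noteq> \<zero>\<^bsub>M\<^esub>}. ?f p)"
      using x by (auto simp: Pi_iff)
    fix f assume f: "(\<forall>p. f p \<in> (if p = d then carrier M else {\<zero>\<^bsub>M\<^esub>})) \<and> finite {p. f p \<noteq> \<zero>\<^bsub>M\<^esub>} \<and>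
      x = (\<Oplus>\<^bsub>M\<^esub>p\<in>{p. f p \<noteq> \<zero>\<^bsub>M\<^esub>}. f p)"
    then have 0: "f p = \<zero>\<^bsub>M\<^esub>" if "p \<noteq> d" for p using that by (metis singletonD)
    have "p \<in> {p. f p \<noteq> \<zero>\<^bsub>M\<^esub>} \<longleftrightarrow> p \<in> (if f d = \<zero>\<^bsub>M\<^esub> then {} else {d})" for p
      using 0[of p] by (cases "p = d") auto
    then have "{p. f p \<noteq> \<zero>\<^bsub>M\<^esub>} = (if f d = \<zero>\<^bsub>M\<^esub> then {} else {d})"
      by blast
    moreover have "f d \<in> carrier M" using f by (metis (full_types))
    ultimately have "x = f d" using f by (auto simp: Pi_iff split: if_splits)
    then show "f = ?f" using 0 by auto
  qed
qed

context cring
begin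

text \<open>The component in degree \<open>p\<close> keeps the coordinates at those \<open>s\<close>
  with \<open>deg s = p\<close>. It is unique because only the component of degree
  \<open>deg s\<close> can be nonzero at \<open>s\<close>.\<close>

lemma graded_free_module:
  assumes S: "finite S"
  shows "graded_module R (free_module R S) (\<lambda>p. {g \<in> carrier (free_module R S). \<forall>s. g s \<noteq> \<zero> \<longrightarrow> deg s = p})"
  unfolding graded_module_def
proof (intro conjI allI ballI free_module)
  let ?F = "free_module R S"
  interpret F: module R ?F by (rule free_module)
  fix p :: int
  show "submodule {g \<in> carrier ?F. \<forall>s. g s \<noteq> \<zero> \<longrightarrow> deg s = p} R ?F"
  proof (rule F.submoduleI)
    fix f assume f: "f \<in> {g \<in> carrier ?F. \<forall>s. g s \<noteq> \<zero> \<longrightarrow> deg s = p}"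
    then show "\<ominus>\<^bsub>?F\<^esub> f \<in> {g \<in> carrier ?F. \<forall>s. g s \<noteq> \<zero> \<longrightarrow> deg s = p}"
      using F.a_inv_closed[of f] by (auto simp: free_module_a_inv)
    show "c \<odot>\<^bsub>?F\<^esub> f \<in> {g \<in> carrier ?F. \<forall>s. g s \<noteq> \<zero> \<longrightarrow> deg s = p}" if "c \<in> carrier R" for c
    proof -
      have "deg s = p" if "c \<otimes> f s \<noteq> \<zero>" for s
        using f that \<open>c \<in> carrier R\<close> by (cases "f s = \<zero>") auto
      then show ?thesis using f that F.smult_closed[of c f] by auto
    qed
    fix g assume g: "g \<in> {g \<in> carrier ?F. \<forall>s. g s \<noteq> \<zero> \<longrightarrow> deg s = p}"
    have "deg s = p" if "(f \<oplus>\<^bsub>?F\<^esub> g) s \<noteq> \<zero>" for s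
      using f g that by (cases "f s = \<zero>") auto
    then show "f \<oplus>\<^bsub>?F\<^esub> g \<in> {g \<in> carrier ?F. \<forall>s. g s \<noteq> \<zero> \<longrightarrow> deg s = p}"
      using f g F.a_closed[of f g] by auto
  qed (use F.zero_closed in auto)
next
  let ?F = "free_module R S"
  fix x assume x: "x \<in> carrier ?F"
  let ?f = "\<lambda>p s. if deg s = p then x s else \<zero>"
  have eval: "finsum ?F f {p. f p \<noteq> \<zero>\<^bsub>?F\<^esub>} s = f (deg s) s"
    if f: "\<And>p. f p \<in> carrier ?F" "\<And>p s. f p s \<noteq> \<zero> \<Longrightarrow> deg s = p" "finite {p. f p \<noteq> \<zero>\<^bsub>?F\<^esub>}" for f s
  proof -
    have "finsum ?F f {p. f p \<noteq> \<zero>\<^bsub>?F\<^esub>} s = (\<Oplus>p\<in>{p. f p \<noteq> \<zero>\<^bsub>?F\<^esub>}. f p s)"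
      using f by (intro free_module_finsum) auto
    also have "\<dots> = (\<Oplus>p\<in>{deg s}. f p s)"
      using f free_module_closed[OF f(1)] by (intro add.finprod_mono_neutral_cong) auto
    finally show ?thesis using free_module_closed[OF f(1)] by simp
  qed
  show "\<exists>!f. (\<forall>p. f p \<in> {g \<in> carrier ?F. \<forall>s. g s \<noteq> \<zero> \<longrightarrow> deg s = p}) \<and>
      finite {p. f p \<noteq> \<zero>\<^bsub>?F\<^esub>} \<and> x = (\<Oplus>\<^bsub>?F\<^esub>p\<in>{p. f p \<noteq> \<zero>\<^bsub>?F\<^esub>}. f p)"
  proof (rule ex1I[of _ ?f])
    have car: "?f p \<in> carrier ?F" for p
      using x by (auto simp: free_module_carrier elim: rev_finite_subset)
    have supp: "{p. ?f p \<noteq> \<zero>\<^bsub>?F\<^esub>} \<subseteq> deg ` S"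
      using x by (auto simp: fun_eq_iff free_module_carrier split: if_splits)
    have fin: "finite {p. ?f p \<noteq> \<zero>\<^bsub>?F\<^esub>}"
      using finite_subset[OF supp finite_imageI[OF S]] .
    have degf: "deg s = p" if "?f p s \<noteq> \<zero>" for p s using that by argo
    have xeq: "x = (\<Oplus>\<^bsub>?F\<^esub>p\<in>{p. ?f p \<noteq> \<zero>\<^bsub>?F\<^esub>}. ?f p)"
    proof
      fix s
      show "x s = finsum ?F ?f {p. ?f p \<noteq> \<zero>\<^bsub>?F\<^esub>} s"
        by (subst eval[of ?f, OF car degf fin]) simp_all
    qed
    show "(\<forall>p. ?f p \<in> {g \<in> carrier ?F. \<forall>s. g s \<noteq> \<zero> \<longrightarrow> deg s = p}) \<and>
      finite {p. ?f p \<noteq> \<zero>\<^bsub>?F\<^esub>} \<and> x = (\<Oplus>\<^bsub>?F\<^esub>p\<in>{p. ?f p \<noteq> \<zero>\<^bsub>?F\<^esub>}. ?f p)"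
    proof (rule conjI[OF _ conjI[OF fin xeq]], rule allI)
      fix p
      show "?f p \<in> {g \<in> carrier ?F. \<forall>s. g s \<noteq> \<zero> \<longrightarrow> deg s = p}"
        using car[of p] degf by blast
    qed
    fix f assume f: "(\<forall>p. f p \<in> {g \<in> carrier ?F. \<forall>s. g s \<noteq> \<zero> \<longrightarrow> deg s = p}) \<and>
      finite {p. f p \<noteq> \<zero>\<^bsub>?F\<^esub>} \<and> x = (\<Oplus>\<^bsub>?F\<^esub>p\<in>{p. f p \<noteq> \<zero>\<^bsub>?F\<^esub>}. f p)"
    then have f1: "\<And>p. f p \<in> carrier ?F" and f2: "\<And>p s. f p s \<noteq> \<zero> \<Longrightarrow> deg s = p"
      and f3: "finite {p. f p \<noteq> \<zero>\<^bsub>?F\<^esub>}" and f4: "x = (\<Oplus>\<^bsub>?F\<^esub>p\<in>{p. f p \<noteq> \<zero>\<^bsub>?F\<^esub>}. f p)"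
      by blast+
    have xs: "x s = f (deg s) s" for s
      by (subst f4) (rule eval[OF f1 f2 f3])
    show "f = ?f"
    proof (intro ext)
      fix p s
      show "f p s = ?f p s"
        using xs[of s] f2[of p s] by auto
    qed
  qed
qed

lemma free_module_mono: "f \<in> carrier (free_module R S) \<Longrightarrow> S \<subseteq> S' \<Longrightarrow> f \<in> carrier (free_module R S')"
  by (auto simp: free_module_carrier)

lemma comb_dif_value_closed:
  "g \<in> carrier (free_module R S) \<Longrightarrow> comb_dif R g s \<in> carrier R"
  by (auto simp: comb_dif_def intro!: finsum_closed)

lemma comb_dif_nonzero:
  assumes "g \<in> carrier (free_module R S)" "comb_dif R g s \<noteq> \<zero>"
  shows "surj_list s \<and> (\<exists>i. Suc i < blocks s \<and> g (merge i s) \<noteq> \<zero>)"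
proof (rule ccontr)
  assume *: "\<not> ?thesis"
  then have "surj_list s \<Longrightarrow> (\<Oplus>i\<in>{..<blocks s - 1}. parity R (dexp s i) \<otimes> g (merge i s)) = \<zero>"
    by (intro add.finprod_one_eqI) auto
  then have "comb_dif R g s = \<zero>"
    by (simp add: comb_dif_def)
  then show False using assms(2) by simp
qed

lemma comb_dif_closed:
  assumes g: "g \<in> carrier (free_module R (sur_lists {2..} n))"
  shows "comb_dif R g \<in> carrier (free_module R (sur_lists {2..} n))"
proof -
  have "s \<in> sur_lists {2..} n" if nz: "comb_dif R g s \<noteq> \<zero>" for s
  proof -
    obtain i where "surj_list s" "g (merge i s) \<noteq> \<zero>"
      using comb_dif_nonzero[OF g nz] by auto
    then have "merge i s \<in> sur_lists {2..} n" using g by (auto simp: free_module_carrier)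
    then show ?thesis using \<open>surj_list s\<close> by (simp add: sur_lists_all)
  qed
  then show ?thesis
    using comb_dif_value_closed[OF g]
    by (auto simp: free_module_carrier intro: finite_subset[OF _ finite_sur_lists])
qed

lemma comb_dif_linear:
  "linear_map R (free_module R (sur_lists {2..} n)) (free_module R (sur_lists {2..} n)) (comb_dif R)"
  unfolding linear_map_def
proof (intro conjI ballI funcsetI comb_dif_closed)
  fix f g c
  assume f: "f \<in> carrier (free_module R (sur_lists {2..} n))"
  then have fs: "f s \<in> carrier R" for s by auto
  {
    assume "g \<in> carrier (free_module R (sur_lists {2..} n))"
    then have "g s \<in> carrier R" for s by auto
    then show "comb_dif R (f \<oplus>\<^bsub>free_module R (sur_lists {2..} n)\<^esub> g)
        = comb_dif R f \<oplus>\<^bsub>free_module R (sur_lists {2..} n)\<^esub> comb_dif R g"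
      using fs by (auto simp: comb_dif_def fun_eq_iff r_distr finsum_addf Pi_iff)
  }
  assume c: "c \<in> carrier R"
  have "(\<Oplus>i\<in>A. parity R (dexp s i) \<otimes> (c \<otimes> f (merge i s))) = c \<otimes> (\<Oplus>i\<in>A. parity R (dexp s i) \<otimes> f (merge i s))"
    if "finite A" for A s
    using that c fs by (subst finsum_rdistr) (auto simp: m_lcomm Pi_iff)
  then show "comb_dif R (c \<odot>\<^bsub>free_module R (sur_lists {2..} n)\<^esub> f)
      = c \<odot>\<^bsub>free_module R (sur_lists {2..} n)\<^esub> comb_dif R f"
    using c fs by (auto simp: comb_dif_def fun_eq_iff)
qed

lemma comb_dif_deg:
  assumes "g \<in> carrier (free_module R S)" "comb_deg R n p g"
  shows "comb_deg R n (p - 1) (comb_dif R g)"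
  unfolding comb_deg_def
proof (intro allI impI)
  fix s assume "comb_dif R g s \<noteq> \<zero>"
  then obtain i where i: "surj_list s" "Suc i < blocks s" "g (merge i s) \<noteq> \<zero>"
    using comb_dif_nonzero[OF assms(1)] by blast
  then have "int n - int (blocks (merge i s)) = p" using assms(2) by (simp add: comb_deg_def)
  then show "int n - int (blocks s) = p - 1" using i by (simp add: blocks_merge)
qed

text \<open>The index pairs consist of those with \<open>i <= j\<close> and of their partners
  \<open>(Suc j, i)\<close>, and partners cancel.\<close>

lemma finsum_cancel:
  assumes X: "\<And>i j. X i j \<in> carrier R" "\<And>i j. i \<le> j \<Longrightarrow> j < m \<Longrightarrow> X (Suc j) i = \<ominus> X i j"
  shows "(\<Oplus>i\<in>{..<Suc m}. \<Oplus>j\<in>{..<m}. X i j) = \<zero>"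
proof -
  let ?X = "\<lambda>(i, j). X i j" and ?h = "\<lambda>(i, j). (Suc j, i)"
  let ?A = "{(i, j). i \<le> j \<and> j < m}"
  have fA: "finite ?A" by (rule finite_subset[of _ "{..m} \<times> {..m}"]) auto
  have "(\<Oplus>i\<in>{..<Suc m}. \<Oplus>j\<in>{..<m}. X i j) = finsum R ?X ({..<Suc m} \<times> {..<m})"
    using X(1) by (subst finsum_Times) auto
  also have "{..<Suc m} \<times> {..<m} = ?A \<union> ?h ` ?A"
    by (auto simp: image_iff Bex_def) (metis Suc_le_D less_Suc_eq_le not_less_eq_eq)
  also have "finsum R ?X (?A \<union> ?h ` ?A) = finsum R ?X ?A \<oplus> finsum R ?X (?h ` ?A)"
    using X(1) fA by (intro finsum_Un_disjoint) auto
  also have "finsum R ?X (?h ` ?A) = (\<Oplus>x\<in>?A. ?X (?h x))"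
    using X(1) by (intro finsum_reindex) (auto simp: inj_on_def)
  also have "finsum R ?X ?A \<oplus> (\<Oplus>x\<in>?A. ?X (?h x)) = (\<Oplus>x\<in>?A. ?X x \<oplus> ?X (?h x))"
    using X(1) by (intro finsum_addf[symmetric]) auto
  also have "\<dots> = \<zero>"
    using X by (intro add.finprod_one_eqI) (auto simp: r_neg)
  finally show ?thesis .
qed

text \<open>Two successive merges can be carried out in two orders, with equal results by
  \<open>merge_merge\<close> and opposite signs by \<open>dexp_merge_merge\<close>.\<close>

lemma comb_dif_dif:
  assumes g: "g \<in> carrier (free_module R S)"
  shows "comb_dif R (comb_dif R g) = (\<lambda>_. \<zero>)"
proof
  fix s
  have gc: "g u \<in> carrier R" for u using g by auto
  show "comb_dif R (comb_dif R g) s = \<zero>"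
  proof (cases "surj_list s \<and> 2 \<le> blocks s")
    case False
    then show ?thesis by (auto simp: comb_dif_def)
  next
    case True
    then obtain m where m: "blocks s = Suc (Suc m)"
      by (metis One_nat_def Suc_le_D numeral_2_eq_2 Suc_le_mono)
    let ?X = "\<lambda>i j. parity R (dexp s i + dexp (merge i s) j) \<otimes> g (merge j (merge i s))"
    have "parity R (dexp s i) \<otimes> comb_dif R g (merge i s) = (\<Oplus>j\<in>{..<m}. ?X i j)" if "i < Suc m" for i
    proof -
      have "blocks (merge i s) - 1 = m" "surj_list (merge i s)"
        using True that m by (simp_all add: blocks_merge surj_merge)
      then have "parity R (dexp s i) \<otimes> comb_dif R g (merge i s)
          = (\<Oplus>j\<in>{..<m}. parity R (dexp s i) \<otimes> (parity R (dexp (merge i s) j) \<otimes> g (merge j (merge i s))))"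
        using gc by (simp add: comb_dif_def finsum_rdistr Pi_iff)
      also have "\<dots> = (\<Oplus>j\<in>{..<m}. ?X i j)"
        using gc by (intro finsum_cong') (auto simp: parity_add m_assoc)
      finally show ?thesis .
    qed
    then have "comb_dif R (comb_dif R g) s = (\<Oplus>i\<in>{..<Suc m}. \<Oplus>j\<in>{..<m}. ?X i j)"
      unfolding comb_dif_def[of R "comb_dif R g"] using True m gc
      by (auto intro!: finsum_cong' finsum_closed)
    also have "\<dots> = \<zero>"
    proof (rule finsum_cancel)
      fix i j :: nat assume "i \<le> j" "j < m"
      then have "parity R (dexp s (Suc j) + dexp (merge (Suc j) s) i) = \<ominus> parity R (dexp s i + dexp (merge i s) j)"
        using dexp_merge_merge[of i j s] by (intro parity_neq) auto
      then show "?X (Suc j) i = \<ominus> ?X i j"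
        using gc merge_merge[OF \<open>i \<le> j\<close>] by (simp add: l_minus)
    qed (use gc in auto)
    finally show ?thesis .
  qed
qed

lemma comb_Gam_nonzero:
  assumes t: "surj_list t" and gs: "gs \<in> decorations (ar (comb R S)) t" and nz: "comb_Gam R t gs s \<noteq> \<zero>"
  obtains us where "admissible t us" "s = sur_subst t us" "\<And>j. j < blocks t \<Longrightarrow> (gs ! j) (us ! j) \<noteq> \<zero>"
proof -
  have car: "(gs ! j) u \<in> carrier R" if "j < blocks t" for j u
    using gs that by (auto simp: decorations_def)
  show ?thesis using t
  proof (cases rule: comb_Gam_cases[where s = s])
    case (decomposed us)
    have "(gs ! j) (us ! j) \<noteq> \<zero>" if "j < blocks t" for j
    proof
      assume "(gs ! j) (us ! j) = \<zero>"
      then have "comb_Gam R t gs s = \<zero>"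
        unfolding decomposed(2) using that car decomposed(1) t
        by (subst comb_Gam_sur_subst) (auto intro!: finprod_zero[of j])
      then show False using nz by simp
    qed
    then show ?thesis using that decomposed by blast
  qed (use nz in simp)
qed

text \<open>The fibre sizes add up to the number of points, and the blocks of the pieces to the
  blocks of the composite.\<close>

lemma comb_Gam_deg:
  assumes t: "surj_list t" and gs: "gs \<in> decorations (ar (comb R S)) t"
    and q: "\<And>j. j < blocks t \<Longrightarrow> comb_deg R (count_list t j) (q j) (gs ! j)"
  shows "comb_deg R (length t) (\<Sum>j<blocks t. q j) (comb_Gam R t gs)"
  unfolding comb_deg_def
proof (intro allI impI)
  fix s assume "comb_Gam R t gs s \<noteq> \<zero>"
  then obtain us where us: "admissible t us" "s = sur_subst t us" "\<And>j. j < blocks t \<Longrightarrow> (gs ! j) (us ! j) \<noteq> \<zero>"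
    using comb_Gam_nonzero[OF t gs] by blast
  have "(\<Sum>j<blocks t. q j) = (\<Sum>j<blocks t. int (count_list t j) - int (blocks (us ! j)))"
    using q us(3) by (intro sum.cong) (auto simp: comb_deg_def)
  also have "\<dots> = int (\<Sum>j<blocks t. count_list t j) - int (offset us (blocks t))"
    by (simp add: sum_subtractf offset_def)
  also have "\<dots> = int (length t) - int (blocks s)"
    using sum_count_list[OF t] surj_sur_subst(2)[OF t us(1)] us(2) by simp
  finally show "int (length t) - int (blocks s) = (\<Sum>j<blocks t. q j)" by simp
qed

text \<open>The Leibniz rule. Merges of \<open>sur_subst t us\<close> inside the piece
  \<open>l\<close> make up the boundary of the entry \<open>l\<close>; merges across two pieces no
  longer refine \<open>t\<close> and drop out.\<close>

lemma comb_Gam_dif: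
  assumes t: "surj_list t" and gs: "gs \<in> decorations (ar (comb R {2..})) t"
    and q: "\<And>j. j < blocks t \<Longrightarrow> comb_deg R (count_list t j) (q j) (gs ! j)"
  shows "comb_dif R (comb_Gam R t gs) s =
    (\<Oplus>l\<in>{..<blocks t}. parity R (nat \<bar>\<Sum>j<l. q j\<bar>) \<otimes> comb_Gam R t (gs[l := comb_dif R (gs ! l)]) s)"
proof -
  have car: "(gs ! j) u \<in> carrier R" if "j < blocks t" for j u
    using gs that by (auto simp: decorations_def)
  have gj: "gs ! j \<in> carrier (free_module R (sur_lists {2..} (count_list t j)))" if "j < blocks t" for j
    using gs that unfolding decorations_comb_iff by auto
  have Gcar: "comb_Gam R t gs u \<in> carrier R" for u
    using comb_Gam_closed[OF t gs] by auto
  show ?thesis using t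
  proof (cases rule: comb_Gam_cases[where s = s])
    case other
    \<comment> \<open>If \<open>s\<close> does not refine \<open>t\<close>, neither does any
      surjection obtained from it by merging, by \<open>coarser_merge\<close>.\<close>
    have "comb_Gam R t gs (merge i s) = \<zero>" if "surj_list s" for i
      using other(1) that coarser_merge[of t i s] by (auto simp: comb_Gam_def)
    then have "comb_dif R (comb_Gam R t gs) s = \<zero>"
      by (auto simp: comb_dif_def intro!: add.finprod_one_eqI)
    then show ?thesis using other(2) by (auto intro!: add.finprod_one_eqI[symmetric])
  next
    case (decomposed us)
    \<comment> \<open>Extended by zero to the last block, which has no right neighbour to merge
      with, so that the sum runs over all blocks of \<open>s\<close> and splits along the
      offsets.\<close>
    let ?F = "\<lambda>w. if Suc w < blocks s then parity R (dexp s w) \<otimes> comb_Gam R t gs (merge w s) else \<zero>"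
    let ?P = "\<lambda>l. \<Otimes>i\<in>{..<blocks t} - {l}. (gs ! i) (us ! i)"
    have s: "surj_list s" "blocks s = offset us (blocks t)"
      using surj_sur_subst[OF t decomposed(1)] decomposed(2) by auto
    have Fc: "?F w \<in> carrier R" for w using Gcar by simp
    have Pc: "?P l \<in> carrier R" for l using car by (intro finprod_closed) auto
    have upd: "comb_Gam R t (gs[l := x]) (sur_subst t us) = x (us ! l) \<otimes> ?P l"
      if "l < blocks t" "\<And>u. x u \<in> carrier R" for l x
    proof -
      have "(\<Otimes>i\<in>{..<blocks t} - {l}. (gs ! i) (restr t (sur_subst t us) i)) = ?P l"
        using car restr_sur_subst[OF t decomposed(1)] by (intro finprod_cong') auto
      then show ?thesis
        using comb_Gam_update[OF t gs that(1), of x "sur_subst t us"] that s decomposed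
          coarser_sur_subst[OF t decomposed(1)] restr_sur_subst[OF t decomposed(1) that(1)] by simp
    qed
    have "comb_dif R (comb_Gam R t gs) s = (\<Oplus>w\<in>{..<blocks s - 1}. ?F w)"
      using s(1) Gcar by (simp add: comb_dif_def) (intro finsum_cong', auto)
    also have "\<dots> = (\<Oplus>w\<in>{..<offset us (blocks t)}. ?F w)"
      using Fc s(2) by (intro add.finprod_mono_neutral_cong_left) auto
    also have "\<dots> = (\<Oplus>l\<in>{..<blocks t}. \<Oplus>v\<in>{..<blocks (us ! l)}. ?F (offset us l + v))"
      using Fc by (intro add.finprod_offset) auto
    also have "\<dots> = (\<Oplus>l\<in>{..<blocks t}. parity R (nat \<bar>\<Sum>j<l. q j\<bar>) \<otimes> comb_Gam R t (gs[l := comb_dif R (gs ! l)]) s)"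
    proof (rule finsum_cong')
      have "comb_Gam R t (gs[l := comb_dif R (gs ! l)]) s \<in> carrier R" if "l < blocks t" for l
        using upd[OF that comb_dif_value_closed[OF gj[OF that]]] decomposed(2) Pc
          comb_dif_value_closed[OF gj[OF that]] by simp
      then show "(\<lambda>l. parity R (nat \<bar>\<Sum>j<l. q j\<bar>) \<otimes> comb_Gam R t (gs[l := comb_dif R (gs ! l)]) s) \<in> {..<blocks t} \<rightarrow> carrier R"
        by auto
      fix l assume "l \<in> {..<blocks t}"
      then have l: "l < blocks t" by simp
      have ul: "surj_list (us ! l)" "length (us ! l) = count_list t l" "length us = blocks t"
        using decomposed(1) l by (auto simp: admissible_def)
      let ?A = "\<Sum>j<l. count_list t j + blocks (us ! j)"
      let ?T = "\<lambda>v. parity R (dexp (us ! l) v) \<otimes> (gs ! l) (merge v (us ! l))"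
      have eval: "?F (offset us l + v) = (parity R ?A \<otimes> ?P l) \<otimes> ?T v" if v: "Suc v < blocks (us ! l)" for v
      proof -
        have w: "Suc (offset us l + v) < blocks s"
          using offset_add_less[OF l v] s(2) by simp
        let ?us = "us[l := merge v (us ! l)]"
        have adm: "admissible t ?us"
          using decomposed(1) l ul v by (intro admissible_update) (auto simp: surj_merge)
        have gi: "(gs ! i) (?us ! i) \<in> carrier R" if "i < blocks t" for i using car that by auto
        have "comb_Gam R t gs (merge (offset us l + v) s) = comb_Gam R t gs (sur_subst t ?us)"
          unfolding decomposed(2) using merge_sur_subst[OF t decomposed(1) l v] by simp
        also have "\<dots> = (\<Otimes>i\<in>{..<blocks t}. (gs ! i) (?us ! i))"
          using comb_Gam_sur_subst[OF t adm gi] .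
        also have "\<dots> = (gs ! l) (?us ! l) \<otimes> (\<Otimes>i\<in>{..<blocks t} - {l}. (gs ! i) (?us ! i))"
          using gi l by (intro finprod_lessThan_update) auto
        also have "(\<Otimes>i\<in>{..<blocks t} - {l}. (gs ! i) (?us ! i)) = ?P l"
          using car by (intro finprod_cong') auto
        also have "(gs ! l) (?us ! l) = (gs ! l) (merge v (us ! l))"
          using l ul(3) by simp
        finally have "?F (offset us l + v) = parity R (?A + dexp (us ! l) v) \<otimes> ((gs ! l) (merge v (us ! l)) \<otimes> ?P l)"
          using w dexp_sur_subst[OF t decomposed(1) l v] decomposed(2) by simp
        then show ?thesis using car[OF l] Pc by (simp add: parity_add m_ac)
      qed
      have last: "?F (offset us l + v) = \<zero>" if v: "\<not> Suc v < blocks (us ! l)" "v < blocks (us ! l)" for v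
      proof (cases "Suc (offset us l + v) < blocks s")
        case True
        have "Suc v = blocks (us ! l)" using v by simp
        then have "Suc l < blocks t"
          using True s(2) l offset_Suc[of us l] by (metis Suc_lessI add_Suc_right less_irrefl)
        then have "\<not> coarser t (merge (offset us l + v) s)"
          unfolding decomposed(2) using v by (intro not_coarser_merge[OF t decomposed(1)]) auto
        then show ?thesis by (simp add: comb_Gam_def)
      qed simp
      have Tc: "?T v \<in> carrier R" for v using car[OF l] by simp
      have "(\<Oplus>v\<in>{..<blocks (us ! l)}. ?F (offset us l + v))
          = (\<Oplus>v\<in>{..<blocks (us ! l) - 1}. (parity R ?A \<otimes> ?P l) \<otimes> ?T v)"
      proof (rule add.finprod_mono_neutral_cong_right)
        show "?F (offset us l + v) = \<zero>" if "v \<in> {..<blocks (us ! l)} - {..<blocks (us ! l) - 1}" for v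
          using that by (intro last) auto
        show "?F (offset us l + v) = (parity R ?A \<otimes> ?P l) \<otimes> ?T v" if "v \<in> {..<blocks (us ! l) - 1}" for v
          using that by (intro eval) auto
      qed (use Fc in auto)
      also have "\<dots> = (parity R ?A \<otimes> ?P l) \<otimes> comb_dif R (gs ! l) (us ! l)"
        using ul Pc Tc by (simp add: comb_dif_def finsum_rdistr Pi_iff)
      \<comment> \<open>The degree \<open>q j\<close> is tied to the piece \<open>us ! j\<close>
        only where \<open>gs ! j\<close> is nonzero, so the signs are compared only if the product
        of the other factors does not vanish.\<close>
      also have "\<dots> = (parity R (nat \<bar>\<Sum>j<l. q j\<bar>) \<otimes> ?P l) \<otimes> comb_dif R (gs ! l) (us ! l)"
      proof (cases "?P l = \<zero>")
        case False
        have nz: "(gs ! j) (us ! j) \<noteq> \<zero>" if "j < l" for j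
        proof
          assume 0: "(gs ! j) (us ! j) = \<zero>"
          have "?P l = (gs ! j) (us ! j) \<otimes> (\<Otimes>i\<in>{..<blocks t} - {l} - {j}. (gs ! i) (us ! i))"
          proof -
            have "{..<blocks t} - {l} = insert j ({..<blocks t} - {l} - {j})" using that l by auto
            then show ?thesis
              using car that l finprod_insert[of "{..<blocks t} - {l} - {j}" j "\<lambda>i. (gs ! i) (us ! i)"]
              by (auto simp: Pi_iff)
          qed
          also have "\<dots> = \<zero>" unfolding 0 using car by (intro l_null finprod_closed) auto
          finally show False using False by simp
        qed
        have "(\<Sum>j<l. q j) = (\<Sum>j<l. int (count_list t j) - int (blocks (us ! j)))"
          using q nz l by (intro sum.cong) (auto simp: comb_deg_def)
        also have "\<dots> = int ?A - 2 * int (\<Sum>j<l. blocks (us ! j))"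
          by (simp add: sum_subtractf sum.distrib)
        finally have "(\<Sum>j<l. q j) = int ?A - 2 * int (\<Sum>j<l. blocks (us ! j))" .
        then have "even (\<Sum>j<l. q j) = even ?A"
          by (simp del: of_nat_sum of_nat_add)
        then have "parity R ?A = parity R (nat \<bar>\<Sum>j<l. q j\<bar>)"
          by (intro parity_eq) (simp add: even_nat_iff)
        then show ?thesis by simp
      qed simp
      also have "\<dots> = parity R (nat \<bar>\<Sum>j<l. q j\<bar>) \<otimes> comb_Gam R t (gs[l := comb_dif R (gs ! l)]) s"
        using upd[OF l comb_dif_value_closed[OF gj[OF l]]] decomposed(2) Pc
          comb_dif_value_closed[OF gj[OF l]] by (simp add: m_ac)
      finally show "(\<Oplus>v\<in>{..<blocks (us ! l)}. ?F (offset us l + v))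
          = parity R (nat \<bar>\<Sum>j<l. q j\<bar>) \<otimes> comb_Gam R t (gs[l := comb_dif R (gs ! l)]) s" .
    qed simp
    finally show ?thesis .
  qed
qed

text \<open>The Leibniz rule in the shape demanded by the axioms of a dg permutad, as an identity of
  functions with integer multiples as signs.\<close>

lemma comb_Gam_dif_sum:
  assumes t: "surj_list t" and gs: "gs \<in> decorations (ar (comb R {2..})) t"
    and q: "\<And>j. j < blocks t \<Longrightarrow> comb_deg R (count_list t j) (q j) (gs ! j)"
  shows "comb_dif R (comb_Gam R t gs) =
    (\<Oplus>\<^bsub>free_module R (sur_lists {2..} (length t))\<^esub>l\<in>{..<blocks t}.
      [neg1_pow (\<Sum>j<l. q j)] \<cdot>\<^bsub>free_module R (sur_lists {2..} (length t))\<^esub>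
        comb_Gam R t (gs[l := comb_dif R (gs ! l)]))"
    and "\<And>l. l < blocks t \<Longrightarrow> gs[l := comb_dif R (gs ! l)] \<in> decorations (ar (comb R {2..})) t"
proof -
  let ?F = "free_module R (sur_lists {2..} (length t))"
  interpret F: module R ?F by (rule free_module)
  show dec: "gs[l := comb_dif R (gs ! l)] \<in> decorations (ar (comb R {2..})) t" if "l < blocks t" for l
  proof (intro decorations_update gs that)
    have "gs ! l \<in> carrier (free_module R (sur_lists {2..} (count_list t l)))"
      using gs that unfolding decorations_comb_iff by blast
    then show "comb_dif R (gs ! l) \<in> carrier (ar (comb R {2..}) (count_list t l + 1))"
      using comb_dif_closed by simp
  qed
  have cl: "comb_Gam R t (gs[l := comb_dif R (gs ! l)]) \<in> carrier ?F" if "l < blocks t" for l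
    by (rule comb_Gam_closed[OF t dec[OF that]])
  show "comb_dif R (comb_Gam R t gs) = (\<Oplus>\<^bsub>?F\<^esub>l\<in>{..<blocks t}.
      [neg1_pow (\<Sum>j<l. q j)] \<cdot>\<^bsub>?F\<^esub> comb_Gam R t (gs[l := comb_dif R (gs ! l)]))"
  proof
    fix s
    have "(\<Oplus>\<^bsub>?F\<^esub>l\<in>{..<blocks t}. [neg1_pow (\<Sum>j<l. q j)] \<cdot>\<^bsub>?F\<^esub> comb_Gam R t (gs[l := comb_dif R (gs ! l)])) s
        = (\<Oplus>l\<in>{..<blocks t}. ([neg1_pow (\<Sum>j<l. q j)] \<cdot>\<^bsub>?F\<^esub> comb_Gam R t (gs[l := comb_dif R (gs ! l)])) s)"
      using cl by (intro free_module_finsum) (auto simp del: free_module_simps simp: F.smult_parity)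
    also have "\<dots> = (\<Oplus>l\<in>{..<blocks t}. parity R (nat \<bar>\<Sum>j<l. q j\<bar>) \<otimes> comb_Gam R t (gs[l := comb_dif R (gs ! l)]) s)"
      using cl free_module_closed[OF cl] by (intro finsum_cong') (auto simp: F.smult_parity)
    finally show "comb_dif R (comb_Gam R t gs) s = (\<Oplus>\<^bsub>?F\<^esub>l\<in>{..<blocks t}.
        [neg1_pow (\<Sum>j<l. q j)] \<cdot>\<^bsub>?F\<^esub> comb_Gam R t (gs[l := comb_dif R (gs ! l)])) s"
      using comb_Gam_dif[OF t gs q] by simp
  qed
qed

lemma dg_permutad_comb: "dg_permutad R (comb R {2..})"
proof (intro dg_permutad.intro dg_permutad_axioms.intro permutad_comb)
  let ?C = "comb R {2..}"
  show "graded_module R (ar ?C n) (hdeg ?C n)" for n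
    using graded_free_module[OF finite_sur_lists, of "{2..}" "n - 1" "\<lambda>s. int (n - 1) - int (blocks s)"]
    by (simp add: comb_def comb_deg_def)
  show "ident ?C \<in> hdeg ?C 1 0"
  proof -
    have "comb_deg R 0 0 (basis_elem R [])"
      by (auto simp: comb_deg_def basis_elem_def blocks_def)
    then show ?thesis by (simp add: sur_lists_0)
  qed
  show "linear_map R (ar ?C n) (ar ?C n) (dif ?C n)" for n
    by (simp add: comb_dif_linear)
  show "dif ?C n x \<in> hdeg ?C n (p - 1)" if "x \<in> hdeg ?C n p" for n x p
    using that by (auto intro: comb_dif_closed comb_dif_deg)
  show "dif ?C n (dif ?C n x) = \<zero>\<^bsub>ar ?C n\<^esub>" if "x \<in> carrier (ar ?C n)" for n x
    using that comb_dif_dif by simp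
next
  fix n t k \<mu>s q
  let ?C = "comb R {2..}"
  assume "n \<ge> 1" and t: "t \<in> Sur n k" and "length \<mu>s = k"
    and \<mu>s: "\<And>j. j < k \<Longrightarrow> \<mu>s ! j \<in> hdeg ?C (count_list t j + 1) (q j)"
  then have gs: "\<mu>s \<in> decorations (ar ?C) t" and st: "surj_list t" "blocks t = k" "length t = n"
    by (auto simp: decorations_def Sur_iff)
  have q: "comb_deg R (count_list t j) (q j) (\<mu>s ! j)" if "j < blocks t" for j
    using \<mu>s[of j] that st by simp
  show "Gam ?C t \<mu>s \<in> hdeg ?C (n + 1) (\<Sum>j<k. q j)"
    using comb_Gam_closed[OF st(1) gs] comb_Gam_deg[OF st(1) gs q] st by simp
  show "dif ?C (n + 1) (Gam ?C t \<mu>s) =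
         (\<Oplus>\<^bsub>ar ?C (n + 1)\<^esub>i\<in>{..<k}. [neg1_pow (\<Sum>j<i. q j)] \<cdot>\<^bsub>ar ?C (n + 1)\<^esub>
            Gam ?C t (\<mu>s[i := dif ?C (count_list t i + 1) (\<mu>s ! i)]))"
    using comb_Gam_dif_sum(1)[OF st(1) gs q] st(2,3) by simp
qed

end

section \<open>Acyclicity\<close>

text \<open>Removing the last point maps the faces of a permutohedron to the faces of the next smaller
  one. The fibre over \<open>u\<close> is a subdivided interval, whose edges \<open>u @ [l]\<close> put the last point
  into block \<open>l\<close> and whose vertices \<open>new_block i u\<close> make it a block of its own.\<close>

definition new_block :: "nat \<Rightarrow> nat list \<Rightarrow> nat list"
  where "new_block i u = map (\<lambda>v. if v < i then v else Suc v) u @ [i]"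

text \<open>Exponent of the sign relating the edge \<open>u @ [l]\<close> to its lower endpoint
  \<open>new_block l u\<close>. The upper endpoint \<open>new_block (Suc l) u\<close> carries the
  opposite sign, see \<open>dexp_new_block\<close>.\<close>

definition edge_exp :: "nat list \<Rightarrow> nat \<Rightarrow> nat"
  where "edge_exp u l = (\<Sum>j<Suc l. count_list u j + 1)"

lemma inj_shift: "inj (\<lambda>v. if v < i then v else Suc v)"
  by (auto simp: inj_def split: if_splits)

lemma surj_append:
  assumes "surj_list u" "l < blocks u"
  shows "surj_list (u @ [l])" "blocks (u @ [l]) = blocks u"
proof -
  have "set (u @ [l]) = set u" using assms by (auto simp: surj_list_def)
  then show "blocks (u @ [l]) = blocks u" by (simp add: blocks_def)
  then show "surj_list (u @ [l])"
    using \<open>set (u @ [l]) = set u\<close> assms(1) by (simp add: surj_list_def)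
qed

lemma set_new_block:
  assumes "surj_list u" "i \<le> blocks u"
  shows "set (new_block i u) = {..<Suc (blocks u)}"
proof -
  let ?f = "\<lambda>v. if v < i then v else Suc v"
  have "insert i (?f ` {..<b}) = {..<Suc b}" if "i \<le> b" for b
  proof (intro equalityI subsetI)
    fix x assume x: "x \<in> {..<Suc b}"
    consider "x = i" | "x < i" | "i < x" by linarith
    then show "x \<in> insert i (?f ` {..<b})"
    proof cases
      case 2
      then show ?thesis using that by (intro insertI2 image_eqI[of _ _ x]) auto
    next
      case 3
      then show ?thesis using x by (intro insertI2 image_eqI[of _ _ "x - 1"]) auto
    qed simp
  qed (use that in auto)
  then show ?thesis
    using assms by (simp add: new_block_def surj_list_def)
qed

lemma surj_new_block:
  assumes "surj_list u" "i \<le> blocks u"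
  shows "surj_list (new_block i u)" "blocks (new_block i u) = Suc (blocks u)"
proof -
  show "blocks (new_block i u) = Suc (blocks u)"
    using set_new_block[OF assms] by (simp add: blocks_def[of "new_block i u"])
  then show "surj_list (new_block i u)"
    using set_new_block[OF assms] by (simp add: surj_list_def)
qed

lemma new_block_top: "surj_list u \<Longrightarrow> new_block (blocks u) u = u @ [blocks u]"
proof -
  assume "surj_list u"
  then have "v < blocks u" if "v \<in> set u" for v
    using that by (simp add: surj_list_def)
  then have "map (\<lambda>v. if v < blocks u then v else Suc v) u = u"
    by (intro map_idI) simp
  then show ?thesis by (simp add: new_block_def)
qed

lemma blocks_butlast_new_block: "blocks (butlast (new_block i u)) = blocks u"
  by (simp add: new_block_def blocks_map_inj[OF inj_on_subset[OF inj_shift]])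

lemma last_new_block: "last (new_block i u) = i" "i \<notin> set (butlast (new_block i u))"
  by (auto simp: new_block_def split: if_splits)

text \<open>The alternative is whether the last point shares its block with another point. If it
  does not, deleting it leaves a gap among the values, which is closed in \<open>u\<close>.\<close>

lemma surj_list_Suc_cases:
  assumes "surj_list s" "length s = Suc n"
  obtains (edge) u l where "surj_list u" "length u = n" "l < blocks u" "s = u @ [l]"
  | (vertex) u i where "surj_list u" "length u = n" "i \<le> blocks u" "s = new_block i u"
proof -
  obtain b l where s: "s = b @ [l]" "length b = n"
    using assms(2) by (metis length_Suc_conv_rev)
  have set: "insert l (set b) = {..<blocks s}"
    using assms(1) s by (simp add: surj_list_def)
  show ?thesis
  proof (cases "l \<in> set b")
    case True
    then have "set b = {..<blocks s}" using set by (metis insert_absorb)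
    then have "blocks b = blocks s" by (simp add: blocks_def[of b])
    then have "surj_list b" "l < blocks b"
      using True \<open>set b = {..<blocks s}\<close> by (simp_all add: surj_list_def)
    then show ?thesis using edge s by blast
  next
    case False
    let ?u = "map (\<lambda>v. if v < l then v else v - 1) b"
    have "l < blocks s" using set by blast
    then obtain m where m: "blocks s = Suc m" "l \<le> m"
      by (cases "blocks s") auto
    have b: "set b = {..<Suc m} - {l}" using False set m by auto
    have "(\<lambda>v. if v < l then v else v - 1) ` ({..<Suc m} - {l}) = {..<m}"
    proof (intro equalityI subsetI)
      fix x assume "x \<in> {..<m}"
      then show "x \<in> (\<lambda>v. if v < l then v else v - 1) ` ({..<Suc m} - {l})"
        by (intro image_eqI[of _ _ "if x < l then x else Suc x"]) auto
    qed (use m in auto)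
    then have u: "set ?u = {..<m}" using b by simp
    then have "blocks ?u = m" by (simp add: blocks_def)
    then have "surj_list ?u" "l \<le> blocks ?u" using u m by (simp_all add: surj_list_def)
    moreover have "s = new_block l ?u"
    proof -
      have "map (\<lambda>v. if v < l then v else Suc v) ?u = b"
        unfolding map_map
      proof (rule map_idI)
        fix v assume "v \<in> set b"
        then have "v \<noteq> l" using False by auto
        then show "((\<lambda>v. if v < l then v else Suc v) \<circ> (\<lambda>v. if v < l then v else v - 1)) v = v" by auto
      qed
      then show ?thesis using s by (simp add: new_block_def)
    qed
    ultimately show ?thesis using vertex s by (metis length_map)
  qed
qed

lemma merge_append: "merge j (u @ [l]) = merge j u @ [if l \<le> j then l else l - 1]"
  by (simp add: merge_def)

text \<open>The second and third identities recover an edge from its two endpoints. The other two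
  are merges away from the new block, which take place in \<open>u\<close>.\<close>

lemma merge_new_block:
  "Suc j < i \<Longrightarrow> merge j (new_block i u) = new_block (i - 1) (merge j u)"
  "merge i (new_block (Suc i) u) = u @ [i]"
  "merge i (new_block i u) = u @ [i]"
  "i \<le> j \<Longrightarrow> merge (Suc j) (new_block i u) = new_block i (merge j u)"
  by (auto simp: merge_def new_block_def intro!: map_idI)

lemma count_new_block:
  "count_list (new_block i u) j = (if j < i then count_list u j else if j = i then 1 else count_list u (j - 1))"
  by (induction u) (auto simp: new_block_def)

lemma sum_count_new_block:
  "(\<Sum>j<m. count_list (new_block i u) j + 1) =
    (if m \<le> i then \<Sum>j<m. count_list u j + 1 else (\<Sum>j<m - 1. count_list u j + 1) + 2)"
proof (induction m)
  case (Suc m)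
  consider "m < i" | "m = i" | m' where "m = Suc m'" "i \<le> m'"
    by (metis Suc_le_D less_Suc_eq_le linorder_neqE_nat Suc_leI)
  then show ?case using Suc by cases (auto simp: count_new_block)
qed simp

lemma dexp_new_block:
  "Suc j < i \<Longrightarrow> dexp (new_block i u) j = dexp u j"
  "dexp (new_block (Suc i) u) i + 1 = edge_exp u i"
  "dexp (new_block i u) i = edge_exp u i"
  "i \<le> j \<Longrightarrow> dexp (new_block i u) (Suc j) = dexp u j + 2"
proof -
  let ?f = "\<lambda>i v. if v < i then v else Suc v"
  have 1: "(=) m \<circ> ?f i = (if m < i then (=) m else if m = i then (\<lambda>_. False) else (=) (m - 1))" for m i :: nat
    by (rule ext) auto
  have 2: "icount (\<lambda>_. False) Q u = 0" "icount P (\<lambda>_. False) u = 0" for P Q :: "nat \<Rightarrow> bool" and u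
    by (induction u) auto
  have inv: "inversions j k (new_block i u) = icount ((=) k \<circ> ?f i) ((=) j \<circ> ?f i) u
      + (if i = j then length (filter ((=) k \<circ> ?f i) u) else 0)" for j k i
    by (auto simp: inversions_def new_block_def icount_append icount_map filter_map)
  show "Suc j < i \<Longrightarrow> dexp (new_block i u) j = dexp u j"
    unfolding dexp_def inv 1 by (simp add: sum_count_new_block count_new_block inversions_def)
  show "dexp (new_block (Suc i) u) i + 1 = edge_exp u i"
    unfolding dexp_def inv 1 by (simp add: sum_count_new_block count_new_block edge_exp_def 2)
  show "dexp (new_block i u) i = edge_exp u i"
    unfolding dexp_def inv 1
    by (simp add: sum_count_new_block count_new_block edge_exp_def 2 count_list_filter[symmetric])
  show "dexp (new_block i u) (Suc j) = dexp u j + 2" if "i \<le> j"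
  proof -
    have "(\<Sum>m<Suc j. count_list (new_block i u) m + 1) = (\<Sum>m<j. count_list u m + 1) + 2"
      using sum_count_new_block[where m = "Suc j" and i = i and u = u] that by simp
    then show ?thesis
      using that unfolding dexp_def inv 1 by (simp add: count_new_block inversions_def)
  qed
qed

text \<open>The signs around the square made of an interval and a merge in the base multiply to
  minus one: the boundary along the interval anticommutes with the boundary of the base.\<close>

lemma dexp_append:
  "odd (dexp (u @ [l]) j + edge_exp (merge j u) (if l \<le> j then l else l - 1) + (edge_exp u l + dexp u j))"
proof -
  have inv: "inversions j (Suc j) (u @ [l]) = inversions j (Suc j) u + (if l = j then count_list u (Suc j) else 0)"
    by (auto simp: inversions_def icount_append count_list_filter)
  have sum: "(\<Sum>m<j. count_list (u @ [l]) m + 1) = (\<Sum>m<j. count_list u m + 1) + (if l < j then 1 else 0)" for j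
    by (induction j) auto
  have edge: "edge_exp (merge j u) k + (if j < Suc k then 1 else 0) = (\<Sum>m<(if j < Suc k then Suc (Suc k) else Suc k). count_list u m + 1)" for k
    using sum_count_merge[of j u "Suc k"] by (simp add: edge_exp_def)
  consider "l < j" | "l = j" | k where "l = Suc k" "j \<le> k"
    by (metis Suc_le_D less_Suc_eq_le linorder_neqE_nat Suc_leI)
  then show ?thesis
  proof cases
    case 1
    then have "edge_exp (merge j u) l = edge_exp u l" using edge[of l] by (simp add: edge_exp_def)
    moreover have "dexp (u @ [l]) j = dexp u j + 1" using 1 unfolding dexp_def inv sum by simp
    ultimately show ?thesis using 1 by auto
  next
    case 2
    then have "edge_exp (merge j u) l = edge_exp u l + count_list u (Suc j)"
      using edge[of l] by (simp add: edge_exp_def)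
    moreover have "dexp (u @ [l]) j = dexp u j + count_list u (Suc j) + 1" using 2 unfolding dexp_def inv sum by simp
    ultimately show ?thesis using 2 by auto
  next
    case 3
    then have "edge_exp u l = edge_exp (merge j u) k + 1" using edge[of k] by (simp add: edge_exp_def)
    moreover have "dexp (u @ [l]) j = dexp u j" using 3 unfolding dexp_def inv sum by simp
    ultimately show ?thesis using 3 by auto
  qed
qed

context cring
begin

lemma comb_dif_append:
  assumes "surj_list u" "l < blocks u"
  shows "comb_dif R g (u @ [l]) =
    (\<Oplus>j\<in>{..<blocks u - 1}. parity R (dexp (u @ [l]) j) \<otimes> g (merge j u @ [if l \<le> j then l else l - 1]))"
  using surj_append[OF assms] by (simp add: comb_dif_def merge_append)

lemma finsum_Suc_shift:
  assumes "\<And>i. f i \<in> carrier R"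
  shows "(\<Oplus>i\<in>{..<Suc m}. f i) = f 0 \<oplus> (\<Oplus>i\<in>{..<m}. f (Suc i))"
  using assms add.finprod_lessThan_add[of 1 m f] by (simp add: lessThan_Suc)

lemma finsum_Suc_top:
  assumes "\<And>i. f i \<in> carrier R"
  shows "(\<Oplus>i\<in>{..<Suc m}. f i) = f m \<oplus> (\<Oplus>i\<in>{..<m}. f i)"
  using assms by (simp add: lessThan_Suc)

text \<open>A vertex of the interval over \<open>u\<close> meets up to two edges, which enter with
  opposite signs; all other merges join two blocks of \<open>u\<close>. The blocks
  \<open>i - 1\<close> and \<open>i\<close> of \<open>u\<close> are separated by the new block,
  which is why the index with \<open>Suc j = i\<close> contributes zero.\<close>

lemma comb_dif_new_block:
  assumes u: "surj_list u" "i \<le> blocks u" and g: "\<And>s. g s \<in> carrier R"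
  shows "comb_dif R g (new_block i u) =
    (if i < blocks u then parity R (edge_exp u i) \<otimes> g (u @ [i]) else \<zero>)
    \<ominus> (case i of 0 \<Rightarrow> \<zero> | Suc k \<Rightarrow> parity R (edge_exp u k) \<otimes> g (u @ [k]))
    \<oplus> (\<Oplus>j\<in>{..<blocks u - 1}. parity R (dexp u j) \<otimes>
        (if Suc j < i then g (new_block (i - 1) (merge j u)) else if i \<le> j then g (new_block i (merge j u)) else \<zero>))"
    (is "_ = ?E \<ominus> ?E' \<oplus> (\<Oplus>j\<in>_. ?Y j)")
proof -
  let ?r = "blocks u"
  let ?X = "\<lambda>j. parity R (dexp (new_block i u) j) \<otimes> g (merge j (new_block i u))"
  have X: "?X j \<in> carrier R" for j using g by simp
  have Y: "?Y j \<in> carrier R" for j using g by simp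
  have lhs: "comb_dif R g (new_block i u) = (\<Oplus>j\<in>{..<?r}. ?X j)"
    using surj_new_block[OF u] by (simp add: comb_dif_def)
  have low: "?X j = ?Y j" if "Suc j < i" for j
    using that by (simp add: merge_new_block(1) dexp_new_block(1))
  have high: "?X (Suc j) = ?Y j" if "i \<le> j" for j
    using that by (simp add: merge_new_block(4) dexp_new_block(4) parity_add) (simp add: parity_def g)
  have mid: "?X i = parity R (edge_exp u i) \<otimes> g (u @ [i])"
    by (simp add: merge_new_block(3) dexp_new_block(3))
  have pre: "?X k = \<ominus> (parity R (edge_exp u k) \<otimes> g (u @ [k]))" if "i = Suc k" for k
  proof -
    have "parity R (dexp (new_block i u) k) = \<ominus> parity R (edge_exp u k)"
      using dexp_new_block(2)[of k u] that by (intro parity_neq) (metis even_Suc Suc_eq_plus1)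
    then show ?thesis using that g by (simp add: merge_new_block(2) l_minus)
  qed
  \<comment> \<open>Among the merges from position \<open>i\<close> on, the first gives the edge
    above the vertex; the others are merges in \<open>u\<close>, with the index lowered by
    one.\<close>
  have rest: "(\<Oplus>j\<in>{..<b}. ?X (i + j)) = ?E \<oplus> (\<Oplus>j\<in>{..<b - 1}. ?Y (i + j))" if b: "?r = i + b" for b
  proof (cases b)
    case 0
    then show ?thesis using b by simp
  next
    case (Suc c)
    have "(\<Oplus>j\<in>{..<b}. ?X (i + j)) = ?X i \<oplus> (\<Oplus>j\<in>{..<c}. ?X (i + Suc j))"
      unfolding Suc using X by (subst finsum_Suc_shift) auto
    also have "(\<Oplus>j\<in>{..<c}. ?X (i + Suc j)) = (\<Oplus>j\<in>{..<c}. ?Y (i + j))"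
      using Y high g by (intro finsum_cong') auto
    finally show ?thesis using Suc b mid by simp
  qed
  obtain b where b: "?r = i + b" using u(2) le_Suc_ex by blast
  have Ec: "?E \<in> carrier R" and Rc: "(\<Oplus>j\<in>{..<m}. ?Y (a + j)) \<in> carrier R" "(\<Oplus>j\<in>{..<m}. ?Y j) \<in> carrier R" for a m
    using g Y by (auto intro!: finsum_closed)
  have split: "(\<Oplus>j\<in>{..<?r}. ?X j) = (\<Oplus>j\<in>{..<i}. ?X j) \<oplus> (?E \<oplus> (\<Oplus>j\<in>{..<b - 1}. ?Y (i + j)))"
    using X add.finprod_lessThan_add[of i b ?X] rest[OF b] unfolding b by simp
  show ?thesis
  proof (cases i)
    case 0
    then show ?thesis
      unfolding lhs split using b Ec Rc by (simp add: a_minus_def)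
  next
    case (Suc k)
    have "(\<Oplus>j\<in>{..<i}. ?X j) = ?X k \<oplus> (\<Oplus>j\<in>{..<k}. ?X j)"
      unfolding Suc using X[unfolded Suc] by (subst lessThan_Suc) simp
    also have "(\<Oplus>j\<in>{..<k}. ?X j) = (\<Oplus>j\<in>{..<k}. ?Y j)"
      using Y low Suc by (intro finsum_cong') auto
    finally have 1: "(\<Oplus>j\<in>{..<i}. ?X j) = \<ominus> ?E' \<oplus> (\<Oplus>j\<in>{..<k}. ?Y j)"
      using pre[OF Suc] Suc by simp
    have "(\<Oplus>j\<in>{..<?r - 1}. ?Y j) = (\<Oplus>j\<in>{..<k}. ?Y j) \<oplus> (\<Oplus>j\<in>{..<b - 1}. ?Y (i + j))"
    proof (cases b)
      case 0
      then show ?thesis using b Suc Rc(2)[of k] by simp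
    next
      case (Suc c)
      then have "?r - 1 = i + c" using b by simp
      then have "(\<Oplus>j\<in>{..<?r - 1}. ?Y j) = (\<Oplus>j\<in>{..<i}. ?Y j) \<oplus> (\<Oplus>j\<in>{..<c}. ?Y (i + j))"
        using Y add.finprod_lessThan_add[of i c ?Y] by simp
      moreover have "(\<Oplus>j\<in>{..<i}. ?Y j) = ?Y k \<oplus> (\<Oplus>j\<in>{..<k}. ?Y j)"
        using finsum_Suc_top[of ?Y k] Y unfolding \<open>i = Suc k\<close> by blast
      moreover have "?Y k = \<zero>" using \<open>i = Suc k\<close> by simp
      ultimately show ?thesis using Suc Rc(2)[of k] by simp
    qed
    moreover have "?E' \<in> carrier R" using g by (simp split: nat.split)
    ultimately show ?thesis
      unfolding lhs split 1 using Ec Rc(1)[of i "b - 1"] Rc(2)[of k] by (simp add: a_minus_def a_ac)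
  qed
qed

text \<open>In the sum over the vertices up to \<open>L\<close> the edge terms telescope to the edge
  at \<open>L\<close>. The interval over \<open>merge j u\<close> has one position fewer, between
  the blocks that were joined, so the partial sum there ends at \<open>L - 1\<close> once
  \<open>L\<close> lies above \<open>j\<close>.\<close>

lemma sum_comb_dif_new_block:
  assumes u: "surj_list u" "L \<le> blocks u" and g: "\<And>s. g s \<in> carrier R"
  shows "(\<Oplus>i\<in>{..<Suc L}. comb_dif R g (new_block i u)) =
    (if L < blocks u then parity R (edge_exp u L) \<otimes> g (u @ [L]) else \<zero>)
    \<oplus> (\<Oplus>j\<in>{..<blocks u - 1}. parity R (dexp u j) \<otimes>
        (\<Oplus>i\<in>{..<Suc (if L \<le> j then L else L - 1)}. g (new_block i (merge j u))))"
    (is "_ = ?E L \<oplus> (\<Oplus>j\<in>?J. ?p j \<otimes> ?G L j)")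
  using u(2)
proof (induction L)
  case 0
  have "(\<Oplus>j\<in>?J. ?p j \<otimes> (if Suc j < 0 then g (new_block (0 - 1) (merge j u)) else if 0 \<le> j then g (new_block 0 (merge j u)) else \<zero>))
      = (\<Oplus>j\<in>?J. ?p j \<otimes> ?G 0 j)"
    using g by (intro finsum_cong') (auto simp: lessThan_Suc)
  moreover have "comb_dif R g (new_block 0 u) \<in> carrier R"
    using g by (auto simp: comb_dif_def intro!: finsum_closed)
  moreover have "?E 0 \<in> carrier R" using g by simp
  ultimately show ?case
    using comb_dif_new_block[OF u(1) _ g, of 0] by (simp add: lessThan_Suc a_minus_def)
next
  case (Suc L)
  have Gc: "?G L j \<in> carrier R" for L j using g by (auto intro!: finsum_closed)
  let ?Y = "\<lambda>j. if Suc j < Suc L then g (new_block (Suc L - 1) (merge j u)) else if Suc L \<le> j then g (new_block (Suc L) (merge j u)) else \<zero>"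
  have Yc: "?Y j \<in> carrier R" for j using g by simp
  have GS: "(\<Oplus>i\<in>{..<Suc (Suc k)}. g (new_block i w)) = (\<Oplus>i\<in>{..<Suc k}. g (new_block i w)) \<oplus> g (new_block (Suc k) w)" for k w
    using g by (subst lessThan_Suc) (simp add: a_comm finsum_closed Pi_iff)
  have step: "?G (Suc L) j = ?G L j \<oplus> ?Y j" for j
  proof -
    consider "Suc L \<le> j" | "L = j" | k where "L = Suc k" "j \<le> k"
      by (metis Suc_le_D less_Suc_eq_le linorder_neqE_nat Suc_leI)
    then show ?thesis
    proof cases
      case 2
      then show ?thesis using Gc[of L L] by simp
    qed (simp_all add: GS)
  qed
  have "(\<Oplus>j\<in>?J. ?p j \<otimes> ?G (Suc L) j) = (\<Oplus>j\<in>?J. (?p j \<otimes> ?G L j) \<oplus> (?p j \<otimes> ?Y j))"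
    unfolding step using Gc Yc by (intro finsum_cong') (auto simp: r_distr)
  also have "\<dots> = (\<Oplus>j\<in>?J. ?p j \<otimes> ?G L j) \<oplus> (\<Oplus>j\<in>?J. ?p j \<otimes> ?Y j)"
    using Gc Yc by (intro finsum_addf) auto
  finally have sum: "(\<Oplus>j\<in>?J. ?p j \<otimes> ?G (Suc L) j) = (\<Oplus>j\<in>?J. ?p j \<otimes> ?G L j) \<oplus> (\<Oplus>j\<in>?J. ?p j \<otimes> ?Y j)" .
  have c: "(\<Oplus>j\<in>?J. ?p j \<otimes> ?G L j) \<in> carrier R" "(\<Oplus>j\<in>?J. ?p j \<otimes> ?Y j) \<in> carrier R"
    using Gc Yc by (auto intro!: finsum_closed)
  have dc: "comb_dif R g s \<in> carrier R" for s
    using g by (auto simp: comb_dif_def intro!: finsum_closed)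
  have E: "?E L = parity R (edge_exp u L) \<otimes> g (u @ [L])" using Suc.prems by simp
  have Ec: "?E L \<in> carrier R" "?E (Suc L) \<in> carrier R" using g by simp_all
  have "(\<Oplus>i\<in>{..<Suc (Suc L)}. comb_dif R g (new_block i u))
      = comb_dif R g (new_block (Suc L) u) \<oplus> (\<Oplus>i\<in>{..<Suc L}. comb_dif R g (new_block i u))"
    using dc by (simp add: lessThan_Suc[of "Suc L"])
  also have "comb_dif R g (new_block (Suc L) u) = ?E (Suc L) \<ominus> ?E L \<oplus> (\<Oplus>j\<in>?J. ?p j \<otimes> ?Y j)"
    unfolding E using comb_dif_new_block[OF u(1) Suc.prems g] by simp
  also have "(\<Oplus>i\<in>{..<Suc L}. comb_dif R g (new_block i u)) = ?E L \<oplus> (\<Oplus>j\<in>?J. ?p j \<otimes> ?G L j)"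
    using Suc by simp
  also have "?E (Suc L) \<ominus> ?E L \<oplus> (\<Oplus>j\<in>?J. ?p j \<otimes> ?Y j) \<oplus> (?E L \<oplus> (\<Oplus>j\<in>?J. ?p j \<otimes> ?G L j))
      = ?E (Suc L) \<oplus> (\<Oplus>j\<in>?J. ?p j \<otimes> ?G (Suc L) j)"
  proof -
    have "a \<ominus> b \<oplus> y \<oplus> (b \<oplus> z) = a \<oplus> (z \<oplus> y)"
      if "a \<in> carrier R" "b \<in> carrier R" "y \<in> carrier R" "z \<in> carrier R" for a b y z
      using that by algebra
    then show ?thesis unfolding sum using c Ec by blast
  qed
  finally show ?case .
qed

text \<open>Sliding the last point to the end of each interval is a contraction onto the faces
  \<open>new_block (blocks u) u\<close>, which form a copy of the next smaller permutohedron.\<close>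

proposition comb_acyclic:
  assumes "g \<in> carrier (free_module R (sur_lists {2..} n))" "comb_deg R n p g" "p \<noteq> 0"
    and "comb_dif R g = (\<lambda>_. \<zero>)"
  shows "\<exists>w \<in> carrier (free_module R (sur_lists {2..} n)). comb_deg R n (p + 1) w \<and> comb_dif R w = g"
  using assms
proof (induction n arbitrary: g)
  case 0
  have "g s = \<zero>" for s
  proof (rule ccontr)
    assume *: "g s \<noteq> \<zero>"
    then have "s = []" using 0(1) by (auto simp: sur_lists_0 free_module_carrier)
    then show False using * 0(2,3) by (auto simp: comb_deg_def blocks_def)
  qed
  moreover have "comb_dif R (\<lambda>_. \<zero>) = (\<lambda>_. \<zero>)"
    by (auto simp: comb_dif_def fun_eq_iff)
  moreover have "(\<lambda>_. \<zero>) \<in> carrier (free_module R (sur_lists {2..} 0))"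
    by (simp add: free_module_carrier)
  ultimately show ?case
    by (intro bexI[of _ "\<lambda>_. \<zero>"]) (auto simp: comb_deg_def fun_eq_iff)
next
  case (Suc n)
  have g: "g s \<in> carrier R" for s using Suc.prems(1) by auto
  let ?G = "\<lambda>u L. \<Oplus>i\<in>{..<Suc L}. g (new_block i u)"
  have Gc: "?G u L \<in> carrier R" for u L using g by (auto intro!: finsum_closed)
  \<comment> \<open>For a cycle, the coefficient on an edge is governed by partial sums along
    neighbouring intervals. The case \<open>L = blocks u\<close> makes \<open>g'\<close> a cycle,
    and the cases below it give the boundary of \<open>W\<close> on edges.\<close>
  have key: "(if L < blocks u then parity R (edge_exp u L) \<otimes> g (u @ [L]) else \<zero>)
    \<oplus> (\<Oplus>j\<in>{..<blocks u - 1}. parity R (dexp u j) \<otimes> ?G (merge j u) (if L \<le> j then L else L - 1)) = \<zero>"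
    if "surj_list u" "L \<le> blocks u" for u L
    using sum_comb_dif_new_block[of u L g, OF that g] Suc.prems(4) by simp
  \<comment> \<open>The pushforward of \<open>g\<close> to the smaller permutohedron: all vertices
    of an interval are added up, while its edges collapse. Both degrees drop by one point and one
    block, so \<open>p\<close> is kept.\<close>
  define g' where "g' = (\<lambda>u. if u \<in> sur_lists {2..} n then ?G u (blocks u) else \<zero>)"
  have g'c: "g' \<in> carrier (free_module R (sur_lists {2..} n))"
    using Gc by (auto simp: free_module_carrier g'_def intro: finite_subset[OF _ finite_sur_lists[of "{2..}" n]])
  have "comb_deg R n p g'"
    unfolding comb_deg_def
  proof (intro allI impI)
    fix u assume *: "g' u \<noteq> \<zero>"
    then have u: "surj_list u" "length u = n" and nz: "?G u (blocks u) \<noteq> \<zero>"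
      by (auto simp: g'_def sur_lists_all split: if_splits)
    obtain i where i: "i \<le> blocks u" "g (new_block i u) \<noteq> \<zero>"
      using nz by (metis (no_types, lifting) add.finprod_one_eqI lessThan_iff less_Suc_eq_le)
    then have "int (Suc n) - int (blocks (new_block i u)) = p"
      using Suc.prems(2) by (simp add: comb_deg_def)
    then show "int n - int (blocks u) = p"
      using surj_new_block(2)[OF u(1) i(1)] by simp
  qed
  moreover have "comb_dif R g' = (\<lambda>_. \<zero>)"
  proof
    fix u
    show "comb_dif R g' u = \<zero>"
    proof (cases "u \<in> sur_lists {2..} n")
      case True
      then have u: "surj_list u" "length u = n" by (auto simp: sur_lists_all)
      have "comb_dif R g' u = (\<Oplus>j\<in>{..<blocks u - 1}. parity R (dexp u j) \<otimes> ?G (merge j u) (if blocks u \<le> j then blocks u else blocks u - 1))"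
      proof -
        have "g' (merge j u) = ?G (merge j u) (blocks u - 1)" if "j < blocks u - 1" for j
          using that u surj_merge[of u j] blocks_merge[of u j] by (simp add: g'_def sur_lists_all)
        then show ?thesis
          using u Gc by (simp add: comb_dif_def) (intro finsum_cong', auto)
      qed
      moreover have "(\<Oplus>j\<in>{..<blocks u - 1}. parity R (dexp u j) \<otimes> ?G (merge j u) (if blocks u \<le> j then blocks u else blocks u - 1)) \<in> carrier R"
        using Gc by (auto intro!: finsum_closed)
      ultimately show ?thesis using key[OF u(1) order_refl] by simp
    next
      case False
      then show ?thesis using comb_dif_closed[OF g'c] by (simp add: free_module_carrier)
    qed
  qed
  ultimately obtain w' where w': "w' \<in> carrier (free_module R (sur_lists {2..} n))"
      "comb_deg R n (p + 1) w'" "comb_dif R w' = g'"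
    using Suc.IH[OF g'c] Suc.prems(3) by blast
  have w'c: "w' u \<in> carrier R" for u using w'(1) by auto
  \<comment> \<open>On edges, the signed partial sums of \<open>g\<close>, which carry every vertex
    coefficient of an interval to its top vertex; on top vertices, the primitive \<open>w'\<close>
    of what accumulates there. The last value occurs earlier in the list exactly for edges.\<close>
  define W where "W = (\<lambda>s. if s \<notin> sur_lists {2..} (Suc n) then \<zero>
     else if last s \<in> set (butlast s) then parity R (edge_exp (butlast s) (last s)) \<otimes> ?G (butlast s) (last s)
     else if last s = blocks (butlast s) then w' (butlast s) else \<zero>)"
  have Wc: "W s \<in> carrier R" for s using Gc w'c by (auto simp: W_def)
  have W_edge: "W (u @ [l]) = parity R (edge_exp u l) \<otimes> ?G u l"
    if "surj_list u" "length u = n" "l < blocks u" for u l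
    using that surj_append[of u l] by (auto simp: W_def sur_lists_all surj_list_def)
  have W_vertex: "W (new_block i u) = (if i = blocks u then w' u else \<zero>)"
    if u: "surj_list u" "length u = n" "i \<le> blocks u" for u i
  proof (cases "i = blocks u")
    case True
    then show ?thesis
      using u surj_new_block[of u i] last_new_block[of i u] by (auto simp: W_def sur_lists_all new_block_top)
  next
    case False
    then show ?thesis
      using last_new_block[of i u] blocks_butlast_new_block[of i u] by (simp add: W_def)
  qed
  have "W \<in> carrier (free_module R (sur_lists {2..} (Suc n)))"
    using Wc by (auto simp: free_module_carrier W_def intro: finite_subset[OF _ finite_sur_lists[of "{2..}" "Suc n"]])
  moreover have "comb_deg R (Suc n) (p + 1) W"
    unfolding comb_deg_def
  proof (intro allI impI)
    fix s assume nz: "W s \<noteq> \<zero>"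
    then have "surj_list s" "length s = Suc n" by (auto simp: W_def sur_lists_all split: if_splits)
    then show "int (Suc n) - int (blocks s) = p + 1"
    proof (cases rule: surj_list_Suc_cases)
      case (edge u l)
      have "?G u l \<noteq> \<zero>"
        using nz W_edge[OF edge(1-3)] edge(4) by auto
      then obtain i where i: "i \<le> l" "g (new_block i u) \<noteq> \<zero>"
        by (metis (no_types, lifting) add.finprod_one_eqI lessThan_iff less_Suc_eq_le)
      then have "int (Suc n) - int (blocks (new_block i u)) = p"
        using Suc.prems(2) by (simp add: comb_deg_def)
      then show ?thesis
        using surj_new_block(2)[OF edge(1), of i] i edge surj_append by simp
    next
      case (vertex u i)
      then have "w' u \<noteq> \<zero>" using nz W_vertex[OF vertex(1-3)] by (auto split: if_splits)
      then show ?thesis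
        using w'(2) vertex surj_new_block(2)[OF vertex(1,3)] by (simp add: comb_deg_def)
    qed
  qed
  moreover have "comb_dif R W = g"
  proof
    fix s
    show "comb_dif R W s = g s"
    proof (cases "surj_list s \<and> length s = Suc n")
      case False
      then have "W (merge i s) = \<zero>" if "surj_list s" for i
        using that by (auto simp: W_def sur_lists_all)
      then have "comb_dif R W s = \<zero>"
        by (auto simp: comb_dif_def intro!: add.finprod_one_eqI)
      moreover have "g s = \<zero>"
        using False Suc.prems(1) sur_lists_all[of s "Suc n"] by (auto simp: free_module_carrier)
      ultimately show ?thesis by simp
    next
      case True
      then have "surj_list s" "length s = Suc n" by auto
      then show ?thesis
      proof (cases rule: surj_list_Suc_cases)
        case (edge u l)
        let ?l = "\<lambda>j. if l \<le> j then l else l - 1"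
        let ?S = "\<Oplus>j\<in>{..<blocks u - 1}. parity R (dexp u j) \<otimes> ?G (merge j u) (?l j)"
        have Sc: "?S \<in> carrier R" using Gc by (auto intro!: finsum_closed)
        have "comb_dif R W s = (\<Oplus>j\<in>{..<blocks u - 1}. parity R (dexp (u @ [l]) j) \<otimes> W (merge j u @ [?l j]))"
          unfolding edge(4) by (rule comb_dif_append[OF edge(1,3)])
        also have "\<dots> = (\<Oplus>j\<in>{..<blocks u - 1}. \<ominus> parity R (edge_exp u l) \<otimes> (parity R (dexp u j) \<otimes> ?G (merge j u) (?l j)))"
        proof (rule finsum_cong')
          fix j assume "j \<in> {..<blocks u - 1}"
          then have j: "Suc j < blocks u" by auto
          have "?l j < blocks (merge j u)"
            using j edge(3) blocks_merge[OF edge(1) j] by auto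
          then have "W (merge j u @ [?l j]) = parity R (edge_exp (merge j u) (?l j)) \<otimes> ?G (merge j u) (?l j)"
            using j edge surj_merge by (intro W_edge) auto
          moreover have "parity R (dexp (u @ [l]) j + edge_exp (merge j u) (?l j)) = \<ominus> parity R (edge_exp u l + dexp u j)"
            using dexp_append[of u l j] by (intro parity_neq) auto
          ultimately show "parity R (dexp (u @ [l]) j) \<otimes> W (merge j u @ [?l j])
              = \<ominus> parity R (edge_exp u l) \<otimes> (parity R (dexp u j) \<otimes> ?G (merge j u) (?l j))"
            using Gc by (simp add: parity_add m_assoc[symmetric] l_minus)
        qed (use Gc in auto)
        also have "\<dots> = \<ominus> parity R (edge_exp u l) \<otimes> ?S"
          using Gc by (intro finsum_rdistr[symmetric]) auto
        \<comment> \<open>This is \<open>key\<close> for an edge, solved for the sum over the base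
          merges.\<close>
        also have "?S = \<ominus> (parity R (edge_exp u l) \<otimes> g (u @ [l]))"
        proof -
          have "parity R (edge_exp u l) \<otimes> g (u @ [l]) \<oplus> ?S = \<zero>"
            using key[OF edge(1) less_imp_le[OF edge(3)]] unfolding if_P[OF edge(3)] .
          then have "?S \<oplus> parity R (edge_exp u l) \<otimes> g (u @ [l]) = \<zero>"
            using g Sc by (subst a_comm) auto
          then show ?thesis
            using g Sc minus_equality[of ?S "parity R (edge_exp u l) \<otimes> g (u @ [l])"] by simp
        qed
        also have "\<ominus> parity R (edge_exp u l) \<otimes> \<ominus> (parity R (edge_exp u l) \<otimes> g (u @ [l])) = g s"
        proof -
          have "parity R (edge_exp u l) \<otimes> parity R (edge_exp u l) = \<one>"
            by (simp add: parity_def l_minus)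
          then show ?thesis
            using g edge(4) by (simp add: l_minus r_minus m_assoc[symmetric])
        qed
        finally show ?thesis .
      next
        case (vertex u i)
        let ?Y = "\<lambda>j. parity R (dexp u j) \<otimes> (if Suc j < i then W (new_block (i - 1) (merge j u)) else if i \<le> j then W (new_block i (merge j u)) else \<zero>)"
        \<comment> \<open>Among vertices, \<open>W\<close> is supported on the top ones. So merges
          in \<open>u\<close> contribute only for \<open>i = blocks u\<close>, where they give the
          boundary of \<open>w'\<close>, that is the full sum along the interval.\<close>
        have Y: "(\<Oplus>j\<in>{..<blocks u - 1}. ?Y j) = (if i = blocks u then ?G u (blocks u) else \<zero>)"
        proof -
          have m: "W (new_block k (merge j u)) = (if k = blocks u - 1 then w' (merge j u) else \<zero>)"
            if "j < blocks u - 1" "k \<le> blocks u - 1" for j k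
            using that vertex(1,2) surj_merge[of u j] blocks_merge[of u j] W_vertex[of "merge j u" k] by simp
          have "?Y j = (if i = blocks u then parity R (dexp u j) \<otimes> w' (merge j u) else \<zero>)" if "j < blocks u - 1" for j
            using that vertex(3) m[of j "i - 1"] m[of j i] by auto
          then have "(\<Oplus>j\<in>{..<blocks u - 1}. ?Y j) = (\<Oplus>j\<in>{..<blocks u - 1}. if i = blocks u then parity R (dexp u j) \<otimes> w' (merge j u) else \<zero>)"
            using w'c by (intro finsum_cong') auto
          also have "\<dots> = (if i = blocks u then comb_dif R w' u else \<zero>)"
            using vertex(1) by (auto simp: comb_dif_def)
          finally show ?thesis
            using w'(3) vertex(1,2) by (simp add: g'_def sur_lists_all)
        qed
        have EW: "parity R (edge_exp u k) \<otimes> W (u @ [k]) = ?G u k" if "k < blocks u" for k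
        proof -
          have "parity R (edge_exp u k) \<otimes> parity R (edge_exp u k) = \<one>"
            by (simp add: parity_def l_minus)
          then show ?thesis
            using W_edge[OF vertex(1,2) that] Gc by (simp add: m_assoc[symmetric])
        qed
        have "comb_dif R W s = (if i < blocks u then ?G u i else \<zero>) \<ominus> (case i of 0 \<Rightarrow> \<zero> | Suc k \<Rightarrow> ?G u k)
            \<oplus> (if i = blocks u then ?G u (blocks u) else \<zero>)"
          unfolding vertex(4) comb_dif_new_block[OF vertex(1,3) Wc] Y
          using EW vertex(3) by (simp split: nat.split)
        \<comment> \<open>At the top vertex the term coming from \<open>w'\<close> takes the place
          of the missing upper edge, so one formula covers all positions.\<close>
        also have "\<dots> = ?G u i \<ominus> (case i of 0 \<Rightarrow> \<zero> | Suc k \<Rightarrow> ?G u k)"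
        proof -
          have "(case i of 0 \<Rightarrow> \<zero> | Suc k \<Rightarrow> ?G u k) \<in> carrier R" using Gc by (simp split: nat.split)
          then show ?thesis
            using vertex(3) Gc by (auto simp: a_minus_def a_comm)
        qed
        also have "\<dots> = g (new_block i u)"
        proof (cases i)
          case 0
          then show ?thesis using g by (simp add: lessThan_Suc a_minus_def)
        next
          case (Suc k)
          have "?G u i = g (new_block i u) \<oplus> ?G u k"
            unfolding Suc using g by (subst lessThan_Suc) simp
          then show ?thesis
            using Suc Gc g by (simp add: a_minus_def a_assoc r_neg)
        qed
        finally show ?thesis using vertex(4) by simp
      qed
    qed
  qed
  ultimately show ?case by blast
qed

end

section \<open>Transport of structure\<close>

text \<open>A block of the composite has the same size as the block of the inner surjection from
  which it comes, hence the arity of the decoration placed there.\<close>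

lemma decorations_concat:
  assumes t: "surj_list t" "admissible t ts" and len: "length \<mu>ss = blocks t"
    and dec: "\<And>j. j < blocks t \<Longrightarrow> \<mu>ss ! j \<in> decorations M (ts ! j)"
  shows "concat \<mu>ss \<in> decorations M (sur_subst t ts)"
proof -
  have lts: "length ts = blocks t" using t(2) by (simp add: admissible_def)
  have l: "length \<mu>ss = length ts" "\<And>j. j < length ts \<Longrightarrow> length (\<mu>ss ! j) = blocks (ts ! j)"
    using len lts dec by (auto simp: decorations_def)
  have b: "blocks (sur_subst t ts) = offset ts (blocks t)" by (rule surj_sur_subst(2)[OF t])
  have "length (concat \<mu>ss) = blocks (sur_subst t ts)"
    using length_concat_offset[of \<mu>ss ts, OF l] b lts by simp
  moreover have "concat \<mu>ss ! w \<in> carrier (M (count_list (sur_subst t ts) w + 1))"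
    if w: "w < blocks (sur_subst t ts)" for w
  proof -
    obtain j v where jv: "j < blocks t" "v < blocks (ts ! j)" "w = offset ts j + v"
      using offset_decomp w b by metis
    then show ?thesis
      using dec[OF jv(1)] concat_index[of \<mu>ss ts, OF l, of j v] lts count_sur_subst[OF t jv(1,2)]
      by (simp add: decorations_def)
  qed
  ultimately show ?thesis by (simp add: decorations_def)
qed

lemma map_upt_update:
  "length \<nu>s = k \<Longrightarrow> j < k \<Longrightarrow>
    (map (\<lambda>j. f j (\<nu>s ! j)) [0..<k])[j := f j x] = map (\<lambda>i. f i (\<nu>s[j := x] ! i)) [0..<k]"
  by (rule nth_equalityI) (auto simp: nth_list_update)

context
  fixes R :: "('a, 'r) ring_scheme" and P :: "('a, 'x, 'm) permutad_scheme"
    and Q :: "('a, 'y, 'n) permutad_scheme" and \<phi> :: "nat \<Rightarrow> 'x \<Rightarrow> 'y"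
  assumes P: "permutad R P"
    and car: "\<And>n. n \<ge> 1 \<Longrightarrow> carrier (ar Q n) = \<phi> n ` carrier (ar P n)"
    and zero: "\<And>n. n \<ge> 1 \<Longrightarrow> \<phi> n \<zero>\<^bsub>ar P n\<^esub> = \<zero>\<^bsub>ar Q n\<^esub>"
    and add: "\<And>n x y. n \<ge> 1 \<Longrightarrow> x \<in> carrier (ar P n) \<Longrightarrow> y \<in> carrier (ar P n) \<Longrightarrow>
      \<phi> n (x \<oplus>\<^bsub>ar P n\<^esub> y) = \<phi> n x \<oplus>\<^bsub>ar Q n\<^esub> \<phi> n y"
    and smult: "\<And>n c x. n \<ge> 1 \<Longrightarrow> c \<in> carrier R \<Longrightarrow> x \<in> carrier (ar P n) \<Longrightarrow>
      \<phi> n (c \<odot>\<^bsub>ar P n\<^esub> x) = c \<odot>\<^bsub>ar Q n\<^esub> \<phi> n x"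
    and ident: "\<phi> 1 (ident P) = ident Q"
    and inj: "inj_on (\<phi> 1) (carrier (ar P 1))"
    and Gam: "\<And>n t k \<mu>s. n \<ge> 1 \<Longrightarrow> t \<in> Sur n k \<Longrightarrow> \<mu>s \<in> decorations (ar P) t \<Longrightarrow>
      \<phi> (n + 1) (Gam P t \<mu>s) = Gam Q t (map (\<lambda>j. \<phi> (count_list t j + 1) (\<mu>s ! j)) [0..<k])"
begin

interpretation P: permutad R P by (rule P)

text \<open>Entries of a composition in \<open>Q\<close> lift to \<open>P\<close>, so that the
  axioms for \<open>Q\<close> can be checked on lifts.\<close>

lemma decorations_image:
  assumes "t \<in> Sur n k" "\<mu>s \<in> decorations (ar Q) t"
  shows "\<exists>\<nu>s\<in>decorations (ar P) t. \<mu>s = map (\<lambda>j. \<phi> (count_list t j + 1) (\<nu>s ! j)) [0..<k]"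
proof -
  have k: "blocks t = k" using assms(1) by (simp add: Sur_iff)
  have "\<exists>x. x \<in> carrier (ar P (count_list t j + 1)) \<and> \<mu>s ! j = \<phi> (count_list t j + 1) x" if "j < k" for j
    using assms(2) that k car[of "count_list t j + 1"] by (auto simp: decorations_def)
  then obtain f where f: "\<And>j. j < k \<Longrightarrow> f j \<in> carrier (ar P (count_list t j + 1)) \<and> \<mu>s ! j = \<phi> (count_list t j + 1) (f j)"
    by metis
  show ?thesis
  proof (rule bexI[of _ "map f [0..<k]"])
    show "\<mu>s = map (\<lambda>j. \<phi> (count_list t j + 1) (map f [0..<k] ! j)) [0..<k]"
      using assms(2) f k by (intro nth_equalityI) (auto simp: decorations_def)
  qed (use f k in \<open>simp add: decorations_def\<close>)
qed

lemma Gam_update: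
  assumes "n \<ge> 1" "t \<in> Sur n k" "\<nu>s \<in> decorations (ar P) t" "j < k" "x \<in> carrier (ar P (count_list t j + 1))"
  shows "Gam Q t ((map (\<lambda>j. \<phi> (count_list t j + 1) (\<nu>s ! j)) [0..<k])[j := \<phi> (count_list t j + 1) x])
    = \<phi> (n + 1) (Gam P t (\<nu>s[j := x]))"
proof -
  have k: "blocks t = k" using assms(2) by (simp add: Sur_iff)
  have len: "length \<nu>s = k" using assms(3) k by (simp add: decorations_def)
  have "\<nu>s[j := x] \<in> decorations (ar P) t"
    using assms k by (intro decorations_update) auto
  then show ?thesis
    using Gam[OF assms(1,2)] map_upt_update[OF len assms(4), of "\<lambda>j. \<phi> (count_list t j + 1)" x] by simp
qed

lemma decorations_update_P:
  assumes "t \<in> Sur n k" "\<nu>s \<in> decorations (ar P) t" "j < k" "x \<in> carrier (ar P (count_list t j + 1))"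
  shows "\<nu>s[j := x] \<in> decorations (ar P) t"
  using assms by (intro decorations_update) (auto simp: Sur_iff)

text \<open>The axioms are inherited along surjections compatible with the operations; injectivity
  is asked in arity 1, to keep the identity a basis there. The lemma thus serves both for the free
  permutad, seen through coordinates, and for quotients.\<close>

lemma permutad_image: "permutad R Q"
proof (rule permutad.intro)
  fix n :: nat assume "n \<ge> 1"
  then show "module R (ar Q n)"
    using module_image[OF P.module_ar, of n "ar Q n" "\<phi> n"] car zero add smult by simp
next
  show "ident Q \<in> carrier (ar Q 1)"
    using car[of 1] ident P.ident_closed by (metis imageI order_refl)
next
  have "bij_betw (\<phi> 1) (carrier (ar P 1)) (carrier (ar Q 1))"
    using inj car[of 1] by (simp add: bij_betw_def)
  then have "bij_betw (\<phi> 1 \<circ> (\<lambda>c. c \<odot>\<^bsub>ar P 1\<^esub> ident P)) (carrier R) (carrier (ar Q 1))"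
    using P.ident_basis by (rule bij_betw_trans[rotated])
  then show "bij_betw (\<lambda>c. c \<odot>\<^bsub>ar Q 1\<^esub> ident Q) (carrier R) (carrier (ar Q 1))"
    by (rule bij_betw_cong[THEN iffD1, rotated])
      (use smult[of 1] ident P.ident_closed in simp)
next
  fix n t k \<mu>s assume *: "n \<ge> 1" "t \<in> Sur n k" "\<mu>s \<in> decorations (ar Q) t"
  obtain \<nu>s where \<nu>s: "\<nu>s \<in> decorations (ar P) t" "\<mu>s = map (\<lambda>j. \<phi> (count_list t j + 1) (\<nu>s ! j)) [0..<k]"
    using decorations_image[OF *(2,3)] by auto
  have "Gam Q t \<mu>s = \<phi> (n + 1) (Gam P t \<nu>s)"
    using Gam[OF *(1,2) \<nu>s(1)] \<nu>s(2) by simp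
  then show "Gam Q t \<mu>s \<in> carrier (ar Q (n + 1))"
    using P.Gam_closed[OF *(1,2) \<nu>s(1)] car[of "n + 1"] by simp
next
  fix n t k \<mu>s j x y
  assume *: "n \<ge> 1" "t \<in> Sur n k" "\<mu>s \<in> decorations (ar Q) t" and j: "j < k"
    and x: "x \<in> carrier (ar Q (count_list t j + 1))" and y: "y \<in> carrier (ar Q (count_list t j + 1))"
  obtain \<nu>s where \<nu>s: "\<nu>s \<in> decorations (ar P) t" "\<mu>s = map (\<lambda>j. \<phi> (count_list t j + 1) (\<nu>s ! j)) [0..<k]"
    using decorations_image[OF *(2,3)] by auto
  obtain x' y' where x': "x' \<in> carrier (ar P (count_list t j + 1))" "x = \<phi> (count_list t j + 1) x'"
    and y': "y' \<in> carrier (ar P (count_list t j + 1))" "y = \<phi> (count_list t j + 1) y'"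
    using x y car[of "count_list t j + 1"] by auto
  note mod = P.module_ar[of "count_list t j + 1"]
  have xy: "x' \<oplus>\<^bsub>ar P (count_list t j + 1)\<^esub> y' \<in> carrier (ar P (count_list t j + 1))"
    using x' y' mod by (simp add: module_def abelian_group_def abelian_monoid.a_closed)
  have "x \<oplus>\<^bsub>ar Q (count_list t j + 1)\<^esub> y = \<phi> (count_list t j + 1) (x' \<oplus>\<^bsub>ar P (count_list t j + 1)\<^esub> y')"
    using add[of "count_list t j + 1" x' y'] x' y' by simp
  then show "Gam Q t (\<mu>s[j := x \<oplus>\<^bsub>ar Q (count_list t j + 1)\<^esub> y])
      = Gam Q t (\<mu>s[j := x]) \<oplus>\<^bsub>ar Q (n + 1)\<^esub> Gam Q t (\<mu>s[j := y])"
    unfolding \<nu>s(2) x'(2) y'(2)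
    using Gam_update[OF *(1,2) \<nu>s(1) j] x' y' xy P.Gam_add[OF *(1,2) \<nu>s(1) j x'(1) y'(1)]
      add[of "n + 1"] P.Gam_closed[OF *(1,2) decorations_update_P[OF *(2) \<nu>s(1) j]] by simp
next
  fix n t k \<mu>s j c x
  assume *: "n \<ge> 1" "t \<in> Sur n k" "\<mu>s \<in> decorations (ar Q) t" and j: "j < k"
    and c: "c \<in> carrier R" and x: "x \<in> carrier (ar Q (count_list t j + 1))"
  obtain \<nu>s where \<nu>s: "\<nu>s \<in> decorations (ar P) t" "\<mu>s = map (\<lambda>j. \<phi> (count_list t j + 1) (\<nu>s ! j)) [0..<k]"
    using decorations_image[OF *(2,3)] by auto
  obtain x' where x': "x' \<in> carrier (ar P (count_list t j + 1))" "x = \<phi> (count_list t j + 1) x'"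
    using x car[of "count_list t j + 1"] by auto
  note mod = P.module_ar[of "count_list t j + 1"]
  have cx: "c \<odot>\<^bsub>ar P (count_list t j + 1)\<^esub> x' \<in> carrier (ar P (count_list t j + 1))"
    using x' c mod by (simp add: module.smult_closed)
  have "c \<odot>\<^bsub>ar Q (count_list t j + 1)\<^esub> x = \<phi> (count_list t j + 1) (c \<odot>\<^bsub>ar P (count_list t j + 1)\<^esub> x')"
    using smult[of "count_list t j + 1" c x'] x' c by simp
  then show "Gam Q t (\<mu>s[j := c \<odot>\<^bsub>ar Q (count_list t j + 1)\<^esub> x]) = c \<odot>\<^bsub>ar Q (n + 1)\<^esub> Gam Q t (\<mu>s[j := x])"
    unfolding \<nu>s(2) x'(2)
    using Gam_update[OF *(1,2) \<nu>s(1) j] x' c cx P.Gam_smult[OF *(1,2) \<nu>s(1) j c x'(1)]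
      smult[of "n + 1"] P.Gam_closed[OF *(1,2) decorations_update_P[OF *(2) \<nu>s(1) j]] by simp
next
  fix n \<mu> assume n: "n \<ge> 1" and \<mu>: "\<mu> \<in> carrier (ar Q (n + 1))"
  obtain \<nu> where \<nu>: "\<nu> \<in> carrier (ar P (n + 1))" "\<mu> = \<phi> (n + 1) \<nu>"
    using \<mu> car[of "n + 1"] by auto
  have c: "corolla n \<in> Sur n 1" "[\<nu>] \<in> decorations (ar P) (corolla n)"
    using surj_corolla[OF n] \<nu>(1) by (auto simp: Sur_iff decorations_def count_list_corolla) (simp add: corolla_def)
  show "Gam Q (corolla n) [\<mu>] = \<mu>"
    using Gam[OF n c] P.Gam_corolla[OF n \<nu>(1)] \<nu>(2) by (simp add: count_list_corolla)
next
  fix n t k m ts \<mu>ss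
  assume n: "n \<ge> 1" and t: "t \<in> Sur n k" and lts: "length ts = k" and l\<mu>: "length \<mu>ss = k"
    and ts: "\<And>j. j < k \<Longrightarrow> ts ! j \<in> Sur (count_list t j) (m j)"
    and dec: "\<And>j. j < k \<Longrightarrow> \<mu>ss ! j \<in> decorations (ar Q) (ts ! j)"
  have k: "blocks t = k" "surj_list t" "length t = n" using t by (auto simp: Sur_iff)
  have adm: "admissible t ts" using ts lts k by (simp add: admissible_def Sur_iff)
  have pos: "count_list t j \<ge> 1" if "j < k" for j
    using k that count_list_pos[of j t] by (simp add: surj_list_def)
  have "\<exists>\<nu>. \<nu> \<in> decorations (ar P) (ts ! j) \<and> \<mu>ss ! j = map (\<lambda>i. \<phi> (count_list (ts ! j) i + 1) (\<nu> ! i)) [0..<m j]"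
    if "j < k" for j
    using decorations_image[OF ts[OF that] dec[OF that]] by blast
  then obtain f where f: "\<And>j. j < k \<Longrightarrow> f j \<in> decorations (ar P) (ts ! j) \<and>
      \<mu>ss ! j = map (\<lambda>i. \<phi> (count_list (ts ! j) i + 1) (f j ! i)) [0..<m j]"
    by metis
  let ?\<nu>ss = "map f [0..<k]"
  let ?S = "sur_subst t ts"
  have S: "?S \<in> Sur n (offset ts k)"
    using surj_sur_subst[OF k(2) adm] k by (simp add: Sur_iff)
  have cP: "concat ?\<nu>ss \<in> decorations (ar P) ?S"
    using decorations_concat[OF k(2) adm, of ?\<nu>ss "ar P"] f k by simp
  have bts: "blocks (ts ! j) = m j" if "j < k" for j using ts[OF that] by (simp add: Sur_iff)
  have l\<nu>: "length (?\<nu>ss ! j) = blocks (ts ! j)" "length (\<mu>ss ! j) = blocks (ts ! j)" if "j < length ts" for j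
    using f that lts dec by (auto simp: decorations_def)
  \<comment> \<open>Lifting commutes with flattening, because a block of the composite and the inner
    block behind it have the same size and so use the same map.\<close>
  have "concat \<mu>ss = map (\<lambda>w. \<phi> (count_list ?S w + 1) (concat ?\<nu>ss ! w)) [0..<offset ts k]"
  proof (rule nth_equalityI)
    show l: "length (concat \<mu>ss) = length (map (\<lambda>w. \<phi> (count_list ?S w + 1) (concat ?\<nu>ss ! w)) [0..<offset ts k])"
      using length_concat_offset[of \<mu>ss ts] l\<nu>(2) l\<mu> lts by simp
    fix w assume w: "w < length (concat \<mu>ss)"
    then have w': "w < offset ts k" using l by simp
    then obtain j v where jv: "j < k" "v < blocks (ts ! j)" "w = offset ts j + v"
      using offset_decomp by metis
    have "concat \<mu>ss ! w = \<mu>ss ! j ! v"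
      unfolding jv(3) using jv(1,2) l\<nu>(2) l\<mu> lts by (intro concat_index) auto
    also have "\<dots> = \<phi> (count_list (ts ! j) v + 1) (f j ! v)"
      using f[OF jv(1)] jv(2) bts[OF jv(1)] by simp
    also have "f j ! v = concat ?\<nu>ss ! w"
      unfolding jv(3) using jv(1,2) l\<nu>(1) lts by (subst concat_index) auto
    also have "count_list (ts ! j) v = count_list ?S w"
      unfolding jv(3) using count_sur_subst[OF k(2) adm, of j v] jv k by simp
    finally show "concat \<mu>ss ! w = map (\<lambda>w. \<phi> (count_list ?S w + 1) (concat ?\<nu>ss ! w)) [0..<offset ts k] ! w"
      using w' by simp
  qed
  then have "Gam Q ?S (concat \<mu>ss) = \<phi> (n + 1) (Gam P ?S (concat ?\<nu>ss))"
    using Gam[OF n S cP] by simp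
  also have "Gam P ?S (concat ?\<nu>ss) = Gam P t (map2 (Gam P) ts ?\<nu>ss)"
    using f by (intro P.Gam_subst[OF n t lts _ ts]) auto
  also have "\<phi> (n + 1) (Gam P t (map2 (Gam P) ts ?\<nu>ss))
      = Gam Q t (map (\<lambda>j. \<phi> (count_list t j + 1) (map2 (Gam P) ts ?\<nu>ss ! j)) [0..<k])"
  proof (rule Gam[OF n t])
    show "map2 (Gam P) ts ?\<nu>ss \<in> decorations (ar P) t"
      using P.Gam_closed[OF pos ts] f k lts by (auto simp: decorations_def)
  qed
  also have "map (\<lambda>j. \<phi> (count_list t j + 1) (map2 (Gam P) ts ?\<nu>ss ! j)) [0..<k] = map2 (Gam Q) ts \<mu>ss"
    using Gam[OF pos ts] f lts l\<mu> by (intro nth_equalityI) auto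
  finally show "Gam Q ?S (concat \<mu>ss) = Gam Q t (map2 (Gam Q) ts \<mu>ss)" .
qed

lemma permutad_hom_image: "permutad_hom R P Q \<phi>"
  unfolding permutad_hom_def linear_map_def
  using P permutad_image car add smult ident Gam by auto

end

text \<open>Bijectivity serves to transport the uniqueness of homogeneous decompositions; the other
  axioms are again checked on lifts.\<close>

lemma dg_permutad_image:
  assumes P: "dg_permutad R P" and hom: "permutad_hom R P Q \<phi>"
    and bij: "\<And>n. n \<ge> 1 \<Longrightarrow> bij_betw (\<phi> n) (carrier (ar P n)) (carrier (ar Q n))"
    and deg: "\<And>n p. n \<ge> 1 \<Longrightarrow> hdeg Q n p = \<phi> n ` hdeg P n p"
    and dif: "\<And>n x. n \<ge> 1 \<Longrightarrow> x \<in> carrier (ar P n) \<Longrightarrow> dif Q n (\<phi> n x) = \<phi> n (dif P n x)"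
  shows "dg_permutad R Q" "dg_permutad_hom R P Q \<phi>"
proof -
  interpret P: dg_permutad R P by (rule P)
  interpret Q: permutad R Q using hom by (simp add: permutad_hom_def)
  have lin: "linear R (ar P n) (ar Q n) (\<phi> n)" if "n \<ge> 1" for n
    using that hom P.module_ar Q.module_ar by (intro linearI) (auto simp: permutad_hom_def)
  have car: "carrier (ar Q n) = \<phi> n ` carrier (ar P n)" and inj: "inj_on (\<phi> n) (carrier (ar P n))" if "n \<ge> 1" for n
    using bij[OF that] by (auto simp: bij_betw_def)
  have sub: "hdeg P n p \<subseteq> carrier (ar P n)" if "n \<ge> 1" for n p
    using P.graded[OF that] P.module_ar[OF that] by (auto simp: graded_module_def dest: module.submodule_subset)
  have difc: "dif P n x \<in> carrier (ar P n)" if "n \<ge> 1" "x \<in> carrier (ar P n)" for n x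
    using P.dif_linear[OF that(1)] that(2) by (auto simp: linear_map_def)
  have dec: "\<exists>\<nu>s. \<mu>s = map (\<lambda>j. \<phi> (count_list t j + 1) (\<nu>s ! j)) [0..<k] \<and> length \<nu>s = k \<and>
      (\<forall>j<k. \<nu>s ! j \<in> hdeg P (count_list t j + 1) (q j))"
    if "length \<mu>s = k" "\<And>j. j < k \<Longrightarrow> \<mu>s ! j \<in> hdeg Q (count_list t j + 1) (q j)" for \<mu>s t k q
  proof -
    have "\<exists>x. x \<in> hdeg P (count_list t j + 1) (q j) \<and> \<mu>s ! j = \<phi> (count_list t j + 1) x" if "j < k" for j
      using \<open>\<And>j. j < k \<Longrightarrow> \<mu>s ! j \<in> hdeg Q (count_list t j + 1) (q j)\<close>[OF that] deg[of "count_list t j + 1"] by auto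
    then obtain f where "\<And>j. j < k \<Longrightarrow> f j \<in> hdeg P (count_list t j + 1) (q j) \<and> \<mu>s ! j = \<phi> (count_list t j + 1) (f j)"
      by metis
    then show ?thesis
      using that(1) by (intro exI[of _ "map f [0..<k]"]) (auto intro!: nth_equalityI)
  qed
  have Gam: "\<phi> (n + 1) (Gam P t \<mu>s) = Gam Q t (map (\<lambda>j. \<phi> (count_list t j + 1) (\<mu>s ! j)) [0..<k])"
    if "n \<ge> 1" "t \<in> Sur n k" "\<mu>s \<in> decorations (ar P) t" for n t k \<mu>s
    using hom that by (auto simp: permutad_hom_def)
  have hdec: "\<nu>s \<in> decorations (ar P) t"
    if "t \<in> Sur n k" "length \<nu>s = k" "\<forall>j<k. \<nu>s ! j \<in> hdeg P (count_list t j + 1) (q j)" for \<nu>s t n k q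
    using that sub by (fastforce simp: decorations_def Sur_iff)
  show "dg_permutad R Q"
  proof (intro dg_permutad.intro dg_permutad_axioms.intro Q.permutad_axioms)
    fix n :: nat assume n: "n \<ge> 1"
    interpret l: linear R "ar P n" "ar Q n" "\<phi> n" by (rule lin[OF n])
    note g = P.graded[OF n, unfolded graded_module_def]
    show "graded_module R (ar Q n) (hdeg Q n)"
      unfolding graded_module_def
    proof (intro conjI allI ballI l.N.module_axioms)
      show "submodule (hdeg Q n p) R (ar Q n)" for p
        unfolding deg[OF n] using g by (intro l.submodule_image) auto
    next
      fix y assume "y \<in> carrier (ar Q n)"
      then obtain x where x: "x \<in> carrier (ar P n)" "y = \<phi> n x" using car[OF n] by auto
      let ?D = "\<lambda>f. (\<forall>p. f p \<in> hdeg P n p) \<and> finite {p. f p \<noteq> \<zero>\<^bsub>ar P n\<^esub>} \<and>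
          x = (\<Oplus>\<^bsub>ar P n\<^esub>p\<in>{p. f p \<noteq> \<zero>\<^bsub>ar P n\<^esub>}. f p)"
      have "\<exists>!f. ?D f" using g x(1) by blast
      then obtain f where D: "?D f" and uD: "\<And>f'. ?D f' \<Longrightarrow> f' = f"
        by (elim ex1E) blast
      then have f: "\<And>p. f p \<in> hdeg P n p" "finite {p. f p \<noteq> \<zero>\<^bsub>ar P n\<^esub>}"
          "x = (\<Oplus>\<^bsub>ar P n\<^esub>p\<in>{p. f p \<noteq> \<zero>\<^bsub>ar P n\<^esub>}. f p)"
        and uniq: "\<And>f'. (\<And>p. f' p \<in> hdeg P n p) \<Longrightarrow> finite {p. f' p \<noteq> \<zero>\<^bsub>ar P n\<^esub>} \<Longrightarrow>
          x = (\<Oplus>\<^bsub>ar P n\<^esub>p\<in>{p. f' p \<noteq> \<zero>\<^bsub>ar P n\<^esub>}. f' p) \<Longrightarrow> f' = f"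
        by blast+
      have z: "\<phi> n u = \<zero>\<^bsub>ar Q n\<^esub> \<longleftrightarrow> u = \<zero>\<^bsub>ar P n\<^esub>" if "u \<in> carrier (ar P n)" for u
        using inj_onD[OF inj[OF n], of u "\<zero>\<^bsub>ar P n\<^esub>"] that l.f_zero by auto
      have supp: "{p. \<phi> n (f' p) \<noteq> \<zero>\<^bsub>ar Q n\<^esub>} = {p. f' p \<noteq> \<zero>\<^bsub>ar P n\<^esub>}" if "\<And>p. f' p \<in> hdeg P n p" for f'
        using z sub[OF n] that by blast
      have fs: "finsum (ar Q n) (\<lambda>p. \<phi> n (f' p)) {p. \<phi> n (f' p) \<noteq> \<zero>\<^bsub>ar Q n\<^esub>}
          = \<phi> n (\<Oplus>\<^bsub>ar P n\<^esub>p\<in>{p. f' p \<noteq> \<zero>\<^bsub>ar P n\<^esub>}. f' p)" if "\<And>p. f' p \<in> hdeg P n p" for f'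
        unfolding supp[OF that] using that sub[OF n] by (intro l.f_finsum[symmetric]) auto
      show "\<exists>!f. (\<forall>p. f p \<in> hdeg Q n p) \<and> finite {p. f p \<noteq> \<zero>\<^bsub>ar Q n\<^esub>} \<and>
        y = (\<Oplus>\<^bsub>ar Q n\<^esub>p\<in>{p. f p \<noteq> \<zero>\<^bsub>ar Q n\<^esub>}. f p)"
      proof (rule ex1I[of _ "\<lambda>p. \<phi> n (f p)"])
        show "(\<forall>p. \<phi> n (f p) \<in> hdeg Q n p) \<and> finite {p. \<phi> n (f p) \<noteq> \<zero>\<^bsub>ar Q n\<^esub>} \<and>
            y = (\<Oplus>\<^bsub>ar Q n\<^esub>p\<in>{p. \<phi> n (f p) \<noteq> \<zero>\<^bsub>ar Q n\<^esub>}. \<phi> n (f p))"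
          using f(1,2) fs[OF f(1)] supp[OF f(1)] x(2) f(3)[symmetric] deg[OF n] by simp
        fix h assume h: "(\<forall>p. h p \<in> hdeg Q n p) \<and> finite {p. h p \<noteq> \<zero>\<^bsub>ar Q n\<^esub>} \<and>
            y = (\<Oplus>\<^bsub>ar Q n\<^esub>p\<in>{p. h p \<noteq> \<zero>\<^bsub>ar Q n\<^esub>}. h p)"
        then have "\<forall>p. \<exists>u. u \<in> hdeg P n p \<and> h p = \<phi> n u" using deg[OF n] by blast
        then obtain f' where f': "\<And>p. f' p \<in> hdeg P n p" "h = (\<lambda>p. \<phi> n (f' p))"
          by (metis (full_types) ext)
        have "\<phi> n x = \<phi> n (\<Oplus>\<^bsub>ar P n\<^esub>p\<in>{p. f' p \<noteq> \<zero>\<^bsub>ar P n\<^esub>}. f' p)"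
          using h fs[OF f'(1)] x(2) f'(2) by simp
        moreover have "(\<Oplus>\<^bsub>ar P n\<^esub>p\<in>{p. f' p \<noteq> \<zero>\<^bsub>ar P n\<^esub>}. f' p) \<in> carrier (ar P n)"
          using f'(1) sub[OF n] by (intro l.M.finsum_closed) auto
        ultimately have "x = (\<Oplus>\<^bsub>ar P n\<^esub>p\<in>{p. f' p \<noteq> \<zero>\<^bsub>ar P n\<^esub>}. f' p)"
          using inj_onD[OF inj[OF n]] x(1) by blast
        moreover have "finite {p. f' p \<noteq> \<zero>\<^bsub>ar P n\<^esub>}"
          using h f'(2) supp[OF f'(1)] by simp
        ultimately show "h = (\<lambda>p. \<phi> n (f p))" using uniq f' by blast
      qed
    qed
    show "linear_map R (ar Q n) (ar Q n) (dif Q n)"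
      unfolding linear_map_def
    proof (intro conjI ballI funcsetI)
      fix y assume "y \<in> carrier (ar Q n)"
      then obtain x where x: "x \<in> carrier (ar P n)" "y = \<phi> n x" using car[OF n] by auto
      then show "dif Q n y \<in> carrier (ar Q n)" using dif[OF n] difc[OF n] by simp
      show "dif Q n (c \<odot>\<^bsub>ar Q n\<^esub> y) = c \<odot>\<^bsub>ar Q n\<^esub> dif Q n y" if c: "c \<in> carrier R" for c
      proof -
        have "dif Q n (\<phi> n (c \<odot>\<^bsub>ar P n\<^esub> x)) = \<phi> n (dif P n (c \<odot>\<^bsub>ar P n\<^esub> x))"
          using c x by (intro dif[OF n]) simp
        also have "dif P n (c \<odot>\<^bsub>ar P n\<^esub> x) = c \<odot>\<^bsub>ar P n\<^esub> dif P n x"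
          using P.dif_linear[OF n] c x by (simp add: linear_map_def)
        finally show ?thesis using c x difc[OF n] dif[OF n] by (simp add: l.f_smult)
      qed
      fix z assume "z \<in> carrier (ar Q n)"
      then obtain w where w: "w \<in> carrier (ar P n)" "z = \<phi> n w" using car[OF n] by auto
      have "dif Q n (\<phi> n (x \<oplus>\<^bsub>ar P n\<^esub> w)) = \<phi> n (dif P n (x \<oplus>\<^bsub>ar P n\<^esub> w))"
        using w x by (intro dif[OF n]) simp
      also have "dif P n (x \<oplus>\<^bsub>ar P n\<^esub> w) = dif P n x \<oplus>\<^bsub>ar P n\<^esub> dif P n w"
        using P.dif_linear[OF n] w x by (simp add: linear_map_def)
      finally show "dif Q n (y \<oplus>\<^bsub>ar Q n\<^esub> z) = dif Q n y \<oplus>\<^bsub>ar Q n\<^esub> dif Q n z"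
        using w x difc[OF n] dif[OF n] by (simp add: l.f_add)
    qed
    show "dif Q n y \<in> hdeg Q n (p - 1)" if "y \<in> hdeg Q n p" for y p
    proof -
      obtain x where x: "x \<in> hdeg P n p" "y = \<phi> n x" using \<open>y \<in> hdeg Q n p\<close> deg[OF n] by auto
      then have "dif Q n y = \<phi> n (dif P n x)" using dif[OF n] sub[OF n] by auto
      then show ?thesis using P.dif_deg[OF n x(1)] deg[OF n] by auto
    qed
    show "dif Q n (dif Q n y) = \<zero>\<^bsub>ar Q n\<^esub>" if "y \<in> carrier (ar Q n)" for y
      using that car[OF n] dif[OF n] difc[OF n] P.dif_dif[OF n] l.f_zero by auto
  next
    show "ident Q \<in> hdeg Q 1 0"
    proof -
      have "ident Q = \<phi> 1 (ident P)" using hom by (simp add: permutad_hom_def)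
      then show ?thesis using deg[of 1 0] P.ident_deg by simp
    qed
  next
    fix n t k \<mu>s q
    assume n: "n \<ge> 1" and t: "t \<in> Sur n k" and len: "length \<mu>s = k"
      and \<mu>s: "\<And>j. j < k \<Longrightarrow> \<mu>s ! j \<in> hdeg Q (count_list t j + 1) (q j)"
    obtain \<nu>s where \<nu>s: "\<mu>s = map (\<lambda>j. \<phi> (count_list t j + 1) (\<nu>s ! j)) [0..<k]" "length \<nu>s = k"
        "\<forall>j<k. \<nu>s ! j \<in> hdeg P (count_list t j + 1) (q j)"
      using dec[OF len \<mu>s] by blast
    have \<nu>sd: "\<nu>s \<in> decorations (ar P) t" by (rule hdec[OF t \<nu>s(2,3)])
    show "Gam Q t \<mu>s \<in> hdeg Q (n + 1) (\<Sum>j<k. q j)"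
    proof -
      have "Gam P t \<nu>s \<in> hdeg P (n + 1) (\<Sum>j<k. q j)"
        using \<nu>s(3) by (intro P.Gam_deg[OF n t \<nu>s(2)]) auto
      moreover have "Gam Q t \<mu>s = \<phi> (n + 1) (Gam P t \<nu>s)"
        using Gam[OF n t \<nu>sd] \<nu>s(1) by simp
      ultimately show ?thesis using deg[of "n + 1"] by simp
    qed
    interpret l: linear R "ar P (n + 1)" "ar Q (n + 1)" "\<phi> (n + 1)" using lin[of "n + 1"] by simp
    let ?\<nu> = "\<lambda>i. \<nu>s[i := dif P (count_list t i + 1) (\<nu>s ! i)]"
    have \<nu>d: "?\<nu> i \<in> decorations (ar P) t" if "i < k" for i
      using \<nu>sd t that difc[of "count_list t i + 1" "\<nu>s ! i"] by (intro decorations_update) (auto simp: Sur_iff decorations_def)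
    have Gc: "Gam P t (?\<nu> i) \<in> carrier (ar P (n + 1))" if "i < k" for i
      by (rule P.Gam_closed[OF n t \<nu>d[OF that]])
    have sg: "[neg1_pow p] \<cdot>\<^bsub>ar P (n + 1)\<^esub> x \<in> carrier (ar P (n + 1)) \<and>
        \<phi> (n + 1) ([neg1_pow p] \<cdot>\<^bsub>ar P (n + 1)\<^esub> x) = [neg1_pow p] \<cdot>\<^bsub>ar Q (n + 1)\<^esub> \<phi> (n + 1) x"
      if "x \<in> carrier (ar P (n + 1))" for p x
      using l.M.smult_parity[OF that, of p] l.N.smult_parity[OF l.closed[OF that], of p]
        l.f_smult[OF l.M.parity_closed that] l.M.smult_closed[OF l.M.parity_closed that] by simp
    have "Gam Q t \<mu>s = \<phi> (n + 1) (Gam P t \<nu>s)"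
      using Gam[OF n t \<nu>sd] \<nu>s(1) by simp
    then have "dif Q (n + 1) (Gam Q t \<mu>s) = \<phi> (n + 1) (dif P (n + 1) (Gam P t \<nu>s))"
      using P.Gam_closed[OF n t \<nu>sd] dif[of "n + 1"] by simp
    also have "dif P (n + 1) (Gam P t \<nu>s) = (\<Oplus>\<^bsub>ar P (n + 1)\<^esub>i\<in>{..<k}. [neg1_pow (\<Sum>j<i. q j)] \<cdot>\<^bsub>ar P (n + 1)\<^esub> Gam P t (?\<nu> i))"
      using \<nu>s(3) by (intro P.Gam_dif[OF n t \<nu>s(2)]) auto
    also have "\<phi> (n + 1) \<dots> = (\<Oplus>\<^bsub>ar Q (n + 1)\<^esub>i\<in>{..<k}. \<phi> (n + 1) ([neg1_pow (\<Sum>j<i. q j)] \<cdot>\<^bsub>ar P (n + 1)\<^esub> Gam P t (?\<nu> i)))"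
      using Gc sg by (intro l.f_finsum) auto
    also have "\<dots> = (\<Oplus>\<^bsub>ar Q (n + 1)\<^esub>i\<in>{..<k}. [neg1_pow (\<Sum>j<i. q j)] \<cdot>\<^bsub>ar Q (n + 1)\<^esub>
        Gam Q t (\<mu>s[i := dif Q (count_list t i + 1) (\<mu>s ! i)]))"
    proof (rule l.N.finsum_cong')
      have eq: "Gam Q t (\<mu>s[i := dif Q (count_list t i + 1) (\<mu>s ! i)]) = \<phi> (n + 1) (Gam P t (?\<nu> i))" if i: "i < k" for i
      proof -
        have "\<nu>s ! i \<in> carrier (ar P (count_list t i + 1))"
          using \<nu>sd t i by (simp add: decorations_def Sur_iff)
        then have "dif Q (count_list t i + 1) (\<mu>s ! i) = \<phi> (count_list t i + 1) (dif P (count_list t i + 1) (\<nu>s ! i))"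
          using \<nu>s(1) i dif[of "count_list t i + 1"] by simp
        then have "\<mu>s[i := dif Q (count_list t i + 1) (\<mu>s ! i)] = map (\<lambda>j. \<phi> (count_list t j + 1) (?\<nu> i ! j)) [0..<k]"
          unfolding \<nu>s(1) using map_upt_update[OF \<nu>s(2) i, of "\<lambda>j. \<phi> (count_list t j + 1)"] i by simp
        then show ?thesis using Gam[OF n t \<nu>d[OF i]] by simp
      qed
      show "(\<lambda>i. [neg1_pow (\<Sum>j<i. q j)] \<cdot>\<^bsub>ar Q (n + 1)\<^esub> Gam Q t (\<mu>s[i := dif Q (count_list t i + 1) (\<mu>s ! i)]))
          \<in> {..<k} \<rightarrow> carrier (ar Q (n + 1))"
      proof
        fix i assume "i \<in> {..<k}"
        then have i: "i < k" by simp
        have "[neg1_pow (\<Sum>j<i. q j)] \<cdot>\<^bsub>ar Q (n + 1)\<^esub> \<phi> (n + 1) (Gam P t (?\<nu> i)) \<in> carrier (ar Q (n + 1))"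
          using sg[OF Gc[OF i], of "\<Sum>j<i. q j"] l.closed by metis
        then show "[neg1_pow (\<Sum>j<i. q j)] \<cdot>\<^bsub>ar Q (n + 1)\<^esub>
            Gam Q t (\<mu>s[i := dif Q (count_list t i + 1) (\<mu>s ! i)]) \<in> carrier (ar Q (n + 1))"
          unfolding eq[OF i] .
      qed
      show "\<phi> (n + 1) ([neg1_pow (\<Sum>j<i. q j)] \<cdot>\<^bsub>ar P (n + 1)\<^esub> Gam P t (?\<nu> i)) = [neg1_pow (\<Sum>j<i. q j)] \<cdot>\<^bsub>ar Q (n + 1)\<^esub>
          Gam Q t (\<mu>s[i := dif Q (count_list t i + 1) (\<mu>s ! i)])" if "i \<in> {..<k}" for i
        using that eq[of i] sg[OF Gc] by simp
    qed simp
    finally show "dif Q (n + 1) (Gam Q t \<mu>s) = \<dots>" .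
  qed
  then show "dg_permutad_hom R P Q \<phi>"
    unfolding dg_permutad_hom_def using P hom deg dif by auto
qed

section \<open>Coordinates on the free permutad\<close>

context abelian_group
begin

lemma diff_eq_zero_iff:
  assumes "x \<in> carrier G" "y \<in> carrier G"
  shows "x \<ominus> y = \<zero> \<longleftrightarrow> x = y"
proof
  assume "x \<ominus> y = \<zero>"
  then show "x = y"
    using assms minus_equality[of x "\<ominus> y"] by (simp add: a_minus_def)
qed (use assms in \<open>simp add: a_minus_def r_neg\<close>)

lemma diff_zero: "x \<in> carrier G \<Longrightarrow> x \<ominus> \<zero> = x"
  by (simp add: a_minus_def)

end

context linear
begin

lemma kernel_submodule: "submodule {x \<in> carrier M. f x = \<zero>\<^bsub>N\<^esub>} R M"
  by (rule M.submoduleI) (auto simp: f_zero f_add f_a_inv f_smult)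

lemma fibre_coset:
  assumes K: "K = {x \<in> carrier M. f x = \<zero>\<^bsub>N\<^esub>}" and x: "x \<in> carrier M"
  shows "{y \<in> carrier M. f y = f x} = K +>\<^bsub>M\<^esub> x"
proof -
  have "f y = f x \<longleftrightarrow> f (y \<ominus>\<^bsub>M\<^esub> x) = \<zero>\<^bsub>N\<^esub>" if "y \<in> carrier M" for y
    using that x N.M.diff_eq_zero_iff[of "f y" "f x"] by (simp add: f_minus)
  then show ?thesis
    using M.mem_coset_iff[OF kernel_submodule x] x unfolding K by blast
qed

text \<open>The first isomorphism theorem in a form where the cosets of the kernel are literally the
  fibres of \<open>f\<close>. The isomorphism from \<open>N\<close> to the quotient is then
  explicit, without a choice of representatives.\<close>

lemma fibre_iso:
  assumes K: "K = {x \<in> carrier M. f x = \<zero>\<^bsub>N\<^esub>}" and surj: "f ` carrier M = carrier N"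
  defines "fib \<equiv> \<lambda>y. {x \<in> carrier M. f x = y}"
  shows "carrier (quot_module M K) = fib ` carrier N"
    and "fib \<zero>\<^bsub>N\<^esub> = \<zero>\<^bsub>quot_module M K\<^esub>"
    and "\<And>y y'. y \<in> carrier N \<Longrightarrow> y' \<in> carrier N \<Longrightarrow> fib (y \<oplus>\<^bsub>N\<^esub> y') = fib y \<oplus>\<^bsub>quot_module M K\<^esub> fib y'"
    and "\<And>c y. c \<in> carrier R \<Longrightarrow> y \<in> carrier N \<Longrightarrow> fib (c \<odot>\<^bsub>N\<^esub> y) = c \<odot>\<^bsub>quot_module M K\<^esub> fib y"
    and "inj_on fib (carrier N)"
proof -
  have sub: "submodule K R M" unfolding K by (rule kernel_submodule)
  have fib: "fib (f x) = K +>\<^bsub>M\<^esub> x" if "x \<in> carrier M" for x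
    unfolding fib_def by (rule fibre_coset[OF K that])
  show "carrier (quot_module M K) = fib ` carrier N"
    unfolding M.carrier_quot_module surj[symmetric] using fib by (auto simp: image_iff)
  show "fib \<zero>\<^bsub>N\<^esub> = \<zero>\<^bsub>quot_module M K\<^esub>"
    using fib[of "\<zero>\<^bsub>M\<^esub>"] f_zero M.coset_zero[OF sub] by simp
  show "fib (y \<oplus>\<^bsub>N\<^esub> y') = fib y \<oplus>\<^bsub>quot_module M K\<^esub> fib y'" if "y \<in> carrier N" "y' \<in> carrier N" for y y'
  proof -
    have "y \<in> f ` carrier M" "y' \<in> f ` carrier M" using that surj by simp_all
    then obtain x x' where "x \<in> carrier M" "y = f x" "x' \<in> carrier M" "y' = f x'"
      by auto
    then show ?thesis
      using fib[of x] fib[of x'] fib[of "x \<oplus>\<^bsub>M\<^esub> x'"] M.coset_sum[OF sub] by (simp add: f_add)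
  qed
  show "fib (c \<odot>\<^bsub>N\<^esub> y) = c \<odot>\<^bsub>quot_module M K\<^esub> fib y" if "c \<in> carrier R" "y \<in> carrier N" for c y
  proof -
    have "y \<in> f ` carrier M" using that surj by simp
    then obtain x where "x \<in> carrier M" "y = f x" by auto
    then show ?thesis
      using that fib[of x] fib[of "c \<odot>\<^bsub>M\<^esub> x"] M.smult_coset[OF sub] by (simp add: f_smult)
  qed
  show "inj_on fib (carrier N)"
  proof (rule inj_onI)
    fix y y' assume "y \<in> carrier N" "y' \<in> carrier N" and eq: "fib y = fib y'"
    then have "y \<in> f ` carrier M" using surj by simp
    then obtain x where "x \<in> carrier M" "y = f x" by auto
    then have "x \<in> fib y'" using eq by (auto simp: fib_def)
    then show "y = y'" using \<open>y = f x\<close> by (simp add: fib_def)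
  qed
qed

end

text \<open>Common form of the generators of \<open>permAs R\<close>, for \<open>S = {2}\<close>,
  and of \<open>permAs_inf R\<close>, for \<open>S = {2..}\<close>.\<close>

definition one_gens :: "('a, 'r) ring_scheme \<Rightarrow> nat set \<Rightarrow> nat \<Rightarrow> ('a, 'a) module"
  where "one_gens R S n = (if n \<in> S then regular_module R else zero_module R)"

lemma permAs_gens_eq: "permAs_gens R = one_gens R {2}"
  and inf_gens_eq: "inf_gens R = one_gens R {2..}"
  by (auto simp: fun_eq_iff permAs_gens_def inf_gens_def one_gens_def)

lemma one_gens_simps [simp]:
  "carrier (one_gens R S n) = (if n \<in> S then carrier R else {\<zero>\<^bsub>R\<^esub>})"
  "zero (one_gens R S n) = \<zero>\<^bsub>R\<^esub>" "add (one_gens R S n) = add R" "smult (one_gens R S n) = monoid.mult R"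
  by (simp_all add: one_gens_def regular_module_def zero_module_def)

lemma trees_iff:
  "(t, \<mu>s) \<in> trees M n \<longleftrightarrow> length t = n \<and> surj_list t \<and> \<mu>s \<in> decorations M t"
  by (auto simp: trees_def Sur_iff)

text \<open>By multilinearity a tree with scalar decorations is the product of the scalars times the
  tree with unit decorations. A decoration of an arity outside \<open>S\<close> is zero, hence the
  value 0 when the surjection is not in \<open>sur_lists\<close>.\<close>

definition tree_val :: "('a, 'r) ring_scheme \<Rightarrow> nat set \<Rightarrow> nat list \<times> 'a list \<Rightarrow> nat list \<Rightarrow> 'a"
  where "tree_val R S z = (\<lambda>s. if s = fst z \<and> s \<in> sur_lists S (length s)
    then \<Otimes>\<^bsub>R\<^esub>j\<in>{..<blocks s}. snd z ! j else \<zero>\<^bsub>R\<^esub>)"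

definition tree_coord ::
    "('a, 'r) ring_scheme \<Rightarrow> nat set \<Rightarrow> nat \<Rightarrow> ('a, 'a) tree_comb \<Rightarrow> nat list \<Rightarrow> 'a"
  where "tree_coord R S n = lin_ext R (free_module R (sur_lists S n)) (tree_val R S)"

text \<open>The elements of the free permutad, which are cosets of the multilinear relations, turn out
  to be exactly the fibres of the coordinate map.\<close>

definition tree_fibre ::
    "('a, 'r) ring_scheme \<Rightarrow> nat set \<Rightarrow> nat \<Rightarrow> (nat list \<Rightarrow> 'a) \<Rightarrow> ('a, 'a) tree_comb set"
  where "tree_fibre R S n g =
    {f \<in> carrier (free_module R (trees (one_gens R S) n)). tree_coord R S n f = g}"

context cring
begin

lemma free_module_support: "f \<in> carrier (free_module R S) \<Longrightarrow> f s \<noteq> \<zero> \<Longrightarrow> s \<in> S"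
  unfolding free_module_carrier by blast

lemma one_gens_in_ring: "x \<in> carrier (one_gens R S n) \<Longrightarrow> x \<in> carrier R"
  by (auto split: if_splits)

lemma decorations_in_ring:
  "\<mu>s \<in> decorations (one_gens R S) t \<Longrightarrow> j < blocks t \<Longrightarrow> \<mu>s ! j \<in> carrier R"
  unfolding decorations_def by (blast intro: one_gens_in_ring)

lemma tree_val_closed_R:
  assumes "(t, \<mu>s) \<in> trees (one_gens R S) n"
  shows "tree_val R S (t, \<mu>s) s \<in> carrier R"
  using assms decorations_in_ring[of \<mu>s S t] by (auto simp: tree_val_def trees_iff intro!: finprod_closed)

lemma tree_val_closed:
  assumes "z \<in> trees (one_gens R S) n"
  shows "tree_val R S z \<in> carrier (free_module R (sur_lists S n))"
proof -
  obtain t \<mu>s where z: "z = (t, \<mu>s)" by (cases z)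
  show ?thesis
    unfolding free_module_carrier z
  proof (intro conjI allI impI)
    show "tree_val R S (t, \<mu>s) s \<in> carrier R" for s
      using assms tree_val_closed_R unfolding z by blast
    show "tree_val R S (t, \<mu>s) s = \<zero>" if "s \<notin> sur_lists S n" for s
      using assms that unfolding z by (auto simp: tree_val_def trees_iff)
    show "finite {s. tree_val R S (t, \<mu>s) s \<noteq> \<zero>}"
      by (rule finite_subset[of _ "{t}"]) (auto simp: tree_val_def)
  qed
qed

lemma tree_coord_linear:
  "linear R (free_module R (trees (one_gens R S) n)) (free_module R (sur_lists S n)) (tree_coord R S n)"
proof (rule linearI[OF free_module free_module])
  interpret N: module R "free_module R (sur_lists S n)" by (rule free_module)
  show "linear_map R (free_module R (trees (one_gens R S) n)) (free_module R (sur_lists S n)) (tree_coord R S n)"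
    unfolding tree_coord_def by (rule N.lin_ext_linear) (auto intro: tree_val_closed)
qed

lemma tree_coord_basis:
  "z \<in> trees (one_gens R S) n \<Longrightarrow> tree_coord R S n (basis_elem R z) = tree_val R S z"
  unfolding tree_coord_def by (rule module.lin_ext_basis[OF free_module]) (rule tree_val_closed)

lemma tree_coord_eval:
  assumes f: "f \<in> carrier (free_module R (trees (one_gens R S) n))"
  shows "tree_coord R S n f s = (\<Oplus>z\<in>{z. f z \<noteq> \<zero>}. f z \<otimes> tree_val R S z s)"
proof -
  interpret N: module R "free_module R (sur_lists S n)" by (rule free_module)
  have "tree_val R S z \<in> carrier (free_module R (sur_lists S n))" if "f z \<noteq> \<zero>" for z
    using free_module_support[OF f that] by (rule tree_val_closed)
  then have "(\<lambda>z. f z \<odot>\<^bsub>free_module R (sur_lists S n)\<^esub> tree_val R S z) \<in> {z. f z \<noteq> \<zero>} \<rightarrow> carrier (free_module R (sur_lists S n))"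
    using f by (intro funcsetI N.smult_closed) auto
  from free_module_finsum[OF this, of s] show ?thesis
    by (simp add: tree_coord_def lin_ext_def)
qed

lemma finprod_list_update:
  assumes "j < k" "length \<mu>s = k" "\<And>i. i < k \<Longrightarrow> \<mu>s ! i \<in> carrier R" "x \<in> carrier R"
  shows "(\<Otimes>i\<in>{..<k}. \<mu>s[j := x] ! i) = x \<otimes> (\<Otimes>i\<in>{..<k} - {j}. \<mu>s ! i)"
proof -
  have "(\<Otimes>i\<in>{..<k}. \<mu>s[j := x] ! i) = \<mu>s[j := x] ! j \<otimes> (\<Otimes>i\<in>{..<k} - {j}. \<mu>s[j := x] ! i)"
    using assms by (intro finprod_lessThan_update) (auto simp: nth_list_update)
  also have "(\<Otimes>i\<in>{..<k} - {j}. \<mu>s[j := x] ! i) = (\<Otimes>i\<in>{..<k} - {j}. \<mu>s ! i)"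
    using assms(3) by (intro finprod_cong') auto
  finally show ?thesis using assms by simp
qed

lemma tree_val_update:
  assumes "(t, \<mu>s) \<in> trees (one_gens R S) n" "j < blocks t" "x \<in> carrier R"
  shows "tree_val R S (t, \<mu>s[j := x]) s = x \<otimes> tree_val R S (t, \<mu>s[j := \<one>]) s"
proof -
  have "length \<mu>s = blocks t" "\<And>i. i < blocks t \<Longrightarrow> \<mu>s ! i \<in> carrier R"
    using assms(1) decorations_in_ring[of \<mu>s S t] by (auto simp: trees_iff decorations_def)
  moreover from this have "(\<Otimes>i\<in>{..<blocks t} - {j}. \<mu>s ! i) \<in> carrier R"
    by (intro finprod_closed) auto
  ultimately show ?thesis
    using assms(2,3) by (auto simp: tree_val_def finprod_list_update)
qed

lemma tree_val_one_closed:
  assumes "(t, \<mu>s) \<in> trees (one_gens R S) n" "j < blocks t"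
  shows "tree_val R S (t, \<mu>s[j := \<one>]) s \<in> carrier R"
proof -
  have "length \<mu>s = blocks t" "\<And>i. i < blocks t \<Longrightarrow> \<mu>s ! i \<in> carrier R"
    using assms(1) decorations_in_ring[of \<mu>s S t] by (auto simp: trees_iff decorations_def)
  then show ?thesis using assms(2) by (auto simp: tree_val_def nth_list_update intro!: finprod_closed)
qed

lemma trees_update:
  "(t, \<mu>s) \<in> trees M n \<Longrightarrow> j < blocks t \<Longrightarrow> x \<in> carrier (M (count_list t j + 1)) \<Longrightarrow> (t, \<mu>s[j := x]) \<in> trees M n"
  by (simp add: trees_iff decorations_update)

text \<open>The coordinate of a tree is the product of its decorations and so is linear in each of
  them; this is exactly what the relations express.\<close>

lemma multilinear_rels_closed:
  "multilinear_rels R (one_gens R S) n \<subseteq> {f \<in> carrier (free_module R (trees (one_gens R S) n)).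
      tree_coord R S n f = \<zero>\<^bsub>free_module R (sur_lists S n)\<^esub>}"
proof
  let ?M = "one_gens R S"
  let ?F = "free_module R (trees ?M n)" and ?N = "free_module R (sur_lists S n)"
  interpret l: linear R ?F ?N "tree_coord R S n" by (rule tree_coord_linear)
  let ?e = "basis_elem R :: nat list \<times> 'a list \<Rightarrow> _"
  fix f assume "f \<in> multilinear_rels R ?M n"
  then consider (add) t \<mu>s j x y where "(t, \<mu>s) \<in> trees ?M n" "j < blocks t"
      "x \<in> carrier (?M (count_list t j + 1))" "y \<in> carrier (?M (count_list t j + 1))"
      "f = ?e (t, \<mu>s[j := x \<oplus>\<^bsub>?M (count_list t j + 1)\<^esub> y]) \<ominus>\<^bsub>?F\<^esub> (?e (t, \<mu>s[j := x]) \<oplus>\<^bsub>?F\<^esub> ?e (t, \<mu>s[j := y]))"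
    | (smult) t \<mu>s j c x where "(t, \<mu>s) \<in> trees ?M n" "j < blocks t"
      "c \<in> carrier R" "x \<in> carrier (?M (count_list t j + 1))"
      "f = ?e (t, \<mu>s[j := c \<odot>\<^bsub>?M (count_list t j + 1)\<^esub> x]) \<ominus>\<^bsub>?F\<^esub> c \<odot>\<^bsub>?F\<^esub> ?e (t, \<mu>s[j := x])"
    unfolding multilinear_rels_def Let_def by blast
  then show "f \<in> {f \<in> carrier ?F. tree_coord R S n f = \<zero>\<^bsub>?N\<^esub>}"
  proof cases
    case add
    have R: "x \<in> carrier R" "y \<in> carrier R" using add(3,4) by (auto intro: one_gens_in_ring)
    have xy: "x \<oplus>\<^bsub>?M (count_list t j + 1)\<^esub> y \<in> carrier (?M (count_list t j + 1))"
      using add(3,4) by (auto split: if_splits)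
    note tr = trees_update[OF add(1,2) xy] trees_update[OF add(1,2) add(3)] trees_update[OF add(1,2) add(4)]
    have "tree_val R S (t, \<mu>s[j := x \<oplus>\<^bsub>?M (count_list t j + 1)\<^esub> y])
        = tree_val R S (t, \<mu>s[j := x]) \<oplus>\<^bsub>?N\<^esub> tree_val R S (t, \<mu>s[j := y])"
    proof
      fix s
      show "tree_val R S (t, \<mu>s[j := x \<oplus>\<^bsub>?M (count_list t j + 1)\<^esub> y]) s
        = (tree_val R S (t, \<mu>s[j := x]) \<oplus>\<^bsub>?N\<^esub> tree_val R S (t, \<mu>s[j := y])) s"
        using R tree_val_update[OF add(1,2), of "x \<oplus> y" s] tree_val_update[OF add(1,2), of x s]
          tree_val_update[OF add(1,2), of y s] tree_val_one_closed[OF add(1,2), of s]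
        by (simp add: l_distr)
    qed
    then show ?thesis
      unfolding add(5) using tr tree_val_closed[OF tr(2)] tree_val_closed[OF tr(3)]
      by (simp add: l.f_minus l.f_add tree_coord_basis l.N.M.diff_eq_zero_iff del: free_module_simps one_gens_simps)
  next
    case smult
    have R: "x \<in> carrier R" using smult(4) by (auto intro: one_gens_in_ring)
    have cx: "c \<odot>\<^bsub>?M (count_list t j + 1)\<^esub> x \<in> carrier (?M (count_list t j + 1))"
      using smult(3,4) by (auto split: if_splits)
    note tr = trees_update[OF smult(1,2) cx] trees_update[OF smult(1,2) smult(4)]
    have "tree_val R S (t, \<mu>s[j := c \<odot>\<^bsub>?M (count_list t j + 1)\<^esub> x])
        = c \<odot>\<^bsub>?N\<^esub> tree_val R S (t, \<mu>s[j := x])"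
    proof
      fix s
      show "tree_val R S (t, \<mu>s[j := c \<odot>\<^bsub>?M (count_list t j + 1)\<^esub> x]) s
        = (c \<odot>\<^bsub>?N\<^esub> tree_val R S (t, \<mu>s[j := x])) s"
        using R smult(3) tree_val_update[OF smult(1,2), of "c \<otimes> x" s] tree_val_update[OF smult(1,2), of x s]
          tree_val_one_closed[OF smult(1,2), of s]
        by (simp add: m_assoc)
    qed
    then show ?thesis
      unfolding smult(5) using tr smult(3) tree_val_closed[OF tr(2)]
      by (simp add: l.f_minus l.f_smult tree_coord_basis l.N.M.diff_eq_zero_iff del: free_module_simps one_gens_simps)
  qed
qed

lemma tensor_rel_submodule: "submodule (tensor_rel R (one_gens R S) n) R (free_module R (trees (one_gens R S) n))"
  and multilinear_rels_subset: "multilinear_rels R (one_gens R S) n \<subseteq> tensor_rel R (one_gens R S) n"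
proof -
  interpret F: module R "free_module R (trees (one_gens R S) n)" by (rule free_module)
  have "multilinear_rels R (one_gens R S) n \<subseteq> carrier (free_module R (trees (one_gens R S) n))"
    using multilinear_rels_closed by blast
  from F.gen_submodule(1,2)[OF this]
  show "submodule (tensor_rel R (one_gens R S) n) R (free_module R (trees (one_gens R S) n))"
    "multilinear_rels R (one_gens R S) n \<subseteq> tensor_rel R (one_gens R S) n"
    by (simp_all add: tensor_rel_def)
qed

lemma multilinear_rels_smultI:
  assumes "(t, \<mu>s) \<in> trees M n" "j < blocks t" "c \<in> carrier R" "x \<in> carrier (M (count_list t j + 1))"
  shows "basis_elem R (t, \<mu>s[j := c \<odot>\<^bsub>M (count_list t j + 1)\<^esub> x])
    \<ominus>\<^bsub>free_module R (trees M n)\<^esub> c \<odot>\<^bsub>free_module R (trees M n)\<^esub> basis_elem R (t, \<mu>s[j := x]) \<in> multilinear_rels R M n"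
  unfolding multilinear_rels_def Let_def using assms by blast

text \<open>A right inverse of the coordinate map, which selects in each coset the normal form with
  unit decorations.\<close>

definition tree_section :: "nat set \<Rightarrow> nat \<Rightarrow> (nat list \<Rightarrow> 'a) \<Rightarrow> ('a, 'a) tree_comb"
  where "tree_section S n =
    lin_ext R (free_module R (trees (one_gens R S) n)) (\<lambda>s. basis_elem R (s, replicate (blocks s) \<one>))"

lemma ones_tree: "s \<in> sur_lists S n \<Longrightarrow> (s, replicate (blocks s) \<one>) \<in> trees (one_gens R S) n"
  by (auto simp: sur_lists_def trees_iff decorations_def)

lemma tree_section_linear:
  "linear R (free_module R (sur_lists S n)) (free_module R (trees (one_gens R S) n)) (tree_section S n)"
proof (rule linearI[OF free_module free_module])
  interpret N: module R "free_module R (trees (one_gens R S) n)" by (rule free_module)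
  show "linear_map R (free_module R (sur_lists S n)) (free_module R (trees (one_gens R S) n)) (tree_section S n)"
    unfolding tree_section_def by (rule N.lin_ext_linear) (auto intro: basis_elem_closed ones_tree)
qed

lemma tree_section_basis:
  "s \<in> sur_lists S n \<Longrightarrow> tree_section S n (basis_elem R s) = basis_elem R (s, replicate (blocks s) \<one>)"
  unfolding tree_section_def by (rule module.lin_ext_basis[OF free_module]) (auto intro: basis_elem_closed ones_tree)

lemma tree_val_ones:
  "s \<in> sur_lists S n \<Longrightarrow> tree_val R S (s, replicate (blocks s) \<one>) = basis_elem R s"
  by (auto simp: tree_val_def basis_elem_def fun_eq_iff sur_lists_def intro!: finprod_one_eqI)

lemma tree_coord_section:
  assumes "g \<in> carrier (free_module R (sur_lists S n))"
  shows "tree_coord R S n (tree_section S n g) = g"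
proof -
  interpret c: linear R "free_module R (trees (one_gens R S) n)" "free_module R (sur_lists S n)" "tree_coord R S n"
    by (rule tree_coord_linear)
  interpret s: linear R "free_module R (sur_lists S n)" "free_module R (trees (one_gens R S) n)" "tree_section S n"
    by (rule tree_section_linear)
  show ?thesis
  proof (rule linear_map_eqI[OF free_module _ _ _ assms])
    show "linear_map R (free_module R (sur_lists S n)) (free_module R (sur_lists S n)) (\<lambda>g. tree_coord R S n (tree_section S n g))"
      by (auto simp: linear_map_def s.f_add s.f_smult c.f_add c.f_smult simp del: free_module_simps)
    show "linear_map R (free_module R (sur_lists S n)) (free_module R (sur_lists S n)) (\<lambda>g. g)"
      by (auto simp: linear_map_def)
    show "tree_coord R S n (tree_section S n (basis_elem R s)) = basis_elem R s" if "s \<in> sur_lists S n" for s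
      using that by (simp add: tree_section_basis tree_coord_basis ones_tree tree_val_ones)
  qed
qed

text \<open>The scalars are pulled out of the vertices one at a time, by one relation each. If some
  vertex has an arity outside \<open>S\<close>, its decoration is zero and the tree itself lies in
  the relations.\<close>

lemma basis_normal_form:
  assumes z: "(t, \<mu>s) \<in> trees (one_gens R S) n"
  shows "basis_elem R (t, \<mu>s) \<ominus>\<^bsub>free_module R (trees (one_gens R S) n)\<^esub> tree_section S n (tree_val R S (t, \<mu>s))
    \<in> tensor_rel R (one_gens R S) n"
proof -
  let ?M = "one_gens R S"
  let ?F = "free_module R (trees ?M n)" and ?T = "tensor_rel R ?M n"
  interpret F: module R ?F by (rule free_module)
  interpret s: linear R "free_module R (sur_lists S n)" ?F "tree_section S n" by (rule tree_section_linear)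
  let ?e = "\<lambda>\<mu>s. basis_elem R (t, \<mu>s)"
  note T = tensor_rel_submodule[of S n]
  have len: "length \<mu>s = blocks t" and R: "\<And>j. j < blocks t \<Longrightarrow> \<mu>s ! j \<in> carrier R"
    and t: "length t = n" "surj_list t"
    using z decorations_in_ring[of \<mu>s S t] by (auto simp: trees_iff decorations_def)
  show ?thesis
  proof (cases "t \<in> sur_lists S n")
    case False
    then obtain j where j: "j < blocks t" "count_list t j + 1 \<notin> S"
      using t by (auto simp: sur_lists_def)
    then have 0: "\<mu>s ! j = \<zero>" using z by (auto simp: trees_iff decorations_def)
    have upd: "\<mu>s[j := \<zero>] = \<mu>s" using 0 by (metis list_update_id)
    \<comment> \<open>The relation that scales the zero decoration by zero exhibits the tree as an
      element of the relations.\<close>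
    have "?e (\<mu>s[j := \<zero> \<odot>\<^bsub>?M (count_list t j + 1)\<^esub> \<zero>]) \<ominus>\<^bsub>?F\<^esub> \<zero> \<odot>\<^bsub>?F\<^esub> ?e (\<mu>s[j := \<zero>]) \<in> ?T"
      using j by (intro subsetD[OF multilinear_rels_subset] multilinear_rels_smultI[OF z]) auto
    then have "?e \<mu>s \<ominus>\<^bsub>?F\<^esub> \<zero>\<^bsub>?F\<^esub> \<in> ?T"
      using upd F.smult_l_null[of "?e \<mu>s"] z by (simp del: free_module_simps)
    moreover have "tree_val R S (t, \<mu>s) = \<zero>\<^bsub>free_module R (sur_lists S n)\<^esub>"
      using False t by (auto simp: tree_val_def fun_eq_iff)
    ultimately show ?thesis using s.f_zero by (simp del: free_module_simps)
  next
    case True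
    then have S: "count_list t j + 1 \<in> S" if "j < blocks t" for j using that by (simp add: sur_lists_def)
    let ?k = "blocks t"
    \<comment> \<open>Interpolates between the unit decorations at \<open>m = 0\<close> and \<mu>s
      at \<open>m = blocks t\<close>.\<close>
    let ?\<nu> = "\<lambda>m. take m \<mu>s @ replicate (?k - m) \<one>"
    let ?p = "\<lambda>m. \<Otimes>j\<in>{..<m}. \<mu>s ! j"
    have pc: "?p m \<in> carrier R" if "m \<le> ?k" for m using R that by (intro finprod_closed) auto
    have \<nu>: "(t, ?\<nu> m) \<in> trees ?M n" if "m \<le> ?k" for m
      using that R S t len by (auto simp: trees_iff decorations_def nth_append)
    have step: "?T +>\<^bsub>?F\<^esub> ?e (?\<nu> m) = ?T +>\<^bsub>?F\<^esub> (?p m \<odot>\<^bsub>?F\<^esub> ?e (?\<nu> 0))" if "m \<le> ?k" for m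
      using that
    proof (induction m)
      case 0
      then show ?case using F.smult_one[of "?e (?\<nu> 0)"] \<nu>[of 0] by (simp del: free_module_simps)
    next
      case (Suc m)
      then have m: "m < ?k" by simp
      have c1: "?e (?\<nu> m) \<in> carrier ?F" "?e (?\<nu> (Suc m)) \<in> carrier ?F" "?e (?\<nu> 0) \<in> carrier ?F"
        using \<nu>[of m] \<nu>[OF Suc.prems] \<nu>[of 0] m by auto
      have "(?\<nu> m)[m := \<mu>s ! m] = ?\<nu> (Suc m)" "(?\<nu> m)[m := \<one>] = ?\<nu> m"
        using m len by (auto simp: list_eq_iff_nth_eq nth_list_update nth_append less_Suc_eq)
      moreover have "?e ((?\<nu> m)[m := \<mu>s ! m \<odot>\<^bsub>?M (count_list t m + 1)\<^esub> \<one>]) \<ominus>\<^bsub>?F\<^esub> \<mu>s ! m \<odot>\<^bsub>?F\<^esub> ?e ((?\<nu> m)[m := \<one>]) \<in> ?T"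
        using m R S by (intro subsetD[OF multilinear_rels_subset] multilinear_rels_smultI \<nu>) auto
      ultimately have "?e (?\<nu> (Suc m)) \<ominus>\<^bsub>?F\<^esub> \<mu>s ! m \<odot>\<^bsub>?F\<^esub> ?e (?\<nu> m) \<in> ?T"
        using R[OF m] by simp
      then have "?T +>\<^bsub>?F\<^esub> ?e (?\<nu> (Suc m)) = ?T +>\<^bsub>?F\<^esub> (\<mu>s ! m \<odot>\<^bsub>?F\<^esub> ?e (?\<nu> m))"
        using F.coset_eq_iff[OF T c1(2) F.smult_closed[OF R[OF m] c1(1)]] by blast
      also have "\<dots> = ?T <+>\<^bsub>?F\<^esub> (\<lambda>x. \<mu>s ! m \<odot>\<^bsub>?F\<^esub> x) ` (?T +>\<^bsub>?F\<^esub> ?e (?\<nu> m))"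
        using F.smult_coset[OF T R[OF m] c1(1)] by simp
      also have "?T +>\<^bsub>?F\<^esub> ?e (?\<nu> m) = ?T +>\<^bsub>?F\<^esub> (?p m \<odot>\<^bsub>?F\<^esub> ?e (?\<nu> 0))"
        using Suc m by simp
      also have "?T <+>\<^bsub>?F\<^esub> (\<lambda>x. \<mu>s ! m \<odot>\<^bsub>?F\<^esub> x) ` \<dots> = ?T +>\<^bsub>?F\<^esub> (\<mu>s ! m \<odot>\<^bsub>?F\<^esub> (?p m \<odot>\<^bsub>?F\<^esub> ?e (?\<nu> 0)))"
        by (rule F.smult_coset[OF T R[OF m] F.smult_closed[OF pc c1(3)]]) (use m in simp)
      also have "\<mu>s ! m \<odot>\<^bsub>?F\<^esub> (?p m \<odot>\<^bsub>?F\<^esub> ?e (?\<nu> 0)) = (\<mu>s ! m \<otimes> ?p m) \<odot>\<^bsub>?F\<^esub> ?e (?\<nu> 0)"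
        using F.smult_assoc1[OF R[OF m] pc c1(3), of m] m by simp
      also have "\<mu>s ! m \<otimes> ?p m = ?p (Suc m)"
        using R m by (simp add: lessThan_Suc Pi_iff)
      finally show ?case .
    qed
    have "tree_val R S (t, \<mu>s) = ?p ?k \<odot>\<^bsub>free_module R (sur_lists S n)\<^esub> basis_elem R t"
      using True t pc[of ?k] by (auto simp: tree_val_def basis_elem_def fun_eq_iff)
    then have "tree_section S n (tree_val R S (t, \<mu>s)) = ?p ?k \<odot>\<^bsub>?F\<^esub> ?e (?\<nu> 0)"
      using s.f_smult[OF pc[of ?k] basis_elem_closed[OF True]] tree_section_basis[OF True] by simp
    moreover have "?e \<mu>s \<ominus>\<^bsub>?F\<^esub> ?p ?k \<odot>\<^bsub>?F\<^esub> ?e (?\<nu> 0) \<in> ?T"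
    proof -
      have "?T +>\<^bsub>?F\<^esub> ?e \<mu>s = ?T +>\<^bsub>?F\<^esub> (?p ?k \<odot>\<^bsub>?F\<^esub> ?e (?\<nu> 0))"
        using step[of ?k] len by simp
      moreover have "?p ?k \<odot>\<^bsub>?F\<^esub> ?e (?\<nu> 0) \<in> carrier ?F"
        using \<nu>[of 0] by (intro F.smult_closed pc) auto
      ultimately show ?thesis
        using F.coset_eq_iff[OF T basis_elem_closed[OF z]] by blast
    qed
    ultimately show ?thesis by simp
  qed
qed

text \<open>The difference between an element and the normal form with the same coordinates depends
  linearly on the element and lies in the relations for single trees, hence always. For an element
  of the kernel that normal form is zero.\<close>

lemma tensor_rel_kernel:
  "tensor_rel R (one_gens R S) n = {f \<in> carrier (free_module R (trees (one_gens R S) n)).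
      tree_coord R S n f = \<zero>\<^bsub>free_module R (sur_lists S n)\<^esub>}" (is "?T = ?K")
proof
  let ?F = "free_module R (trees (one_gens R S) n)"
  interpret c: linear R ?F "free_module R (sur_lists S n)" "tree_coord R S n" by (rule tree_coord_linear)
  interpret s: linear R "free_module R (sur_lists S n)" ?F "tree_section S n" by (rule tree_section_linear)
  show "?T \<subseteq> ?K"
    unfolding tensor_rel_def
    by (rule c.M.gen_submodule(3)[OF _ c.kernel_submodule multilinear_rels_closed])
      (use multilinear_rels_closed in blast)
  show "?K \<subseteq> ?T"
  proof
    let ?h = "\<lambda>f. f \<ominus>\<^bsub>?F\<^esub> tree_section S n (tree_coord R S n f)"
    have "linear_map R ?F ?F ?h"
      unfolding linear_map_def
    proof (intro conjI ballI funcsetI)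
      fix f assume f: "f \<in> carrier ?F"
      show "?h f \<in> carrier ?F" using f by (simp del: free_module_simps)
      show "?h (a \<odot>\<^bsub>?F\<^esub> f) = a \<odot>\<^bsub>?F\<^esub> ?h f" if "a \<in> carrier R" for a
        using f that by (simp add: a_minus_def c.f_smult s.f_smult c.M.smult_r_distr c.M.smult_r_minus del: free_module_simps)
      show "?h (f \<oplus>\<^bsub>?F\<^esub> g) = ?h f \<oplus>\<^bsub>?F\<^esub> ?h g" if "g \<in> carrier ?F" for g
        using f that by (simp add: a_minus_def c.f_add s.f_add c.M.M.minus_add c.M.M.a_ac del: free_module_simps)
    qed
    then interpret h: linear R ?F ?F ?h by (intro linearI free_module)
    fix f assume f: "f \<in> ?K"
    then have fc: "f \<in> carrier ?F" by simp
    have "f \<in> {f \<in> carrier ?F. ?h f \<in> ?T}"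
    proof (rule free_module_span[OF h.submodule_preimage[OF tensor_rel_submodule]])
      show "f \<in> carrier ?F" by (rule fc)
      fix z assume "f z \<noteq> \<zero>"
      then have "z \<in> trees (one_gens R S) n" by (rule free_module_support[OF fc])
      then show "basis_elem R z \<in> {f \<in> carrier ?F. ?h f \<in> ?T}"
        using basis_normal_form[of "fst z" "snd z" S n] by (simp add: tree_coord_basis)
    qed
    then have "?h f \<in> ?T" by simp
    moreover have "tree_section S n (tree_coord R S n f) = \<zero>\<^bsub>?F\<^esub>"
      using f s.f_zero by (simp del: free_module_simps)
    moreover have "f \<ominus>\<^bsub>?F\<^esub> \<zero>\<^bsub>?F\<^esub> = f"
      by (rule c.M.M.diff_zero[OF fc])
    ultimately show "f \<in> ?T" by metis
  qed
qed

lemma tree_coord_surj: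
  "tree_coord R S n ` carrier (free_module R (trees (one_gens R S) n)) = carrier (free_module R (sur_lists S n))"
proof -
  interpret c: linear R "free_module R (trees (one_gens R S) n)" "free_module R (sur_lists S n)" "tree_coord R S n"
    by (rule tree_coord_linear)
  interpret s: linear R "free_module R (sur_lists S n)" "free_module R (trees (one_gens R S) n)" "tree_section S n"
    by (rule tree_section_linear)
  show ?thesis
  proof (intro equalityI subsetI)
    fix g assume "g \<in> carrier (free_module R (sur_lists S n))"
    then show "g \<in> tree_coord R S n ` carrier (free_module R (trees (one_gens R S) n))"
      using tree_coord_section[of g S n] s.closed[of g] by (metis imageI)
  qed auto
qed

lemmas tree_fibre_iso =
  linear.fibre_iso[OF tree_coord_linear tensor_rel_kernel tree_coord_surj,
    folded tensor_sum_def tree_fibre_def]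

lemma tree_fibre_coset:
  "f \<in> carrier (free_module R (trees (one_gens R S) n)) \<Longrightarrow>
    tree_fibre R S n (tree_coord R S n f)
      = tensor_rel R (one_gens R S) n +>\<^bsub>free_module R (trees (one_gens R S) n)\<^esub> f"
  unfolding tree_fibre_def by (rule linear.fibre_coset[OF tree_coord_linear tensor_rel_kernel])

lemma tree_class_fibre:
  assumes "(t, \<mu>s) \<in> trees (one_gens R S) (length t)"
  shows "tree_class R (one_gens R S) t \<mu>s = tree_fibre R S (length t) (tree_val R S (t, \<mu>s))"
  using tree_fibre_coset[OF basis_elem_closed[OF assms]] assms
  by (simp add: tree_class_def tree_coord_basis)

end

section \<open>Composition and identity of the free permutad in coordinates\<close>

lemma free_permutad_simps [simp]:
  "ar (free_permutad R M) n = tensor_sum R M (n - 1)"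
  "ident (free_permutad R M) = tree_class R M [] []"
  "Gam (free_permutad R M) t Xs = tensor_rel R M (length t) <+>\<^bsub>free_module R (trees M (length t))\<^esub>
              subst_ext R M t ` {fs. list_all2 (\<in>) fs Xs}"
  by (simp_all add: free_permutad_def)

context cring
begin

text \<open>The pieces of a composite are determined by it (\<open>restr_sur_subst\<close>), so both
  sides vanish unless the surjections agree. If they agree, the product over the flattened
  decorations is regrouped by outer vertices.\<close>

lemma tree_val_sur_subst:
  assumes t: "surj_list t" "admissible t us"
    and len: "length zs = blocks t" and zs: "\<And>j. j < blocks t \<Longrightarrow> zs ! j \<in> trees (one_gens R S) (count_list t j)"
  shows "tree_val R S (sur_subst t (map fst zs), concat (map snd zs)) (sur_subst t us)
    = (\<Otimes>j\<in>{..<blocks t}. tree_val R S (zs ! j) (us ! j))"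
proof -
  let ?ts = "map fst zs" and ?\<mu> = "map snd zs"
  have z: "surj_list (?ts ! j)" "length (?ts ! j) = count_list t j" "length (?\<mu> ! j) = blocks (?ts ! j)"
    if "j < blocks t" for j
    using zs[OF that] trees_iff[of "fst (zs ! j)" "snd (zs ! j)" "one_gens R S" "count_list t j"] that len
    by (auto simp: decorations_def)
  have R: "?\<mu> ! j ! v \<in> carrier R" if "j < blocks t" "v < blocks (?ts ! j)" for j v
    using zs[OF that(1)] trees_iff[of "fst (zs ! j)" "snd (zs ! j)" "one_gens R S" "count_list t j"] that len
      decorations_in_ring[of "snd (zs ! j)" S "fst (zs ! j)" v] by auto
  have adm: "admissible t ?ts" using z len by (simp add: admissible_def)
  have val: "tree_val R S (zs ! j) u \<in> carrier R" if "j < blocks t" for j u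
    using tree_val_closed_R[of "fst (zs ! j)" "snd (zs ! j)" S] zs[OF that] by simp
  show ?thesis
  proof (cases "?ts = us")
    case False
    have "\<exists>j<blocks t. ?ts ! j \<noteq> us ! j"
      using False t(2) len by (metis (no_types, lifting) admissible_def length_map nth_equalityI)
    then obtain j where j: "j < blocks t" "fst (zs ! j) \<noteq> us ! j" using len by auto
    have "sur_subst t ?ts \<noteq> sur_subst t us"
      using j restr_sur_subst[OF t(1) adm j(1)] restr_sur_subst[OF t j(1)] len by auto
    moreover have "(\<Otimes>j\<in>{..<blocks t}. tree_val R S (zs ! j) (us ! j)) = \<zero>"
      using j val by (intro finprod_zero[of j]) (auto simp: tree_val_def)
    ultimately show ?thesis by (auto simp: tree_val_def)
  next
    case True
    have us: "us ! j = fst (zs ! j)" if "j < blocks t" for j using True that len by auto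
    show ?thesis
    proof (cases "sur_subst t us \<in> sur_lists S (length t)")
      case False
      then obtain j where j: "j < blocks t" "us ! j \<notin> sur_lists S (count_list t j)"
        using sur_lists_sur_subst[OF t] by auto
      have "length (us ! j) = count_list t j" using t(2) j(1) by (simp add: admissible_def)
      then have "(\<Otimes>j\<in>{..<blocks t}. tree_val R S (zs ! j) (us ! j)) = \<zero>"
        using j val by (intro finprod_zero[of j]) (auto simp: tree_val_def)
      then show ?thesis using False by (auto simp: tree_val_def)
    next
      case S: True
      have usS: "us ! j \<in> sur_lists S (length (us ! j))" if "j < blocks t" for j
        using S sur_lists_sur_subst[OF t] t(2) that by (simp add: admissible_def)
      have fac: "tree_val R S (zs ! j) (us ! j) = (\<Otimes>v\<in>{..<blocks (?ts ! j)}. ?\<mu> ! j ! v)" if "j < blocks t" for j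
        using usS[OF that] us[OF that] that len by (simp add: tree_val_def)
      have ci: "concat ?\<mu> ! (offset ?ts j + v) = ?\<mu> ! j ! v" if "j < blocks t" "v < blocks (?ts ! j)" for j v
        using z len that by (intro concat_index) auto
      have b: "blocks (sur_subst t us) = offset ?ts (blocks t)"
        using surj_sur_subst(2)[OF t] True by simp
      have "concat ?\<mu> ! w \<in> carrier R" if w: "w < offset ?ts (blocks t)" for w
      proof -
        obtain j v where "j < blocks t" "v < blocks (?ts ! j)" "w = offset ?ts j + v"
          using offset_decomp w by metis
        then show ?thesis using ci R by simp
      qed
      then have "(\<Otimes>w\<in>{..<offset ?ts (blocks t)}. concat ?\<mu> ! w)
          = (\<Otimes>j\<in>{..<blocks t}. \<Otimes>v\<in>{..<blocks (?ts ! j)}. concat ?\<mu> ! (offset ?ts j + v))"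
        by (intro finprod_offset) auto
      also have "\<dots> = (\<Otimes>j\<in>{..<blocks t}. tree_val R S (zs ! j) (us ! j))"
      proof (rule finprod_cong')
        show "(\<lambda>j. tree_val R S (zs ! j) (us ! j)) \<in> {..<blocks t} \<rightarrow> carrier R" using val by auto
        fix j assume "j \<in> {..<blocks t}"
        then have j: "j < blocks t" by simp
        show "(\<Otimes>v\<in>{..<blocks (?ts ! j)}. concat ?\<mu> ! (offset ?ts j + v)) = tree_val R S (zs ! j) (us ! j)"
          unfolding fac[OF j] using ci[OF j] R[OF j] by (intro finprod_cong') auto
      qed simp
      finally show ?thesis
        using S True b by (simp add: tree_val_def)
    qed
  qed
qed

text \<open>In coordinates the sum over all choices of trees becomes a product of sums by
  \<open>finprod_finsum_lists\<close>, and each of these sums is a coordinate of one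
  argument.\<close>

lemma subst_ext_fibre:
  assumes t: "surj_list t" and gs: "gs \<in> decorations (ar (comb R S)) t"
    and len: "length fs = blocks t" and fs: "\<And>j. j < blocks t \<Longrightarrow> fs ! j \<in> tree_fibre R S (count_list t j) (gs ! j)"
  shows "subst_ext R (one_gens R S) t fs \<in> tree_fibre R S (length t) (comb_Gam R t gs)"
proof -
  let ?M = "one_gens R S" and ?k = "blocks t"
  let ?F = "free_module R (trees ?M (length t))" and ?N = "free_module R (sur_lists S (length t))"
  interpret c: linear R ?F ?N "tree_coord R S (length t)" by (rule tree_coord_linear)
  let ?A = "{zs. length zs = ?k \<and> (\<forall>j<?k. zs ! j \<in> {z. (fs ! j) z \<noteq> \<zero>})}"
  let ?v = "\<lambda>zs. (sur_subst t (map fst zs), concat (map snd zs))"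
  let ?c = "\<lambda>zs. \<Otimes>j\<in>{..<?k}. (fs ! j) (zs ! j)"
  have fc: "fs ! j \<in> carrier (free_module R (trees ?M (count_list t j)))" and
    fg: "tree_coord R S (count_list t j) (fs ! j) = gs ! j" if "j < ?k" for j
    using fs[OF that] by (auto simp: tree_fibre_def)
  have R: "(fs ! j) z \<in> carrier R" if "j < ?k" for j z using fc[OF that] by auto
  have fin: "finite {z. (fs ! j) z \<noteq> \<zero>}" if "j < ?k" for j
    using fc[OF that] unfolding free_module_carrier by blast
  have A: "finite ?A" using fin by (rule finite_lists_nth)
  have tr: "zs ! j \<in> trees ?M (count_list t j)" if "zs \<in> ?A" "j < ?k" for zs j
    using that free_module_support[OF fc[OF that(2)]] by blast
  have val: "tree_val R S z u \<in> carrier R" if "(fs ! j) z \<noteq> \<zero>" "j < ?k" for j z u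
    using tree_val_closed_R[of "fst z" "snd z" S] free_module_support[OF fc[OF that(2)] that(1)] by simp
  have adm: "admissible t (map fst zs)" if "zs \<in> ?A" for zs
    using tr[OF that] that trees_iff[of "fst (zs ! j)" "snd (zs ! j)" ?M "count_list t j" for j]
    by (simp add: admissible_def)
  have v: "?v zs \<in> trees ?M (length t)" if "zs \<in> ?A" for zs
  proof -
    have "map snd zs ! j \<in> decorations ?M (map fst zs ! j)" if "j < ?k" for j
      using tr[OF \<open>zs \<in> ?A\<close> that] \<open>zs \<in> ?A\<close> that
        trees_iff[of "fst (zs ! j)" "snd (zs ! j)" ?M "count_list t j"] by simp
    then have "concat (map snd zs) \<in> decorations ?M (sur_subst t (map fst zs))"
      using that by (intro decorations_concat[OF t adm[OF that]]) auto
    then show ?thesis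
      using surj_sur_subst(1)[OF t adm[OF that]] by (simp add: trees_iff)
  qed
  have cc: "?c zs \<in> carrier R" for zs using R by (intro finprod_closed) auto
  have summand: "?c zs \<odot>\<^bsub>?F\<^esub> basis_elem R (?v zs) \<in> carrier ?F" if "zs \<in> ?A" for zs
    using v[OF that] cc by (intro c.M.smult_closed basis_elem_closed)
  have se: "subst_ext R ?M t fs = (\<Oplus>\<^bsub>?F\<^esub>zs\<in>?A. ?c zs \<odot>\<^bsub>?F\<^esub> basis_elem R (?v zs))"
    unfolding subst_ext_def Let_def len by simp
  have "tree_coord R S (length t) (subst_ext R ?M t fs) = (\<Oplus>\<^bsub>?N\<^esub>zs\<in>?A. ?c zs \<odot>\<^bsub>?N\<^esub> tree_val R S (?v zs))"
    unfolding se
  proof (subst c.f_finsum)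
    show "(\<lambda>zs. ?c zs \<odot>\<^bsub>?F\<^esub> basis_elem R (?v zs)) \<in> ?A \<rightarrow> carrier ?F" using summand by blast
    show "(\<Oplus>\<^bsub>?N\<^esub>zs\<in>?A. tree_coord R S (length t) (?c zs \<odot>\<^bsub>?F\<^esub> basis_elem R (?v zs)))
        = (\<Oplus>\<^bsub>?N\<^esub>zs\<in>?A. ?c zs \<odot>\<^bsub>?N\<^esub> tree_val R S (?v zs))"
    proof (rule c.N.finsum_cong')
      show "(\<lambda>zs. ?c zs \<odot>\<^bsub>?N\<^esub> tree_val R S (?v zs)) \<in> ?A \<rightarrow> carrier ?N"
        using v cc by (intro funcsetI c.N.smult_closed tree_val_closed)
      show "tree_coord R S (length t) (?c zs \<odot>\<^bsub>?F\<^esub> basis_elem R (?v zs)) = ?c zs \<odot>\<^bsub>?N\<^esub> tree_val R S (?v zs)"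
        if "zs \<in> ?A" for zs
        using c.f_smult[OF cc basis_elem_closed[OF v[OF that]]] tree_coord_basis[OF v[OF that]] by simp
    qed simp
  qed
  also have "\<dots> = comb_Gam R t gs"
  proof
    fix s
    have "(\<lambda>zs. ?c zs \<odot>\<^bsub>?N\<^esub> tree_val R S (?v zs)) \<in> ?A \<rightarrow> carrier ?N"
      using v cc by (intro funcsetI c.N.smult_closed tree_val_closed)
    from free_module_finsum[OF this, of s]
    have eval: "(\<Oplus>\<^bsub>?N\<^esub>zs\<in>?A. ?c zs \<odot>\<^bsub>?N\<^esub> tree_val R S (?v zs)) s
        = (\<Oplus>zs\<in>?A. ?c zs \<otimes> tree_val R S (?v zs) s)" by simp
    show "(\<Oplus>\<^bsub>?N\<^esub>zs\<in>?A. ?c zs \<odot>\<^bsub>?N\<^esub> tree_val R S (?v zs)) s = comb_Gam R t gs s"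
      using t
    proof (cases rule: comb_Gam_cases[where s = s])
      case other
      have "?c zs \<otimes> tree_val R S (?v zs) s = \<zero>" if "zs \<in> ?A" for zs
      proof -
        have "s \<noteq> sur_subst t (map fst zs)"
          using other(1) surj_sur_subst(1)[OF t adm[OF that]] coarser_sur_subst[OF t adm[OF that]] by auto
        then show ?thesis using cc by (simp add: tree_val_def)
      qed
      then show ?thesis unfolding eval using other(2) by (intro trans[OF add.finprod_one_eqI]) auto
    next
      case (decomposed us)
      let ?h = "\<lambda>j z. (fs ! j) z \<otimes> tree_val R S z (us ! j)"
      have hc: "?h j (zs ! j) \<in> carrier R" if "zs \<in> ?A" "j < ?k" for zs j
        using R[OF that(2)] val[of j "zs ! j"] that by blast
      have "(\<Oplus>zs\<in>?A. ?c zs \<otimes> tree_val R S (?v zs) s) = (\<Oplus>zs\<in>?A. \<Otimes>j\<in>{..<?k}. ?h j (zs ! j))"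
      proof (rule finsum_cong')
        show "(\<lambda>zs. \<Otimes>j\<in>{..<?k}. ?h j (zs ! j)) \<in> ?A \<rightarrow> carrier R"
          using hc by (intro funcsetI finprod_closed) blast
        fix zs assume zs: "zs \<in> ?A"
        have "tree_val R S (?v zs) s = (\<Otimes>j\<in>{..<?k}. tree_val R S (zs ! j) (us ! j))"
          unfolding decomposed(2) using tr[OF zs] zs by (intro tree_val_sur_subst[OF t decomposed(1)]) auto
        moreover have "(\<lambda>j. (fs ! j) (zs ! j)) \<in> {..<?k} \<rightarrow> carrier R"
          "(\<lambda>j. tree_val R S (zs ! j) (us ! j)) \<in> {..<?k} \<rightarrow> carrier R"
          using R val zs by blast+
        ultimately show "?c zs \<otimes> tree_val R S (?v zs) s = (\<Otimes>j\<in>{..<?k}. ?h j (zs ! j))"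
          by (simp only: finprod_multf)
      qed simp
      also have "\<dots> = (\<Otimes>j\<in>{..<?k}. \<Oplus>z\<in>{z. (fs ! j) z \<noteq> \<zero>}. ?h j z)"
        using fin R val by (intro finprod_finsum_lists[symmetric]) auto
      also have "\<dots> = (\<Otimes>j\<in>{..<?k}. (gs ! j) (us ! j))"
      proof (rule finprod_cong')
        show "(\<lambda>j. (gs ! j) (us ! j)) \<in> {..<?k} \<rightarrow> carrier R" using gs by (auto simp: decorations_def)
        show "(\<Oplus>z\<in>{z. (fs ! j) z \<noteq> \<zero>}. ?h j z) = (gs ! j) (us ! j)" if "j \<in> {..<?k}" for j
          using that tree_coord_eval[OF fc, of j "us ! j"] fg[of j] by simp
      qed simp
      also have "\<dots> = comb_Gam R t gs s"
        unfolding decomposed(2) using gs decomposed(1) t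
        by (subst comb_Gam_sur_subst) (auto simp: decorations_def)
      finally show ?thesis unfolding eval .
    qed
  qed
  finally have "tree_coord R S (length t) (subst_ext R ?M t fs) = comb_Gam R t gs" .
  moreover have "subst_ext R ?M t fs \<in> carrier ?F"
    unfolding se using summand by (intro c.M.finsum_closed) blast
  ultimately show ?thesis by (simp add: tree_fibre_def)
qed

text \<open>The composites of all representatives lie in one fibre, so \<open>set_add_coset\<close>
  applies. The section provides representatives and thereby shows that there are such composites at
  all.\<close>

lemma free_Gam_fibre:
  assumes t: "surj_list t" and gs: "gs \<in> decorations (ar (comb R S)) t"
  shows "Gam (free_permutad R (one_gens R S)) t (map (\<lambda>j. tree_fibre R S (count_list t j) (gs ! j)) [0..<blocks t])
    = tree_fibre R S (length t) (comb_Gam R t gs)"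
proof -
  let ?M = "one_gens R S" and ?Xs = "map (\<lambda>j. tree_fibre R S (count_list t j) (gs ! j)) [0..<blocks t]"
  let ?F = "free_module R (trees ?M (length t))" and ?A = "{fs. list_all2 (\<in>) fs ?Xs}"
  interpret F: module R ?F by (rule free_module)
  have fs: "subst_ext R ?M t fs \<in> tree_fibre R S (length t) (comb_Gam R t gs)" if "fs \<in> ?A" for fs
    using that by (intro subst_ext_fibre[OF t gs]) (auto simp: list_all2_conv_all_nth)
  have gc: "gs ! j \<in> carrier (free_module R (sur_lists S (count_list t j)))" if "j < blocks t" for j
    using gs that unfolding decorations_comb_iff by blast
  have "tree_section S (count_list t j) (gs ! j) \<in> tree_fibre R S (count_list t j) (gs ! j)" if "j < blocks t" for j
    using tree_coord_section[OF gc[OF that]] linear.closed[OF tree_section_linear gc[OF that]]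
    by (simp add: tree_fibre_def)
  then have "map (\<lambda>j. tree_section S (count_list t j) (gs ! j)) [0..<blocks t] \<in> ?A"
    by (auto simp: list_all2_conv_all_nth)
  then obtain fs where fs0: "fs \<in> ?A" by blast
  let ?f = "subst_ext R ?M t fs"
  have f: "?f \<in> carrier ?F" "tree_fibre R S (length t) (comb_Gam R t gs) = tensor_rel R ?M (length t) +>\<^bsub>?F\<^esub> ?f"
    using fs[OF fs0] tree_fibre_coset[of ?f S "length t"] by (auto simp: tree_fibre_def)
  have "tensor_rel R ?M (length t) <+>\<^bsub>?F\<^esub> subst_ext R ?M t ` ?A = tensor_rel R ?M (length t) +>\<^bsub>?F\<^esub> ?f"
    using fs fs0 f(2) by (intro F.set_add_coset[OF tensor_rel_submodule f(1)]) auto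
  then show ?thesis using f(2) by simp
qed

lemma free_ident_fibre: "ident (free_permutad R (one_gens R S)) = tree_fibre R S 0 (basis_elem R [])"
proof -
  have tr: "([], []) \<in> trees (one_gens R S) 0"
    by (simp add: trees_iff surj_list_def blocks_def decorations_def)
  have "tree_val R S ([], []) = basis_elem R []"
    by (auto simp: fun_eq_iff tree_val_def basis_elem_def sur_lists_0 blocks_def)
  then show ?thesis using tree_class_fibre[of "[]" "[]" S] tr by simp
qed

text \<open>The fibre map transports the structure of \<open>comb R S\<close>, so the axioms of the
  free permutad are never verified on cosets.\<close>

proposition free_permutad_comb:
  shows "permutad R (free_permutad R (one_gens R S))"
    and "permutad_iso R (comb R S) (free_permutad R (one_gens R S)) (\<lambda>n. tree_fibre R S (n - 1))"
proof -
  let ?P = "free_permutad R (one_gens R S)" and ?\<phi> = "\<lambda>n. tree_fibre R S (n - 1)"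
  have Gam: "?\<phi> (n + 1) (Gam (comb R S) t \<mu>s) = Gam ?P t (map (\<lambda>j. ?\<phi> (count_list t j + 1) (\<mu>s ! j)) [0..<k])"
    if "t \<in> Sur n k" "\<mu>s \<in> decorations (ar (comb R S)) t" for n t k \<mu>s
    using free_Gam_fibre[OF _ that(2)] that(1) by (simp add: Sur_iff del: free_permutad_simps(3))
  have inj: "inj_on (?\<phi> n) (carrier (ar (comb R S) n))" for n
    using tree_fibre_iso(5)[of S "n - 1"] by simp
  have car: "carrier (ar ?P n) = ?\<phi> n ` carrier (ar (comb R S) n)"
    and zero: "?\<phi> n \<zero>\<^bsub>ar (comb R S) n\<^esub> = \<zero>\<^bsub>ar ?P n\<^esub>" for n
    using tree_fibre_iso(1,2)[of S "n - 1"] by simp_all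
  have add: "?\<phi> n (x \<oplus>\<^bsub>ar (comb R S) n\<^esub> y) = ?\<phi> n x \<oplus>\<^bsub>ar ?P n\<^esub> ?\<phi> n y"
    if "x \<in> carrier (ar (comb R S) n)" "y \<in> carrier (ar (comb R S) n)" for n x y
    using tree_fibre_iso(3)[of x S "n - 1" y] that by simp
  have smult: "?\<phi> n (c \<odot>\<^bsub>ar (comb R S) n\<^esub> x) = c \<odot>\<^bsub>ar ?P n\<^esub> ?\<phi> n x"
    if "c \<in> carrier R" "x \<in> carrier (ar (comb R S) n)" for n c x
    using tree_fibre_iso(4)[of c x S "n - 1"] that by simp
  have ident: "?\<phi> 1 (ident (comb R S)) = ident ?P"
    using free_ident_fibre[of S] by simp
  note hom = permutad_comb[of S] car zero add smult ident inj Gam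
  show "permutad R ?P"
    by (rule permutad_image[where P = "comb R S" and \<phi> = ?\<phi>]; rule hom; assumption)
  have "permutad_hom R (comb R S) ?P ?\<phi>"
    by (rule permutad_hom_image; rule hom; assumption)
  then show "permutad_iso R (comb R S) ?P ?\<phi>"
    unfolding permutad_iso_def using inj car by (simp add: bij_betw_def)
qed

end

section \<open>The differential and grading of \<open>permAs_inf R\<close> in coordinates\<close>

lemma count_list_ge_1: "surj_list t \<Longrightarrow> j < blocks t \<Longrightarrow> count_list t j \<ge> 1"
  using count_list_pos[of j t] by (simp add: surj_list_def)

text \<open>The cycle moves the place \<open>p\<close> past the next \<open>q\<close> places, and is
  thus a product of \<open>q\<close> adjacent transpositions.\<close>

lemma rotation_sign:
  fixes p q :: nat
  defines "c \<equiv> \<lambda>q a. if a < p then a else if a = p then p + q else if a \<le> p + q then a - 1 else a"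
  shows "permutation (c q) \<and> sign (c q) = (- 1) ^ q"
proof (induction q)
  case 0
  have "c 0 = id" by (auto simp: c_def fun_eq_iff)
  then show ?case by simp
next
  case (Suc q)
  let ?t = "transpose (p + q) (Suc (p + q))"
  have eq: "c (Suc q) = ?t \<circ> c q"
    by (auto simp: c_def fun_eq_iff transpose_def)
  have "permutation (c (Suc q))"
    unfolding eq using Suc by (intro permutation_compose permutation_swap_id) blast
  moreover have "sign (c (Suc q)) = sign ?t * sign (c q)"
    unfolding eq using Suc by (intro sign_compose permutation_swap_id) blast
  ultimately show ?case
    using Suc by (simp add: sign_swap_id)
qed

text \<open>Appending a \<open>1\<close> leaves the shuffle unchanged. Appending a \<open>0\<close>
  lists the new position before the positions of all entries \<open>1\<close>; this is a rotation
  past as many places as there are new inversions.\<close>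

lemma shuffle_perm_sign:
  "set t \<subseteq> {0, 1} \<Longrightarrow> permutation (shuffle_perm t) \<and> sign (shuffle_perm t) = (- 1) ^ inversions 0 1 t"
proof (induction t rule: rev_induct)
  case Nil
  have "shuffle_perm [] = id" by (auto simp: shuffle_perm_def fun_eq_iff)
  then show ?case by (simp add: inversions_def)
next
  case (snoc x t)
  let ?n = "length t"
  let ?A = "filter (\<lambda>a. t ! a = 0) [0..<?n]" and ?B = "filter (\<lambda>a. t ! a = 1) [0..<?n]"
  have len: "length ?A + length ?B = ?n" "length ?B = length (filter ((=) 1) t)"
  proof -
    have fl: "length (filter (\<lambda>a. t ! a = v) [0..<?n]) = length (filter ((=) v) t)" for v
    proof -
      have "filter ((=) v) (map ((!) t) [0..<?n]) = map ((!) t) (filter ((=) v \<circ> (!) t) [0..<?n])"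
        by (rule filter_map)
      then have "length (filter ((=) v) t) = length (filter ((=) v \<circ> (!) t) [0..<?n])"
        unfolding map_nth by simp
      also have "(=) v \<circ> (!) t = (\<lambda>a. t ! a = v)" by auto
      finally show ?thesis by simp
    qed
    show "length ?B = length (filter ((=) 1) t)" by (rule fl)
    have "length (filter ((=) 0) u) + length (filter ((=) 1) u) = length u" if "set u \<subseteq> {0, 1}" for u :: "nat list"
      using that by (induction u) auto
    from this[of t] have "length (filter ((=) 0) t) + length (filter ((=) 1) t) = length t"
      using snoc.prems by simp
    then show "length ?A + length ?B = ?n" unfolding fl .
  qed
  have filt: "filter (\<lambda>a. (t @ [x]) ! a = v) [0..<length (t @ [x])]
      = filter (\<lambda>a. t ! a = v) [0..<?n] @ (if x = v then [?n] else [])" for v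
    by (auto simp: nth_append intro!: filter_cong)
  have IH: "permutation (shuffle_perm t)" "sign (shuffle_perm t) = (- 1) ^ inversions 0 1 t"
    using snoc by auto
  show ?case
  proof (cases "x = 1")
    case True
    have "shuffle_perm (t @ [x]) = shuffle_perm t"
      unfolding shuffle_perm_def Let_def filt using True len(1)
      by (auto simp: fun_eq_iff nth_append less_Suc_eq)
    moreover have "inversions 0 1 (t @ [x]) = inversions 0 1 t"
      using True by (simp add: inversions_def icount_append)
    ultimately show ?thesis using IH by simp
  next
    case False
    then have x: "x = 0" using snoc.prems by auto
    let ?p = "length ?A" and ?q = "length ?B"
    let ?c = "\<lambda>a. if a < ?p then a else if a = ?p then ?p + ?q else if a \<le> ?p + ?q then a - 1 else a"
    define c where "c = ?c"
    have c: "permutation c" "sign c = (- 1) ^ ?q"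
      unfolding c_def using rotation_sign[of ?p ?q] by blast+
    have eq: "shuffle_perm (t @ [x]) = shuffle_perm t \<circ> c"
      unfolding c_def
    proof
      fix a
      have L: "shuffle_perm (t @ [x]) a = (if a < Suc ?n then (?A @ [?n] @ ?B) ! a else a)"
        unfolding shuffle_perm_def Let_def filt using x by simp
      have R: "shuffle_perm t b = (if b < ?n then (?A @ ?B) ! b else b)" for b
        by (simp add: shuffle_perm_def Let_def)
      consider "a < ?p" | "a = ?p" | "?p < a" "a \<le> ?p + ?q" | "?p + ?q < a" by linarith
      then show "shuffle_perm (t @ [x]) a = (shuffle_perm t \<circ> ?c) a"
        unfolding L comp_apply R using len(1) by cases (auto simp: nth_append)
    qed
    have "inversions 0 1 (t @ [x]) = inversions 0 1 t + ?q"
      using x len(2) by (simp add: inversions_def icount_append)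
    moreover have "permutation (shuffle_perm (t @ [x]))"
      unfolding eq by (rule permutation_compose[OF IH(1) c(1)])
    moreover have "sign (shuffle_perm (t @ [x])) = sign (shuffle_perm t) * sign c"
      unfolding eq by (rule sign_compose[OF IH(1) c(1)])
    ultimately show ?thesis
      using IH(2) c(2) by (simp add: power_add)
  qed
qed

text \<open>For two blocks the sum in \<open>dexp t 0\<close> is empty, and what remains are the two
  exponents of \<open>sur_sgn\<close>. This ties \<open>comb_dif\<close> to the prescribed
  differential of the generators.\<close>

lemma sur_sgn_neg1_pow:
  assumes "t \<in> Sur n 2"
  shows "sur_sgn t = neg1_pow (int (dexp t 0))"
proof -
  have "{..<2} = {0, 1 :: nat}" by auto
  then have "set t \<subseteq> {0, 1}" using assms by (simp add: Sur_def)
  then have "sur_sgn t = (- 1) ^ (inversions 0 1 t + count_list t 0)"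
    by (simp add: sur_sgn_def shuffle_perm_sign power_add)
  also have "inversions 0 1 t + count_list t 0 = dexp t 0"
    by (simp add: dexp_def)
  finally show ?thesis by (simp add: neg1_pow_def)
qed

lemma linear_map_compose:
  "linear_map R A B f \<Longrightarrow> linear_map R B C g \<Longrightarrow> linear_map R A C (\<lambda>x. g (f x))"
  by (auto simp: linear_map_def Pi_iff)

context cring
begin

lemma tensor_sum_module: "module R (tensor_sum R (one_gens R S) n)"
  unfolding tensor_sum_def by (rule module.quot_module[OF free_module tensor_rel_submodule])

lemma tree_fibre_linear:
  "linear R (free_module R (sur_lists S n)) (tensor_sum R (one_gens R S) n) (tree_fibre R S n)"
proof (rule linearI[OF free_module tensor_sum_module])
  show "linear_map R (free_module R (sur_lists S n)) (tensor_sum R (one_gens R S) n) (tree_fibre R S n)"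
    unfolding linear_map_def using tree_fibre_iso[where S = S and n = n] by (auto simp del: free_module_simps)
qed

text \<open>Coordinates of the generator of arity \<open>c + 1\<close>, multiplied by the scalar
  \<open>a\<close>.\<close>

definition corolla_comb :: "nat \<Rightarrow> 'a \<Rightarrow> nat list \<Rightarrow> 'a"
  where "corolla_comb c a = (\<lambda>s. if s = corolla c then a else \<zero>)"

lemma corolla_comb_closed:
  assumes "c \<ge> 1" "a \<in> carrier R"
  shows "corolla_comb c a \<in> carrier (free_module R (sur_lists {2..} c))"
    and "comb_deg R c (int c - 1) (corolla_comb c a)"
  using surj_corolla[OF assms(1)] assms(2)
  by (auto simp: free_module_carrier corolla_comb_def sur_lists_all comb_deg_def)
    (simp add: corolla_def)

lemma corolla_tree:
  assumes "c \<ge> 1" "a \<in> carrier R"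
  shows "(corolla c, [a]) \<in> trees (one_gens R {2..}) (length (corolla c))"
  using surj_corolla[OF assms(1)] assms by (auto simp: trees_iff decorations_def count_list_corolla)

lemma tree_val_corolla:
  assumes "c \<ge> 1" "a \<in> carrier R"
  shows "tree_val R {2..} (corolla c, [a]) = corolla_comb c a"
  using surj_corolla[OF assms(1)] assms(2)
  by (auto simp: fun_eq_iff tree_val_def corolla_comb_def sur_lists_all lessThan_Suc)

lemma corolla_class_fibre:
  assumes "c \<ge> 1" "a \<in> carrier R"
  shows "tree_class R (one_gens R {2..}) (corolla c) [a] = tree_fibre R {2..} c (corolla_comb c a)"
  using tree_class_fibre[OF corolla_tree[OF assms]] tree_val_corolla[OF assms] by (simp add: corolla_def)

lemma blocks_eq_1_imp_corolla:
  assumes "surj_list s" "blocks s = 1"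
  shows "s = corolla (length s)"
proof -
  have "set s = {0}" using assms by (auto simp: surj_list_def)
  then show ?thesis by (simp add: corolla_def replicate_length_same)
qed

text \<open>The corolla is the only surjection on these points with a single block, and a merge has
  a single block exactly when it starts from two.\<close>

lemma comb_dif_corolla:
  assumes "c \<ge> 1" "a \<in> carrier R"
  shows "comb_dif R (corolla_comb c a) s = (if s \<in> Sur c 2 then parity R (dexp s 0) \<otimes> a else \<zero>)"
proof (cases "surj_list s")
  case True
  have m: "merge i s = corolla c \<longleftrightarrow> s \<in> Sur c 2" if i: "i < blocks s - 1" for i
  proof
    assume "merge i s = corolla c"
    then have "blocks s - 1 = 1" "length s = c"
      using True i surj_corolla[OF assms(1)] blocks_merge[of s i] length_merge[of i s] by (auto simp: corolla_def)
    then show "s \<in> Sur c 2" using True by (simp add: Sur_iff)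
  next
    assume "s \<in> Sur c 2"
    then have "blocks (merge i s) = 1" "length s = c" using True i by (auto simp: Sur_iff blocks_merge)
    then show "merge i s = corolla c"
      using blocks_eq_1_imp_corolla[of "merge i s"] surj_merge[OF True, of i] i by simp
  qed
  show ?thesis
  proof (cases "s \<in> Sur c 2")
    case S: True
    then have "blocks s - 1 = 1" by (simp add: Sur_iff)
    then show ?thesis
      using True S m[of 0] assms(2) by (simp add: comb_dif_def corolla_comb_def lessThan_Suc)
  next
    case False
    then show ?thesis
      using m by (auto simp: comb_dif_def corolla_comb_def intro!: add.finprod_one_eqI)
  qed
qed (simp add: comb_dif_def Sur_iff)

lemma finite_Sur: "finite (Sur n k)"
  by (rule finite_subset[of _ "{s. set s \<subseteq> {..<k} \<and> length s = n}"]) (auto simp: Sur_def finite_lists_length_eq)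

lemma inf_dif_gen_fibre:
  assumes c: "c \<ge> 1" and a: "a \<in> carrier R"
  shows "inf_dif_gen R c a = tree_fibre R {2..} c (comb_dif R (corolla_comb c a))"
proof -
  let ?N = "free_module R (sur_lists {2..} c)" and ?A = "tensor_sum R (one_gens R {2..}) c"
  interpret l: linear R ?N ?A "tree_fibre R {2..} c" by (rule tree_fibre_linear)
  have sl: "t \<in> sur_lists {2..} c" if "t \<in> Sur c 2" for t
    using that by (simp add: Sur_iff sur_lists_all)
  have tc: "tree_class R (one_gens R {2..}) t [\<one>, \<one>] = tree_fibre R {2..} c (basis_elem R t)" if t: "t \<in> Sur c 2" for t
  proof -
    have len: "length t = c" "blocks t = 2" using t by (auto simp: Sur_iff)
    have tr: "(t, [\<one>, \<one>]) \<in> trees (one_gens R {2..}) c"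
      using ones_tree[OF sl[OF t]] len(2) by (simp add: numeral_2_eq_2)
    have "tree_val R {2..} (t, [\<one>, \<one>]) = basis_elem R t"
      using tree_val_ones[OF sl[OF t]] len(2) by (simp add: numeral_2_eq_2)
    then show ?thesis using tree_class_fibre[of t "[\<one>, \<one>]" "{2..}"] tr len(1) by simp
  qed
  let ?b = "\<lambda>t. parity R (dexp t 0) \<odot>\<^bsub>?N\<^esub> (a \<odot>\<^bsub>?N\<^esub> basis_elem R t)"
  have b: "?b t \<in> carrier ?N" if "t \<in> Sur c 2" for t
    using sl[OF that] a by (intro l.M.smult_closed basis_elem_closed) auto
  have summand: "[sur_sgn t] \<cdot>\<^bsub>?A\<^esub> (a \<odot>\<^bsub>?A\<^esub> tree_class R (one_gens R {2..}) t [\<one>, \<one>]) = tree_fibre R {2..} c (?b t)"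
    if t: "t \<in> Sur c 2" for t
  proof -
    have ab: "a \<odot>\<^bsub>?N\<^esub> basis_elem R t \<in> carrier ?N" "basis_elem R t \<in> carrier ?N"
      using sl[OF t] a by (auto intro!: l.M.smult_closed basis_elem_closed simp del: free_module_simps)
    have "a \<odot>\<^bsub>?A\<^esub> tree_class R (one_gens R {2..}) t [\<one>, \<one>] = tree_fibre R {2..} c (a \<odot>\<^bsub>?N\<^esub> basis_elem R t)"
      using l.f_smult[OF a ab(2)] tc[OF t] by simp
    then show ?thesis
      using l.N.smult_parity[OF l.closed[OF ab(1)], of "int (dexp t 0)"] l.f_smult[OF parity_closed ab(1)]
        sur_sgn_neg1_pow[OF t] by simp
  qed
  have "inf_dif_gen R c a = (\<Oplus>\<^bsub>?A\<^esub>t\<in>Sur c 2. [sur_sgn t] \<cdot>\<^bsub>?A\<^esub> (a \<odot>\<^bsub>?A\<^esub> tree_class R (one_gens R {2..}) t [\<one>, \<one>]))"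
    by (simp add: inf_dif_gen_def inf_gens_eq)
  also have "\<dots> = (\<Oplus>\<^bsub>?A\<^esub>t\<in>Sur c 2. tree_fibre R {2..} c (?b t))"
  proof (rule l.N.finsum_cong'[OF refl])
    show "(\<lambda>t. tree_fibre R {2..} c (?b t)) \<in> Sur c 2 \<rightarrow> carrier ?A" by (intro funcsetI l.closed b)
  qed (rule summand)
  also have "\<dots> = tree_fibre R {2..} c (\<Oplus>\<^bsub>?N\<^esub>t\<in>Sur c 2. ?b t)"
    using b by (intro l.f_finsum[symmetric]) blast
  also have "(\<Oplus>\<^bsub>?N\<^esub>t\<in>Sur c 2. ?b t) = comb_dif R (corolla_comb c a)"
  proof
    fix s
    have "(\<Oplus>\<^bsub>?N\<^esub>t\<in>Sur c 2. ?b t) s = (\<Oplus>t\<in>Sur c 2. ?b t s)"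
      using b by (intro free_module_finsum) blast
    also have "\<dots> = (\<Oplus>t\<in>Sur c 2. if t = s then parity R (dexp t 0) \<otimes> a else \<zero>)"
      using a by (intro finsum_cong') (auto simp: basis_elem_def)
    also have "\<dots> = (if s \<in> Sur c 2 then parity R (dexp s 0) \<otimes> a else \<zero>)"
    proof (cases "s \<in> Sur c 2")
      case True
      then show ?thesis
        using a finite_Sur add.finprod_singleton_swap[of s "Sur c 2" "\<lambda>t. parity R (dexp t 0) \<otimes> a"] by auto
    next
      case False
      then show ?thesis by (auto intro!: add.finprod_one_eqI)
    qed
    finally show "(\<Oplus>\<^bsub>?N\<^esub>t\<in>Sur c 2. ?b t) s = comb_dif R (corolla_comb c a) s"
      using comb_dif_corolla[OF c a] by simp
  qed
  finally show ?thesis .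
qed

text \<open>A tree is the composite of its own vertices: each corolla has one block, so the offset
  of vertex \<open>j\<close> is \<open>j\<close>.\<close>

lemma sur_subst_corollas:
  assumes t: "surj_list t"
  shows "admissible t (map (\<lambda>j. corolla (count_list t j)) [0..<blocks t])"
    and "sur_subst t (map (\<lambda>j. corolla (count_list t j)) [0..<blocks t]) = t"
proof -
  let ?us = "map (\<lambda>j. corolla (count_list t j)) [0..<blocks t]"
  have pos: "count_list t j \<ge> 1" if "j < blocks t" for j
    using t that count_list_pos[of j t] by (simp add: surj_list_def)
  show adm: "admissible t ?us"
    using surj_corolla[OF pos] by (simp add: admissible_def) (simp add: corolla_def)
  show "sur_subst t ?us = t"
  proof (rule part_ext[of _ t])
    fix j assume "j \<in> set t"
    then have j: "j < blocks t" using t by (simp add: surj_list_def)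
    have "blocks (?us ! i) = 1" if "i < j" for i using surj_corolla[OF pos, of i] that j by simp
    then have "offset ?us j = j" by (simp add: offset_def)
    moreover have "part t t j = replicate (count_list t j) j"
      by (induction t) (auto simp: part_def replicate_append_same)
    ultimately show "part t (sur_subst t ?us) j = part t t j"
      using adm j by (subst part_sur_subst) (auto simp: admissible_def corolla_def)
  qed simp_all
qed

lemma corollas_decorations:
  assumes "surj_list t" "\<And>j. j < blocks t \<Longrightarrow> \<mu>s ! j \<in> carrier R"
  shows "map (\<lambda>j. corolla_comb (count_list t j) (\<mu>s ! j)) [0..<blocks t] \<in> decorations (ar (comb R {2..})) t"
proof -
  note pos = count_list_ge_1[OF assms(1)]
  show "map (\<lambda>j. corolla_comb (count_list t j) (\<mu>s ! j)) [0..<blocks t] \<in> decorations (ar (comb R {2..})) t"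
    unfolding decorations_comb_iff using corolla_comb_closed(1)[OF pos assms(2)] by simp
qed

text \<open>Each entry is supported on one corolla, so the composite is supported on
  \<open>t\<close> alone.\<close>

lemma comb_Gam_corollas:
  assumes tr: "(t, \<mu>s) \<in> trees (one_gens R {2..}) n"
  shows "comb_Gam R t (map (\<lambda>j. corolla_comb (count_list t j) (\<mu>s ! j)) [0..<blocks t]) = tree_val R {2..} (t, \<mu>s)"
    (is "comb_Gam R t ?gs = _")
proof
  fix s
  have t: "surj_list t" using tr by (simp add: trees_iff)
  have R: "\<mu>s ! j \<in> carrier R" if "j < blocks t" for j
    using tr decorations_in_ring[of \<mu>s "{2..}" t j] that by (simp add: trees_iff)
  have gR: "(?gs ! j) u \<in> carrier R" if "j < blocks t" for j u
    using R that by (simp add: corolla_comb_def)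
  let ?us = "map (\<lambda>j. corolla (count_list t j)) [0..<blocks t]"
  note c = sur_subst_corollas[OF t]
  show "comb_Gam R t ?gs s = tree_val R {2..} (t, \<mu>s) s"
  proof (cases "s = t")
    case True
    have "comb_Gam R t ?gs (sur_subst t ?us) = (\<Otimes>j\<in>{..<blocks t}. (?gs ! j) (?us ! j))"
      using gR by (rule comb_Gam_sur_subst[OF t c(1)])
    also have "\<dots> = (\<Otimes>j\<in>{..<blocks t}. \<mu>s ! j)"
      using R by (intro finprod_cong') (auto simp: corolla_comb_def)
    finally show ?thesis
      using True c(2) t by (simp add: tree_val_def sur_lists_all)
  next
    case False
    have "comb_Gam R t ?gs s = \<zero>"
      using t
    proof (cases rule: comb_Gam_cases[where s = s])
      case (decomposed us)
      have "\<exists>j<blocks t. us ! j \<noteq> ?us ! j"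
        using False decomposed c by (metis (no_types, lifting) admissible_def nth_equalityI)
      then obtain j where j: "j < blocks t" "us ! j \<noteq> corolla (count_list t j)" by auto
      have "comb_Gam R t ?gs (sur_subst t us) = (\<Otimes>j\<in>{..<blocks t}. (?gs ! j) (us ! j))"
        using gR by (rule comb_Gam_sur_subst[OF t decomposed(1)])
      also have "\<dots> = \<zero>"
        using j gR by (intro finprod_zero[of j]) (auto simp: corolla_comb_def)
      finally show ?thesis using decomposed(2) by simp
    qed simp
    then show ?thesis using False by (simp add: tree_val_def)
  qed
qed

text \<open>\<open>inf_dif_tree\<close> spells out the Leibniz rule for a composite of generators.
  By \<open>comb_Gam_dif_sum\<close> the operator \<open>comb_dif\<close> obeys the same rule, and
  the two agree on generators by \<open>inf_dif_gen_fibre\<close>.\<close>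

lemma inf_dif_tree_fibre:
  assumes tr: "(t, \<mu>s) \<in> trees (one_gens R {2..}) n"
  shows "inf_dif_tree R (t, \<mu>s) = tree_fibre R {2..} n (comb_dif R (tree_val R {2..} (t, \<mu>s)))"
proof -
  let ?M = "one_gens R {2..}" and ?k = "blocks t"
  let ?N = "free_module R (sur_lists {2..} n)" and ?A = "tensor_sum R ?M n"
  interpret l: linear R ?N ?A "tree_fibre R {2..} n" by (rule tree_fibre_linear)
  have t: "surj_list t" "length t = n" using tr by (auto simp: trees_iff)
  have R: "\<mu>s ! j \<in> carrier R" if "j < ?k" for j
    using tr decorations_in_ring[of \<mu>s "{2..}" t j] that by (simp add: trees_iff)
  let ?gs = "map (\<lambda>j. corolla_comb (count_list t j) (\<mu>s ! j)) [0..<?k]"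
  \<comment> \<open>The degree of the generator at vertex \<open>j\<close>, as it enters the sign in
    \<open>inf_dif_tree\<close>.\<close>
  let ?q = "\<lambda>j. int (count_list t j) - 1"
  note pos = count_list_ge_1[OF t(1)]
  have gs: "?gs \<in> decorations (ar (comb R {2..})) t" by (rule corollas_decorations[OF t(1)]) (rule R)
  have q: "comb_deg R (count_list t j) (?q j) (?gs ! j)" if "j < ?k" for j
    using corolla_comb_closed(2)[OF pos[OF that] R[OF that]] that by simp
  let ?G = "\<lambda>i. comb_Gam R t (?gs[i := comb_dif R (?gs ! i)])"
  have dec: "?gs[i := comb_dif R (?gs ! i)] \<in> decorations (ar (comb R {2..})) t" if "i < ?k" for i
    by (rule comb_Gam_dif_sum(2)[OF t(1) gs _ that]) (rule q)
  have Gc: "?G i \<in> carrier ?N" if "i < ?k" for i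
    using comb_Gam_closed[OF t(1) dec[OF that]] t(2) by simp
  have Gam: "Gam (free_permutad R ?M) t (map (\<lambda>j. if j = i then inf_dif_gen R (count_list t j) (\<mu>s ! j)
        else tree_class R ?M (corolla (count_list t j)) [\<mu>s ! j]) [0..<?k]) = tree_fibre R {2..} n (?G i)"
    if i: "i < ?k" for i
  proof -
    have eq: "map (\<lambda>j. if j = i then inf_dif_gen R (count_list t j) (\<mu>s ! j)
        else tree_class R ?M (corolla (count_list t j)) [\<mu>s ! j]) [0..<?k]
      = map (\<lambda>j. tree_fibre R {2..} (count_list t j) (?gs[i := comb_dif R (?gs ! i)] ! j)) [0..<?k]"
      using i inf_dif_gen_fibre[OF pos R] corolla_class_fibre[OF pos R]
      by (intro map_cong) (auto simp: nth_list_update)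
    show ?thesis unfolding eq using free_Gam_fibre[OF t(1) dec[OF i]] t(2) by (simp only:)
  qed
  have sg: "[neg1_pow p] \<cdot>\<^bsub>?N\<^esub> x \<in> carrier ?N \<and>
      tree_fibre R {2..} n ([neg1_pow p] \<cdot>\<^bsub>?N\<^esub> x) = [neg1_pow p] \<cdot>\<^bsub>?A\<^esub> tree_fibre R {2..} n x"
    if "x \<in> carrier ?N" for p x
    using l.M.smult_parity[OF that, of p] l.N.smult_parity[OF l.closed[OF that], of p]
      l.f_smult[OF parity_closed that] l.M.smult_closed[OF parity_closed that] by simp
  have "inf_dif_tree R (t, \<mu>s) = (\<Oplus>\<^bsub>?A\<^esub>i\<in>{..<?k}. [neg1_pow (\<Sum>j<i. ?q j)] \<cdot>\<^bsub>?A\<^esub> tree_fibre R {2..} n (?G i))"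
  proof -
    let ?T = "\<lambda>i. Gam (free_permutad R ?M) t (map (\<lambda>j. if j = i then inf_dif_gen R (count_list t j) (\<mu>s ! j)
        else tree_class R ?M (corolla (count_list t j)) [\<mu>s ! j]) [0..<?k])"
    have "inf_dif_tree R (t, \<mu>s) = (\<Oplus>\<^bsub>?A\<^esub>i\<in>{..<?k}. [neg1_pow (\<Sum>j<i. ?q j)] \<cdot>\<^bsub>?A\<^esub> ?T i)"
      unfolding inf_dif_tree_def inf_gens_eq Let_def prod.case t(2) by (simp del: free_permutad_simps(2,3))
    also have "\<dots> = (\<Oplus>\<^bsub>?A\<^esub>i\<in>{..<?k}. [neg1_pow (\<Sum>j<i. ?q j)] \<cdot>\<^bsub>?A\<^esub> tree_fibre R {2..} n (?G i))"
    proof (rule l.N.finsum_cong'[OF refl])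
      show "(\<lambda>i. [neg1_pow (\<Sum>j<i. ?q j)] \<cdot>\<^bsub>?A\<^esub> tree_fibre R {2..} n (?G i)) \<in> {..<?k} \<rightarrow> carrier ?A"
      proof
        fix i assume "i \<in> {..<?k}"
        then have i: "i < ?k" by simp
        show "[neg1_pow (\<Sum>j<i. ?q j)] \<cdot>\<^bsub>?A\<^esub> tree_fibre R {2..} n (?G i) \<in> carrier ?A"
        proof -
          have "tree_fibre R {2..} n ([neg1_pow (\<Sum>j<i. ?q j)] \<cdot>\<^bsub>?N\<^esub> ?G i) \<in> carrier ?A"
            using sg[OF Gc[OF i]] by (intro l.closed) blast
          then show ?thesis using sg[OF Gc[OF i]] by (simp only:)
        qed
      qed
      show "[neg1_pow (\<Sum>j<i. ?q j)] \<cdot>\<^bsub>?A\<^esub> ?T i = [neg1_pow (\<Sum>j<i. ?q j)] \<cdot>\<^bsub>?A\<^esub> tree_fibre R {2..} n (?G i)"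
        if "i \<in> {..<?k}" for i
        using Gam[of i] that by (simp only: lessThan_iff)
    qed
    finally show ?thesis .
  qed
  also have "\<dots> = (\<Oplus>\<^bsub>?A\<^esub>i\<in>{..<?k}. tree_fibre R {2..} n ([neg1_pow (\<Sum>j<i. ?q j)] \<cdot>\<^bsub>?N\<^esub> ?G i))"
  proof (rule l.N.finsum_cong'[OF refl])
    show "(\<lambda>i. tree_fibre R {2..} n ([neg1_pow (\<Sum>j<i. ?q j)] \<cdot>\<^bsub>?N\<^esub> ?G i)) \<in> {..<?k} \<rightarrow> carrier ?A"
      using sg[OF Gc] by (intro funcsetI l.closed) blast
  qed (use sg[OF Gc] in simp)
  also have "\<dots> = tree_fibre R {2..} n (\<Oplus>\<^bsub>?N\<^esub>i\<in>{..<?k}. [neg1_pow (\<Sum>j<i. ?q j)] \<cdot>\<^bsub>?N\<^esub> ?G i)"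
    using sg[OF Gc] by (intro l.f_finsum[symmetric]) blast
  also have "(\<Oplus>\<^bsub>?N\<^esub>i\<in>{..<?k}. [neg1_pow (\<Sum>j<i. ?q j)] \<cdot>\<^bsub>?N\<^esub> ?G i) = comb_dif R (comb_Gam R t ?gs)"
    using comb_Gam_dif_sum(1)[OF t(1) gs q] t(2) by simp
  finally show ?thesis using comb_Gam_corollas[OF tr] by simp
qed

text \<open>The linear extension depends on a representative only through its coordinates, so the
  union in \<open>inf_dif\<close> is over equal sets; the section shows that this union is not over
  an empty class.\<close>

lemma inf_dif_fibre:
  assumes g: "g \<in> carrier (free_module R (sur_lists {2..} n))"
  shows "inf_dif R (n + 1) (tree_fibre R {2..} n g) = tree_fibre R {2..} n (comb_dif R g)"
proof -
  let ?M = "one_gens R {2..}"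
  let ?F = "free_module R (trees ?M n)" and ?N = "free_module R (sur_lists {2..} n)" and ?A = "tensor_sum R ?M n"
  interpret A: module R ?A by (rule tensor_sum_module)
  have v: "inf_dif_tree R z \<in> carrier ?A" if "z \<in> trees ?M n" for z
  proof -
    have "inf_dif_tree R z = tree_fibre R {2..} n (comb_dif R (tree_val R {2..} z))"
      using inf_dif_tree_fibre[of "fst z" "snd z" n] that by simp
    then show ?thesis
      using linear.closed[OF tree_fibre_linear comb_dif_closed[OF tree_val_closed[OF that]]] by simp
  qed
  have ext: "lin_ext R ?A (inf_dif_tree R) f = tree_fibre R {2..} n (comb_dif R (tree_coord R {2..} n f))"
    if f: "f \<in> carrier ?F" for f
  proof (rule linear_map_eqI[OF tensor_sum_module _ _ _ f])
    show "linear_map R ?F ?A (lin_ext R ?A (inf_dif_tree R))"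
      using v by (intro A.lin_ext_linear) auto
    show "linear_map R ?F ?A (\<lambda>f. tree_fibre R {2..} n (comb_dif R (tree_coord R {2..} n f)))"
      by (rule linear_map_compose[OF linear_map_compose[OF linear.linear[OF tree_coord_linear[of "{2..}" n]]
          comb_dif_linear[of n]] linear.linear[OF tree_fibre_linear[of "{2..}" n]]])
    show "lin_ext R ?A (inf_dif_tree R) (basis_elem R z) = tree_fibre R {2..} n (comb_dif R (tree_coord R {2..} n (basis_elem R z)))"
      if "z \<in> trees ?M n" for z
      using A.lin_ext_basis[of "inf_dif_tree R" z] v[OF that] that tree_coord_basis[OF that]
        inf_dif_tree_fibre[of "fst z" "snd z" n] by simp
  qed
  have "inf_dif R (n + 1) (tree_fibre R {2..} n g) = (\<Union>f\<in>tree_fibre R {2..} n g. lin_ext R ?A (inf_dif_tree R) f)"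
    by (simp add: inf_dif_def inf_gens_eq lin_ext_def Let_def)
  also have "\<dots> = (\<Union>f\<in>tree_fibre R {2..} n g. tree_fibre R {2..} n (comb_dif R g))"
    using ext by (intro SUP_cong) (auto simp: tree_fibre_def)
  also have "\<dots> = tree_fibre R {2..} n (comb_dif R g)"
  proof -
    have "tree_section {2..} n g \<in> tree_fibre R {2..} n g"
      using tree_coord_section[OF g] linear.closed[OF tree_section_linear g] by (simp add: tree_fibre_def)
    then show ?thesis by blast
  qed
  finally show ?thesis .
qed

text \<open>A nonzero product of decorations forces each \<open>q j\<close> to be the degree of the
  generator at \<open>j\<close>, so homogeneous trees have homogeneous coordinates. Conversely,
  basis elements are trees with unit decorations.\<close>

lemma inf_hdeg_fibre:
  "free_hdeg R (inf_gens R) (inf_gens_hdeg R) (n + 1) p = tree_fibre R {2..} n ` hdeg (comb R {2..}) (n + 1) p"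
proof -
  let ?M = "one_gens R {2..}"
  let ?N = "free_module R (sur_lists {2..} n)" and ?A = "tensor_sum R ?M n"
  let ?H = "{g \<in> carrier ?N. comb_deg R n p g}"
  let ?X = "{tree_class R ?M t \<mu>s | t \<mu>s q. (t, \<mu>s) \<in> trees ?M n \<and>
         (\<forall>j<blocks t. \<mu>s ! j \<in> inf_gens_hdeg R (count_list t j + 1) (q j)) \<and> (\<Sum>j<blocks t. q j) = p}"
  interpret l: linear R ?N ?A "tree_fibre R {2..} n" by (rule tree_fibre_linear)
  interpret C: dg_permutad R "comb R {2..}" by (rule dg_permutad_comb)
  have H: "submodule ?H R ?N"
    using C.graded[of "n + 1"] by (simp add: graded_module_def)
  have X: "?X \<subseteq> tree_fibre R {2..} n ` ?H"
  proof
    fix X assume "X \<in> ?X"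
    then obtain t \<mu>s q where X: "X = tree_class R ?M t \<mu>s" and tr: "(t, \<mu>s) \<in> trees ?M n"
      and deg: "\<And>j. j < blocks t \<Longrightarrow> \<mu>s ! j \<in> inf_gens_hdeg R (count_list t j + 1) (q j)" and p: "(\<Sum>j<blocks t. q j) = p"
      by blast
    have t: "surj_list t" "length t = n" using tr by (auto simp: trees_iff)
    have R: "\<mu>s ! j \<in> carrier R" if "j < blocks t" for j
      using tr decorations_in_ring[of \<mu>s "{2..}" t j] that by (simp add: trees_iff)
    have "comb_deg R n p (tree_val R {2..} (t, \<mu>s))"
      unfolding comb_deg_def
    proof (intro allI impI)
      fix s assume nz: "tree_val R {2..} (t, \<mu>s) s \<noteq> \<zero>"
      then have s: "s = t" and "(\<Otimes>j\<in>{..<blocks t}. \<mu>s ! j) \<noteq> \<zero>"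
        by (auto simp: tree_val_def split: if_splits)
      then have "\<mu>s ! j \<noteq> \<zero>" if "j < blocks t" for j
        using that R finprod_zero[of j "blocks t" "\<lambda>j. \<mu>s ! j"] by auto
      then have "q j = int (count_list t j) - 1" if "j < blocks t" for j
        using deg[OF that] that by (auto simp: inf_gens_hdeg_def inf_gens_eq split: if_splits)
      then have "p = (\<Sum>j<blocks t. int (count_list t j) - 1)" unfolding p[symmetric] by (intro sum.cong) auto
      also have "\<dots> = int (\<Sum>j<blocks t. count_list t j) - int (blocks t)"
        by (simp add: sum_subtractf)
      finally show "int n - int (blocks s) = p"
        using s t sum_count_list[OF t(1)] by simp
    qed
    moreover have "X = tree_fibre R {2..} n (tree_val R {2..} (t, \<mu>s))"
      unfolding X using tree_class_fibre[of t \<mu>s "{2..}"] tr t(2) by simp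
    ultimately show "X \<in> tree_fibre R {2..} n ` ?H"
      using tree_val_closed[OF tr] by blast
  qed
  have "tree_fibre R {2..} n ` ?H \<subseteq> carrier ?A"
    by (intro image_subsetI l.closed) simp
  with X have Xc: "?X \<subseteq> carrier ?A" by (rule subset_trans)
  note gen = l.N.gen_submodule[OF Xc]
  have "gen_submodule R ?A ?X = tree_fibre R {2..} n ` ?H"
  proof
    show "gen_submodule R ?A ?X \<subseteq> tree_fibre R {2..} n ` ?H"
      by (rule gen(3)[OF l.submodule_image[OF H] X])
    show "tree_fibre R {2..} n ` ?H \<subseteq> gen_submodule R ?A ?X"
    proof
      fix Y assume "Y \<in> tree_fibre R {2..} n ` ?H"
      then obtain g where g: "g \<in> carrier ?N" "comb_deg R n p g" "Y = tree_fibre R {2..} n g" by blast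
      have "g \<in> {g \<in> carrier ?N. tree_fibre R {2..} n g \<in> gen_submodule R ?A ?X}"
      proof (rule free_module_span[OF l.submodule_preimage[OF gen(1)] g(1)])
        fix s assume nz: "g s \<noteq> \<zero>"
        have s: "s \<in> sur_lists {2..} n" by (rule free_module_support[OF g(1) nz])
        then have surj: "surj_list s" "length s = n" by (auto simp: sur_lists_all)
        let ?o = "replicate (blocks s) \<one>"
        have eq: "tree_class R ?M s ?o = tree_fibre R {2..} n (basis_elem R s)"
          using tree_class_fibre[of s ?o "{2..}"] ones_tree[OF s] tree_val_ones[OF s] surj(2) by simp
        have "tree_class R ?M s ?o \<in> ?X"
        proof -
          have "(\<Sum>j<blocks s. int (count_list s j) - 1) = int (\<Sum>j<blocks s. count_list s j) - int (blocks s)"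
            by (simp add: sum_subtractf)
          then have "(\<Sum>j<blocks s. int (count_list s j) - 1) = p"
            using g(2) nz sum_count_list[OF surj(1)] surj(2) by (simp add: comb_deg_def)
          moreover have "?o ! j \<in> inf_gens_hdeg R (count_list s j + 1) (int (count_list s j) - 1)" if "j < blocks s" for j
            using that surj(1) count_list_pos[of j s] by (simp add: inf_gens_hdeg_def inf_gens_eq surj_list_def Suc_le_eq)
          ultimately show ?thesis
            by (intro CollectI exI[of _ s] exI[of _ ?o] exI[of _ "\<lambda>j. int (count_list s j) - 1"]
                conjI refl ones_tree[OF s] allI impI)
        qed
        from subsetD[OF gen(2) this]
        show "basis_elem R s \<in> {g \<in> carrier ?N. tree_fibre R {2..} n g \<in> gen_submodule R ?A ?X}"
          unfolding eq using basis_elem_closed[OF s] by blast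
      qed
      then show "Y \<in> gen_submodule R ?A ?X" using g(3) by blast
    qed
  qed
  then show ?thesis
    by (simp add: free_hdeg_def inf_gens_eq)
qed

lemma permAs_inf_simps [simp]:
  "ar (permAs_inf R) = ar (free_permutad R (inf_gens R))"
  "ident (permAs_inf R) = ident (free_permutad R (inf_gens R))"
  "Gam (permAs_inf R) = Gam (free_permutad R (inf_gens R))"
  "hdeg (permAs_inf R) = free_hdeg R (inf_gens R) (inf_gens_hdeg R)"
  "dif (permAs_inf R) = inf_dif R"
  by (simp_all add: permAs_inf_def Let_def)

lemma permutad_permAs_inf: "permutad R (permAs_inf R) \<longleftrightarrow> permutad R (free_permutad R (inf_gens R))"
  by (simp add: permutad_def)

proposition permAs_inf_comb:
  shows "dg_permutad R (permAs_inf R)"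
    and "dg_permutad_hom R (comb R {2..}) (permAs_inf R) (\<lambda>n. tree_fibre R {2..} (n - 1))"
    and "n \<ge> 1 \<Longrightarrow> bij_betw (tree_fibre R {2..} (n - 1)) (carrier (ar (comb R {2..}) n)) (carrier (ar (permAs_inf R) n))"
proof -
  let ?\<phi> = "\<lambda>n. tree_fibre R {2..} (n - 1)"
  note iso = free_permutad_comb(2)[of "{2..}", folded inf_gens_eq]
  have hom: "permutad_hom R (comb R {2..}) (permAs_inf R) ?\<phi>"
    using iso by (simp add: permutad_iso_def permutad_hom_def permutad_permAs_inf del: free_permutad_simps)
  show bij: "bij_betw (?\<phi> n) (carrier (ar (comb R {2..}) n)) (carrier (ar (permAs_inf R) n))" if "n \<ge> 1" for n
    using iso that by (simp add: permutad_iso_def del: free_permutad_simps)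
  have deg: "hdeg (permAs_inf R) n p = ?\<phi> n ` hdeg (comb R {2..}) n p" if "n \<ge> 1" for n p
    using inf_hdeg_fibre[of "n - 1" p] that by simp
  have dif: "dif (permAs_inf R) n (?\<phi> n x) = ?\<phi> n (dif (comb R {2..}) n x)"
    if "n \<ge> 1" "x \<in> carrier (ar (comb R {2..}) n)" for n x
    using inf_dif_fibre[of x "n - 1"] that by simp
  show "dg_permutad R (permAs_inf R)" "dg_permutad_hom R (comb R {2..}) (permAs_inf R) ?\<phi>"
    by (rule dg_permutad_image[where \<phi> = ?\<phi> and P = "comb R {2..}"]; (rule dg_permutad_comb hom bij deg dif); assumption)+
qed

end

section \<open>Quotients and quasi-isomorphisms onto degree 0\<close>

lemma (in abelian_group) diff_add_cancel: "x \<in> carrier G \<Longrightarrow> y \<in> carrier G \<Longrightarrow> x \<ominus> y \<oplus> y = x"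
  by (simp add: a_minus_def a_assoc l_neg)

lemma permutad_hom_compose:
  assumes "permutad_hom R P Q \<phi>" "permutad_hom R Q T \<psi>"
  shows "permutad_hom R P T (\<lambda>n x. \<psi> n (\<phi> n x))"
  unfolding permutad_hom_def
proof (intro conjI allI impI ballI)
  show "permutad R P" "permutad R T" "\<psi> 1 (\<phi> 1 (ident P)) = ident T"
    using assms by (auto simp: permutad_hom_def)
  show "linear_map R (ar P n) (ar T n) (\<lambda>x. \<psi> n (\<phi> n x))" if "n \<ge> 1" for n
  proof -
    have "linear_map R (ar P n) (ar Q n) (\<phi> n)" "linear_map R (ar Q n) (ar T n) (\<psi> n)"
      using assms that by (auto simp: permutad_hom_def)
    then show ?thesis by (rule linear_map_compose)
  qed
  fix n k t \<mu>s assume n: "n \<ge> (1::nat)" and t: "t \<in> Sur n k" and \<mu>s: "\<mu>s \<in> decorations (ar P) t"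
  let ?\<nu>s = "map (\<lambda>j. \<phi> (count_list t j + 1) (\<mu>s ! j)) [0..<k]"
  have k: "blocks t = k" using t by (simp add: Sur_iff)
  have c: "\<phi> (count_list t j + 1) x \<in> carrier (ar Q (count_list t j + 1))"
    if "x \<in> carrier (ar P (count_list t j + 1))" for j x
    using assms(1) that by (auto simp: permutad_hom_def linear_map_def)
  have "?\<nu>s \<in> decorations (ar Q) t"
    using \<mu>s k c by (simp add: decorations_def)
  then have "\<psi> (n + 1) (Gam Q t ?\<nu>s) = Gam T t (map (\<lambda>j. \<psi> (count_list t j + 1) (?\<nu>s ! j)) [0..<k])"
    using assms(2) n t by (simp add: permutad_hom_def)
  moreover have "\<phi> (n + 1) (Gam P t \<mu>s) = Gam Q t ?\<nu>s"
    using assms(1) n t \<mu>s by (simp add: permutad_hom_def)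
  moreover have "map (\<lambda>j. \<psi> (count_list t j + 1) (?\<nu>s ! j)) [0..<k]
      = map (\<lambda>j. \<psi> (count_list t j + 1) (\<phi> (count_list t j + 1) (\<mu>s ! j))) [0..<k]"
    by (intro map_cong) auto
  ultimately show "\<psi> (n + 1) (\<phi> (n + 1) (Gam P t \<mu>s))
      = Gam T t (map (\<lambda>j. \<psi> (count_list t j + 1) (\<phi> (count_list t j + 1) (\<mu>s ! j))) [0..<k])"
    by (simp only:)
qed

lemma permutad_iso_inverse:
  assumes "permutad_iso R P Q \<phi>"
  shows "permutad_hom R Q P (\<lambda>n. the_inv_into (carrier (ar P n)) (\<phi> n))"
proof -
  let ?\<psi> = "\<lambda>n. the_inv_into (carrier (ar P n)) (\<phi> n)"
  have hom: "permutad_hom R P Q \<phi>" and bij: "\<And>n. n \<ge> 1 \<Longrightarrow> bij_betw (\<phi> n) (carrier (ar P n)) (carrier (ar Q n))"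
    using assms by (auto simp: permutad_iso_def)
  interpret P: permutad R P using hom by (simp add: permutad_hom_def)
  have closed: "?\<psi> n y \<in> carrier (ar P n)" and inv: "\<phi> n (?\<psi> n y) = y" if "n \<ge> 1" "y \<in> carrier (ar Q n)" for n y
    using bij[OF that(1)] that(2) the_inv_into_into[of "\<phi> n" "carrier (ar P n)" y "carrier (ar P n)"]
      f_the_inv_into_f[of "\<phi> n" "carrier (ar P n)" y] by (auto simp: bij_betw_def)
  have inv': "?\<psi> n (\<phi> n x) = x" if "n \<ge> 1" "x \<in> carrier (ar P n)" for n x
    using bij[OF that(1)] that(2) by (simp add: the_inv_into_f_f bij_betw_def)
  have lin: "linear_map R (ar P n) (ar Q n) (\<phi> n)" if "n \<ge> 1" for n
    using hom that by (simp add: permutad_hom_def)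
  show ?thesis
    unfolding permutad_hom_def
  proof (intro conjI allI impI ballI)
    show "permutad R Q" "permutad R P" using hom by (auto simp: permutad_hom_def)
    have "\<phi> 1 (ident P) = ident Q" using hom by (simp add: permutad_hom_def)
    then show "?\<psi> 1 (ident Q) = ident P" using inv'[of 1 "ident P"] P.ident_closed by simp
  next
    fix n :: nat assume n: "n \<ge> 1"
    interpret Pn: module R "ar P n" by (rule P.module_ar[OF n])
    show "linear_map R (ar Q n) (ar P n) (?\<psi> n)"
      unfolding linear_map_def
    proof (intro conjI ballI funcsetI closed[OF n])
      fix x y c
      assume x: "x \<in> carrier (ar Q n)"
      have px: "?\<psi> n x \<in> carrier (ar P n)" "\<phi> n (?\<psi> n x) = x" using closed[OF n x] inv[OF n x] by auto
      {
        assume y: "y \<in> carrier (ar Q n)"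
        have py: "?\<psi> n y \<in> carrier (ar P n)" "\<phi> n (?\<psi> n y) = y" using closed[OF n y] inv[OF n y] by auto
        have "\<phi> n (?\<psi> n x \<oplus>\<^bsub>ar P n\<^esub> ?\<psi> n y) = x \<oplus>\<^bsub>ar Q n\<^esub> y"
          using lin[OF n] px py by (simp add: linear_map_def)
        then show "?\<psi> n (x \<oplus>\<^bsub>ar Q n\<^esub> y) = ?\<psi> n x \<oplus>\<^bsub>ar P n\<^esub> ?\<psi> n y"
          using inv'[OF n, of "?\<psi> n x \<oplus>\<^bsub>ar P n\<^esub> ?\<psi> n y"] px py by simp
      }
      assume c: "c \<in> carrier R"
      have "\<phi> n (c \<odot>\<^bsub>ar P n\<^esub> ?\<psi> n x) = c \<odot>\<^bsub>ar Q n\<^esub> x"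
        using lin[OF n] px c by (simp add: linear_map_def)
      then show "?\<psi> n (c \<odot>\<^bsub>ar Q n\<^esub> x) = c \<odot>\<^bsub>ar P n\<^esub> ?\<psi> n x"
        using inv'[OF n, of "c \<odot>\<^bsub>ar P n\<^esub> ?\<psi> n x"] px c by simp
    qed
  next
    fix n k t \<mu>s assume n: "n \<ge> (1::nat)" and t: "t \<in> Sur n k" and \<mu>s: "\<mu>s \<in> decorations (ar Q) t"
    let ?\<nu>s = "map (\<lambda>j. ?\<psi> (count_list t j + 1) (\<mu>s ! j)) [0..<k]"
    have k: "blocks t = k" using t by (simp add: Sur_iff)
    have dec: "?\<nu>s \<in> decorations (ar P) t"
      using \<mu>s k closed by (simp add: decorations_def)
    have "map (\<lambda>j. \<phi> (count_list t j + 1) (?\<nu>s ! j)) [0..<k] = \<mu>s"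
      using \<mu>s k inv by (intro nth_equalityI) (auto simp: decorations_def)
    then have "\<phi> (n + 1) (Gam P t ?\<nu>s) = Gam Q t \<mu>s"
      using hom n t dec by (simp add: permutad_hom_def)
    then show "?\<psi> (n + 1) (Gam Q t \<mu>s) = Gam P t ?\<nu>s"
      using inv'[of "n + 1" "Gam P t ?\<nu>s"] P.Gam_closed[OF n t dec] by simp
  qed
qed

context permutad
begin

lemma Gam_zero:
  assumes "n \<ge> 1" "t \<in> Sur n k" "\<mu>s \<in> decorations (ar P) t" "j < k" "\<mu>s ! j = \<zero>\<^bsub>ar P (count_list t j + 1)\<^esub>"
  shows "Gam P t \<mu>s = \<zero>\<^bsub>ar P (n + 1)\<^esub>"
proof -
  interpret M: module R "ar P (count_list t j + 1)" by (rule module_ar) simp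
  interpret N: module R "ar P (n + 1)" by (rule module_ar) simp
  have "Gam P t (\<mu>s[j := \<zero>\<^bsub>R\<^esub> \<odot>\<^bsub>ar P (count_list t j + 1)\<^esub> \<mu>s ! j])
      = \<zero>\<^bsub>R\<^esub> \<odot>\<^bsub>ar P (n + 1)\<^esub> Gam P t (\<mu>s[j := \<mu>s ! j])"
    unfolding assms(5) by (intro Gam_smult[OF assms(1-4)] M.R.zero_closed M.M.zero_closed)
  then have "Gam P t (\<mu>s[j := \<mu>s ! j]) = \<zero>\<^bsub>R\<^esub> \<odot>\<^bsub>ar P (n + 1)\<^esub> Gam P t (\<mu>s[j := \<mu>s ! j])"
    by (simp only: M.smult_l_null[OF M.M.zero_closed] assms(5))
  then show ?thesis
    using N.smult_l_null[OF Gam_closed[OF assms(1-3)]] by simp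
qed

text \<open>The entries are exchanged one after the other, and each exchange alters the value by a
  composition with one entry in the ideal.\<close>

lemma Gam_coset:
  assumes I: "permutad_ideal R P I" and n: "n \<ge> 1" and t: "t \<in> Sur n k"
    and \<mu>s: "\<mu>s \<in> decorations (ar P) t" and len: "length \<nu>s = k"
    and \<nu>s: "\<And>j. j < k \<Longrightarrow> \<nu>s ! j \<in> I (count_list t j + 1) +>\<^bsub>ar P (count_list t j + 1)\<^esub> \<mu>s ! j"
  shows "Gam P t \<nu>s \<in> I (n + 1) +>\<^bsub>ar P (n + 1)\<^esub> Gam P t \<mu>s"
proof -
  interpret N: module R "ar P (n + 1)" by (rule module_ar) simp
  have sub: "submodule (I m) R (ar P m)" if "m \<ge> 1" for m
    using I that by (simp add: permutad_ideal_def)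
  have k: "blocks t = k" "length \<mu>s = k" using t \<mu>s by (auto simp: Sur_iff decorations_def)
  have \<nu>c: "\<nu>s ! j \<in> carrier (ar P (count_list t j + 1))"
    and \<nu>d: "\<nu>s ! j \<ominus>\<^bsub>ar P (count_list t j + 1)\<^esub> \<mu>s ! j \<in> I (count_list t j + 1)" if "j < k" for j
  proof -
    have "\<mu>s ! j \<in> carrier (ar P (count_list t j + 1))" using \<mu>s k that by (simp add: decorations_def)
    then show "\<nu>s ! j \<in> carrier (ar P (count_list t j + 1))"
      "\<nu>s ! j \<ominus>\<^bsub>ar P (count_list t j + 1)\<^esub> \<mu>s ! j \<in> I (count_list t j + 1)"
      using \<nu>s[OF that] module.mem_coset_iff[OF module_ar sub, of "count_list t j + 1" "\<mu>s ! j" "\<nu>s ! j"] by auto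
  qed
  let ?h = "\<lambda>m. take m \<nu>s @ drop m \<mu>s"
  have dec: "?h m \<in> decorations (ar P) t" if "m \<le> k" for m
    using that \<mu>s k len \<nu>c by (auto simp: decorations_def nth_append)
  have "I (n + 1) +>\<^bsub>ar P (n + 1)\<^esub> Gam P t (?h m) = I (n + 1) +>\<^bsub>ar P (n + 1)\<^esub> Gam P t \<mu>s" if "m \<le> k" for m
    using that
  proof (induction m)
    case (Suc m)
    then have m: "m < k" by simp
    let ?M = "ar P (count_list t m + 1)"
    interpret M: module R ?M by (rule module_ar) simp
    have \<mu>c: "\<mu>s ! m \<in> carrier ?M" using \<mu>s k m by (simp add: decorations_def)
    let ?d = "\<nu>s ! m \<ominus>\<^bsub>?M\<^esub> \<mu>s ! m"
    have dc: "?d \<in> carrier ?M" by (rule M.M.minus_closed[OF \<nu>c[OF m] \<mu>c])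
    have "?d \<oplus>\<^bsub>?M\<^esub> \<mu>s ! m = \<nu>s ! m"
      by (rule M.M.diff_add_cancel[OF \<nu>c[OF m] \<mu>c])
    moreover have "(?h m)[m := \<nu>s ! m] = ?h (Suc m)" "(?h m)[m := \<mu>s ! m] = ?h m"
      using m len k by (auto simp: list_eq_iff_nth_eq nth_list_update nth_append less_Suc_eq)
    ultimately have "Gam P t (?h (Suc m)) = Gam P t ((?h m)[m := ?d]) \<oplus>\<^bsub>ar P (n + 1)\<^esub> Gam P t (?h m)"
      using Gam_add[OF n t dec[of m] m dc \<mu>c] m by simp
    moreover have "Gam P t ((?h m)[m := ?d]) \<in> I (n + 1)"
    proof -
      have "(?h m)[m := ?d] \<in> decorations (ar P) t"
        using dec[of m] m k dc by (intro decorations_update) auto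
      moreover have "(?h m)[m := ?d] ! m \<in> I (count_list t m + 1)"
        using \<nu>d[OF m] m len k by simp
      ultimately show ?thesis using I n t m unfolding permutad_ideal_def by blast
    qed
    ultimately have "Gam P t (?h (Suc m)) \<in> I (n + 1) +>\<^bsub>ar P (n + 1)\<^esub> Gam P t (?h m)"
      by (auto simp: a_r_coset_def')
    then have "I (n + 1) +>\<^bsub>ar P (n + 1)\<^esub> Gam P t (?h (Suc m)) = I (n + 1) +>\<^bsub>ar P (n + 1)\<^esub> Gam P t (?h m)"
      using Gam_closed[OF n t dec] m sub[of "n + 1"] N.mem_coset_iff N.coset_eq_iff by auto
    then show ?case using Suc m by simp
  qed simp
  from this[of k] show ?thesis
    using N.coset_self[OF sub Gam_closed[OF n t dec], of k] len k by simp
qed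

text \<open>The ideal has to vanish in arity 1, since otherwise scaling the identity would no longer
  be injective there.\<close>

lemma quot_permutad:
  assumes I: "permutad_ideal R P I" and I1: "I 1 = {\<zero>\<^bsub>ar P 1\<^esub>}"
  shows "permutad R (quot_permutad P I)"
    and "permutad_hom R P (quot_permutad P I) (\<lambda>n x. I n +>\<^bsub>ar P n\<^esub> x)"
proof -
  let ?Q = "quot_permutad P I" and ?q = "\<lambda>n x. I n +>\<^bsub>ar P n\<^esub> x"
  have sub: "submodule (I m) R (ar P m)" if "m \<ge> 1" for m
    using I that by (simp add: permutad_ideal_def)
  have Q: "ar ?Q n = quot_module (ar P n) (I n)" for n by (simp add: quot_permutad_def)
  note lin = module.quot_module(2)[OF module_ar sub]
  have car: "carrier (ar ?Q n) = ?q n ` carrier (ar P n)" if "n \<ge> 1" for n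
    unfolding Q by (rule module.carrier_quot_module[OF module_ar[OF that]])
  have zero: "?q n \<zero>\<^bsub>ar P n\<^esub> = \<zero>\<^bsub>ar ?Q n\<^esub>" if "n \<ge> 1" for n
    using module.coset_zero[OF module_ar sub, OF that that] by (simp add: Q quot_module_def)
  have add: "?q n (x \<oplus>\<^bsub>ar P n\<^esub> y) = ?q n x \<oplus>\<^bsub>ar ?Q n\<^esub> ?q n y"
    if "n \<ge> 1" "x \<in> carrier (ar P n)" "y \<in> carrier (ar P n)" for n x y
    using lin[OF that(1) that(1)] that(2,3) by (simp add: linear_map_def Q)
  have smult: "?q n (c \<odot>\<^bsub>ar P n\<^esub> x) = c \<odot>\<^bsub>ar ?Q n\<^esub> ?q n x"
    if "n \<ge> 1" "c \<in> carrier R" "x \<in> carrier (ar P n)" for n c x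
    using lin[OF that(1) that(1)] that(2,3) by (simp add: linear_map_def Q)
  have ident: "?q 1 (ident P) = ident ?Q" by (simp add: quot_permutad_def)
  interpret P1: module R "ar P 1" by (rule module_ar) simp
  have inj: "inj_on (?q 1) (carrier (ar P 1))"
    using sub[of 1] I1 P1.coset_eq_iff P1.M.diff_eq_zero_iff by (intro inj_onI) simp
  have Gam: "?q (n + 1) (Gam P t \<mu>s) = Gam ?Q t (map (\<lambda>j. ?q (count_list t j + 1) (\<mu>s ! j)) [0..<k])"
    if n: "n \<ge> 1" and t: "t \<in> Sur n k" and \<mu>s: "\<mu>s \<in> decorations (ar P) t" for n t k \<mu>s
  proof -
    interpret N: module R "ar P (n + 1)" by (rule module_ar) simp
    have len: "length t = n" "length \<mu>s = k" "blocks t = k" using t \<mu>s by (auto simp: Sur_iff decorations_def)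
    let ?A = "{\<nu>s. list_all2 (\<in>) \<nu>s (map (\<lambda>j. ?q (count_list t j + 1) (\<mu>s ! j)) [0..<k])}"
    have "Gam P t \<nu>s \<in> ?q (n + 1) (Gam P t \<mu>s)" if "\<nu>s \<in> ?A" for \<nu>s
      using that by (intro Gam_coset[OF I n t \<mu>s]) (auto simp: list_all2_conv_all_nth)
    moreover have "\<mu>s \<in> ?A"
    proof -
      have "\<mu>s ! j \<in> ?q (count_list t j + 1) (\<mu>s ! j)" if "j < k" for j
        using \<mu>s len that by (intro module.coset_self[OF module_ar sub]) (auto simp: decorations_def)
      then show ?thesis using len by (simp add: list_all2_conv_all_nth)
    qed
    ultimately have "I (n + 1) <+>\<^bsub>ar P (n + 1)\<^esub> Gam P t ` ?A = ?q (n + 1) (Gam P t \<mu>s)"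
      by (intro N.set_add_coset[OF sub Gam_closed[OF n t \<mu>s]]) auto
    then show ?thesis using len by (simp add: quot_permutad_def)
  qed
  note hom = permutad_axioms car zero add smult ident inj Gam
  show "permutad R ?Q"
    by (rule permutad_image[where P = P and \<phi> = ?q]; (rule hom); assumption)
  show "permutad_hom R P ?Q ?q"
    by (rule permutad_hom_image; (rule hom); assumption)
qed

end

section \<open>Complexes concentrated in degree 0\<close>

lemma in_degree_0_simps [simp]:
  "ar (in_degree_0 P) = ar P" "ident (in_degree_0 P) = ident P" "Gam (in_degree_0 P) = Gam P"
  "hdeg (in_degree_0 P) n p = (if p = 0 then carrier (ar P n) else {\<zero>\<^bsub>ar P n\<^esub>})"
  "dif (in_degree_0 P) n = (\<lambda>_. \<zero>\<^bsub>ar P n\<^esub>)"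
  by (simp_all add: in_degree_0_def)

text \<open>An entry of nonzero degree is zero and makes the whole composite zero, which settles all
  degree patterns except the constant zero one.\<close>

lemma dg_permutad_in_degree_0:
  assumes "permutad R P"
  shows "dg_permutad R (in_degree_0 P)"
proof -
  interpret P: permutad R P by fact
  let ?D = "in_degree_0 P"
  show ?thesis
  proof (intro dg_permutad.intro dg_permutad_axioms.intro)
    show "permutad R ?D" using assms by (simp add: permutad_def)
    fix n :: nat and x p assume n: "n \<ge> 1"
    interpret M: module R "ar P n" by (rule P.module_ar[OF n])
    show "graded_module R (ar ?D n) (hdeg ?D n)"
      using M.graded_module_concentrated[of 0] by (simp add: in_degree_0_def)
    show "linear_map R (ar ?D n) (ar ?D n) (dif ?D n)"
      by (auto simp: linear_map_def)
    show "dif ?D n x \<in> hdeg ?D n (p - 1)" if "x \<in> hdeg ?D n p" by simp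
    show "dif ?D n (dif ?D n x) = \<zero>\<^bsub>ar ?D n\<^esub>" if "x \<in> carrier (ar ?D n)" by simp
  next
    show "ident ?D \<in> hdeg ?D 1 0" using P.ident_closed by simp
  next
    fix n t k \<mu>s q
    assume n: "n \<ge> 1" and t: "t \<in> Sur n k" and len: "length \<mu>s = k"
      and deg: "\<And>j. j < k \<Longrightarrow> \<mu>s ! j \<in> hdeg ?D (count_list t j + 1) (q j)"
    interpret M: module R "ar P (n + 1)" by (rule P.module_ar) simp
    have zc: "\<zero>\<^bsub>ar P (m + 1)\<^esub> \<in> carrier (ar P (m + 1))" for m
      using P.module_ar[of "m + 1"] by (simp add: module_def abelian_group_def abelian_monoid.zero_closed)
    have "\<mu>s ! j \<in> carrier (ar P (count_list t j + 1))" if "j < k" for j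
      using deg[OF that] zc[of "count_list t j"] by (auto split: if_splits)
    then have dec: "\<mu>s \<in> decorations (ar P) t"
      using t len by (auto simp: decorations_def Sur_iff)
    show "Gam ?D t \<mu>s \<in> hdeg ?D (n + 1) (\<Sum>j<k. q j)"
    proof (cases "\<forall>j<k. q j = 0")
      case True
      then show ?thesis using P.Gam_closed[OF n t dec] by simp
    next
      case False
      then obtain j where j: "j < k" "q j \<noteq> 0" by auto
      then have "\<mu>s ! j = \<zero>\<^bsub>ar P (count_list t j + 1)\<^esub>"
        using deg[OF j(1)] by simp
      with j(1) have "Gam P t \<mu>s = \<zero>\<^bsub>ar P (n + 1)\<^esub>" by (rule P.Gam_zero[OF n t dec])
      then show ?thesis using zc[of n] by simp
    qed
    have z: "Gam P t (\<mu>s[i := \<zero>\<^bsub>ar P (count_list t i + 1)\<^esub>]) = \<zero>\<^bsub>ar P (n + 1)\<^esub>" if "i < k" for i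
    proof (rule P.Gam_zero[OF n t _ that])
      show "\<mu>s[i := \<zero>\<^bsub>ar P (count_list t i + 1)\<^esub>] \<in> decorations (ar P) t"
        using dec that t zc by (intro decorations_update) (auto simp: Sur_iff)
      show "\<mu>s[i := \<zero>\<^bsub>ar P (count_list t i + 1)\<^esub>] ! i = \<zero>\<^bsub>ar P (count_list t i + 1)\<^esub>"
        using that len by simp
    qed
    have "(\<Oplus>\<^bsub>ar P (n + 1)\<^esub>i\<in>{..<k}. [neg1_pow (\<Sum>j<i. q j)] \<cdot>\<^bsub>ar P (n + 1)\<^esub>
        Gam P t (\<mu>s[i := \<zero>\<^bsub>ar P (count_list t i + 1)\<^esub>])) = \<zero>\<^bsub>ar P (n + 1)\<^esub>"
      using z M.smult_parity[OF M.M.zero_closed] M.smult_r_null[OF M.parity_closed] by (intro M.M.add.finprod_one_eqI) simp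
    then show "dif ?D (n + 1) (Gam ?D t \<mu>s) =
         (\<Oplus>\<^bsub>ar ?D (n + 1)\<^esub>i\<in>{..<k}. [neg1_pow (\<Sum>j<i. q j)] \<cdot>\<^bsub>ar ?D (n + 1)\<^esub>
            Gam ?D t (\<mu>s[i := dif ?D (count_list t i + 1) (\<mu>s ! i)]))"
      by simp
  qed
qed

text \<open>The target has zero differential, so its homology consists of singletons and a class is
  sent to the value at any of its representatives. What remains is acyclicity off degree 0, and
  surjectivity and the kernel in degree 0.\<close>

lemma quasi_iso_in_degree_0:
  assumes hom: "dg_permutad_hom R P (in_degree_0 Q) \<phi>"
    and acyclic: "\<And>n p x. n \<ge> 1 \<Longrightarrow> p \<noteq> 0 \<Longrightarrow> x \<in> cycles P n p \<Longrightarrow> x \<in> boundaries P n p"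
    and cycles_0: "\<And>n. n \<ge> 1 \<Longrightarrow> cycles P n 0 = hdeg P n 0"
    and surj: "\<And>n. n \<ge> 1 \<Longrightarrow> \<phi> n ` hdeg P n 0 = carrier (ar Q n)"
    and ker: "\<And>n x. n \<ge> 1 \<Longrightarrow> x \<in> hdeg P n 0 \<Longrightarrow> \<phi> n x = \<zero>\<^bsub>ar Q n\<^esub> \<Longrightarrow> x \<in> boundaries P n 0"
  shows "quasi_iso R P (in_degree_0 Q) \<phi>"
  unfolding quasi_iso_def
proof (intro conjI hom allI impI)
  fix n :: nat and p :: int assume n: "n \<ge> 1"
  interpret P: dg_permutad R P using hom by (simp add: dg_permutad_hom_def)
  interpret Q: dg_permutad R "in_degree_0 Q" using hom by (simp add: dg_permutad_hom_def)
  have lm: "linear_map R (ar P n) (ar Q n) (\<phi> n)"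
    using hom n by (auto simp: dg_permutad_hom_def permutad_hom_def)
  interpret l: linear R "ar P n" "ar Q n" "\<phi> n"
    using P.module_ar[OF n] Q.module_ar[OF n] lm by (intro linearI) auto
  have sub: "submodule (hdeg P n p) R (ar P n)" for p
    using P.graded[OF n] by (simp add: graded_module_def)
  interpret d: linear R "ar P n" "ar P n" "dif P n"
    using P.module_ar[OF n] P.dif_linear[OF n] by (intro linearI)
  have bsub: "submodule (boundaries P n p) R (ar P n)" for p
    unfolding boundaries_def by (rule d.submodule_image[OF sub])
  have b0: "\<phi> n x = \<zero>\<^bsub>ar Q n\<^esub>" if "x \<in> boundaries P n p" for x p
  proof -
    obtain y where "y \<in> hdeg P n (p + 1)" "x = dif P n y"
      using \<open>x \<in> boundaries P n p\<close> by (auto simp: boundaries_def)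
    moreover from this have "y \<in> carrier (ar P n)" using l.M.submodule_subset[OF sub] by blast
    ultimately show ?thesis using hom n by (simp add: dg_permutad_hom_def)
  qed
  have bc: "x \<in> cycles P n p" if "x \<in> boundaries P n p" for x p
  proof -
    obtain y where y: "y \<in> hdeg P n (p + 1)" "x = dif P n y"
      using \<open>x \<in> boundaries P n p\<close> by (auto simp: boundaries_def)
    then have "y \<in> carrier (ar P n)" using l.M.submodule_subset[OF sub] by blast
    then show ?thesis
      using P.dif_deg[OF n y(1)] P.dif_dif[OF n] y(2) by (simp add: cycles_def)
  qed
  have hP: "carrier (homology P n p) = (\<lambda>x. boundaries P n p +>\<^bsub>ar P n\<^esub> x) ` cycles P n p"
    by (auto simp: homology_def quot_module_def A_RCOSETS_def' a_r_coset_def')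
  have bQ: "boundaries (in_degree_0 Q) n p = {\<zero>\<^bsub>ar Q n\<^esub>}"
    using l.N.M.zero_closed by (auto simp: boundaries_def image_constant_conv)
  have hQ: "carrier (homology (in_degree_0 Q) n p) = (\<lambda>y. {y}) ` (if p = 0 then carrier (ar Q n) else {\<zero>\<^bsub>ar Q n\<^esub>})"
    by (auto simp: homology_def quot_module_def A_RCOSETS_def' a_r_coset_def' bQ cycles_def)
  have map: "homology_map (in_degree_0 Q) \<phi> n p (boundaries P n p +>\<^bsub>ar P n\<^esub> x) = {\<phi> n x}"
    if x: "x \<in> carrier (ar P n)" for x
  proof -
    have "\<phi> n ` (boundaries P n p +>\<^bsub>ar P n\<^esub> x) = {\<phi> n x}"
    proof (intro equalityI subsetI)
      fix y assume "y \<in> \<phi> n ` (boundaries P n p +>\<^bsub>ar P n\<^esub> x)"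
      then obtain h where h: "h \<in> boundaries P n p" "y = \<phi> n (h \<oplus>\<^bsub>ar P n\<^esub> x)"
        by (auto simp: a_r_coset_def')
      moreover have "h \<in> carrier (ar P n)" using h(1) l.M.submodule_subset[OF bsub] by auto
      ultimately show "y \<in> {\<phi> n x}" using b0 x l.f_add by simp
    qed (use l.M.coset_self[OF bsub x] in auto)
    then show ?thesis
      unfolding homology_map_def bQ set_add_def' using l.closed[OF x] by simp
  qed
  have cyc: "cycles P n p \<subseteq> carrier (ar P n)"
    using l.M.submodule_subset[OF sub] by (auto simp: cycles_def)
  show "bij_betw (homology_map (in_degree_0 Q) \<phi> n p) (carrier (homology P n p)) (carrier (homology (in_degree_0 Q) n p))"
    unfolding bij_betw_def
  proof
    have "homology_map (in_degree_0 Q) \<phi> n p ` carrier (homology P n p) = (\<lambda>x. {\<phi> n x}) ` cycles P n p"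
      unfolding hP image_image using cyc map by (intro image_cong) auto
    also have "\<dots> = (\<lambda>y. {y}) ` (\<phi> n ` cycles P n p)" by (simp add: image_image)
    also have "\<phi> n ` cycles P n p = (if p = 0 then carrier (ar Q n) else {\<zero>\<^bsub>ar Q n\<^esub>})"
    proof (cases "p = 0")
      case True
      then show ?thesis using cycles_0[OF n] surj[OF n] by simp
    next
      case False
      then have "cycles P n p = boundaries P n p" using acyclic[OF n] bc by blast
      moreover have "\<zero>\<^bsub>ar P n\<^esub> \<in> boundaries P n p" by (rule l.M.submodule_zero[OF bsub])
      ultimately show ?thesis using False b0 by force
    qed
    finally show "homology_map (in_degree_0 Q) \<phi> n p ` carrier (homology P n p) = carrier (homology (in_degree_0 Q) n p)"
      unfolding hQ .
    show "inj_on (homology_map (in_degree_0 Q) \<phi> n p) (carrier (homology P n p))"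
      unfolding hP
    proof (rule inj_onI)
      fix X Y assume "X \<in> (\<lambda>x. boundaries P n p +>\<^bsub>ar P n\<^esub> x) ` cycles P n p" "Y \<in> (\<lambda>x. boundaries P n p +>\<^bsub>ar P n\<^esub> x) ` cycles P n p"
        and eq: "homology_map (in_degree_0 Q) \<phi> n p X = homology_map (in_degree_0 Q) \<phi> n p Y"
      then obtain x y where xy: "x \<in> cycles P n p" "X = boundaries P n p +>\<^bsub>ar P n\<^esub> x"
          "y \<in> cycles P n p" "Y = boundaries P n p +>\<^bsub>ar P n\<^esub> y" by blast
      have c: "x \<in> carrier (ar P n)" "y \<in> carrier (ar P n)" using xy cyc by auto
      have \<phi>: "\<phi> n x = \<phi> n y" using eq map c xy by simp
      have "x \<ominus>\<^bsub>ar P n\<^esub> y \<in> boundaries P n p"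
      proof (cases "p = 0")
        case True
        have "x \<in> hdeg P n 0" "y \<in> hdeg P n 0" using xy True by (auto simp: cycles_def)
        then have "x \<ominus>\<^bsub>ar P n\<^esub> y \<in> hdeg P n 0" by (rule l.M.submodule_diff[OF sub])
        moreover have "\<phi> n (x \<ominus>\<^bsub>ar P n\<^esub> y) = \<zero>\<^bsub>ar Q n\<^esub>"
          using c \<phi> l.f_minus[OF c] l.N.M.diff_eq_zero_iff[of "\<phi> n x" "\<phi> n y"] by simp
        ultimately show ?thesis using ker[OF n] True by simp
      next
        case False
        then show ?thesis
          using acyclic[OF n False] xy(1,3) l.M.submodule_diff[OF bsub] by blast
      qed
      then show "X = Y" unfolding xy(2,4) using l.M.coset_eq_iff[OF bsub c] by simp
    qed
  qed
qed

section \<open>Boundaries of edges\<close>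

text \<open>The numbers \<open>count_list s j - 1\<close> are nonnegative and sum to
  \<open>length s - blocks s\<close>. These lists are therefore the permutations, the vertices of
  the permutohedron.\<close>

lemma sur_lists_2: "s \<in> sur_lists {2} m \<longleftrightarrow> length s = m \<and> surj_list s \<and> blocks s = m"
proof
  assume s: "s \<in> sur_lists {2} m"
  then have "(\<Sum>j<blocks s. count_list s j) = (\<Sum>j<blocks s. 1)"
    by (intro sum.cong) (auto simp: sur_lists_def)
  then show "length s = m \<and> surj_list s \<and> blocks s = m"
    using s sum_count_list[of s] by (simp add: sur_lists_def)
next
  assume s: "length s = m \<and> surj_list s \<and> blocks s = m"
  have "(\<Sum>j<m. count_list s j - 1) = (\<Sum>j<m. count_list s j) - (\<Sum>j<m. 1)"
    using s count_list_ge_1[of s] by (intro sum_subtractf_nat) auto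
  also have "\<dots> = 0" using s sum_count_list[of s] by simp
  finally have "\<forall>j<m. count_list s j - 1 = 0" by simp
  then have "\<forall>j<m. count_list s j = 1"
    using s count_list_ge_1[of s] by (metis le_antisym diff_is_0_eq)
  then show "s \<in> sur_lists {2} m" using s by (simp add: sur_lists_def)
qed

definition edge_lists :: "nat \<Rightarrow> nat list set"
  where "edge_lists m = {s. length s = m \<and> surj_list s \<and> Suc (blocks s) = m}"

text \<open>The numbers \<open>count_list s j - 1\<close> are nonnegative and sum to 1 here.\<close>

lemma edge_lists_counts:
  assumes "s \<in> edge_lists m"
  obtains l where "l < blocks s" "count_list s l = 2" "\<And>j. j < blocks s \<Longrightarrow> j \<noteq> l \<Longrightarrow> count_list s j = 1"
proof -
  have s: "length s = m" "surj_list s" "Suc (blocks s) = m" using assms by (auto simp: edge_lists_def)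
  have "(\<Sum>j<blocks s. count_list s j - 1) = (\<Sum>j<blocks s. count_list s j) - (\<Sum>j<blocks s. 1)"
    using s count_list_ge_1[of s] by (intro sum_subtractf_nat) auto
  also have "\<dots> = 1" using s sum_count_list[of s] by simp
  finally obtain l where l: "l < blocks s" "count_list s l - 1 = 1" "\<forall>j<blocks s. l \<noteq> j \<longrightarrow> count_list s j - 1 = 0"
    using sum_eq_1_iff[of "{..<blocks s}" "\<lambda>j. count_list s j - 1"] by auto
  show ?thesis
  proof (rule that[OF l(1)])
    show "count_list s l = 2" using l(2) by simp
    show "count_list s j = 1" if "j < blocks s" "j \<noteq> l" for j
      using l(3) that count_list_ge_1[OF s(2) that(1)] by (metis le_antisym diff_is_0_eq)
  qed
qed

context cring
begin

lemma free_module_restrict: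
  "f \<in> carrier (free_module R S) \<Longrightarrow> (\<And>s. f s \<noteq> \<zero> \<Longrightarrow> s \<in> T) \<Longrightarrow> f \<in> carrier (free_module R T)"
  by (auto simp: free_module_carrier)

lemma sur_lists_2_subset: "sur_lists {2} m \<subseteq> sur_lists {2..} m"
  by (auto simp: sur_lists_all sur_lists_2)

text \<open>Identifies the degree 0 part of the model for \<open>S = {2..}\<close> with the model
  for \<open>S = {2}\<close>, the free permutad of which \<open>permAs R\<close> is a
  quotient.\<close>

lemma deg_0_iff:
  "g \<in> carrier (free_module R (sur_lists {2..} m)) \<and> comb_deg R m 0 g
    \<longleftrightarrow> g \<in> carrier (free_module R (sur_lists {2} m))"
proof
  assume g: "g \<in> carrier (free_module R (sur_lists {2..} m)) \<and> comb_deg R m 0 g"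
  show "g \<in> carrier (free_module R (sur_lists {2} m))"
  proof (rule free_module_restrict[OF conjunct1[OF g]])
    fix s assume nz: "g s \<noteq> \<zero>"
    then have "s \<in> sur_lists {2..} m" by (rule free_module_support[OF conjunct1[OF g]])
    moreover have "int m - int (blocks s) = 0" using g nz unfolding comb_deg_def by blast
    ultimately show "s \<in> sur_lists {2} m" by (simp add: sur_lists_all sur_lists_2)
  qed
next
  assume g: "g \<in> carrier (free_module R (sur_lists {2} m))"
  have "comb_deg R m 0 g"
    unfolding comb_deg_def
  proof (intro allI impI)
    fix s assume "g s \<noteq> \<zero>"
    then have "s \<in> sur_lists {2} m" by (rule free_module_support[OF g])
    then show "int m - int (blocks s) = 0" by (simp add: sur_lists_2)
  qed
  then show "g \<in> carrier (free_module R (sur_lists {2..} m)) \<and> comb_deg R m 0 g"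
    using free_module_mono[OF g sur_lists_2_subset] by blast
qed

lemma deg_1_iff:
  "g \<in> carrier (free_module R (sur_lists {2..} m)) \<and> comb_deg R m 1 g
    \<longleftrightarrow> g \<in> carrier (free_module R (edge_lists m))"
proof
  assume g: "g \<in> carrier (free_module R (sur_lists {2..} m)) \<and> comb_deg R m 1 g"
  show "g \<in> carrier (free_module R (edge_lists m))"
  proof (rule free_module_restrict[OF conjunct1[OF g]])
    fix s assume nz: "g s \<noteq> \<zero>"
    then have "s \<in> sur_lists {2..} m" by (rule free_module_support[OF conjunct1[OF g]])
    moreover have "int m - int (blocks s) = 1" using g nz unfolding comb_deg_def by blast
    ultimately show "s \<in> edge_lists m" unfolding sur_lists_all edge_lists_def by simp
  qed
next
  assume g: "g \<in> carrier (free_module R (edge_lists m))"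
  have "comb_deg R m 1 g"
    unfolding comb_deg_def
  proof (intro allI impI)
    fix s assume "g s \<noteq> \<zero>"
    then have "s \<in> edge_lists m" by (rule free_module_support[OF g])
    then show "int m - int (blocks s) = 1" by (auto simp: edge_lists_def)
  qed
  moreover have "edge_lists m \<subseteq> sur_lists {2..} m" by (auto simp: sur_lists_all edge_lists_def)
  ultimately show "g \<in> carrier (free_module R (sur_lists {2..} m)) \<and> comb_deg R m 1 g"
    using free_module_mono[OF g] by blast
qed

text \<open>A merge has fewer blocks than points and so is never a permutation.\<close>

lemma comb_dif_deg_0:
  assumes g: "g \<in> carrier (free_module R (sur_lists {2} m))"
  shows "comb_dif R g = (\<lambda>_. \<zero>)"
proof (rule ext, rule ccontr)
  fix s assume "comb_dif R g s \<noteq> \<zero>"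
  then obtain i where i: "surj_list s" "Suc i < blocks s" "g (merge i s) \<noteq> \<zero>"
    using comb_dif_nonzero[OF g] by blast
  from free_module_support[OF g i(3)] have "blocks s - 1 = m" "length s = m"
    using blocks_merge[OF i(1,2)] by (auto simp: sur_lists_2 merge_def)
  then show False using blocks_le_length[of s] i(2) by simp
qed

lemma comb_dif_edges: "linear R (free_module R (edge_lists m)) (free_module R (sur_lists {2} m)) (comb_dif R)"
proof (rule linearI[OF free_module free_module])
  have in_all: "f \<in> carrier (free_module R (sur_lists {2..} m))" if "f \<in> carrier (free_module R (edge_lists m))" for f
    using that deg_1_iff by blast
  have "comb_dif R f \<in> carrier (free_module R (sur_lists {2} m))" if "f \<in> carrier (free_module R (edge_lists m))" for f
    proof -
    have "comb_deg R m 1 f" using that deg_1_iff by blast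
    from comb_dif_deg[OF that this] have "comb_deg R m 0 (comb_dif R f)" by simp
    then show ?thesis using comb_dif_closed[OF in_all[OF that]] deg_0_iff by blast
  qed
  then show "linear_map R (free_module R (edge_lists m)) (free_module R (sur_lists {2} m)) (comb_dif R)"
    using comb_dif_linear[of m] in_all by (auto simp: linear_map_def)
qed

text \<open>In the Leibniz rule only the summand at the one entry that may fail to be a cycle
  survives.\<close>

lemma comb_Gam_dif_single:
  assumes t: "surj_list t" and hs: "hs \<in> decorations (ar (comb R {2..})) t"
    and q: "\<And>j. j < blocks t \<Longrightarrow> comb_deg R (count_list t j) (q j) (hs ! j)"
    and l: "l < blocks t" "\<And>j. j < blocks t \<Longrightarrow> j \<noteq> l \<Longrightarrow> comb_dif R (hs ! j) = (\<lambda>_. \<zero>)"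
  shows "comb_dif R (comb_Gam R t hs) s
    = parity R (nat \<bar>\<Sum>j<l. q j\<bar>) \<otimes> comb_Gam R t (hs[l := comb_dif R (hs ! l)]) s"
proof -
  let ?T = "\<lambda>j. parity R (nat \<bar>\<Sum>i<j. q i\<bar>) \<otimes> comb_Gam R t (hs[j := comb_dif R (hs ! j)]) s"
  have c: "?T j \<in> carrier R" if "j < blocks t" for j
  proof -
    have "comb_Gam R t (hs[j := comb_dif R (hs ! j)]) \<in> carrier (free_module R (sur_lists {2..} (length t)))"
      by (rule comb_Gam_closed[OF t comb_Gam_dif_sum(2)[OF t hs _ that]]) (rule q)
    then show ?thesis by auto
  qed
  have z: "?T j = \<zero>" if "j < blocks t" "j \<noteq> l" for j
  proof -
    have "(\<Otimes>i\<in>{..<blocks t} - {j}. (hs ! i) (restr t s i)) \<in> carrier R"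
      using hs by (intro finprod_closed) (auto simp: decorations_def)
    then show ?thesis
      unfolding l(2)[OF that] comb_Gam_update[OF t hs that(1) zero_closed] by simp
  qed
  have "comb_dif R (comb_Gam R t hs) s = (\<Oplus>j\<in>{..<blocks t}. ?T j)"
    using q by (rule comb_Gam_dif[OF t hs])
  also have "\<dots> = (\<Oplus>j\<in>{l}. ?T j)"
    using l(1) c z by (intro add.finprod_mono_neutral_cong_right) auto
  also have "\<dots> = ?T l" using c[OF l(1)] by simp
  finally show ?thesis .
qed

text \<open>Here \<open>m\<close> counts points, so that the arity concerned is
  \<open>m + 1\<close>.\<close>

definition vertex_boundaries :: "nat \<Rightarrow> (nat list \<Rightarrow> 'a) set"
  where "vertex_boundaries m = comb_dif R ` carrier (free_module R (edge_lists m))"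

lemma vertex_boundaries_submodule: "submodule (vertex_boundaries m) R (free_module R (sur_lists {2} m))"
  unfolding vertex_boundaries_def
  by (rule linear.submodule_image[OF comb_dif_edges module.carrier_is_submodule[OF free_module]])

lemma vertex_boundaries_closed: "vertex_boundaries m \<subseteq> carrier (free_module R (sur_lists {2} m))"
  by (rule module.submodule_subset[OF free_module vertex_boundaries_submodule])

text \<open>A primitive of the entry \<open>j\<close> is put in its place. The other entries have
  degree 0 and are cycles, so the boundary of the new composite is the old composite; its sign is
  positive because the entries before \<open>j\<close> have degree 0.\<close>

lemma vertex_boundaries_ideal:
  assumes t: "surj_list t" and gs: "gs \<in> decorations (ar (comb R {2})) t"
    and j: "j < blocks t" "gs ! j \<in> vertex_boundaries (count_list t j)"
  shows "comb_Gam R t gs \<in> vertex_boundaries (length t)"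
proof -
  obtain w where w: "w \<in> carrier (free_module R (edge_lists (count_list t j)))" "gs ! j = comb_dif R w"
    using j(2) by (auto simp: vertex_boundaries_def)
  have gc: "gs ! i \<in> carrier (free_module R (sur_lists {2} (count_list t i)))" if "i < blocks t" for i
    using gs that unfolding decorations_comb_iff by blast
  have len: "length gs = blocks t" using gs by (simp add: decorations_def)
  let ?hs = "gs[j := w]" and ?q = "\<lambda>i. if i = j then 1 else 0 :: int"
  have hg: "?hs ! i \<in> carrier (free_module R (sur_lists {2..} (count_list t i))) \<and> comb_deg R (count_list t i) (?q i) (?hs ! i)"
    if "i < blocks t" for i
    using gc[OF that] deg_0_iff[of "gs ! i" "count_list t i"] deg_1_iff[of w "count_list t j"] w(1) that len
    by (cases "i = j") auto
  have hs: "?hs \<in> decorations (ar (comb R {2..})) t"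
    unfolding decorations_comb_iff using hg len by simp
  have q: "comb_deg R (count_list t i) (?q i) (?hs ! i)" if "i < blocks t" for i
    using hg[OF that] by blast
  have "comb_dif R (?hs ! i) = (\<lambda>_. \<zero>)" if "i < blocks t" "i \<noteq> j" for i
    using comb_dif_deg_0[OF gc[OF that(1)]] that(2) by simp
  then have "comb_dif R (comb_Gam R t ?hs) s
      = parity R (nat \<bar>\<Sum>i<j. ?q i\<bar>) \<otimes> comb_Gam R t (?hs[j := comb_dif R (?hs ! j)]) s" for s
    using q by (intro comb_Gam_dif_single[OF t hs _ j(1)])
  moreover have "?hs[j := comb_dif R (?hs ! j)] = gs"
    using w(2) j(1) len by (metis list_update_id list_update_overwrite nth_list_update_eq)
  moreover have "(\<Sum>i<j. ?q i) = 0" by simp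
  moreover have "comb_Gam R t gs s \<in> carrier R" for s
    using comb_Gam_closed[OF t gs] by auto
  ultimately have "comb_dif R (comb_Gam R t ?hs) = comb_Gam R t gs"
    by (simp add: fun_eq_iff parity_def)
  moreover have "comb_Gam R t ?hs \<in> carrier (free_module R (edge_lists (length t)))"
  proof -
    have "comb_deg R (length t) (\<Sum>i<blocks t. ?q i) (comb_Gam R t ?hs)"
      using q by (rule comb_Gam_deg[OF t hs])
    moreover have "(\<Sum>i<blocks t. ?q i) = 1" using j(1) by simp
    ultimately show ?thesis using comb_Gam_closed[OF t hs] deg_1_iff by metis
  qed
  ultimately show ?thesis unfolding vertex_boundaries_def by (metis imageI)
qed

text \<open>Coordinates of the defining relation of \<open>permAs R\<close>: the difference of the
  two composites of the binary generator with itself.\<close>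

definition square :: "nat list \<Rightarrow> 'a"
  where "square = basis_elem R [0, 1] \<ominus>\<^bsub>free_module R (sur_lists {2} 2)\<^esub> basis_elem R [1, 0]"

lemma surj_list_pair: "surj_list [a, b] \<and> blocks [a, b] = 2 \<longleftrightarrow> [a, b] = [0, 1] \<or> [a, b] = [1, 0]"
proof -
  have "surj_list [a, b] \<and> blocks [a, b] = 2 \<longleftrightarrow> [a, b] \<in> Sur 2 2" by (auto simp: Sur_iff)
  moreover have "{..<2} = {0, 1 :: nat}" by auto
  ultimately show ?thesis by (simp add: Sur_def doubleton_eq_iff)
qed

lemma sur_lists_2_2: "sur_lists {2} 2 = {[0, 1], [1, 0]}"
proof (intro equalityI subsetI)
  fix s assume "s \<in> sur_lists {2} 2"
  then have s: "length s = 2" "surj_list s" "blocks s = 2" by (auto simp: sur_lists_2)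
  then obtain a b where "s = [a, b]" by (auto simp: length_Suc_conv numeral_2_eq_2)
  then show "s \<in> {[0, 1], [1, 0]}" using s surj_list_pair[of a b] by simp
next
  fix s :: "nat list" assume "s \<in> {[0, 1], [1, 0]}"
  then show "s \<in> sur_lists {2} 2"
    using surj_list_pair[of 0 1] surj_list_pair[of 1 0] by (auto simp: sur_lists_2)
qed

lemma square_closed: "square \<in> carrier (free_module R (sur_lists {2} 2))"
proof -
  interpret F: module R "free_module R (sur_lists {2} 2)" by (rule free_module)
  show ?thesis
    unfolding square_def by (intro F.M.minus_closed basis_elem_closed) (auto simp: sur_lists_2_2)
qed

text \<open>The boundary exponents are 1 for \<open>[0, 1]\<close> and 2 for \<open>[1, 0]\<close>,
  whence the minus sign.\<close>

lemma comb_dif_square: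
  "comb_dif R (corolla_comb 2 \<one>) = \<ominus>\<^bsub>free_module R (sur_lists {2} 2)\<^esub> square"
proof
  fix s
  let ?F = "free_module R (sur_lists {2} 2)"
  have "basis_elem R [1, 0] \<in> carrier ?F" by (simp add: sur_lists_2_2)
  then have sq: "square s = basis_elem R [0, 1] s \<ominus> basis_elem R [1, 0] s"
    by (simp add: square_def a_minus_def free_module_a_inv)
  have "s \<in> Sur 2 2 \<longleftrightarrow> s = [0, 1] \<or> s = [1, 0]"
    using sur_lists_2_2 by (auto simp: Sur_iff sur_lists_2 set_eq_iff)
  moreover have "dexp [0, 1] 0 = 1" "dexp [1, 0] 0 = 2"
    by (simp_all add: dexp_def inversions_def)
  ultimately show "comb_dif R (corolla_comb 2 \<one>) s = (\<ominus>\<^bsub>?F\<^esub> square) s"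
    unfolding free_module_a_inv[OF square_closed] sq
    by (subst comb_dif_corolla) (auto simp: parity_def basis_elem_def a_minus_def)
qed

lemma square_boundary: "square \<in> vertex_boundaries 2"
proof -
  interpret F: module R "free_module R (sur_lists {2} 2)" by (rule free_module)
  have "corolla_comb 2 \<one> \<in> carrier (free_module R (edge_lists 2))"
    using corolla_comb_closed[of 2 \<one>] deg_1_iff[of "corolla_comb 2 \<one>" 2] by simp
  then have "\<ominus>\<^bsub>free_module R (sur_lists {2} 2)\<^esub> square \<in> vertex_boundaries 2"
    unfolding vertex_boundaries_def comb_dif_square[symmetric] by (rule imageI)
  from F.submoduleE(3)[OF vertex_boundaries_submodule this] show ?thesis
    using F.M.minus_minus[OF square_closed] by simp
qed

text \<open>Applied to the two permutations of two points in \<open>permAs_rel_square\<close> and to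
  the edges in \<open>vertex_boundaries_minimal\<close>.\<close>

lemma basis_as_Gam:
  assumes s: "s \<in> sur_lists {2..} m"
  shows "comb_Gam R s (map (\<lambda>j. corolla_comb (count_list s j) \<one>) [0..<blocks s]) = basis_elem R s"
proof -
  have "map (\<lambda>j. corolla_comb (count_list s j) \<one>) [0..<blocks s]
      = map (\<lambda>j. corolla_comb (count_list s j) (replicate (blocks s) \<one> ! j)) [0..<blocks s]"
    by simp
  then show ?thesis
    unfolding \<open>map _ _ = _\<close> using comb_Gam_corollas[OF ones_tree[OF s]] tree_val_ones[OF s] by simp
qed

section \<open>The ideal of relations of \<open>permAs R\<close>\<close>

abbreviation "binary_free \<equiv> free_permutad R (one_gens R {2})"
abbreviation "binary_fibre \<equiv> tree_fibre R {2}"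

lemma binary_free_decorations:
  assumes "t \<in> Sur n k" "\<mu>s \<in> decorations (ar binary_free) t"
  obtains gs where "gs \<in> decorations (ar (comb R {2})) t" "\<mu>s = map (\<lambda>j. binary_fibre (count_list t j) (gs ! j)) [0..<k]"
proof -
  have k: "blocks t = k" using assms(1) by (simp add: Sur_iff)
  have "\<exists>g. g \<in> carrier (free_module R (sur_lists {2} (count_list t j))) \<and> \<mu>s ! j = binary_fibre (count_list t j) g" if "j < k" for j
  proof -
    have "\<mu>s ! j \<in> carrier (tensor_sum R (one_gens R {2}) (count_list t j))"
      using assms(2) that k by (simp add: decorations_def)
    then show ?thesis unfolding tree_fibre_iso(1) by auto
  qed
  then obtain f where f: "\<And>j. j < k \<Longrightarrow> f j \<in> carrier (free_module R (sur_lists {2} (count_list t j))) \<and> \<mu>s ! j = binary_fibre (count_list t j) (f j)"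
    by metis
  show ?thesis
  proof (rule that[of "map f [0..<k]"])
    show "map f [0..<k] \<in> decorations (ar (comb R {2})) t"
      unfolding decorations_comb_iff using f k by simp
    show "\<mu>s = map (\<lambda>j. binary_fibre (count_list t j) (map f [0..<k] ! j)) [0..<k]"
      using assms(2) f k by (intro nth_equalityI) (auto simp: decorations_def)
  qed
qed

text \<open>The binary generator is the surjection on one point with unit decoration; the relation
  of arity 3 lives on two points.\<close>

lemma permAs_rel_square:
  "permAs_rel R n = (if n = 3 then {binary_fibre 2 square} else {})"
proof -
  interpret l: linear R "free_module R (sur_lists {2} 2)" "tensor_sum R (one_gens R {2}) 2" "binary_fibre 2"
    by (rule tree_fibre_linear)
  let ?\<mu> = "tree_class R (one_gens R {2}) (corolla 1) [\<one>]"
  have s1: "[0] \<in> sur_lists {2} 1"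
    by (auto simp: sur_lists_2 surj_list_def blocks_def)
  have "?\<mu> = binary_fibre 1 (basis_elem R [0])"
    using tree_class_fibre[of "[0]" "[\<one>]" "{2}"] ones_tree[OF s1] tree_val_ones[OF s1]
    by (simp add: corolla_def blocks_def)
  moreover have "basis_elem R [0] = corolla_comb 1 \<one>"
    by (auto simp: basis_elem_def corolla_comb_def corolla_def)
  ultimately have \<mu>: "?\<mu> = binary_fibre 1 (corolla_comb 1 \<one>)" by simp
  have Gam: "Gam binary_free s [?\<mu>, ?\<mu>] = binary_fibre 2 (basis_elem R s)" if "s = [0, 1] \<or> s = [1, 0]" for s
  proof -
    have s2: "s \<in> sur_lists {2} 2" using that by (auto simp: sur_lists_2_2)
    then have s: "surj_list s" "blocks s = 2" "length s = 2" by (auto simp: sur_lists_2)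
    have cnt: "count_list s 0 = 1" "count_list s 1 = 1" using that by auto
    let ?gs = "map (\<lambda>j. corolla_comb (count_list s j) \<one>) [0..<blocks s]"
    have c1: "corolla_comb 1 \<one> \<in> carrier (free_module R (sur_lists {2} 1))"
      using corolla_comb_closed[of 1 \<one>] deg_0_iff[of "corolla_comb 1 \<one>" 1] by simp
    have "?gs ! j \<in> carrier (free_module R (sur_lists {2} (count_list s j)))" if "j < blocks s" for j
      using that s(2) cnt c1 by (auto simp: less_2_cases_iff)
    then have gs: "?gs \<in> decorations (ar (comb R {2})) s"
      unfolding decorations_comb_iff by simp
    have "map (\<lambda>j. binary_fibre (count_list s j) (?gs ! j)) [0..<blocks s] = [?\<mu>, ?\<mu>]"
      unfolding \<mu> using s(2) cnt by (simp add: upt_rec numeral_2_eq_2)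
    then show ?thesis
      using free_Gam_fibre[OF s(1) gs] basis_as_Gam[of s 2] s by (simp add: sur_lists_all del: free_permutad_simps)
  qed
  have "Gam binary_free [0, 1] [?\<mu>, ?\<mu>] \<ominus>\<^bsub>ar binary_free 3\<^esub> Gam binary_free [1, 0] [?\<mu>, ?\<mu>] = binary_fibre 2 square"
    using Gam[of "[0, 1]"] Gam[of "[1, 0]"] l.f_minus[of "basis_elem R [0, 1]" "basis_elem R [1, 0]"]
    by (simp add: square_def sur_lists_2_2 del: free_permutad_simps(2,3))
  then show ?thesis
    by (simp add: permAs_rel_def permAs_gens_eq Let_def del: free_permutad_simps)
qed

lemma vertex_boundaries_is_ideal: "permutad_ideal R binary_free (\<lambda>n. binary_fibre (n - 1) ` vertex_boundaries (n - 1))"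
  unfolding permutad_ideal_def
proof (intro conjI allI impI ballI)
  fix n :: nat
  show "submodule (binary_fibre (n - 1) ` vertex_boundaries (n - 1)) R (ar binary_free n)"
    using linear.submodule_image[OF tree_fibre_linear vertex_boundaries_submodule] by simp
next
  fix n k t \<mu>s assume n: "n \<ge> (1::nat)" and t: "t \<in> Sur n k" and \<mu>s: "\<mu>s \<in> decorations (ar binary_free) t"
    and ex: "\<exists>j<k. \<mu>s ! j \<in> binary_fibre (count_list t j + 1 - 1) ` vertex_boundaries (count_list t j + 1 - 1)"
  have st: "surj_list t" "blocks t = k" "length t = n" using t by (auto simp: Sur_iff)
  obtain gs where gs: "gs \<in> decorations (ar (comb R {2})) t" "\<mu>s = map (\<lambda>j. binary_fibre (count_list t j) (gs ! j)) [0..<k]"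
    using binary_free_decorations[OF t \<mu>s] .
  obtain j b where j: "j < k" and b: "b \<in> vertex_boundaries (count_list t j)" "\<mu>s ! j = binary_fibre (count_list t j) b"
    using ex by auto
  have "gs ! j \<in> carrier (free_module R (sur_lists {2} (count_list t j)))"
    using gs(1) j st(2) unfolding decorations_comb_iff by blast
  moreover have "b \<in> carrier (free_module R (sur_lists {2} (count_list t j)))"
    using b(1) vertex_boundaries_closed by blast
  moreover have "binary_fibre (count_list t j) (gs ! j) = binary_fibre (count_list t j) b"
    using b(2) gs(2) j by simp
  ultimately have "gs ! j = b" using inj_onD[OF tree_fibre_iso(5)] by blast
  then have "comb_Gam R t gs \<in> vertex_boundaries n"
    using vertex_boundaries_ideal[OF st(1) gs(1), of j] j b(1) st by simp
  moreover have "Gam binary_free t \<mu>s = binary_fibre n (comb_Gam R t gs)"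
    using free_Gam_fibre[OF st(1) gs(1)] gs(2) st by (simp del: free_permutad_simps)
  ultimately show "Gam binary_free t \<mu>s \<in> binary_fibre (n + 1 - 1) ` vertex_boundaries (n + 1 - 1)"
    by (simp del: free_permutad_simps)
qed

text \<open>An edge has exactly one fibre of size two, so it is a composite of corollas on one point
  and one corolla on two points. Its boundary is, up to sign, the composite with the relation at
  that place, and lies in every ideal that contains the relation.\<close>

lemma vertex_boundaries_minimal:
  assumes J: "permutad_ideal R binary_free J" and rel: "\<And>n. n \<ge> 1 \<Longrightarrow> permAs_rel R n \<subseteq> J n"
  shows "binary_fibre m ` vertex_boundaries m \<subseteq> J (m + 1)"
proof
  have sub: "submodule (J (m + 1)) R (tensor_sum R (one_gens R {2}) m)" for m
  proof -
    have "\<forall>n\<ge>1. submodule (J n) R (ar binary_free n)" using J unfolding permutad_ideal_def by (rule conjunct1)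
    from mp[OF spec[OF this, of "m + 1"]] have "submodule (J (m + 1)) R (ar binary_free (m + 1))" by simp
    then show ?thesis by simp
  qed
  have sq: "binary_fibre 2 square \<in> J 3" using rel[of 3] permAs_rel_square[of 3] by simp
  let ?V = "free_module R (sur_lists {2} m)"
  interpret l: linear R ?V "tensor_sum R (one_gens R {2}) m" "binary_fibre m" by (rule tree_fibre_linear)
  interpret d: linear R "free_module R (edge_lists m)" ?V "comb_dif R" by (rule comb_dif_edges)
  let ?J = "{g \<in> carrier ?V. binary_fibre m g \<in> J (m + 1)}"
  have Jsub: "submodule ?J R ?V" by (rule l.submodule_preimage[OF sub])
  fix X assume "X \<in> binary_fibre m ` vertex_boundaries m"
  then obtain w where w: "w \<in> carrier (free_module R (edge_lists m))" "X = binary_fibre m (comb_dif R w)"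
    by (auto simp: vertex_boundaries_def)
  have "w \<in> {w \<in> carrier (free_module R (edge_lists m)). comb_dif R w \<in> ?J}"
  proof (rule free_module_span[OF d.submodule_preimage[OF Jsub] w(1)])
    fix s assume "w s \<noteq> \<zero>"
    then have s: "s \<in> edge_lists m" by (rule free_module_support[OF w(1)])
    then have st: "surj_list s" "length s = m" "Suc (blocks s) = m" by (auto simp: edge_lists_def)
    obtain l where l: "l < blocks s" "count_list s l = 2" "\<And>j. j < blocks s \<Longrightarrow> j \<noteq> l \<Longrightarrow> count_list s j = 1"
      by (rule edge_lists_counts[OF s]) (rule that)
    let ?gs = "map (\<lambda>j. corolla_comb (count_list s j) \<one>) [0..<blocks s]"
    \<comment> \<open>The corolla on two points is replaced by its boundary, which is minus the
      relation.\<close>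
    let ?hs = "?gs[l := comb_dif R (?gs ! l)]"
    have cc: "corolla_comb (count_list s j) \<one> \<in> carrier (free_module R (sur_lists {2..} (count_list s j)))"
      "comb_deg R (count_list s j) (int (count_list s j) - 1) (corolla_comb (count_list s j) \<one>)" if "j < blocks s" for j
      using corolla_comb_closed[OF count_list_ge_1[OF st(1) that]] by auto
    have gs: "?gs \<in> decorations (ar (comb R {2..})) s"
      unfolding decorations_comb_iff using cc(1) by simp
    have q: "comb_deg R (count_list s j) (int (count_list s j) - 1) (?gs ! j)" if "j < blocks s" for j
      using cc(2) that by simp
    have c1: "corolla_comb 1 \<one> \<in> carrier (free_module R (sur_lists {2} 1))"
      using corolla_comb_closed[of 1 \<one>] deg_0_iff[of "corolla_comb 1 \<one>" 1] by simp
    have "comb_dif R (?gs ! j) = (\<lambda>_. \<zero>)" if "j < blocks s" "j \<noteq> l" for j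
      using comb_dif_deg_0[OF c1] l(3)[OF that] that by simp
    then have single: "comb_dif R (comb_Gam R s ?gs) u
        = parity R (nat \<bar>\<Sum>j<l. int (count_list s j) - 1\<bar>) \<otimes> comb_Gam R s ?hs u" for u
      using q by (intro comb_Gam_dif_single[OF st(1) gs _ l(1)])
    have hl: "?hs ! l = \<ominus>\<^bsub>free_module R (sur_lists {2} 2)\<^esub> square"
      using l(1,2) comb_dif_square by simp
    interpret F2: module R "free_module R (sur_lists {2} 2)" by (rule free_module)
    have "?hs ! j \<in> carrier (free_module R (sur_lists {2} (count_list s j)))" if "j < blocks s" for j
      using that l(2,3) c1 hl F2.M.a_inv_closed[OF square_closed] by (cases "j = l") auto
    then have hs: "?hs \<in> decorations (ar (comb R {2})) s"
      unfolding decorations_comb_iff by simp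
    have "binary_fibre m (comb_Gam R s ?hs) \<in> J (m + 1)"
    proof -
      let ?\<mu>s = "map (\<lambda>j. binary_fibre (count_list s j) (?hs ! j)) [0..<blocks s]"
      have "?\<mu>s ! j \<in> carrier (ar binary_free (count_list s j + 1))" if "j < blocks s" for j
      proof -
        have "?hs ! j \<in> carrier (free_module R (sur_lists {2} (count_list s j)))"
          using hs that unfolding decorations_comb_iff by blast
        then show ?thesis using linear.closed[OF tree_fibre_linear] that by simp
      qed
      then have "?\<mu>s \<in> decorations (ar binary_free) s" by (simp add: decorations_def)
      moreover have "?\<mu>s ! l \<in> J (count_list s l + 1)"
      proof -
        interpret l2: linear R "free_module R (sur_lists {2} 2)" "tensor_sum R (one_gens R {2}) 2" "binary_fibre 2"
          by (rule tree_fibre_linear)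
        have "binary_fibre 2 (\<ominus>\<^bsub>free_module R (sur_lists {2} 2)\<^esub> square) \<in> J (2 + 1)"
          unfolding l2.f_a_inv[OF square_closed] using sq by (intro l2.N.submoduleE(3)[OF sub]) simp
        then show ?thesis using l(1,2) hl by simp
      qed
      moreover have "s \<in> Sur m (blocks s)" "m \<ge> 1" using st by (auto simp: Sur_iff)
      ultimately have "Gam binary_free s ?\<mu>s \<in> J (m + 1)"
        using J l(1) unfolding permutad_ideal_def by blast
      then show ?thesis
        using free_Gam_fibre[OF st(1) hs] st(2) by simp
    qed
    then have "comb_Gam R s ?hs \<in> ?J"
      using comb_Gam_closed[OF st(1) hs] st(2) by simp
    then have "parity R (nat \<bar>\<Sum>j<l. int (count_list s j) - 1\<bar>) \<odot>\<^bsub>?V\<^esub> comb_Gam R s ?hs \<in> ?J"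
      by (intro l.M.submoduleE(4)[OF Jsub]) auto
    moreover have "comb_Gam R s ?gs = basis_elem R s"
      using st by (intro basis_as_Gam[of s m]) (simp add: sur_lists_all)
    moreover have "comb_dif R (comb_Gam R s ?gs) = parity R (nat \<bar>\<Sum>j<l. int (count_list s j) - 1\<bar>) \<odot>\<^bsub>?V\<^esub> comb_Gam R s ?hs"
      using single by (simp add: fun_eq_iff)
    ultimately show "basis_elem R s \<in> {w \<in> carrier (free_module R (edge_lists m)). comb_dif R w \<in> ?J}"
      using s by simp
  qed
  then show "X \<in> J (m + 1)" using w(2) by simp
qed

text \<open>Stated from arity 1 on, because ideals are unconstrained in arity 0.\<close>

proposition permAs_ideal:
  assumes "n \<ge> 1"
  shows "gen_ideal R binary_free (permAs_rel R) n = binary_fibre (n - 1) ` vertex_boundaries (n - 1)"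
proof
  have "permAs_rel R m \<subseteq> binary_fibre (m - 1) ` vertex_boundaries (m - 1)" for m
    using square_boundary by (auto simp: permAs_rel_square)
  then show "gen_ideal R binary_free (permAs_rel R) n \<subseteq> binary_fibre (n - 1) ` vertex_boundaries (n - 1)"
    unfolding gen_ideal_def using vertex_boundaries_is_ideal by blast
  show "binary_fibre (n - 1) ` vertex_boundaries (n - 1) \<subseteq> gen_ideal R binary_free (permAs_rel R) n"
    unfolding gen_ideal_def using vertex_boundaries_minimal[of _ "n - 1"] assms by fastforce
qed

end

section \<open>The projection onto permAs\<close>

context cring
begin

definition vertex_part :: "nat \<Rightarrow> (nat list \<Rightarrow> 'a) \<Rightarrow> nat list \<Rightarrow> 'a"
  where "vertex_part m g = (\<lambda>s. if s \<in> sur_lists {2} m then g s else \<zero>)"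

lemma vertex_part_id: "g \<in> carrier (free_module R (sur_lists {2} m)) \<Longrightarrow> vertex_part m g = g"
  unfolding free_module_carrier vertex_part_def by auto

lemma vertex_part_closed:
  assumes "g \<in> carrier (free_module R S)"
  shows "vertex_part m g \<in> carrier (free_module R (sur_lists {2} m))"
proof -
  have "finite {s. vertex_part m g s \<noteq> \<zero>}"
    by (rule finite_subset[OF _ finite_sur_lists[of "{2}" m]]) (auto simp: vertex_part_def)
  moreover have "vertex_part m g s \<in> carrier R" for s
    using free_module_closed[OF assms] by (simp add: vertex_part_def)
  ultimately show ?thesis unfolding free_module_carrier by (simp add: vertex_part_def)
qed

lemma vertex_part_linear:
  "linear_map R (free_module R S) (free_module R (sur_lists {2} m)) (vertex_part m)"
  unfolding linear_map_def
proof (intro conjI ballI funcsetI vertex_part_closed)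
  fix x y assume "x \<in> carrier (free_module R S)" "y \<in> carrier (free_module R S)"
  then show "vertex_part m (x \<oplus>\<^bsub>free_module R S\<^esub> y)
      = vertex_part m x \<oplus>\<^bsub>free_module R (sur_lists {2} m)\<^esub> vertex_part m y"
    by (simp add: vertex_part_def fun_eq_iff)
next
  fix c x assume "c \<in> carrier R" "x \<in> carrier (free_module R S)"
  then show "vertex_part m (c \<odot>\<^bsub>free_module R S\<^esub> x)
      = c \<odot>\<^bsub>free_module R (sur_lists {2} m)\<^esub> vertex_part m x"
    by (simp add: vertex_part_def fun_eq_iff)
qed

lemma vertex_part_deg:
  assumes "comb_deg R m p g" "p \<noteq> 0"
  shows "vertex_part m g = (\<lambda>_. \<zero>)"
proof
  fix s
  have "g s = \<zero>" if "s \<in> sur_lists {2} m"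
  proof (rule ccontr)
    assume "g s \<noteq> \<zero>"
    then have "int m - int (blocks s) = p" using assms(1) unfolding comb_deg_def by blast
    then show False using assms(2) that by (simp add: sur_lists_2)
  qed
  then show "vertex_part m g s = \<zero>" by (simp add: vertex_part_def)
qed

text \<open>Permutations occur only in boundaries of edges, so the restriction of \<open>g\<close>
  to the edges is a primitive.\<close>

lemma vertex_part_dif:
  assumes g: "g \<in> carrier (free_module R (sur_lists {2..} m))"
  shows "vertex_part m (comb_dif R g) \<in> vertex_boundaries m"
proof -
  define h where "h = (\<lambda>s. if s \<in> edge_lists m then g s else \<zero>)"
  have "{s. h s \<noteq> \<zero>} \<subseteq> {s. g s \<noteq> \<zero>}" by (auto simp: h_def)
  then have "finite {s. h s \<noteq> \<zero>}"
    by (rule finite_subset) (use g in \<open>simp add: free_module_carrier\<close>)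
  moreover have "h s \<in> carrier R" for s
    using free_module_closed[OF g] by (simp add: h_def)
  ultimately have h: "h \<in> carrier (free_module R (edge_lists m))"
    unfolding free_module_carrier by (simp add: h_def)
  have "comb_dif R h = vertex_part m (comb_dif R g)"
  proof
    fix s
    show "comb_dif R h s = vertex_part m (comb_dif R g) s"
    proof (cases "s \<in> sur_lists {2} m")
      case True
      then have s: "surj_list s" "blocks s = m" "length s = m" by (auto simp: sur_lists_2)
      have "h (merge i s) = g (merge i s)" if "i \<in> {..<blocks s - 1}" for i
      proof -
        have "Suc i < blocks s" using that by auto
        then have "merge i s \<in> edge_lists m"
          using blocks_merge[OF s(1)] surj_merge[OF s(1)] s by (simp add: edge_lists_def)
        then show ?thesis by (simp add: h_def)
      qed
      then have "comb_dif R h s = comb_dif R g s"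
        using s(1) free_module_closed[OF g] unfolding comb_dif_def by (auto intro!: finsum_cong')
      then show ?thesis using True by (simp add: vertex_part_def)
    next
      case False
      have "comb_dif R h \<in> carrier (free_module R (sur_lists {2} m))"
        by (rule linear.closed[OF comb_dif_edges h])
      then have "comb_dif R h s = \<zero>" using False unfolding free_module_carrier by blast
      then show ?thesis using False by (simp add: vertex_part_def)
    qed
  qed
  then show ?thesis using h unfolding vertex_boundaries_def by (metis imageI)
qed

text \<open>A composite is a permutation exactly when all its pieces are, by
  \<open>sur_lists_sur_subst\<close>; hence restricting coordinates to permutations commutes with
  composition.\<close>

lemma vertex_part_Gam:
  assumes t: "surj_list t" and gs: "gs \<in> decorations (ar (comb R {2..})) t"
  shows "vertex_part (length t) (comb_Gam R t gs)
    = comb_Gam R t (map (\<lambda>j. vertex_part (count_list t j) (gs ! j)) [0..<blocks t])"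
    (is "_ = comb_Gam R t ?hs")
proof
  have gc: "(gs ! j) u \<in> carrier R" if "j < blocks t" for j u
    using gs that unfolding decorations_comb_iff by auto
  then have hc: "(?hs ! j) u \<in> carrier R" if "j < blocks t" for j u
    using that by (simp add: vertex_part_def)
  fix s
  show "vertex_part (length t) (comb_Gam R t gs) s = comb_Gam R t ?hs s"
    using t
  proof (cases rule: comb_Gam_cases[where s = s])
    case (decomposed us)
    note G = comb_Gam_sur_subst[OF t decomposed(1), folded decomposed(2)]
    show ?thesis
    proof (cases "\<forall>j<blocks t. us ! j \<in> sur_lists {2} (count_list t j)")
      case True
      then have "s \<in> sur_lists {2} (length t)"
        using sur_lists_sur_subst[OF t decomposed(1)] decomposed(2) by simp
      then have "vertex_part (length t) (comb_Gam R t gs) s = (\<Otimes>j\<in>{..<blocks t}. (gs ! j) (us ! j))"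
        using G[of gs] gc by (simp add: vertex_part_def)
      also have "\<dots> = (\<Otimes>j\<in>{..<blocks t}. (?hs ! j) (us ! j))"
        using True gc by (intro finprod_cong') (auto simp: vertex_part_def)
      also have "\<dots> = comb_Gam R t ?hs s" using G[of ?hs] hc by simp
      finally show ?thesis .
    next
      case False
      then obtain j where j: "j < blocks t" "us ! j \<notin> sur_lists {2} (count_list t j)" by blast
      have "s \<notin> sur_lists {2} (length t)"
        using False sur_lists_sur_subst[OF t decomposed(1)] decomposed(2) by simp
      then have "vertex_part (length t) (comb_Gam R t gs) s = \<zero>" by (simp add: vertex_part_def)
      also have "\<zero> = (\<Otimes>j\<in>{..<blocks t}. (?hs ! j) (us ! j))"
        using j hc by (intro finprod_zero[of j, symmetric]) (auto simp: vertex_part_def)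
      also have "\<dots> = comb_Gam R t ?hs s" using G[of ?hs] hc by simp
      finally show ?thesis .
    qed
  next
    case other
    then show ?thesis by (simp add: vertex_part_def)
  qed
qed

lemma vertex_part_hom: "permutad_hom R (comb R {2..}) (comb R {2}) (\<lambda>n. vertex_part (n - 1))"
  unfolding permutad_hom_def
proof (intro conjI allI impI ballI permutad_comb)
  fix n :: nat
  show "linear_map R (ar (comb R {2..}) n) (ar (comb R {2}) n) (vertex_part (n - 1))"
    using vertex_part_linear by simp
next
  show "vertex_part (1 - 1) (ident (comb R {2..})) = ident (comb R {2})"
    by (auto simp: vertex_part_def basis_elem_def sur_lists_0)
next
  fix n k t gs assume "t \<in> Sur n k" and gs: "gs \<in> decorations (ar (comb R {2..})) t"
  then have t: "surj_list t" "blocks t = k" "length t = n" by (auto simp: Sur_iff)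
  show "vertex_part (n + 1 - 1) (Gam (comb R {2..}) t gs)
      = Gam (comb R {2}) t (map (\<lambda>j. vertex_part (count_list t j + 1 - 1) (gs ! j)) [0..<k])"
    using vertex_part_Gam[OF t(1) gs] t by simp
qed

lemma permAs_quot: "permAs R = quot_permutad binary_free (gen_ideal R binary_free (permAs_rel R))"
  by (simp add: permAs_def Let_def permAs_gens_eq)

text \<open>There are no edges on zero points, so the ideal vanishes in arity 1, as
  \<open>quot_permutad\<close> requires.\<close>

lemma permAs_permutad:
  shows "permutad R (permAs R)"
    and "permutad_hom R binary_free (permAs R) (\<lambda>n x. gen_ideal R binary_free (permAs_rel R) n +>\<^bsub>ar binary_free n\<^esub> x)"
    and "permutad_ideal R binary_free (gen_ideal R binary_free (permAs_rel R))"
proof -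
  let ?I = "gen_ideal R binary_free (permAs_rel R)" and ?J = "\<lambda>n. binary_fibre (n - 1) ` vertex_boundaries (n - 1)"
  have eq: "?I n = ?J n" if "n \<ge> 1" for n by (rule permAs_ideal[OF that])
  \<comment> \<open>The second half of \<open>permutad_ideal\<close> mentions the ideal only in
    arities of successor form, and this shape lets it be rewritten there.\<close>
  then have eq1: "?I (n + 1) = ?J (n + 1)" for n by simp
  have J: "permutad_ideal R binary_free ?J" by (rule vertex_boundaries_is_ideal)
  show I: "permutad_ideal R binary_free ?I"
    unfolding permutad_ideal_def eq1
  proof (rule conjI)
    show "\<forall>n\<ge>1. submodule (?I n) R (ar binary_free n)"
      using conjunct1[OF J[unfolded permutad_ideal_def]] eq by metis
  qed (rule conjunct2[OF J[unfolded permutad_ideal_def]])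
  have "vertex_boundaries 0 = {\<lambda>_. \<zero>}"
  proof -
    have "carrier (free_module R (edge_lists 0)) = {\<lambda>_. \<zero>}"
      by (auto simp: free_module_carrier edge_lists_def fun_eq_iff)
    moreover have "comb_dif R (\<lambda>_. \<zero>) = (\<lambda>_. \<zero>)"
      using linear.f_zero[OF comb_dif_edges] by simp
    ultimately show ?thesis by (simp add: vertex_boundaries_def)
  qed
  moreover have "binary_fibre 0 (\<lambda>_. \<zero>) = \<zero>\<^bsub>tensor_sum R (one_gens R {2}) 0\<^esub>"
    using linear.f_zero[OF tree_fibre_linear] by simp
  ultimately have "?I 1 = {\<zero>\<^bsub>ar binary_free 1\<^esub>}"
    by (subst permAs_ideal) simp_all
  from permutad.quot_permutad[OF free_permutad_comb(1) I this]
  show "permutad R (permAs R)" "permutad_hom R binary_free (permAs R) (\<lambda>n x. ?I n +>\<^bsub>ar binary_free n\<^esub> x)"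
    unfolding permAs_quot by blast+
qed

definition vertex_class :: "nat \<Rightarrow> (nat list \<Rightarrow> 'a) \<Rightarrow> ('a, 'a) tree_comb set set"
  where "vertex_class n g = gen_ideal R binary_free (permAs_rel R) n +>\<^bsub>ar binary_free n\<^esub> binary_fibre (n - 1) (vertex_part (n - 1) g)"

lemma vertex_class_hom: "permutad_hom R (comb R {2..}) (permAs R) vertex_class"
proof -
  have "permutad_hom R (comb R {2}) binary_free (\<lambda>n. binary_fibre (n - 1))"
    using free_permutad_comb(2)[of "{2}"] unfolding permutad_iso_def by blast
  from permutad_hom_compose[OF permutad_hom_compose[OF vertex_part_hom this] permAs_permutad(2)]
  show ?thesis unfolding vertex_class_def .
qed

text \<open>The coordinate map is injective on classes, so membership in the ideal is decided on
  coordinates, where the ideal consists of the boundaries. This gives both the compatibility with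
  differentials and the kernel in degree 0.\<close>

lemma vertex_class_eq_zero_iff:
  assumes n: "n \<ge> 1" and g: "g \<in> carrier (free_module R S)"
  shows "vertex_class n g = \<zero>\<^bsub>ar (permAs R) n\<^esub> \<longleftrightarrow> vertex_part (n - 1) g \<in> vertex_boundaries (n - 1)"
proof -
  let ?I = "gen_ideal R binary_free (permAs_rel R)" and ?m = "n - 1"
  let ?A = "tensor_sum R (one_gens R {2}) ?m"
  interpret l: linear R "free_module R (sur_lists {2} ?m)" ?A "binary_fibre ?m" by (rule tree_fibre_linear)
  have I: "?I n = binary_fibre ?m ` vertex_boundaries ?m" by (rule permAs_ideal[OF n])
  have sub: "submodule (?I n) R ?A"
    unfolding I by (rule l.submodule_image[OF vertex_boundaries_submodule])
  have v: "vertex_part ?m g \<in> carrier (free_module R (sur_lists {2} ?m))" by (rule vertex_part_closed[OF g])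
  have "vertex_class n g = \<zero>\<^bsub>ar (permAs R) n\<^esub> \<longleftrightarrow> ?I n +>\<^bsub>?A\<^esub> binary_fibre ?m (vertex_part ?m g) = ?I n +>\<^bsub>?A\<^esub> \<zero>\<^bsub>?A\<^esub>"
    unfolding l.N.coset_zero[OF sub]
    by (simp add: vertex_class_def permAs_quot quot_permutad_def quot_module_def)
  also have "\<dots> \<longleftrightarrow> binary_fibre ?m (vertex_part ?m g) \<ominus>\<^bsub>?A\<^esub> \<zero>\<^bsub>?A\<^esub> \<in> ?I n"
    by (rule l.N.coset_eq_iff[OF sub l.closed[OF v] l.N.M.zero_closed])
  also have "binary_fibre ?m (vertex_part ?m g) \<ominus>\<^bsub>?A\<^esub> \<zero>\<^bsub>?A\<^esub> = binary_fibre ?m (vertex_part ?m g)"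
    by (rule l.N.M.diff_zero[OF l.closed[OF v]])
  also have "binary_fibre ?m (vertex_part ?m g) \<in> ?I n \<longleftrightarrow> vertex_part ?m g \<in> vertex_boundaries ?m"
    unfolding I by (rule inj_on_image_mem_iff[OF tree_fibre_iso(5) v vertex_boundaries_closed])
  finally show ?thesis .
qed

end

lemma permutad_in_degree_0: "permutad R (in_degree_0 P) \<longleftrightarrow> permutad R P"
  by (simp add: permutad_def)

context cring
begin

section \<open>The quasi-isomorphism from \<open>permAs_inf R\<close> to
  \<open>permAs R\<close>\<close>

lemma permAs_inf_hdeg:
  assumes "n \<ge> 1"
  shows "hdeg (permAs_inf R) n p = tree_fibre R {2..} (n - 1) `
    {g \<in> carrier (free_module R (sur_lists {2..} (n - 1))). comb_deg R (n - 1) p g}"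
  using inf_hdeg_fibre[of "n - 1" p] assms by simp

lemma permAs_inf_dif:
  assumes "n \<ge> 1" "g \<in> carrier (free_module R (sur_lists {2..} (n - 1)))"
  shows "dif (permAs_inf R) n (tree_fibre R {2..} (n - 1) g) = tree_fibre R {2..} (n - 1) (comb_dif R g)"
  using inf_dif_fibre[OF assms(2)] assms(1) by simp

lemma permAs_inf_dif_eq_zero_iff:
  assumes "n \<ge> 1" "g \<in> carrier (free_module R (sur_lists {2..} (n - 1)))"
  shows "dif (permAs_inf R) n (tree_fibre R {2..} (n - 1) g) = \<zero>\<^bsub>ar (permAs_inf R) n\<^esub>
    \<longleftrightarrow> comb_dif R g = (\<lambda>_. \<zero>)"
proof -
  let ?F = "free_module R (sur_lists {2..} (n - 1))" and ?\<phi> = "tree_fibre R {2..} (n - 1)"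
  interpret l: linear R ?F "tensor_sum R (one_gens R {2..}) (n - 1)" ?\<phi> by (rule tree_fibre_linear)
  have "\<zero>\<^bsub>ar (permAs_inf R) n\<^esub> = ?\<phi> \<zero>\<^bsub>?F\<^esub>"
    using l.f_zero by (simp add: inf_gens_eq)
  then have "dif (permAs_inf R) n (?\<phi> g) = \<zero>\<^bsub>ar (permAs_inf R) n\<^esub> \<longleftrightarrow> ?\<phi> (comb_dif R g) = ?\<phi> \<zero>\<^bsub>?F\<^esub>"
    using permAs_inf_dif[OF assms] by simp
  also have "\<dots> \<longleftrightarrow> comb_dif R g = \<zero>\<^bsub>?F\<^esub>"
    by (rule inj_on_eq_iff[OF tree_fibre_iso(5) comb_dif_closed[OF assms(2)] l.M.M.zero_closed])
  finally show ?thesis by simp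
qed

definition perm_proj :: "nat \<Rightarrow> ('a, 'a) tree_comb set \<Rightarrow> ('a, 'a) tree_comb set set"
  where "perm_proj n X = vertex_class n (the_inv_into (carrier (ar (comb R {2..}) n)) (tree_fibre R {2..} (n - 1)) X)"

lemma perm_proj_fibre:
  assumes "g \<in> carrier (free_module R (sur_lists {2..} (n - 1)))"
  shows "perm_proj n (tree_fibre R {2..} (n - 1) g) = vertex_class n g"
  using the_inv_into_f_f[OF tree_fibre_iso(5) assms] by (simp add: perm_proj_def)

lemma perm_proj_permutad_hom: "permutad_hom R (permAs_inf R) (permAs R) perm_proj"
proof -
  have "permutad_iso R (comb R {2..}) (permAs_inf R) (\<lambda>n. tree_fibre R {2..} (n - 1))"
    using permAs_inf_comb(2,3) unfolding permutad_iso_def dg_permutad_hom_def by blast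
  from permutad_hom_compose[OF permutad_iso_inverse[OF this] vertex_class_hom]
  show ?thesis unfolding perm_proj_def .
qed

text \<open>Compatibility with the zero differential of the target means that boundaries go to zero,
  which is \<open>vertex_part_dif\<close> read through
  \<open>vertex_class_eq_zero_iff\<close>.\<close>

lemma perm_proj_dg_hom: "dg_permutad_hom R (permAs_inf R) (in_degree_0 (permAs R)) perm_proj"
  unfolding dg_permutad_hom_def
proof (intro conjI allI impI ballI subsetI permAs_inf_comb(1) dg_permutad_in_degree_0 permAs_permutad(1))
  show "permutad_hom R (permAs_inf R) (in_degree_0 (permAs R)) perm_proj"
    using perm_proj_permutad_hom unfolding permutad_hom_def permutad_in_degree_0 in_degree_0_simps .
next
  fix n p Y assume n: "n \<ge> (1::nat)" and Y: "Y \<in> perm_proj n ` hdeg (permAs_inf R) n p"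
  then obtain g where g: "g \<in> carrier (free_module R (sur_lists {2..} (n - 1)))" "comb_deg R (n - 1) p g"
    and Yg: "Y = perm_proj n (tree_fibre R {2..} (n - 1) g)"
    unfolding permAs_inf_hdeg[OF n] by blast
  have Y': "Y = vertex_class n g" unfolding Yg by (rule perm_proj_fibre[OF g(1)])
  show "Y \<in> hdeg (in_degree_0 (permAs R)) n p"
  proof (cases "p = 0")
    case True
    have "linear_map R (ar (comb R {2..}) n) (ar (permAs R) n) (vertex_class n)"
      using vertex_class_hom n unfolding permutad_hom_def by blast
    then have "vertex_class n g \<in> carrier (ar (permAs R) n)"
      using g(1) unfolding linear_map_def by auto
    then show ?thesis using True Y' by simp
  next
    case False
    have "\<zero>\<^bsub>free_module R (sur_lists {2} (n - 1))\<^esub> \<in> vertex_boundaries (n - 1)"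
      unfolding vertex_boundaries_def linear.f_zero[OF comb_dif_edges, symmetric]
      by (intro imageI abelian_monoid.zero_closed abelian_group.axioms(1) module.axioms(2)[OF free_module])
    then have "vertex_class n g = \<zero>\<^bsub>ar (permAs R) n\<^esub>"
      unfolding vertex_class_eq_zero_iff[OF n g(1)] vertex_part_deg[OF g(2) False] by simp
    then show ?thesis using False Y' by simp
  qed
next
  fix n X assume n: "n \<ge> (1::nat)" and X: "X \<in> carrier (ar (permAs_inf R) n)"
  then obtain g where g: "g \<in> carrier (free_module R (sur_lists {2..} (n - 1)))"
    and Xg: "X = tree_fibre R {2..} (n - 1) g"
    using bij_betw_imp_surj_on[OF permAs_inf_comb(3)[OF n]] by auto
  have "perm_proj n (dif (permAs_inf R) n X) = vertex_class n (comb_dif R g)"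
    unfolding Xg permAs_inf_dif[OF n g] by (rule perm_proj_fibre[OF comb_dif_closed[OF g]])
  also have "\<dots> = \<zero>\<^bsub>ar (permAs R) n\<^esub>"
    unfolding vertex_class_eq_zero_iff[OF n comb_dif_closed[OF g]] by (rule vertex_part_dif[OF g])
  finally show "perm_proj n (dif (permAs_inf R) n X) = dif (in_degree_0 (permAs R)) n (perm_proj n X)"
    by simp
qed

text \<open>A combination of permutations is an element of degree 0 in the larger model and is fixed
  by \<open>vertex_part\<close>, so it maps to its own class.\<close>

lemma perm_proj_surj:
  assumes n: "n \<ge> 1"
  shows "perm_proj n ` hdeg (permAs_inf R) n 0 = carrier (ar (permAs R) n)"
proof
  have "perm_proj n ` hdeg (permAs_inf R) n 0 \<subseteq> hdeg (in_degree_0 (permAs R)) n 0"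
    using perm_proj_dg_hom n unfolding dg_permutad_hom_def by blast
  then show "perm_proj n ` hdeg (permAs_inf R) n 0 \<subseteq> carrier (ar (permAs R) n)" by simp
next
  show "carrier (ar (permAs R) n) \<subseteq> perm_proj n ` hdeg (permAs_inf R) n 0"
  proof
    fix Y assume "Y \<in> carrier (ar (permAs R) n)"
    then have "Y \<in> (\<lambda>X. gen_ideal R binary_free (permAs_rel R) n +>\<^bsub>ar binary_free n\<^esub> X) ` carrier (ar binary_free n)"
      unfolding module.carrier_quot_module[OF permutad.module_ar[OF free_permutad_comb(1) n], symmetric]
      by (simp add: permAs_quot quot_permutad_def)
    then obtain g where g: "g \<in> carrier (free_module R (sur_lists {2} (n - 1)))"
      and Y: "Y = gen_ideal R binary_free (permAs_rel R) n +>\<^bsub>ar binary_free n\<^esub> binary_fibre (n - 1) g"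
      unfolding free_permutad_simps(1) tree_fibre_iso(1) by blast
    have g': "g \<in> carrier (free_module R (sur_lists {2..} (n - 1)))" "comb_deg R (n - 1) 0 g"
      using g deg_0_iff by blast+
    have "perm_proj n (tree_fibre R {2..} (n - 1) g) = Y"
      unfolding perm_proj_fibre[OF g'(1)] Y vertex_class_def vertex_part_id[OF g] ..
    then show "Y \<in> perm_proj n ` hdeg (permAs_inf R) n 0"
      unfolding permAs_inf_hdeg[OF n] using g' by blast
  qed
qed

text \<open>Off degree 0 this is \<open>comb_acyclic\<close> seen through coordinates. In degree 0
  the kernel of the projection is the ideal of relations, that is \<open>vertex_boundaries\<close>,
  and these are boundaries of edges.\<close>

proposition perm_proj_quasi_iso: "quasi_iso R (permAs_inf R) (in_degree_0 (permAs R)) perm_proj"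
proof (rule quasi_iso_in_degree_0[OF perm_proj_dg_hom])
  fix n :: nat and p X assume n: "n \<ge> 1" and p: "p \<noteq> (0::int)" and "X \<in> cycles (permAs_inf R) n p"
  then have X: "X \<in> hdeg (permAs_inf R) n p" "dif (permAs_inf R) n X = \<zero>\<^bsub>ar (permAs_inf R) n\<^esub>"
    unfolding cycles_def by blast+
  obtain g where g: "g \<in> carrier (free_module R (sur_lists {2..} (n - 1)))" "comb_deg R (n - 1) p g"
    and Xg: "X = tree_fibre R {2..} (n - 1) g"
    using X(1) unfolding permAs_inf_hdeg[OF n] by blast
  have "comb_dif R g = (\<lambda>_. \<zero>)"
    using X(2) unfolding Xg permAs_inf_dif_eq_zero_iff[OF n g(1)] .
  from comb_acyclic[OF g p this]
  obtain w where w: "w \<in> carrier (free_module R (sur_lists {2..} (n - 1)))" "comb_deg R (n - 1) (p + 1) w" "comb_dif R w = g"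
    by blast
  have "X = dif (permAs_inf R) n (tree_fibre R {2..} (n - 1) w)"
    unfolding permAs_inf_dif[OF n w(1)] w(3) by (rule Xg)
  then show "X \<in> boundaries (permAs_inf R) n p"
    unfolding boundaries_def permAs_inf_hdeg[OF n] using w(1,2) by blast
next
  fix n :: nat assume n: "n \<ge> 1"
  show "cycles (permAs_inf R) n 0 = hdeg (permAs_inf R) n 0"
  proof -
    have "dif (permAs_inf R) n X = \<zero>\<^bsub>ar (permAs_inf R) n\<^esub>" if X: "X \<in> hdeg (permAs_inf R) n 0" for X
    proof -
      obtain g where g: "g \<in> carrier (free_module R (sur_lists {2..} (n - 1)))" "comb_deg R (n - 1) 0 g"
        and Xg: "X = tree_fibre R {2..} (n - 1) g"
        using X unfolding permAs_inf_hdeg[OF n] by blast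
      have "g \<in> carrier (free_module R (sur_lists {2} (n - 1)))" using g deg_0_iff by blast
      then show ?thesis
        unfolding Xg permAs_inf_dif_eq_zero_iff[OF n g(1)] by (rule comb_dif_deg_0)
    qed
    then show ?thesis unfolding cycles_def by blast
  qed
next
  fix n :: nat assume "n \<ge> 1"
  then show "perm_proj n ` hdeg (permAs_inf R) n 0 = carrier (ar (permAs R) n)" by (rule perm_proj_surj)
next
  fix n X assume n: "n \<ge> (1::nat)" and X: "X \<in> hdeg (permAs_inf R) n 0"
    and zero: "perm_proj n X = \<zero>\<^bsub>ar (permAs R) n\<^esub>"
  obtain g where g: "g \<in> carrier (free_module R (sur_lists {2..} (n - 1)))" "comb_deg R (n - 1) 0 g"
    and Xg: "X = tree_fibre R {2..} (n - 1) g"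
    using X unfolding permAs_inf_hdeg[OF n] by blast
  have g0: "g \<in> carrier (free_module R (sur_lists {2} (n - 1)))" using g deg_0_iff by blast
  have "g \<in> vertex_boundaries (n - 1)"
    using zero unfolding Xg perm_proj_fibre[OF g(1)] vertex_class_eq_zero_iff[OF n g(1)] vertex_part_id[OF g0] .
  then obtain w where w: "w \<in> carrier (free_module R (edge_lists (n - 1)))" "g = comb_dif R w"
    unfolding vertex_boundaries_def by blast
  have w': "w \<in> carrier (free_module R (sur_lists {2..} (n - 1)))" "comb_deg R (n - 1) (0 + 1) w"
    using w(1) deg_1_iff[of w "n - 1"] by simp_all
  have "X = dif (permAs_inf R) n (tree_fibre R {2..} (n - 1) w)"
    unfolding permAs_inf_dif[OF n w'(1)] w(2)[symmetric] by (rule Xg)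
  then show "X \<in> boundaries (permAs_inf R) n 0"
    unfolding boundaries_def permAs_inf_hdeg[OF n] using w' by blast
qed

lemma one_gens_module: "module R (one_gens R S n)"
  by (intro moduleI abelian_groupI is_cring)
    (auto simp: a_ac m_assoc l_distr r_distr split: if_splits intro: bexI[of _ "\<ominus> x" for x] l_neg)

text \<open>The underlying permutad of \<open>permAs_inf R\<close> is the free one by construction,
  and its grading is the induced one, so the identity map is the required isomorphism.\<close>

lemma permAs_inf_quasi_free: "quasi_free_on R (permAs_inf R) (inf_gens R) (inf_gens_hdeg R)"
  unfolding quasi_free_on_def
proof (intro conjI permAs_inf_comb(1) allI impI exI[of _ "\<lambda>n x. x"])
  fix n :: nat
  show "graded_module R (inf_gens R n) (inf_gens_hdeg R n)"
    using module.graded_module_concentrated[OF one_gens_module[of "{2..}" n], of "int n - 2"]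
    unfolding inf_gens_hdeg_def inf_gens_eq .
next
  show "carrier (inf_gens R 1) = {\<zero>\<^bsub>inf_gens R 1\<^esub>}" by (simp add: inf_gens_eq)
next
  have P: "permutad R (free_permutad R (inf_gens R))"
    unfolding inf_gens_eq by (rule free_permutad_comb(1))
  have "map (\<lambda>j. \<mu>s ! j) [0..<k] = \<mu>s"
    if "t \<in> Sur n k" "\<mu>s \<in> decorations (ar (free_permutad R (inf_gens R))) t" for n k t \<mu>s
    using that map_nth[of \<mu>s] by (simp add: decorations_def Sur_iff)
  then have "permutad_hom R (free_permutad R (inf_gens R)) (permAs_inf R) (\<lambda>n x. x)"
    using P unfolding permutad_hom_def permutad_permAs_inf permAs_inf_simps by (auto simp: linear_map_def simp del: free_permutad_simps)
  then show "permutad_iso R (free_permutad R (inf_gens R)) (permAs_inf R) (\<lambda>n x. x)"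
    unfolding permutad_iso_def permAs_inf_simps bij_betw_def by simp
next
  show "(\<lambda>x. x) ` free_hdeg R (inf_gens R) (inf_gens_hdeg R) n p = hdeg (permAs_inf R) n p" for n p
    unfolding permAs_inf_simps by simp
qed

end

theorem proposition5p4:
  fixes R :: "('a, 'r) ring_scheme"
  assumes "cring R"
  shows "dg_permutad R (permAs_inf R)
    \<and> (\<exists>(M :: nat \<Rightarrow> ('a, 'a) module) G. quasi_free_on R (permAs_inf R) M G)
    \<and> (\<exists>\<phi>. quasi_iso R (permAs_inf R) (in_degree_0 (permAs R)) \<phi>)"
proof -
  interpret cring R by (rule assms)
  show ?thesis
    using permAs_inf_comb(1) permAs_inf_quasi_free perm_proj_quasi_iso by blast
qed

end
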